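(* Let $p\ge2$. Then $\mathcal R=(0,\beta_p]$. Moreover: (i) For $\beta>0$, $\beta\in\mathcal R$ if and only if $\int_0^r\xi''(s)(\rho_\beta(s)-s)\,ds\le0$ for all $r\in(0,1]$. (ii) If $0<\beta<\beta_p$, then $\int_0^r\xi''(s)(\rho_\beta(s)-s)\,ds<0$ for all $r\in(0,1]$.
   Context: $\Sigma_N=\{-1,1\}^N$, $(g_{i_1,\dots,i_p})$ i.i.d. standard Gaussians, $H_N(\sigma)=N^{-(p-1)/2}\sum_{1\le i_1,\dots,i_p\le N}g_{i_1,\dots,i_p}\sigma_{i_1}\cdots\sigma_{i_p}$, $F_N(\beta)=\frac1N\log\sum_{\sigma\in\Sigma_N}2^{-N}\exp(\tfrac{\beta}{\sqrt2}H_N(\sigma))$. It is known that $F_N(\beta)\to F(\beta)$ a.s. with $F(\beta)$ nonrandom and $F(\beta)\le\beta^2/4$. $\mathcal R=\{\beta>0:F(\beta)=\beta^2/4\}$, $\beta_p=\max\mathcal R$. Let $\xi(s)=s^p/2$ and, with $g$ a standard normal random variable, $$\rho_\beta(s)=\mathbb E\Big[\tanh^2\big(\beta g\sqrt{\xi'(s)}\big)\cosh\big(\beta g\sqrt{\xi'(s)}\big)\Big]e^{-\frac{\beta^2}{2}\xi'(s)},\quad s\in[0,1].$$ *)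

theory Defs
  imports "HOL-Probability.Probability"
begin

text \<open>Disorder: an i.i.d. family of standard Gaussians indexed by index tuples
  (lists of natural numbers), realised on the canonical infinite product space.
  H_N uses the tuples of length p with entries < N (indices 0..N-1).\<close>

definition disorder :: "(nat list \<Rightarrow> real) measure" where
  "disorder = (\<Pi>\<^sub>M i\<in>(UNIV :: nat list set). std_normal_distribution)"

definition spins :: "nat \<Rightarrow> real list set" where
  "spins N = {\<sigma>. length \<sigma> = N \<and> set \<sigma> \<subseteq> {-1, 1}}"

definition tuples :: "nat \<Rightarrow> nat \<Rightarrow> nat list set" where
  "tuples p N = {is. length is = p \<and> set is \<subseteq> {..<N}}"

definition hamiltonian :: "nat \<Rightarrow> nat \<Rightarrow> (nat list \<Rightarrow> real) \<Rightarrow> real list \<Rightarrow> real" where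
  "hamiltonian p N g \<sigma> =
     real N powr (- (real p - 1) / 2) *
     (\<Sum>is\<in>tuples p N. g is * (\<Prod>k<p. \<sigma> ! (is ! k)))"

definition free_energy_N :: "nat \<Rightarrow> nat \<Rightarrow> real \<Rightarrow> (nat list \<Rightarrow> real) \<Rightarrow> real" where
  "free_energy_N p N \<beta> g =
     (1 / real N) * ln (\<Sum>\<sigma>\<in>spins N. 2 powr (- real N) *
        exp (\<beta> / sqrt 2 * hamiltonian p N g \<sigma>))"

definition free_energy :: "nat \<Rightarrow> real \<Rightarrow> real" where
  "free_energy p \<beta> =
     (THE c. AE g in disorder. (\<lambda>N. free_energy_N p N \<beta> g) \<longlonglongrightarrow> c)"

definition replica_symmetric_set :: "nat \<Rightarrow> real set" where
  "replica_symmetric_set p = {\<beta>. \<beta> > 0 \<and> free_energy p \<beta> = \<beta>^2 / 4}"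

definition beta_crit :: "nat \<Rightarrow> real" where
  "beta_crit p = (GREATEST \<beta>. \<beta> \<in> replica_symmetric_set p)"

definition xi :: "nat \<Rightarrow> real \<Rightarrow> real" where
  "xi p s = s ^ p / 2"

definition xi' :: "nat \<Rightarrow> real \<Rightarrow> real" where
  "xi' p s = real p * s ^ (p - 1) / 2"

definition xi'' :: "nat \<Rightarrow> real \<Rightarrow> real" where
  "xi'' p s = real p * (real p - 1) * s ^ (p - 2) / 2"

definition rho :: "nat \<Rightarrow> real \<Rightarrow> real \<Rightarrow> real" where
  "rho p \<beta> s =
     (\<integral>g. (tanh (\<beta> * g * sqrt (xi' p s)))\<^sup>2 * cosh (\<beta> * g * sqrt (xi' p s))
        \<partial>std_normal_distribution) * exp (- (\<beta>^2 / 2) * xi' p s)"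

end

(*
Everything is expressed through the fractional moments E Z^m, 0 < m < 1, of Gaussian partition
functions.  If two Gaussian Hamiltonians on a spin space satisfy a covariance comparison up to
negative parts of overlaps, then their moments compare up to a negligible error: along an
interpolation, small optimally chosen perturbations force the Ghirlanda-Guerra identities for the
Gibbs measure tilted by Z^m, and Talagrand's positivity principle then removes the negative overlaps.

Put Phi(u) = (beta^2/2) * int_0^u xi''(rho_beta - s) ds.  Integration by parts gives
Phi(u) = At(beta sqrt(xi'(u))) - (beta^2/2)(xi'(u) + theta(u)), where
At(y) = exp(-y^2/2) E[cosh(yz) log cosh(yz)] and theta(u) = u xi'(u) - xi(u).
If Phi(u) > 0 for some u, comparing the p-spin model with independent fields of variance
beta^2 xi'(u), with m close to 1, gives F < beta^2/4.  If Phi <= 0 on [0,1], then under the measure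
weighted by Z the part of Z with overlap u with a planted configuration is compared, with m close
to 0, with a tilted field; hence Z is of order E Z with probability at least exp(-o(N)), and
concentration gives F = beta^2/4.  Comparing the model with independent blocks shows that the
limit F exists.  Finally rho_beta is strictly increasing in beta, the condition holds for small
beta, fails for beta > 2, and is closed under limits in beta.
*)
theory Submission
  imports Defs
begin

section \<open>Infinite families of independent standard Gaussians\<close>

text \<open>Under interpolation the derivative of ln E Z^m has a diagonal covariance term and an
  off-diagonal one weighted by 1 - m. So m near 1 probes the annealed regime and m near 0 the
  quenched one. Expanding the moments of the comparison fields to first order in 1 - m, respectively
  in m, gives the same coefficient Phi(u) up to sign, which is why its sign decides both directions.
  The obstacle is odd p: s^p is then not convex on [-1,1], and the convexity bounds behind both
  comparisons and behind the existence of the limit fail for negative overlaps. A fixed small error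
  in the positivity of overlaps is affordable, so the perturbing fields keep a variance independent
  of N and their cost vanishes after division by N. Existence of the limit belongs to the proof
  because \<open>free_energy\<close> is a definite description: without convergence, a strict upper
  bound on the means of the log partition function would say nothing about its value.\<close>

abbreviation std_gauss :: "real measure" where
  "std_gauss \<equiv> std_normal_distribution"

text \<open>Kept polymorphic in the index type: \<open>disorder\<close> is the instance
  \<open>nat list\<close>, and independent families of fields arise from sums of index types instead
  of products of measures.\<close>

definition gauss :: "('i \<Rightarrow> real) measure" where
  "gauss = (\<Pi>\<^sub>M i\<in>UNIV. std_gauss)"

lemma sets_gauss: "sets gauss = sets (\<Pi>\<^sub>M i\<in>UNIV. borel)"
  unfolding gauss_def by (rule sets_PiM_cong) auto

lemma space_gauss [simp]: "space gauss = UNIV"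
  by (simp add: gauss_def space_PiM)

lemma prob_space_std_gauss: "prob_space std_gauss"
  by (rule prob_space_normal_density) simp

interpretation std_gauss: prob_space std_gauss
  by (rule prob_space_std_gauss)

lemma measurable_into_std_gauss: "measurable M std_gauss = borel_measurable M"
  by (rule measurable_cong_sets) auto

lemma measurable_from_std_gauss: "measurable std_gauss M = measurable borel M"
  by (rule measurable_cong_sets) auto

lemma prob_space_gauss: "prob_space gauss"
  unfolding gauss_def by (rule prob_space_PiM) (rule prob_space_std_gauss)

interpretation gauss: prob_space gauss
  by (rule prob_space_gauss)

lemma measurable_gauss_component [measurable]: "(\<lambda>g. g i) \<in> borel_measurable gauss"
proof -
  have "(\<lambda>g. g i) \<in> measurable (\<Pi>\<^sub>M i\<in>UNIV. borel) borel"
    by (rule measurable_component_singleton) simp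
  then show ?thesis
    by (simp add: measurable_cong_sets[OF sets_gauss refl])
qed

lemma measurable_into_gauss:
  assumes "\<And>i. (\<lambda>x. f x i) \<in> borel_measurable M"
  shows "f \<in> measurable M gauss"
proof -
  have "(\<lambda>x. \<lambda>i\<in>UNIV. f x i) \<in> measurable M (\<Pi>\<^sub>M i\<in>UNIV. borel)"
    by (rule measurable_restrict) (use assms in auto)
  then show ?thesis
    by (simp add: measurable_cong_sets[OF refl sets_gauss] restrict_def)
qed

text \<open>Selecting coordinates along an injection gives again an i.i.d. family; this moves a
  field from a larger index type to a smaller one without changing its moments.\<close>

lemma gauss_reindex:
  assumes "inj f"
  shows "distr gauss gauss (\<lambda>g n. g (f n)) = gauss"
proof -
  have "distr (Pi\<^sub>M UNIV (\<lambda>_. std_gauss)) (\<Pi>\<^sub>M i\<in>UNIV. std_gauss) (\<lambda>g. \<lambda>n\<in>UNIV. g (f n))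
      = (\<Pi>\<^sub>M i\<in>UNIV. std_gauss)"
    by (rule distr_PiM_reindex) (use assms prob_space_std_gauss in auto)
  then show ?thesis by (simp add: gauss_def restrict_def)
qed

lemma measurable_reindex: "(\<lambda>g n. g (f n)) \<in> measurable gauss gauss"
  by (rule measurable_into_gauss) simp

lemma integral_gauss_reindex:
  fixes F :: "('i \<Rightarrow> real) \<Rightarrow> real"
  assumes "inj f" and [measurable]: "F \<in> borel_measurable gauss"
  shows "(\<integral>g. F (\<lambda>n. g (f n)) \<partial>gauss) = (\<integral>g. F g \<partial>gauss)"
proof -
  have "(\<integral>g. F g \<partial>gauss) = (\<integral>g. F g \<partial>distr gauss gauss (\<lambda>g n. g (f n)))"
    by (simp add: gauss_reindex[OF assms(1)])
  also have "\<dots> = (\<integral>g. F (\<lambda>n. g (f n)) \<partial>gauss)"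
    by (rule integral_distr) (auto intro: measurable_reindex)
  finally show ?thesis by simp
qed

lemma measurable_upd: "(\<lambda>(x, g). g(i := x)) \<in> measurable (std_gauss \<Otimes>\<^sub>M gauss) gauss"
proof (rule measurable_into_gauss)
  fix j
  have [measurable]: "(\<lambda>p. fst p) \<in> borel_measurable (std_gauss \<Otimes>\<^sub>M gauss)"
    using measurable_fst[of std_gauss gauss] by (simp only: measurable_into_std_gauss)
  show "(\<lambda>x. (case x of (x, g) \<Rightarrow> g(i := x)) j) \<in> borel_measurable (std_gauss \<Otimes>\<^sub>M gauss)"
    by (cases "j = i") (auto simp: split_beta')
qed

text \<open>Resampling one coordinate preserves the law. Overwriting \<open>i\<close>, rather than
  deleting it from the index type, lets one-dimensional facts be applied in \<open>x\<close> with
  \<open>g\<close> as a frozen parameter.\<close>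

lemma gauss_split:
  fixes i :: 'i
  shows "distr (std_gauss \<Otimes>\<^sub>M gauss) gauss (\<lambda>(x, g). g(i := x)) = (gauss :: ('i \<Rightarrow> real) measure)"
proof -
  let ?G = "\<Pi>\<^sub>M i\<in>UNIV - {i}. std_gauss"
  have r: "distr (gauss :: ('i \<Rightarrow> real) measure) ?G (\<lambda>g. restrict g (UNIV - {i})) = ?G"
  proof -
    have "distr (Pi\<^sub>M UNIV (\<lambda>_. std_gauss)) ?G (\<lambda>g. \<lambda>n\<in>UNIV - {i}. g (id n)) = ?G"
      by (rule distr_PiM_reindex) (use prob_space_std_gauss in auto)
    then show ?thesis by (simp add: gauss_def restrict_def)
  qed
  have mr: "(\<lambda>g. restrict g (UNIV - {i})) \<in> measurable (gauss :: ('i \<Rightarrow> real) measure) ?G"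
    unfolding gauss_def by (rule measurable_restrict_subset) auto
  have ins: "insert i (UNIV - {i}) = UNIV" by auto
  have mu: "(\<lambda>(x, X). X(i := x)) \<in> measurable (std_gauss \<Otimes>\<^sub>M ?G) gauss"
  proof (rule measurable_into_gauss)
    fix j
    have 1: "(\<lambda>p. fst p) \<in> borel_measurable (std_gauss \<Otimes>\<^sub>M ?G)"
      using measurable_fst[of std_gauss ?G] by (simp only: measurable_into_std_gauss)
    have 2: "(\<lambda>p. snd p j) \<in> borel_measurable (std_gauss \<Otimes>\<^sub>M ?G)" if "j \<noteq> i"
    proof -
      have "(\<lambda>X. X j) \<in> measurable ?G std_gauss"
        by (rule measurable_component_singleton) (use that in auto)
      then have "(\<lambda>X. X j) \<in> borel_measurable ?G"
        by (simp only: measurable_into_std_gauss)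
      then show ?thesis by measurable
    qed
    show "(\<lambda>x. (case x of (x, X) \<Rightarrow> X(i := x)) j) \<in> borel_measurable (std_gauss \<Otimes>\<^sub>M ?G)"
      using 1 2 by (cases "j = i") (auto simp: split_beta')
  qed
  have "distr (std_gauss \<Otimes>\<^sub>M ?G) (\<Pi>\<^sub>M i\<in>insert i (UNIV - {i}). std_gauss) (\<lambda>(x, X). X(i := x))
      = (\<Pi>\<^sub>M i\<in>insert i (UNIV - {i}). std_gauss)"
    by (rule distr_pair_PiM_eq_PiM) (use prob_space_std_gauss in auto)
  then have "gauss = distr (std_gauss \<Otimes>\<^sub>M ?G) gauss (\<lambda>(x, X). X(i := x))"
    by (simp add: ins gauss_def)
  also have "std_gauss \<Otimes>\<^sub>M ?G = distr std_gauss std_gauss (\<lambda>x. x) \<Otimes>\<^sub>M distr gauss ?G (\<lambda>g. restrict g (UNIV - {i}))"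
    by (simp add: r distr_id2)
  also have "\<dots> = distr (std_gauss \<Otimes>\<^sub>M gauss) (std_gauss \<Otimes>\<^sub>M ?G) (\<lambda>(x, g). (x, restrict g (UNIV - {i})))"
    by (rule pair_measure_distr) (use mr in \<open>auto simp: r prob_space_imp_sigma_finite prob_space_PiM prob_space_std_gauss\<close>)
  also have "distr \<dots> gauss (\<lambda>(x, X). X(i := x))
     = distr (std_gauss \<Otimes>\<^sub>M gauss) gauss ((\<lambda>(x, X). X(i := x)) \<circ> (\<lambda>(x, g). (x, restrict g (UNIV - {i}))))"
    by (rule distr_distr[OF mu])
       (auto simp: split_beta' intro!: measurable_Pair measurable_compose[OF measurable_snd mr])
  also have "((\<lambda>(x, X). X(i := x)) \<circ> (\<lambda>(x, g). (x, restrict g (UNIV - {i})))) = (\<lambda>(x, g). g(i := x))"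
    by (auto simp: fun_eq_iff)
  finally show ?thesis by simp
qed

lemma measurable_upd_snd [measurable]:
  assumes "F \<in> borel_measurable gauss"
  shows "(\<lambda>x. F (g(i := x))) \<in> borel_measurable borel"
proof -
  have "(\<lambda>x. g(i := x)) \<in> measurable borel gauss"
  proof (rule measurable_into_gauss)
    fix j show "(\<lambda>x. (g(i := x)) j) \<in> borel_measurable borel"
      by (cases "j = i") auto
  qed
  then show ?thesis using assms by measurable
qed

lemma nn_integral_gauss_split:
  fixes F :: "('i \<Rightarrow> real) \<Rightarrow> ennreal"
  assumes [measurable]: "F \<in> borel_measurable gauss"
  shows "(\<integral>\<^sup>+g. F g \<partial>gauss) = (\<integral>\<^sup>+g. \<integral>\<^sup>+x. F (g(i := x)) \<partial>std_gauss \<partial>gauss)"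
proof -
  interpret P: pair_sigma_finite std_gauss "gauss :: ('i \<Rightarrow> real) measure" ..
  have m: "(\<lambda>(x, g). F (g(i := x))) \<in> borel_measurable (std_gauss \<Otimes>\<^sub>M gauss)"
    using measurable_compose[OF measurable_upd[of i] assms] by (simp add: split_beta')
  have "(\<integral>\<^sup>+g. F g \<partial>gauss) = (\<integral>\<^sup>+g. F g \<partial>distr (std_gauss \<Otimes>\<^sub>M gauss) gauss (\<lambda>(x, g). g(i := x)))"
    by (simp add: gauss_split)
  also have "\<dots> = (\<integral>\<^sup>+p. F ((\<lambda>(x, g). g(i := x)) p) \<partial>(std_gauss \<Otimes>\<^sub>M gauss))"
    by (rule nn_integral_distr) (auto intro: measurable_upd)
  also have "\<dots> = (\<integral>\<^sup>+g. \<integral>\<^sup>+x. F (g(i := x)) \<partial>std_gauss \<partial>gauss)"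
    using P.nn_integral_snd[OF m] by (simp add: split_beta')
  finally show ?thesis .
qed

lemma integral_gauss_split:
  fixes F :: "('i \<Rightarrow> real) \<Rightarrow> real"
  assumes F: "integrable gauss F"
  shows "(\<integral>g. F g \<partial>gauss) = (\<integral>g. \<integral>x. F (g(i := x)) \<partial>std_gauss \<partial>gauss)"
    and "integrable gauss (\<lambda>g. \<integral>x. F (g(i := x)) \<partial>std_gauss)"
proof -
  interpret P: pair_sigma_finite std_gauss "gauss :: ('i \<Rightarrow> real) measure" ..
  have [measurable]: "F \<in> borel_measurable gauss" using F by auto
  have "integrable (distr (std_gauss \<Otimes>\<^sub>M gauss) gauss (\<lambda>(x, g). g(i := x))) F"
    using F by (simp add: gauss_split)
  then have I: "integrable (std_gauss \<Otimes>\<^sub>M gauss) (\<lambda>(x, g). F (g(i := x)))"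
    by (subst (asm) integrable_distr_eq) (use measurable_upd[of i] in \<open>auto simp: split_beta'\<close>)
  have "(\<integral>g. F g \<partial>gauss) = (\<integral>g. F g \<partial>distr (std_gauss \<Otimes>\<^sub>M gauss) gauss (\<lambda>(x, g). g(i := x)))"
    by (simp add: gauss_split)
  also have "\<dots> = (\<integral>p. F ((\<lambda>(x, g). g(i := x)) p) \<partial>(std_gauss \<Otimes>\<^sub>M gauss))"
    by (rule integral_distr) (auto intro: measurable_upd)
  also have "\<dots> = (\<integral>g. \<integral>x. F (g(i := x)) \<partial>std_gauss \<partial>gauss)"
    using P.integral_snd[OF I] by (simp add: split_beta')
  finally show "(\<integral>g. F g \<partial>gauss) = (\<integral>g. \<integral>x. F (g(i := x)) \<partial>std_gauss \<partial>gauss)" .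
  show "integrable gauss (\<lambda>g. \<integral>x. F (g(i := x)) \<partial>std_gauss)"
    using P.integrable_snd[OF I] by simp
qed

lemma measurable_gauss_section:
  fixes F :: "('i \<Rightarrow> real) \<Rightarrow> real"
  assumes "F \<in> borel_measurable gauss"
  shows "(\<lambda>g. \<integral>x. F (g(i := x)) \<partial>std_gauss) \<in> borel_measurable gauss"
proof -
  interpret P: pair_sigma_finite std_gauss "gauss :: ('i \<Rightarrow> real) measure" ..
  have "(\<lambda>(x, g). F (g(i := x))) \<in> borel_measurable (std_gauss \<Otimes>\<^sub>M gauss)"
    using measurable_compose[OF measurable_upd[of i] assms] by (simp add: split_beta')
  then have "(\<lambda>(g, x). F (g(i := x))) \<in> borel_measurable (gauss \<Otimes>\<^sub>M std_gauss)"
    by (subst measurable_pair_swap_iff) (simp add: split_beta')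
  then show ?thesis
    by (rule std_gauss.borel_measurable_lebesgue_integral)
qed

section \<open>One-dimensional Gaussian integrals\<close>

lemma integral_std_gauss:
  fixes f :: "real \<Rightarrow> real"
  assumes [measurable]: "f \<in> borel_measurable borel"
  shows "(\<integral>x. f x \<partial>std_gauss) = (\<integral>x. std_normal_density x * f x \<partial>lborel)"
  by (subst integral_density) auto

lemma integrable_std_gauss_iff:
  fixes f :: "real \<Rightarrow> real"
  assumes [measurable]: "f \<in> borel_measurable borel"
  shows "integrable std_gauss f \<longleftrightarrow> integrable lborel (\<lambda>x. std_normal_density x * f x)"
  by (subst integrable_density) auto

lemma exp_mult_std_normal_density:
  "exp (a * x) * std_normal_density x = exp (a\<^sup>2 / 2) * std_normal_density (x - a)"
proof -
  have "exp (a * x) * exp (- x\<^sup>2 / 2) = exp (a\<^sup>2 / 2) * exp (- (x - a)\<^sup>2 / 2)"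
    unfolding mult_exp_exp by (rule arg_cong[where f=exp]) (simp add: power2_eq_square field_simps)
  then show ?thesis
    unfolding std_normal_density_def by (metis mult.left_commute)
qed

lemma std_normal_density_exp_mult:
  "std_normal_density x * (exp (a * x) * y) = exp (a\<^sup>2 / 2) * (std_normal_density (x - a) * y)"
  using arg_cong[OF exp_mult_std_normal_density[of a x], of "\<lambda>z. z * y"]
  by (simp only: mult.assoc mult.left_commute)

text \<open>One-dimensional Cameron-Martin formula: completing the square turns the exponential
  factor into a translation of the density.\<close>

lemma std_gauss_shift:
  fixes f :: "real \<Rightarrow> real"
  assumes [measurable]: "f \<in> borel_measurable borel"
  shows "(\<integral>x. exp (a * x) * f x \<partial>std_gauss) = exp (a\<^sup>2 / 2) * (\<integral>x. f (x + a) \<partial>std_gauss)"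
proof -
  have "(\<integral>x. exp (a * x) * f x \<partial>std_gauss)
      = (\<integral>x. exp (a\<^sup>2 / 2) * (std_normal_density (x - a) * f x) \<partial>lborel)"
    by (subst integral_std_gauss) (auto simp: std_normal_density_exp_mult)
  also have "\<dots> = exp (a\<^sup>2 / 2) * (\<integral>x. std_normal_density (x - a) * f x \<partial>lborel)"
    by simp
  also have "(\<integral>x. std_normal_density (x - a) * f x \<partial>lborel) = (\<integral>x. std_normal_density x * f (x + a) \<partial>lborel)"
    by (subst lborel_integral_real_affine[where c=1 and t=a]) (auto simp: add.commute)
  also have "\<dots> = (\<integral>x. f (x + a) \<partial>std_gauss)"
    by (subst integral_std_gauss) auto
  finally show ?thesis .
qed

lemma nn_std_gauss_shift:
  fixes f :: "real \<Rightarrow> ennreal"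
  assumes [measurable]: "f \<in> borel_measurable borel"
  shows "(\<integral>\<^sup>+x. ennreal (exp (a * x)) * f x \<partial>std_gauss) = ennreal (exp (a\<^sup>2 / 2)) * (\<integral>\<^sup>+x. f (x + a) \<partial>std_gauss)"
proof -
  have "(\<integral>\<^sup>+x. ennreal (exp (a * x)) * f x \<partial>std_gauss)
      = (\<integral>\<^sup>+x. ennreal (exp (a\<^sup>2 / 2)) * (ennreal (std_normal_density (x - a)) * f x) \<partial>lborel)"
    by (subst nn_integral_density)
       (auto intro!: nn_integral_cong simp: ennreal_mult[symmetric] mult.assoc[symmetric]
          exp_mult_std_normal_density mult.commute[of "std_normal_density _" "exp _"] simp del: mult_exp_exp)
  also have "\<dots> = ennreal (exp (a\<^sup>2 / 2)) * (\<integral>\<^sup>+x. ennreal (std_normal_density (x - a)) * f x \<partial>lborel)"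
    by (subst nn_integral_cmult) auto
  also have "(\<integral>\<^sup>+x. ennreal (std_normal_density (x - a)) * f x \<partial>lborel)
      = (\<integral>\<^sup>+x. ennreal (std_normal_density x) * f (x + a) \<partial>lborel)"
    by (subst nn_integral_real_affine[where c=1 and t=a]) (auto simp: add.commute)
  also have "\<dots> = (\<integral>\<^sup>+x. f (x + a) \<partial>std_gauss)"
    by (subst nn_integral_density) auto
  finally show ?thesis .
qed

lemma std_gauss_reflect:
  fixes f :: "real \<Rightarrow> real"
  assumes [measurable]: "f \<in> borel_measurable borel"
  shows "(\<integral>x. f (- x) \<partial>std_gauss) = (\<integral>x. f x \<partial>std_gauss)"
proof -
  have "(\<integral>x. f x \<partial>std_gauss) = (\<integral>x. std_normal_density x * f x \<partial>lborel)"
    by (subst integral_std_gauss) auto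
  also have "\<dots> = (\<integral>x. std_normal_density x * f (- x) \<partial>lborel)"
    by (subst lborel_integral_real_affine[where c="-1" and t=0]) (auto simp: std_normal_density_def)
  also have "\<dots> = (\<integral>x. f (- x) \<partial>std_gauss)"
    by (subst integral_std_gauss) auto
  finally show ?thesis by simp
qed

lemma nn_integral_exp_std_gauss: "(\<integral>\<^sup>+x. ennreal (exp (a * x)) \<partial>std_gauss) = ennreal (exp (a\<^sup>2 / 2))"
  using nn_std_gauss_shift[of "\<lambda>_. 1" a] std_gauss.emeasure_space_1 by simp

lemma integrable_exp_std_gauss: "integrable std_gauss (\<lambda>x. exp (a * x))"
  by (rule integrableI_nonneg) (auto simp: nn_integral_exp_std_gauss)

lemma integral_exp_std_gauss: "(\<integral>x. exp (a * x) \<partial>std_gauss) = exp (a\<^sup>2 / 2)"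
  by (subst integral_eq_nn_integral) (auto simp: nn_integral_exp_std_gauss)

lemma exp_abs_le: "exp (c * \<bar>x\<bar>) \<le> exp (c * x) + exp (- c * (x::real))"
  by (cases "x \<ge> 0") (auto simp: abs_if)

lemma nn_integral_exp_abs_std_gauss: "(\<integral>\<^sup>+x. ennreal (exp (c * \<bar>x\<bar>)) \<partial>std_gauss) \<le> ennreal (2 * exp (c\<^sup>2 / 2))"
proof -
  have "(\<integral>\<^sup>+x. ennreal (exp (c * \<bar>x\<bar>)) \<partial>std_gauss)
      \<le> (\<integral>\<^sup>+x. ennreal (exp (c * x)) + ennreal (exp (- c * x)) \<partial>std_gauss)"
    by (intro nn_integral_mono) (auto simp flip: ennreal_plus intro!: ennreal_leI exp_abs_le[simplified])
  also have "\<dots> = ennreal (exp (c\<^sup>2 / 2)) + ennreal (exp (c\<^sup>2 / 2))"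
    using nn_integral_exp_std_gauss[of c] nn_integral_exp_std_gauss[of "-c"]
    by (subst nn_integral_add) auto
  also have "\<dots> = ennreal (2 * exp (c\<^sup>2 / 2))"
    by (subst ennreal_plus[symmetric]) auto
  finally show ?thesis .
qed

lemma integrable_exp_abs_std_gauss: "integrable std_gauss (\<lambda>x. exp (c * \<bar>x\<bar>))"
  by (rule integrableI_nonneg)
     (auto intro: order.strict_trans1[OF nn_integral_exp_abs_std_gauss])

section \<open>Exponential growth and Gaussian integration by parts\<close>

lemma integrable_std_gauss_bound:
  fixes f :: "real \<Rightarrow> real"
  assumes "f \<in> borel_measurable borel" "\<And>x. \<bar>f x\<bar> \<le> C * exp (C * \<bar>x\<bar>)"
  shows "integrable std_gauss f"
proof (rule Bochner_Integration.integrable_bound)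
  show "integrable std_gauss (\<lambda>x. C * exp (C * \<bar>x\<bar>))"
    using integrable_exp_abs_std_gauss by auto
  show "AE x in std_gauss. norm (f x) \<le> norm (C * exp (C * \<bar>x\<bar>))"
    using order.trans[OF assms(2) abs_ge_self] by (intro AE_I2) simp
qed (use assms in \<open>auto simp: measurable_from_std_gauss\<close>)

lemma abs_le_exp: "\<bar>x\<bar> \<le> exp \<bar>x::real\<bar>"
  using exp_ge_add_one_self[of "\<bar>x\<bar>"] by linarith

lemma tendsto_density_exp:
  "((\<lambda>x. C * exp (C * \<bar>x\<bar>) * std_normal_density x) \<longlongrightarrow> 0) at_top"
  "((\<lambda>x. C * exp (C * \<bar>x\<bar>) * std_normal_density x) \<longlongrightarrow> 0) at_bot"
proof -
  have *: "((\<lambda>x::real. exp (C\<^sup>2 / 2) * exp (- (x - C)\<^sup>2 / 2)) \<longlongrightarrow> 0) at_top" for C :: real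
  proof -
    have "filterlim (\<lambda>x::real. (x - C)\<^sup>2 / 2) at_top at_top"
    proof (rule filterlim_at_top_mono)
      show "filterlim (\<lambda>x::real. (- C - 1 / 2) + x) at_top at_top"
        by (rule filterlim_tendsto_add_at_top[OF tendsto_const filterlim_ident])
      show "\<forall>\<^sub>F x in at_top. (- C - 1 / 2) + x \<le> (x - C)\<^sup>2 / 2"
      proof (rule always_eventually, rule allI)
        fix x :: real
        show "(- C - 1 / 2) + x \<le> (x - C)\<^sup>2 / 2"
          using zero_le_power2[of "x - C - 1"] by (simp add: power2_eq_square algebra_simps)
      qed
    qed
    then have "filterlim (\<lambda>x::real. - ((x - C)\<^sup>2 / 2)) at_bot at_top"
      by (simp add: filterlim_uminus_at_bot)
    then have "((\<lambda>x::real. exp (- ((x - C)\<^sup>2 / 2))) \<longlongrightarrow> 0) at_top"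
      by (rule filterlim_compose[OF exp_at_bot])
    then show ?thesis using tendsto_mult_right_zero by fastforce
  qed
  have **: "((\<lambda>x. exp (C * x) * std_normal_density x) \<longlongrightarrow> 0) at_top"
  proof -
    have eq: "exp (C * x) * std_normal_density x = 1 / sqrt (2 * pi) * (exp (C\<^sup>2 / 2) * exp (- (x - C)\<^sup>2 / 2))" for x
      unfolding exp_mult_std_normal_density by (simp add: std_normal_density_def)
    show ?thesis unfolding eq by (intro tendsto_mult_right_zero *)
  qed
  have "((\<lambda>x. C * (exp (C * x) * std_normal_density x)) \<longlongrightarrow> 0) at_top"
    by (intro tendsto_mult_right_zero **)
  then show t: "((\<lambda>x. C * exp (C * \<bar>x\<bar>) * std_normal_density x) \<longlongrightarrow> 0) at_top"
    by (rule Lim_transform_eventually)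
       (auto intro!: eventually_mono[OF eventually_ge_at_top[of 0]])
  show "((\<lambda>x. C * exp (C * \<bar>x\<bar>) * std_normal_density x) \<longlongrightarrow> 0) at_bot"
    using t by (subst filterlim_at_bot_mirror) (simp add: std_normal_density_def)
qed

text \<open>The fundamental theorem of calculus on the whole line for \<open>f\<close> times the
  density, whose derivative is \<open>- x\<close> times itself; the growth bound makes the boundary
  terms vanish.\<close>

lemma std_gauss_ibp:
  fixes f f' :: "real \<Rightarrow> real"
  assumes d: "\<And>x. (f has_field_derivative f' x) (at x)"
    and c: "\<And>x. isCont f' x"
    and b: "\<And>x. \<bar>f x\<bar> \<le> C * exp (C * \<bar>x\<bar>)" "\<And>x. \<bar>f' x\<bar> \<le> C * exp (C * \<bar>x\<bar>)"
  shows "(\<integral>x. x * f x \<partial>std_gauss) = (\<integral>x. f' x \<partial>std_gauss)"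
proof -
  let ?\<phi> = std_normal_density
  have cf: "isCont f x" for x using d DERIV_isCont by blast
  have C0: "0 \<le> C" using b(1)[of 0] by simp
  have mf [measurable]: "f \<in> borel_measurable borel" "f' \<in> borel_measurable borel"
    using cf c by (auto intro!: borel_measurable_continuous_onI continuous_at_imp_continuous_on)
  have i1: "integrable std_gauss f'" by (rule integrable_std_gauss_bound) (use b in auto)
  have i2: "integrable std_gauss (\<lambda>x. x * f x)"
  proof (rule integrable_std_gauss_bound[where C="C+1"])
    fix x :: real
    have "\<bar>x * f x\<bar> \<le> exp \<bar>x\<bar> * (C * exp (C * \<bar>x\<bar>))"
      unfolding abs_mult by (intro mult_mono b abs_le_exp) auto
    also have "\<dots> = C * exp ((C + 1) * \<bar>x\<bar>)" by (simp add: algebra_simps exp_add)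
    also have "\<dots> \<le> (C + 1) * exp ((C + 1) * \<bar>x\<bar>)" by simp
    finally show "\<bar>x * f x\<bar> \<le> (C + 1) * exp ((C + 1) * \<bar>x\<bar>)" .
  qed auto
  have I: "integrable lborel (\<lambda>x. ?\<phi> x * (f' x - x * f x))"
    using Bochner_Integration.integrable_diff[OF i1 i2] by (subst (asm) integrable_std_gauss_iff) auto
  have lim0: "((\<lambda>x. f x * ?\<phi> x) \<longlongrightarrow> 0) F"
    if "((\<lambda>x. C * exp (C * \<bar>x\<bar>) * ?\<phi> x) \<longlongrightarrow> 0) F" for F
    by (rule Lim_null_comparison[OF _ that])
       (use b(1) in \<open>auto simp: abs_mult intro!: always_eventually mult_right_mono\<close>)
  have "(LBINT x=-\<infinity>..\<infinity>. ?\<phi> x * (f' x - x * f x)) = 0 - 0"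
  proof (rule interval_integral_FTC_integrable[where F="\<lambda>x. f x * ?\<phi> x"])
    fix x :: real
    have d\<phi>: "(?\<phi> has_field_derivative (- x * ?\<phi> x)) (at x)"
    proof -
      define K where "K = 1 / sqrt (2 * pi)"
      show ?thesis
        unfolding std_normal_density_def K_def[symmetric] by (auto intro!: derivative_eq_intros)
    qed
    have "((\<lambda>x. f x * ?\<phi> x) has_field_derivative (?\<phi> x * (f' x - x * f x))) (at x)"
      by (rule derivative_eq_intros d d\<phi> refl)+ (simp add: algebra_simps)
    then show "((\<lambda>x. f x * ?\<phi> x) has_vector_derivative ?\<phi> x * (f' x - x * f x)) (at x)"
      by (simp add: has_real_derivative_iff_has_vector_derivative)
    show "isCont (\<lambda>x. ?\<phi> x * (f' x - x * f x)) x"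
      unfolding std_normal_density_def by (intro continuous_intros c cf) auto
  next
    show "set_integrable lborel (einterval (- \<infinity>) \<infinity>) (\<lambda>x. ?\<phi> x * (f' x - x * f x))"
      using I by (simp add: set_integrable_def einterval_def)
    show "(((\<lambda>x. f x * ?\<phi> x) \<circ> real_of_ereal) \<longlongrightarrow> 0) (at_right (- \<infinity>))"
      using lim0[OF tendsto_density_exp(2)] by (simp only: ereal_tendsto_simps1)
    show "(((\<lambda>x. f x * ?\<phi> x) \<circ> real_of_ereal) \<longlongrightarrow> 0) (at_left \<infinity>)"
      using lim0[OF tendsto_density_exp(1)] by (simp only: ereal_tendsto_simps1)
  qed simp
  then have "(\<integral>x. ?\<phi> x * (f' x - x * f x) \<partial>lborel) = 0"
    by (simp add: interval_lebesgue_integral_def set_lebesgue_integral_def einterval_def)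
  then have "(\<integral>x. f' x - x * f x \<partial>std_gauss) = 0"
    by (subst integral_std_gauss) auto
  then show ?thesis using i1 i2 by simp
qed

text \<open>At most exponential growth in finitely many coordinates, with one constant as prefactor
  and as rate. The class is closed under sums and products, contains exponentials of linear forms
  and consists of integrable functions, so integrability becomes a matter of introduction
  rules.\<close>

definition tame :: "(('i \<Rightarrow> real) \<Rightarrow> real) \<Rightarrow> bool" where
  "tame F \<longleftrightarrow> F \<in> borel_measurable gauss \<and>
     (\<exists>J C. finite J \<and> (\<forall>g. \<bar>F g\<bar> \<le> C * exp (C * (\<Sum>j\<in>J. \<bar>g j\<bar>))))"

lemma nn_integral_exp_sum_abs:
  assumes "finite J"
  shows "(\<integral>\<^sup>+g. ennreal (exp (c * (\<Sum>j\<in>J. \<bar>g j\<bar>))) \<partial>gauss) < \<infinity>"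
  using assms
proof (induction J rule: finite_induct)
  case empty
  then show ?case by (simp add: gauss.emeasure_space_1[simplified])
next
  case (insert j J)
  have "(\<integral>\<^sup>+g. ennreal (exp (c * (\<Sum>i\<in>insert j J. \<bar>g i\<bar>))) \<partial>gauss)
      = (\<integral>\<^sup>+g. \<integral>\<^sup>+x. ennreal (exp (c * (\<Sum>i\<in>insert j J. \<bar>(g(j := x)) i\<bar>))) \<partial>std_gauss \<partial>gauss)"
    by (rule nn_integral_gauss_split) measurable
  also have "\<dots> = (\<integral>\<^sup>+g. ennreal (exp (c * (\<Sum>i\<in>J. \<bar>g i\<bar>))) * (\<integral>\<^sup>+x. ennreal (exp (c * \<bar>x\<bar>)) \<partial>std_gauss) \<partial>gauss)"
  proof (rule nn_integral_cong)
    fix g :: "'a \<Rightarrow> real"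
    have "(\<Sum>i\<in>insert j J. \<bar>(g(j := x)) i\<bar>) = \<bar>x\<bar> + (\<Sum>i\<in>J. \<bar>g i\<bar>)" for x
      using insert.hyps by (auto intro!: sum.cong)
    then show "(\<integral>\<^sup>+x. ennreal (exp (c * (\<Sum>i\<in>insert j J. \<bar>(g(j := x)) i\<bar>))) \<partial>std_gauss)
        = ennreal (exp (c * (\<Sum>i\<in>J. \<bar>g i\<bar>))) * (\<integral>\<^sup>+x. ennreal (exp (c * \<bar>x\<bar>)) \<partial>std_gauss)"
      by (subst nn_integral_cmult[symmetric])
         (auto simp: ring_distribs exp_add ennreal_mult mult.commute measurable_from_std_gauss)
  qed
  also have "\<dots> = (\<integral>\<^sup>+g. ennreal (exp (c * (\<Sum>i\<in>J. \<bar>g i\<bar>))) \<partial>gauss) * (\<integral>\<^sup>+x. ennreal (exp (c * \<bar>x\<bar>)) \<partial>std_gauss)"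
    by (rule nn_integral_multc) measurable
  also have "\<dots> < \<infinity>"
    using insert.IH order.strict_trans1[OF nn_integral_exp_abs_std_gauss[of c], of \<infinity>]
    by (auto simp: ennreal_mult_less_top)
  finally show ?case .
qed

lemma integrable_tame:
  assumes "tame F"
  shows "integrable gauss F"
proof -
  obtain J C where J: "finite J" "\<And>g. \<bar>F g\<bar> \<le> C * exp (C * (\<Sum>j\<in>J. \<bar>g j\<bar>))"
    and [measurable]: "F \<in> borel_measurable gauss"
    using assms unfolding tame_def by blast
  have "integrable gauss (\<lambda>g. exp (C * (\<Sum>j\<in>J. \<bar>g j\<bar>)))"
    by (rule integrableI_nonneg) (use nn_integral_exp_sum_abs[OF J(1)] in auto)
  then have "integrable gauss (\<lambda>g. C * exp (C * (\<Sum>j\<in>J. \<bar>g j\<bar>)))" by simp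
  then show ?thesis
    by (rule Bochner_Integration.integrable_bound)
       (use order.trans[OF J(2) abs_ge_self] in auto)
qed

lemma tame_bound_mono:
  assumes "finite J'" "J \<subseteq> J'" "C \<le> C'" "0 \<le> C"
  shows "C * exp (C * (\<Sum>j\<in>J. \<bar>g j\<bar>)) \<le> C' * exp (C' * (\<Sum>j\<in>J'. \<bar>g j :: real\<bar>))"
  by (intro mult_mono exp_le_cancel_iff[THEN iffD2] sum_mono2) (use assms in \<open>auto intro: sum_nonneg\<close>)

lemma tame_obtain_common:
  assumes "tame F" "tame G"
  obtains J C where "finite J" "0 \<le> C" "\<And>g. \<bar>F g\<bar> \<le> C * exp (C * (\<Sum>j\<in>J. \<bar>g j\<bar>))"
    "\<And>g. \<bar>G g\<bar> \<le> C * exp (C * (\<Sum>j\<in>J. \<bar>g j\<bar>))"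
proof -
  obtain J1 C1 where 1: "finite J1" "\<And>g. \<bar>F g\<bar> \<le> C1 * exp (C1 * (\<Sum>j\<in>J1. \<bar>g j\<bar>))"
    using assms unfolding tame_def by blast
  obtain J2 C2 where 2: "finite J2" "\<And>g. \<bar>G g\<bar> \<le> C2 * exp (C2 * (\<Sum>j\<in>J2. \<bar>g j\<bar>))"
    using assms unfolding tame_def by blast
  have "0 \<le> C1" using 1(2)[of "\<lambda>_. 0"] by simp
  moreover have "0 \<le> C2" using 2(2)[of "\<lambda>_. 0"] by simp
  ultimately show thesis
    using 1 2
    by (intro that[of "J1 \<union> J2" "max C1 C2"])
       (auto intro!: order.trans[OF 1(2) tame_bound_mono] order.trans[OF 2(2) tame_bound_mono])
qed

lemma tame_const [intro, simp]: "tame (\<lambda>_. c)"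
  unfolding tame_def by (auto intro!: exI[of _ "{}"] exI[of _ "\<bar>c\<bar>"])

lemma tame_component [intro]: "tame (\<lambda>g. g i)"
  unfolding tame_def using abs_le_exp by (auto intro!: exI[of _ "{i}"] exI[of _ 1])

lemma tame_bound:
  assumes "F \<in> borel_measurable gauss" "tame G" "\<And>g. \<bar>F g\<bar> \<le> G g"
  shows "tame F"
  using assms unfolding tame_def by (meson abs_le_D1 order_trans)

lemma tame_add [intro]:
  assumes "tame F" "tame G"
  shows "tame (\<lambda>g. F g + G g)"
proof -
  obtain J C where J: "finite J" "0 \<le> C" "\<And>g. \<bar>F g\<bar> \<le> C * exp (C * (\<Sum>j\<in>J. \<bar>g j\<bar>))"
    "\<And>g. \<bar>G g\<bar> \<le> C * exp (C * (\<Sum>j\<in>J. \<bar>g j\<bar>))"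
    by (rule tame_obtain_common[OF assms]) blast
  have [measurable]: "F \<in> borel_measurable gauss" "G \<in> borel_measurable gauss"
    using assms by (auto simp: tame_def)
  have "\<bar>F g + G g\<bar> \<le> (2 * C) * exp ((2 * C) * (\<Sum>j\<in>J. \<bar>g j\<bar>))" for g
  proof -
    have "\<bar>F g + G g\<bar> \<le> 2 * (C * exp (C * (\<Sum>j\<in>J. \<bar>g j\<bar>)))"
      using J(3,4)[of g] by linarith
    also have "\<dots> \<le> (2 * C) * exp ((2 * C) * (\<Sum>j\<in>J. \<bar>g j\<bar>))"
    proof -
      have "C * (\<Sum>j\<in>J. \<bar>g j\<bar>) \<le> (2 * C) * (\<Sum>j\<in>J. \<bar>g j\<bar>)"
        by (rule mult_right_mono) (use J(2) in \<open>auto intro: sum_nonneg\<close>)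
      then have "(2 * C) * exp (C * (\<Sum>j\<in>J. \<bar>g j\<bar>)) \<le> (2 * C) * exp ((2 * C) * (\<Sum>j\<in>J. \<bar>g j\<bar>))"
        using J(2) by (intro mult_left_mono) simp_all
      then show ?thesis by (simp only: mult.assoc)
    qed
    finally show ?thesis .
  qed
  then show ?thesis unfolding tame_def using J(1) by auto
qed

lemma tame_mult [intro]:
  assumes "tame F" "tame G"
  shows "tame (\<lambda>g. F g * G g)"
proof -
  obtain J C where J: "finite J" "0 \<le> C" "\<And>g. \<bar>F g\<bar> \<le> C * exp (C * (\<Sum>j\<in>J. \<bar>g j\<bar>))"
    "\<And>g. \<bar>G g\<bar> \<le> C * exp (C * (\<Sum>j\<in>J. \<bar>g j\<bar>))"
    by (rule tame_obtain_common[OF assms]) blast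
  have [measurable]: "F \<in> borel_measurable gauss" "G \<in> borel_measurable gauss"
    using assms by (auto simp: tame_def)
  let ?C = "2 * C + C * C"
  have "\<bar>F g * G g\<bar> \<le> ?C * exp (?C * (\<Sum>j\<in>J. \<bar>g j\<bar>))" for g
  proof -
    have "\<bar>F g * G g\<bar> \<le> (C * exp (C * (\<Sum>j\<in>J. \<bar>g j\<bar>))) * (C * exp (C * (\<Sum>j\<in>J. \<bar>g j\<bar>)))"
      unfolding abs_mult by (intro mult_mono J) (use J(2) in auto)
    also have "\<dots> = (C * C) * exp ((2 * C) * (\<Sum>j\<in>J. \<bar>g j\<bar>))"
      by (simp add: mult_exp_exp algebra_simps)
    also have "\<dots> \<le> ?C * exp (?C * (\<Sum>j\<in>J. \<bar>g j\<bar>))"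
    proof (rule mult_mono)
      show "exp ((2 * C) * (\<Sum>j\<in>J. \<bar>g j\<bar>)) \<le> exp (?C * (\<Sum>j\<in>J. \<bar>g j\<bar>))"
        unfolding exp_le_cancel_iff
        by (rule mult_right_mono) (use J(2) in \<open>auto intro: sum_nonneg\<close>)
    qed (use J(2) in auto)
    finally show ?thesis .
  qed
  then show ?thesis unfolding tame_def using J(1) by auto
qed

lemma tame_sum [intro]:
  assumes "\<And>i. i \<in> I \<Longrightarrow> tame (F i)"
  shows "tame (\<lambda>g. \<Sum>i\<in>I. F i g)"
  using assms by (induction I rule: infinite_finite_induct) auto

lemma tame_exp_linear [intro]: "tame (\<lambda>g. exp (\<Sum>j\<in>J. a j * g j))"
proof (cases "finite J")
  case True
  let ?C = "1 + (\<Sum>j\<in>J. \<bar>a j\<bar>)"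
  have C: "1 \<le> ?C" by (auto intro: sum_nonneg)
  have "\<bar>exp (\<Sum>j\<in>J. a j * g j)\<bar> \<le> ?C * exp (?C * (\<Sum>j\<in>J. \<bar>g j\<bar>))" for g
  proof -
    have "a j * g j \<le> ?C * \<bar>g j\<bar>" if "j \<in> J" for j
    proof -
      have "\<bar>a j\<bar> \<le> (\<Sum>j\<in>J. \<bar>a j\<bar>)" by (rule member_le_sum) (use that True in auto)
      then have "\<bar>a j\<bar> * \<bar>g j\<bar> \<le> ?C * \<bar>g j\<bar>" by (intro mult_right_mono) auto
      then show ?thesis using abs_ge_self[of "a j * g j"] by (simp only: abs_mult)
    qed
    then have "(\<Sum>j\<in>J. a j * g j) \<le> ?C * (\<Sum>j\<in>J. \<bar>g j\<bar>)"
      unfolding sum_distrib_left by (intro sum_mono)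
    then have "exp (\<Sum>j\<in>J. a j * g j) \<le> exp (?C * (\<Sum>j\<in>J. \<bar>g j\<bar>))" by simp
    also have "\<dots> \<le> ?C * exp (?C * (\<Sum>j\<in>J. \<bar>g j\<bar>))" using C by simp
    finally show ?thesis by simp
  qed
  then have "\<exists>J C. finite J \<and> (\<forall>g. \<bar>exp (\<Sum>j\<in>J'. a j * g j)\<bar> \<le> C * exp (C * (\<Sum>j\<in>J. \<bar>g j\<bar>)))" if "J' = J" for J'
    using True that by blast
  then show ?thesis unfolding tame_def by simp
qed simp

lemma tame_section:
  assumes "tame F"
  obtains C where "\<And>x. \<bar>F (g(i := x))\<bar> \<le> C * exp (C * \<bar>x\<bar>)"
proof -
  obtain J C where J: "finite J" "\<And>g. \<bar>F g\<bar> \<le> C * exp (C * (\<Sum>j\<in>J. \<bar>g j\<bar>))"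
    using assms unfolding tame_def by blast
  have C: "0 \<le> C" using J(2)[of "\<lambda>_. 0"] by simp
  let ?D = "C + C * exp (C * (\<Sum>j\<in>J. \<bar>g j\<bar>))"
  have "\<bar>F (g(i := x))\<bar> \<le> ?D * exp (?D * \<bar>x\<bar>)" for x
  proof -
    have "(\<Sum>j\<in>J. \<bar>(g(i := x)) j\<bar>) \<le> (\<Sum>j\<in>J. \<bar>g j\<bar> + (if j = i then \<bar>x\<bar> else 0))"
      by (intro sum_mono) auto
    also have "\<dots> \<le> (\<Sum>j\<in>J. \<bar>g j\<bar>) + \<bar>x\<bar>"
      using J(1) by (auto simp: sum.distrib)
    finally have "C * exp (C * (\<Sum>j\<in>J. \<bar>(g(i := x)) j\<bar>)) \<le> C * exp (C * ((\<Sum>j\<in>J. \<bar>g j\<bar>) + \<bar>x\<bar>))"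
      using C by (auto intro!: mult_left_mono)
    also have "\<dots> = (C * exp (C * (\<Sum>j\<in>J. \<bar>g j\<bar>))) * exp (C * \<bar>x\<bar>)"
      by (simp add: ring_distribs exp_add)
    also have "\<dots> \<le> ?D * exp (?D * \<bar>x\<bar>)"
      using C by (intro mult_mono) (auto intro!: mult_right_mono)
    finally show ?thesis using J(2)[of "g(i := x)"] by simp
  qed
  then show thesis by (rule that)
qed

lemma gauss_ibp:
  assumes F: "tame F" "tame F'"
    and d: "\<And>g x. ((\<lambda>x. F (g(i := x))) has_field_derivative F' (g(i := x))) (at x)"
    and c: "\<And>g x. isCont (\<lambda>x. F' (g(i := x))) x"
  shows "(\<integral>g. g i * F g \<partial>gauss) = (\<integral>g. F' g \<partial>gauss)"
proof -
  have "(\<integral>g. g i * F g \<partial>gauss) = (\<integral>g. \<integral>x. (g(i := x)) i * F (g(i := x)) \<partial>std_gauss \<partial>gauss)"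
    by (rule integral_gauss_split(1)) (use F in \<open>auto intro!: integrable_tame\<close>)
  also have "\<dots> = (\<integral>g. \<integral>x. F' (g(i := x)) \<partial>std_gauss \<partial>gauss)"
  proof (rule Bochner_Integration.integral_cong[OF refl])
    fix g :: "'a \<Rightarrow> real"
    obtain C1 where C1: "\<And>x. \<bar>F (g(i := x))\<bar> \<le> C1 * exp (C1 * \<bar>x\<bar>)"
      by (rule tame_section[OF F(1)]) blast
    obtain C2 where C2: "\<And>x. \<bar>F' (g(i := x))\<bar> \<le> C2 * exp (C2 * \<bar>x\<bar>)"
      by (rule tame_section[OF F(2)]) blast
    have pos: "0 \<le> C1" "0 \<le> C2" using C1[of 0] C2[of 0] by auto
    have mono: "C * exp (C * \<bar>x\<bar>) \<le> max C1 C2 * exp (max C1 C2 * \<bar>x\<bar>)"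
      if "0 \<le> C" "C \<le> max C1 C2" for C x :: real
      by (intro mult_mono exp_le_cancel_iff[THEN iffD2] mult_right_mono) (use that in auto)
    have "(\<integral>x. x * F (g(i := x)) \<partial>std_gauss) = (\<integral>x. F' (g(i := x)) \<partial>std_gauss)"
      by (rule std_gauss_ibp[where C="max C1 C2"])
         (use d c pos in \<open>auto intro!: order.trans[OF C1 mono] order.trans[OF C2 mono]\<close>)
    then show "(\<integral>x. (g(i := x)) i * F (g(i := x)) \<partial>std_gauss) = (\<integral>x. F' (g(i := x)) \<partial>std_gauss)"
      by simp
  qed
  also have "\<dots> = (\<integral>g. F' g \<partial>gauss)"
    by (rule integral_gauss_split(1)[symmetric]) (use F in \<open>auto intro!: integrable_tame\<close>)
  finally show ?thesis .
qed

text \<open>Cameron-Martin formula for finitely many coordinates, by shifting one coordinate at a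
  time. For \<open>ennreal\<close>-valued functions no integrability has to be carried through the
  induction.\<close>

lemma nn_gauss_shift:
  fixes F :: "('i \<Rightarrow> real) \<Rightarrow> ennreal"
  assumes "finite J" and "F \<in> borel_measurable gauss"
  shows "(\<integral>\<^sup>+g. ennreal (exp (\<Sum>j\<in>J. a j * g j)) * F g \<partial>gauss)
    = ennreal (exp ((\<Sum>j\<in>J. (a j)\<^sup>2) / 2)) * (\<integral>\<^sup>+g. F (\<lambda>j. if j \<in> J then g j + a j else g j) \<partial>gauss)"
  using assms
proof (induction J arbitrary: F rule: finite_induct)
  case empty
  then show ?case by simp
next
  case (insert i J)
  note [measurable] = insert.prems
  let ?s = "\<lambda>g j. if j \<in> J then g j + a j else g j"
  have ms [measurable]: "?s \<in> measurable gauss gauss"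
    by (rule measurable_into_gauss) auto
  have mi [measurable]: "(\<lambda>g. g(i := g i + a i)) \<in> measurable gauss gauss"
  proof (rule measurable_into_gauss)
    fix j show "(\<lambda>g. (g(i := g i + a i)) j) \<in> borel_measurable gauss"
      by (cases "j = i") auto
  qed
  define G where "G = (\<lambda>g. ennreal (exp (a i * g i)) * F g)"
  have [measurable]: "G \<in> borel_measurable gauss" unfolding G_def by measurable
  have "(\<integral>\<^sup>+g. ennreal (exp (\<Sum>j\<in>insert i J. a j * g j)) * F g \<partial>gauss)
      = (\<integral>\<^sup>+g. ennreal (exp (\<Sum>j\<in>J. a j * g j)) * G g \<partial>gauss)"
  proof (rule nn_integral_cong)
    fix g :: "'i \<Rightarrow> real"
    have "exp (\<Sum>j\<in>insert i J. a j * g j) = exp (\<Sum>j\<in>J. a j * g j) * exp (a i * g i)"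
      using insert.hyps by (simp add: exp_add)
    then show "ennreal (exp (\<Sum>j\<in>insert i J. a j * g j)) * F g = ennreal (exp (\<Sum>j\<in>J. a j * g j)) * G g"
      unfolding G_def by (simp only: ennreal_mult exp_ge_zero mult.assoc)
  qed
  also have "\<dots> = ennreal (exp ((\<Sum>j\<in>J. (a j)\<^sup>2) / 2)) * (\<integral>\<^sup>+g. G (?s g) \<partial>gauss)"
    by (rule insert.IH) measurable
  also have "(\<integral>\<^sup>+g. G (?s g) \<partial>gauss) = (\<integral>\<^sup>+g. \<integral>\<^sup>+x. G (?s (g(i := x))) \<partial>std_gauss \<partial>gauss)"
    by (rule nn_integral_gauss_split) measurable
  also have "\<dots> = (\<integral>\<^sup>+g. ennreal (exp ((a i)\<^sup>2 / 2)) * (\<integral>\<^sup>+x. F (?s (g(i := x + a i))) \<partial>std_gauss) \<partial>gauss)"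
  proof (rule nn_integral_cong)
    fix g :: "'i \<Rightarrow> real"
    have m: "(\<lambda>x. F (?s (g(i := x)))) \<in> borel_measurable borel"
      by (rule measurable_upd_snd[of "\<lambda>g. F (?s g)"]) measurable
    have "(\<integral>\<^sup>+x. G (?s (g(i := x))) \<partial>std_gauss) = (\<integral>\<^sup>+x. ennreal (exp (a i * x)) * F (?s (g(i := x))) \<partial>std_gauss)"
      unfolding G_def using insert.hyps by auto
    also have "\<dots> = ennreal (exp ((a i)\<^sup>2 / 2)) * (\<integral>\<^sup>+x. F (?s (g(i := x + a i))) \<partial>std_gauss)"
      by (rule nn_std_gauss_shift[OF m])
    finally show "(\<integral>\<^sup>+x. G (?s (g(i := x))) \<partial>std_gauss)
        = ennreal (exp ((a i)\<^sup>2 / 2)) * (\<integral>\<^sup>+x. F (?s (g(i := x + a i))) \<partial>std_gauss)" .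
  qed
  also have "\<dots> = (\<integral>\<^sup>+g. \<integral>\<^sup>+x. ennreal (exp ((a i)\<^sup>2 / 2)) * F (?s ((g(i := x))(i := (g(i := x)) i + a i))) \<partial>std_gauss \<partial>gauss)"
  proof (rule nn_integral_cong)
    fix g :: "'i \<Rightarrow> real"
    have m: "(\<lambda>x. F (?s (g(i := x)))) \<in> borel_measurable borel"
      by (rule measurable_upd_snd[of "\<lambda>g. F (?s g)"]) measurable
    have "(\<lambda>x. F (?s (g(i := x + a i)))) \<in> borel_measurable std_gauss"
      unfolding measurable_from_std_gauss by (rule measurable_compose[OF _ m]) measurable
    moreover have "(g(i := x))(i := (g(i := x)) i + a i) = g(i := x + a i)" for x by simp
    ultimately show "ennreal (exp ((a i)\<^sup>2 / 2)) * (\<integral>\<^sup>+x. F (?s (g(i := x + a i))) \<partial>std_gauss)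
        = (\<integral>\<^sup>+x. ennreal (exp ((a i)\<^sup>2 / 2)) * F (?s ((g(i := x))(i := (g(i := x)) i + a i))) \<partial>std_gauss)"
      by (simp only: nn_integral_cmult)
  qed
  also have "\<dots> = (\<integral>\<^sup>+g. ennreal (exp ((a i)\<^sup>2 / 2)) * F (?s (g(i := g i + a i))) \<partial>gauss)"
    by (rule nn_integral_gauss_split[symmetric]) measurable
  also have "\<dots> = ennreal (exp ((a i)\<^sup>2 / 2)) * (\<integral>\<^sup>+g. F (?s (g(i := g i + a i))) \<partial>gauss)"
    by (rule nn_integral_cmult) measurable
  also have "(\<lambda>g. F (?s (g(i := g i + a i)))) = (\<lambda>g. F (\<lambda>j. if j \<in> insert i J then g j + a j else g j))"
  proof (rule ext, rule arg_cong[where f=F], rule ext)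
    fix g j
    show "(if j \<in> J then (g(i := g i + a i)) j + a j else (g(i := g i + a i)) j)
        = (if j \<in> insert i J then g j + a j else g j)"
      using insert.hyps by (cases "j = i") auto
  qed
  also have "ennreal (exp ((\<Sum>j\<in>J. (a j)\<^sup>2) / 2)) * (ennreal (exp ((a i)\<^sup>2 / 2)) * X)
      = ennreal (exp ((\<Sum>j\<in>insert i J. (a j)\<^sup>2) / 2)) * X" for X
  proof -
    have "exp ((\<Sum>j\<in>insert i J. (a j)\<^sup>2) / 2) = exp ((\<Sum>j\<in>J. (a j)\<^sup>2) / 2) * exp ((a i)\<^sup>2 / 2)"
      using insert.hyps by (simp add: add_divide_distrib exp_add)
    then show ?thesis by (simp only: ennreal_mult exp_ge_zero mult.assoc)
  qed
  finally show ?case .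
qed

section \<open>Gaussian concentration\<close>

lemma UNIV_sets_gauss [simp, measurable]: "UNIV \<in> sets gauss"
  using sets.top[of gauss] by simp

lemma exp_plus_exp_minus_mono:
  fixes s t :: real
  assumes "\<bar>t\<bar> \<le> \<bar>s\<bar>"
  shows "exp t + exp (- t) \<le> exp s + exp (- s)"
proof -
  have "cosh \<bar>t\<bar> \<le> cosh \<bar>s\<bar>" using assms by (subst cosh_real_nonneg_le_iff) auto
  then show ?thesis by (cases "0 \<le> t"; cases "0 \<le> s") (simp_all add: cosh_def)
qed

text \<open>Symmetrisation: the mean of \<open>exp (l * (f x - f y))\<close> over independent
  \<open>x\<close>, \<open>y\<close> is a mean of \<open>cosh\<close>, which grows with the absolute
  value of its argument, so \<open>f\<close> may be replaced by the linear function of slope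
  \<open>c\<close>. That mean is explicit, and Jensen's inequality removes the copy
  \<open>y\<close>. The exponent is twice the optimal one, which only affects constants.\<close>

lemma std_gauss_lipschitz_exp:
  fixes f :: "real \<Rightarrow> real"
  assumes f [measurable]: "f \<in> borel_measurable borel" and c: "0 \<le> c"
    and lip: "\<And>x y. \<bar>f x - f y\<bar> \<le> c * \<bar>x - y\<bar>"
  shows "integrable std_gauss f"
    and "integrable std_gauss (\<lambda>x. exp (l * f x))"
    and "(\<integral>x. exp (l * f x) \<partial>std_gauss) \<le> exp (l * (\<integral>x. f x \<partial>std_gauss) + l\<^sup>2 * c\<^sup>2)"
proof -
  have [measurable]: "f \<in> borel_measurable std_gauss" by (simp add: measurable_from_std_gauss)
  have fb: "\<bar>f x\<bar> \<le> \<bar>f 0\<bar> + c * \<bar>x\<bar>" for x using lip[of x 0] by simp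
  have I: "integrable std_gauss (\<lambda>x. exp (l * f x))" for l
  proof (rule Bochner_Integration.integrable_bound)
    show "integrable std_gauss (\<lambda>x. exp (\<bar>l\<bar> * \<bar>f 0\<bar>) * exp (\<bar>l\<bar> * c * \<bar>x\<bar>))"
      using integrable_exp_abs_std_gauss by auto
    show "AE x in std_gauss. norm (exp (l * f x)) \<le> norm (exp (\<bar>l\<bar> * \<bar>f 0\<bar>) * exp (\<bar>l\<bar> * c * \<bar>x\<bar>))"
    proof (rule AE_I2)
      fix x
      have "l * f x \<le> \<bar>l\<bar> * \<bar>f x\<bar>" by (metis abs_ge_self abs_mult)
      also have "\<dots> \<le> \<bar>l\<bar> * (\<bar>f 0\<bar> + c * \<bar>x\<bar>)" by (intro mult_left_mono fb) auto
      finally show "norm (exp (l * f x)) \<le> norm (exp (\<bar>l\<bar> * \<bar>f 0\<bar>) * exp (\<bar>l\<bar> * c * \<bar>x\<bar>))"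
        by (simp add: mult_exp_exp algebra_simps)
    qed
  qed simp
  show "integrable std_gauss (\<lambda>x. exp (l * f x))" by (rule I)
  show If: "integrable std_gauss f"
  proof (rule Bochner_Integration.integrable_bound)
    show "integrable std_gauss (\<lambda>x. exp (1 * f x) + exp (- 1 * f x))"
      using I[of 1] I[of "-1"] by simp
    show "AE x in std_gauss. norm (f x) \<le> norm (exp (1 * f x) + exp (- 1 * f x))"
    proof (rule AE_I2)
      fix x
      have "\<bar>f x\<bar> \<le> exp \<bar>f x\<bar>" by (rule abs_le_exp)
      also have "\<dots> \<le> exp (1 * f x) + exp (- 1 * f x)" using exp_abs_le[of 1 "f x"] by simp
      finally show "norm (f x) \<le> norm (exp (1 * f x) + exp (- 1 * f x))" by simp
    qed
  qed simp
  let ?A = "\<integral>x. exp (l * f x) \<partial>std_gauss" and ?B = "\<integral>x. exp (- l * f x) \<partial>std_gauss"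
  let ?m = "\<integral>x. f x \<partial>std_gauss" and ?M = "exp ((l * c)\<^sup>2 / 2)"
  have IA: "integrable std_gauss (\<lambda>x. exp (l * f x))" and IB: "integrable std_gauss (\<lambda>x. exp (- l * f x))"
    by (rule I)+
  have IE: "integrable std_gauss (\<lambda>x. exp (l * c * x))" "integrable std_gauss (\<lambda>x. exp (- (l * c) * x))"
    by (rule integrable_exp_std_gauss)+
  \<comment> \<open>The copy is integrated out for fixed \<open>x\<close>, so that single integrals
    suffice. Adding the two signs of \<open>l\<close> produces the \<open>cosh\<close> to be
    compared.\<close>
  have inner: "exp (l * f x) * ?B + exp (- l * f x) * ?A \<le> exp (l * c * x) * ?M + exp (- (l * c) * x) * ?M" for x
  proof -
    have "exp (l * f x) * ?B + exp (- l * f x) * ?A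
        = (\<integral>y. exp (l * f x) * exp (- l * f y) + exp (- l * f x) * exp (l * f y) \<partial>std_gauss)"
      by (subst Bochner_Integration.integral_add) (use IA IB in auto)
    also have "\<dots> \<le> (\<integral>y. exp (l * c * x) * exp (- (l * c) * y) + exp (- (l * c) * x) * exp (l * c * y) \<partial>std_gauss)"
    proof (rule integral_mono)
      fix y
      have "\<bar>l * (f x - f y)\<bar> \<le> \<bar>l * c * (x - y)\<bar>"
        using lip[of x y] c by (simp add: abs_mult mult_left_mono mult.assoc)
      from exp_plus_exp_minus_mono[OF this]
      show "exp (l * f x) * exp (- l * f y) + exp (- l * f x) * exp (l * f y)
         \<le> exp (l * c * x) * exp (- (l * c) * y) + exp (- (l * c) * x) * exp (l * c * y)"
        unfolding mult_exp_exp by (simp add: algebra_simps)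
    qed (use IA IB IE in \<open>auto intro!: Bochner_Integration.integrable_add\<close>)
    also have "\<dots> = exp (l * c * x) * ?M + exp (- (l * c) * x) * ?M"
      using integral_exp_std_gauss[of "l * c"] integral_exp_std_gauss[of "- (l * c)"]
      by (subst Bochner_Integration.integral_add) (use IE in auto)
    finally show ?thesis .
  qed
  have "?A * ?B + ?B * ?A = (\<integral>x. exp (l * f x) * ?B + exp (- l * f x) * ?A \<partial>std_gauss)"
    by (subst Bochner_Integration.integral_add) (use IA IB in auto)
  also have "\<dots> \<le> (\<integral>x. exp (l * c * x) * ?M + exp (- (l * c) * x) * ?M \<partial>std_gauss)"
    by (rule integral_mono) (use IA IB IE inner in \<open>auto intro!: Bochner_Integration.integrable_add\<close>)
  also have "\<dots> = ?M * ?M + ?M * ?M"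
    using integral_exp_std_gauss[of "l * c"] integral_exp_std_gauss[of "- (l * c)"]
    by (subst Bochner_Integration.integral_add) (use IE in auto)
  finally have AB: "?A * ?B \<le> exp (l\<^sup>2 * c\<^sup>2)"
    by (simp add: mult_exp_exp power_mult_distrib mult.commute)
  \<comment> \<open>Jensen's inequality in the form \<open>1 + t \<le> exp t\<close>: the centred
    exponential moment \<open>exp (l * ?m) * ?B\<close> is at least 1, so inserting it only enlarges
    \<open>?A\<close>.\<close>
  have "1 = (\<integral>x. 1 + - l * (f x - ?m) \<partial>std_gauss)"
    using If by (simp add: std_gauss.prob_space[simplified])
  also have "\<dots> \<le> (\<integral>x. exp (l * ?m) * exp (- l * f x) \<partial>std_gauss)"
  proof (rule integral_mono)
    fix x
    show "1 + - l * (f x - ?m) \<le> exp (l * ?m) * exp (- l * f x)"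
      using exp_ge_add_one_self[of "- l * (f x - ?m)"] by (simp add: mult_exp_exp algebra_simps)
  qed (use If IB in auto)
  also have "\<dots> = exp (l * ?m) * ?B" by simp
  finally have B: "1 \<le> exp (l * ?m) * ?B" .
  have A0: "0 \<le> ?A" by (rule integral_nonneg_AE) auto
  have "?A \<le> ?A * (exp (l * ?m) * ?B)" using mult_left_mono[OF B A0] by simp
  also have "\<dots> = exp (l * ?m) * (?A * ?B)" by simp
  also have "\<dots> \<le> exp (l * ?m) * exp (l\<^sup>2 * c\<^sup>2)" by (intro mult_left_mono AB) auto
  finally show "?A \<le> exp (l * ?m + l\<^sup>2 * c\<^sup>2)" by (simp add: exp_add)
qed

text \<open>The sum of the squares of \<open>c\<close> acts as the variance. For the log partition
  functions below it is of order N, so deviations of order N are exponentially unlikely.\<close>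

definition coord_lipschitz :: "'i set \<Rightarrow> ('i \<Rightarrow> real) \<Rightarrow> (('i \<Rightarrow> real) \<Rightarrow> real) \<Rightarrow> bool" where
  "coord_lipschitz J c X \<longleftrightarrow> finite J \<and> X \<in> borel_measurable gauss \<and> (\<forall>j\<in>J. 0 \<le> c j)
     \<and> (\<forall>g g'. (\<forall>j\<in>J. g j = g' j) \<longrightarrow> X g = X g')
     \<and> (\<forall>g. \<forall>j\<in>J. \<forall>x y. \<bar>X (g(j := x)) - X (g(j := y))\<bar> \<le> c j * \<bar>x - y\<bar>)"

lemma coord_lipschitzD:
  assumes "coord_lipschitz J c X"
  shows "finite J" "X \<in> borel_measurable gauss" "\<And>j. j \<in> J \<Longrightarrow> 0 \<le> c j"
    "\<And>g g'. (\<And>j. j \<in> J \<Longrightarrow> g j = g' j) \<Longrightarrow> X g = X g'"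
    "\<And>g j x y. j \<in> J \<Longrightarrow> \<bar>X (g(j := x)) - X (g(j := y))\<bar> \<le> c j * \<bar>x - y\<bar>"
  using assms by (simp_all add: coord_lipschitz_def del: fun_upd_apply)

lemma coord_lipschitz_bound:
  assumes "coord_lipschitz J c X"
  shows "\<bar>X g - X (\<lambda>_. 0)\<bar> \<le> (\<Sum>j\<in>J. c j * \<bar>g j\<bar>)"
proof -
  have "finite J" using assms by (simp add: coord_lipschitz_def)
  moreover have "K \<subseteq> J \<Longrightarrow> \<bar>X g - X (\<lambda>j. if j \<in> K then 0 else g j)\<bar> \<le> (\<Sum>j\<in>K. c j * \<bar>g j\<bar>)" if "finite K" for K
    using that
  proof (induction K rule: finite_induct)
    case (insert k K)
    let ?h = "\<lambda>j. if j \<in> K then 0 else g j"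
    have e: "(\<lambda>j. if j \<in> insert k K then 0 else g j) = ?h(k := 0)" "?h = ?h(k := g k)"
      using insert.hyps by auto
    have "\<forall>g. \<forall>j\<in>J. \<forall>x y. \<bar>X (g(j := x)) - X (g(j := y))\<bar> \<le> c j * \<bar>x - y\<bar>"
      using assms by (simp add: coord_lipschitz_def)
    then have "\<bar>X (?h(k := g k)) - X (?h(k := 0))\<bar> \<le> c k * \<bar>g k - 0\<bar>"
      using insert.prems by blast
    then show ?case using insert unfolding e(1) using e(2) by (smt (verit) insert_subset sum.insert)
  qed simp
  ultimately have "\<bar>X g - X (\<lambda>j. if j \<in> J then 0 else g j)\<bar> \<le> (\<Sum>j\<in>J. c j * \<bar>g j\<bar>)" by blast
  moreover have "X (\<lambda>j. if j \<in> J then 0 else g j) = X (\<lambda>_. 0)"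
    using assms unfolding coord_lipschitz_def by (smt (verit))
  ultimately show ?thesis by simp
qed

lemma tame_abs [intro]: "tame F \<Longrightarrow> tame (\<lambda>g. \<bar>F g\<bar>)"
  unfolding tame_def by auto

lemma coord_lipschitz_tame:
  assumes "coord_lipschitz J c X"
  shows "tame X"
proof (rule tame_bound)
  show "tame (\<lambda>g. \<bar>X (\<lambda>_. 0)\<bar> + (\<Sum>j\<in>J. c j * \<bar>g j\<bar>))"
    by (intro tame_add tame_sum tame_mult tame_const tame_abs tame_component)
  show "\<bar>X g\<bar> \<le> \<bar>X (\<lambda>_. 0)\<bar> + (\<Sum>j\<in>J. c j * \<bar>g j\<bar>)" for g
    using coord_lipschitz_bound[OF assms, of g] by linarith
qed (use assms in \<open>simp add: coord_lipschitz_def\<close>)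

text \<open>Only the coordinatewise Lipschitz constants enter, so the Gaussian concentration
  inequality tensorises one coordinate at a time.\<close>

lemma gauss_concentration:
  assumes "coord_lipschitz J c X"
  shows "(\<integral>\<^sup>+g. ennreal (exp (l * X g)) \<partial>gauss) \<le> ennreal (exp (l * (\<integral>g. X g \<partial>gauss) + l\<^sup>2 * (\<Sum>j\<in>J. (c j)\<^sup>2)))"
proof -
  have "finite J" using assms by (simp add: coord_lipschitz_def)
  then show ?thesis using assms
  proof (induction J arbitrary: X rule: finite_induct)
    case empty
    then have c: "X g = X g'" for g g' unfolding coord_lipschitz_def by blast
    define a where "a = X (\<lambda>_. 0)"
    have "X = (\<lambda>_. a)" unfolding a_def by (rule ext) (rule c)
    then show ?case
      by (simp add: gauss.emeasure_space_1[simplified] gauss.prob_space[simplified])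
  next
    case (insert i J)
    note Xm [measurable] = coord_lipschitzD(2)[OF insert.prems]
    note c = coord_lipschitzD(3)[OF insert.prems]
    note dep = coord_lipschitzD(4)[OF insert.prems]
    note lip = coord_lipschitzD(5)[OF insert.prems]
    let ?T = "\<lambda>g. \<integral>x. X (g(i := x)) \<partial>std_gauss"
    have m: "(\<lambda>x. X (g(i := x))) \<in> borel_measurable borel" for g
      by (rule measurable_upd_snd[OF Xm])
    have sec: "integrable std_gauss (\<lambda>x. X (g(i := x)))"
      "integrable std_gauss (\<lambda>x. exp (l * X (g(i := x))))"
      "(\<integral>x. exp (l * X (g(i := x))) \<partial>std_gauss) \<le> exp (l * ?T g + l\<^sup>2 * (c i)\<^sup>2)" for g
      by (rule std_gauss_lipschitz_exp[OF m c lip]; simp)+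
    \<comment> \<open>Averaging over coordinate \<open>i\<close> keeps the Lipschitz constants of
      the other coordinates; the induction hypothesis then handles \<open>?T\<close>, and
      \<open>sec(3)\<close> contributes the square of \<open>c i\<close>.\<close>
    have T: "coord_lipschitz J c ?T"
      unfolding coord_lipschitz_def
    proof (intro conjI allI ballI impI)
      show "?T \<in> borel_measurable gauss" by (rule measurable_gauss_section) fact
      fix g g' :: "'a \<Rightarrow> real" assume "\<forall>j\<in>J. g j = g' j"
      then have "X (g(i := x)) = X (g'(i := x))" for x by (intro dep) auto
      then show "?T g = ?T g'" by simp
    next
      fix g :: "'a \<Rightarrow> real" and j x y assume j: "j \<in> J"
      then have ne: "j \<noteq> i" using insert.hyps by auto
      have le: "\<bar>X (g(j := x, i := z)) - X (g(j := y, i := z))\<bar> \<le> c j * \<bar>x - y\<bar>" for z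
        unfolding fun_upd_twist[OF ne] by (rule lip) (use j in simp)
      have "\<bar>?T (g(j := x)) - ?T (g(j := y))\<bar> = \<bar>\<integral>z. X (g(j := x, i := z)) - X (g(j := y, i := z)) \<partial>std_gauss\<bar>"
        by (subst Bochner_Integration.integral_diff) (rule sec refl)+
      also have "\<dots> \<le> (\<integral>z. \<bar>X (g(j := x, i := z)) - X (g(j := y, i := z))\<bar> \<partial>std_gauss)"
        by (rule integral_abs_bound)
      also have "\<dots> \<le> (\<integral>z. c j * \<bar>x - y\<bar> \<partial>std_gauss)"
        by (rule integral_mono)
           (auto intro!: integrable_abs Bochner_Integration.integrable_diff sec(1) le)
      also have "\<dots> = c j * \<bar>x - y\<bar>" by (simp add: std_gauss.prob_space[simplified])
      finally show "\<bar>?T (g(j := x)) - ?T (g(j := y))\<bar> \<le> c j * \<bar>x - y\<bar>" .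
    next
      show "finite J" by (rule insert.hyps)
      show "0 \<le> c j" if "j \<in> J" for j using that c by blast
    qed
    have "(\<integral>\<^sup>+g. ennreal (exp (l * X g)) \<partial>gauss)
        = (\<integral>\<^sup>+g. \<integral>\<^sup>+x. ennreal (exp (l * X (g(i := x)))) \<partial>std_gauss \<partial>gauss)"
      by (rule nn_integral_gauss_split) measurable
    also have "\<dots> \<le> (\<integral>\<^sup>+g. ennreal (exp (l\<^sup>2 * (c i)\<^sup>2)) * ennreal (exp (l * ?T g)) \<partial>gauss)"
    proof (rule nn_integral_mono)
      fix g :: "'a \<Rightarrow> real"
      have "(\<integral>\<^sup>+x. ennreal (exp (l * X (g(i := x)))) \<partial>std_gauss)
          = ennreal (\<integral>x. exp (l * X (g(i := x))) \<partial>std_gauss)"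
        by (rule nn_integral_eq_integral) (rule sec(2), simp)
      also have "\<dots> \<le> ennreal (exp (l\<^sup>2 * (c i)\<^sup>2) * exp (l * ?T g))"
        by (rule ennreal_leI) (use sec(3)[of g] in \<open>simp add: mult_exp_exp add.commute\<close>)
      finally show "(\<integral>\<^sup>+x. ennreal (exp (l * X (g(i := x)))) \<partial>std_gauss)
          \<le> ennreal (exp (l\<^sup>2 * (c i)\<^sup>2)) * ennreal (exp (l * ?T g))"
        by (simp add: ennreal_mult)
    qed
    also have "\<dots> = ennreal (exp (l\<^sup>2 * (c i)\<^sup>2)) * (\<integral>\<^sup>+g. ennreal (exp (l * ?T g)) \<partial>gauss)"
    proof (rule nn_integral_cmult)
      note [measurable] = coord_lipschitzD(2)[OF T]
      show "(\<lambda>g. ennreal (exp (l * ?T g))) \<in> borel_measurable gauss" by measurable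
    qed
    also have "\<dots> \<le> ennreal (exp (l\<^sup>2 * (c i)\<^sup>2)) * ennreal (exp (l * (\<integral>g. ?T g \<partial>gauss) + l\<^sup>2 * (\<Sum>j\<in>J. (c j)\<^sup>2)))"
      by (intro mult_left_mono insert.IH T) simp
    also have "(\<integral>g. ?T g \<partial>gauss) = (\<integral>g. X g \<partial>gauss)"
      by (rule integral_gauss_split(1)[symmetric])
         (rule integrable_tame[OF coord_lipschitz_tame[OF insert.prems]])
    also have "ennreal (exp (l\<^sup>2 * (c i)\<^sup>2)) * ennreal (exp (l * (\<integral>g. X g \<partial>gauss) + l\<^sup>2 * (\<Sum>j\<in>J. (c j)\<^sup>2)))
        = ennreal (exp (l * (\<integral>g. X g \<partial>gauss) + l\<^sup>2 * (\<Sum>j\<in>insert i J. (c j)\<^sup>2)))"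
      using insert.hyps by (simp add: ennreal_mult[symmetric] mult_exp_exp algebra_simps)
    finally show ?case .
  qed
qed

lemma gauss_tail_bound:
  assumes X: "coord_lipschitz J c X" and V: "(\<Sum>j\<in>J. (c j)\<^sup>2) \<le> V" "0 < V" and t: "0 \<le> t"
  shows "measure gauss {g. X g \<ge> (\<integral>g. X g \<partial>gauss) + t} \<le> exp (- t\<^sup>2 / (4 * V))"
    and "measure gauss {g. X g \<le> (\<integral>g. X g \<partial>gauss) - t} \<le> exp (- t\<^sup>2 / (4 * V))"
proof -
  have m [measurable]: "X \<in> borel_measurable gauss" using X by (simp add: coord_lipschitz_def)
  let ?m = "\<integral>g. X g \<partial>gauss"
  have main: "measure gauss {g. s * (X g - ?m) \<ge> t} \<le> exp (- t\<^sup>2 / (4 * V))" if s: "s\<^sup>2 = 1" for s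
  proof -
    \<comment> \<open>The minimiser of \<open>- l * t + l\<^sup>2 * V\<close> in the exponential
      Markov inequality. The sign \<open>s\<close> treats both tails at once.\<close>
    define l where "l = t / (2 * V)"
    have l0: "0 \<le> l" using t V by (simp add: l_def)
    have "emeasure gauss {g \<in> space gauss. 1 \<le> ennreal (exp (- l * t - l * s * ?m)) * ennreal (exp (l * s * X g))}
       \<le> ennreal (exp (- l * t - l * s * ?m)) * (\<integral>\<^sup>+g. ennreal (exp (l * s * X g)) * indicator (space gauss) g \<partial>gauss)"
      by (rule nn_integral_Markov_inequality) auto
    also have "(\<integral>\<^sup>+g. ennreal (exp (l * s * X g)) * indicator (space gauss) g \<partial>gauss) = (\<integral>\<^sup>+g. ennreal (exp ((l * s) * X g)) \<partial>gauss)"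
      by (intro nn_integral_cong) simp
    also have "ennreal (exp (- l * t - l * s * ?m)) * (\<integral>\<^sup>+g. ennreal (exp ((l * s) * X g)) \<partial>gauss)
       \<le> ennreal (exp (- l * t - l * s * ?m)) * ennreal (exp ((l * s) * ?m + (l * s)\<^sup>2 * (\<Sum>j\<in>J. (c j)\<^sup>2)))"
      by (intro mult_left_mono gauss_concentration[OF X]) simp
    also have "\<dots> = ennreal (exp (- l * t + l\<^sup>2 * (\<Sum>j\<in>J. (c j)\<^sup>2)))"
      using s by (simp add: ennreal_mult[symmetric] mult_exp_exp power_mult_distrib)
    also have "\<dots> \<le> ennreal (exp (- t\<^sup>2 / (4 * V)))"
    proof (intro ennreal_leI exp_le_cancel_iff[THEN iffD2])
      have "- l * t + l\<^sup>2 * (\<Sum>j\<in>J. (c j)\<^sup>2) \<le> - l * t + l\<^sup>2 * V"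
        by (intro add_left_mono mult_left_mono V) auto
      also have "\<dots> = - t\<^sup>2 / (4 * V)"
        using V by (simp add: l_def power2_eq_square field_simps)
      finally show "- l * t + l\<^sup>2 * (\<Sum>j\<in>J. (c j)\<^sup>2) \<le> - t\<^sup>2 / (4 * V)" .
    qed
    finally have M: "emeasure gauss {g \<in> space gauss. 1 \<le> ennreal (exp (- l * t - l * s * ?m)) * ennreal (exp (l * s * X g))}
       \<le> ennreal (exp (- t\<^sup>2 / (4 * V)))" .
    have "{g. s * (X g - ?m) \<ge> t} \<subseteq> {g \<in> space gauss. 1 \<le> ennreal (exp (- l * t - l * s * ?m)) * ennreal (exp (l * s * X g))}"
    proof safe
      fix g assume "t \<le> s * (X g - ?m)"
      then have "0 \<le> l * (s * (X g - ?m) - t)" using l0 by simp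
      then have "1 \<le> exp (- l * t - l * s * ?m) * exp (l * s * X g)"
        by (simp add: mult_exp_exp algebra_simps)
      then show "1 \<le> ennreal (exp (- l * t - l * s * ?m)) * ennreal (exp (l * s * X g))"
        by (simp add: ennreal_mult[symmetric])
    qed simp
    moreover have "{g \<in> space gauss. 1 \<le> ennreal (exp (- l * t - l * s * ?m)) * ennreal (exp (l * s * X g))} \<in> sets gauss"
      by measurable
    ultimately have "emeasure gauss {g. s * (X g - ?m) \<ge> t} \<le> ennreal (exp (- t\<^sup>2 / (4 * V)))"
      by (rule order.trans[OF emeasure_mono M])
    then show ?thesis by (simp add: gauss.emeasure_eq_measure)
  qed
  have "{g. X g \<ge> ?m + t} = {g. 1 * (X g - ?m) \<ge> t}" by auto
  then show "measure gauss {g. X g \<ge> ?m + t} \<le> exp (- t\<^sup>2 / (4 * V))"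
    using main[of 1] by (simp only: power_one)
  have "{g. X g \<le> ?m - t} = {g. - 1 * (X g - ?m) \<ge> t}" by auto
  then show "measure gauss {g. X g \<le> ?m - t} \<le> exp (- t\<^sup>2 / (4 * V))"
    using main[of "- 1"] by (simp only: power2_minus power_one)
qed

section \<open>Gibbs weights tilted by a power of the partition function\<close>

text \<open>Dominated convergence of difference quotients, which the mean value theorem bounds by
  \<open>H\<close>. The open interval makes the domination a local requirement on the
  parameter.\<close>

lemma gauss_leibniz:
  fixes F :: "real \<Rightarrow> ('i \<Rightarrow> real) \<Rightarrow> real"
  assumes x: "lo < x" "x < hi"
    and F: "\<And>y. lo < y \<Longrightarrow> y < hi \<Longrightarrow> integrable gauss (F y)"
    and F' [measurable]: "F' x \<in> borel_measurable gauss"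
    and d: "\<And>y g. lo < y \<Longrightarrow> y < hi \<Longrightarrow> ((\<lambda>y. F y g) has_field_derivative F' y g) (at y)"
    and H: "integrable gauss H" "\<And>y g. lo < y \<Longrightarrow> y < hi \<Longrightarrow> \<bar>F' y g\<bar> \<le> H g"
  shows "((\<lambda>y. \<integral>g. F y g \<partial>gauss) has_field_derivative (\<integral>g. F' x g \<partial>gauss)) (at x)"
proof -
  have lip: "\<bar>F y g - F x g\<bar> \<le> H g * \<bar>y - x\<bar>" if "lo < y" "y < hi" for y g
  proof -
    have "norm (F y g - F x g) \<le> H g * norm (y - x)"
      by (rule field_differentiable_bound[where S="{lo<..<hi}" and f'="\<lambda>y. F' y g"])
         (use that x H(2) in \<open>auto intro: has_field_derivative_at_within d\<close>)
    then show ?thesis by simp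
  qed
  show ?thesis
    unfolding has_field_derivative_iff tendsto_at_iff_sequentially
  proof (intro allI impI)
    fix X assume X: "\<forall>i. X i \<in> UNIV - {x}" "X \<longlonglongrightarrow> x"
    have ev: "\<forall>\<^sub>F n in sequentially. lo < X n \<and> X n < hi"
      using order_tendstoD(1)[OF X(2) x(1)] order_tendstoD(2)[OF X(2) x(2)] by eventually_elim simp
    then obtain N where N: "\<And>n. n \<ge> N \<Longrightarrow> lo < X n \<and> X n < hi"
      unfolding eventually_sequentially by blast
    define Y where "Y n = X (n + N)" for n
    have Y: "lo < Y n" "Y n < hi" "Y n \<noteq> x" for n using N[of "n+N"] X(1) by (auto simp: Y_def)
    have Yx: "Y \<longlonglongrightarrow> x" unfolding Y_def using X(2) by (rule LIMSEQ_ignore_initial_segment)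
    have "(\<lambda>n. \<integral>g. (F (Y n) g - F x g) / (Y n - x) \<partial>gauss) \<longlonglongrightarrow> (\<integral>g. F' x g \<partial>gauss)"
    proof (rule integral_dominated_convergence[where w=H])
      show "(\<lambda>g. (F (Y n) g - F x g) / (Y n - x)) \<in> borel_measurable gauss" for n
        using F[OF Y(1,2)] F[OF x] by auto
      show "AE g in gauss. (\<lambda>n. (F (Y n) g - F x g) / (Y n - x)) \<longlonglongrightarrow> F' x g"
      proof (rule AE_I2)
        fix g
        have "((\<lambda>y. (F y g - F x g) / (y - x)) \<longlongrightarrow> F' x g) (at x)"
          using d[OF x, of g] by (simp add: has_field_derivative_iff)
        then show "(\<lambda>n. (F (Y n) g - F x g) / (Y n - x)) \<longlonglongrightarrow> F' x g"
          using Y Yx by (auto simp: tendsto_at_iff_sequentially comp_def)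
      qed
      show "AE g in gauss. norm ((F (Y n) g - F x g) / (Y n - x)) \<le> H g" for n
        using lip[OF Y(1,2)] Y(3) by (intro AE_I2) (simp add: abs_divide divide_le_eq)
    qed (use H in auto)
    moreover have "(\<integral>g. (F (Y n) g - F x g) / (Y n - x) \<partial>gauss)
        = ((\<integral>g. F (Y n) g \<partial>gauss) - (\<integral>g. F x g \<partial>gauss)) / (Y n - x)" for n
      using F[OF Y(1,2)] F[OF x] by simp
    ultimately have "(\<lambda>n. ((\<integral>g. F (X (n + N)) g \<partial>gauss) - (\<integral>g. F x g \<partial>gauss)) / (X (n + N) - x))
        \<longlonglongrightarrow> (\<integral>g. F' x g \<partial>gauss)"
      by (simp only: Y_def)
    then show "((\<lambda>y. ((\<integral>g. F y g \<partial>gauss) - (\<integral>g. F x g \<partial>gauss)) / (y - x)) \<circ> X)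
        \<longlonglongrightarrow> (\<integral>g. F' x g \<partial>gauss)"
      unfolding comp_def by (rule LIMSEQ_offset)
  qed
qed

text \<open>One notion for three kinds of lists: index tuples \<open>words {..<N} p\<close>, spin
  configurations \<open>words {-1, 1} N\<close>, and lists of replicas
  \<open>words S n\<close>.\<close>

definition words :: "'a set \<Rightarrow> nat \<Rightarrow> 'a list set" where
  "words A n = {xs. length xs = n \<and> set xs \<subseteq> A}"

lemma finite_words: "finite A \<Longrightarrow> finite (words A n)"
  unfolding words_def using finite_lists_length_eq[of A n] by (simp add: conj_commute)

lemma words_0 [simp]: "words A 0 = {[]}"
  by (auto simp: words_def)

lemma words_Suc: "words A (Suc n) = (\<lambda>(x, xs). x # xs) ` (A \<times> words A n)"
  by (auto simp: words_def length_Suc_conv image_iff)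

lemma sum_words_Suc:
  "finite A \<Longrightarrow> (\<Sum>xs\<in>words A (Suc n). f xs) = (\<Sum>xs\<in>words A n. \<Sum>x\<in>A. f (x # xs))"
proof -
  assume "finite A"
  have "(\<Sum>xs\<in>words A (Suc n). f xs) = (\<Sum>p\<in>A \<times> words A n. f (fst p # snd p))"
    unfolding words_Suc by (subst sum.reindex) (auto simp: inj_on_def split_beta')
  also have "\<dots> = (\<Sum>x\<in>A. \<Sum>xs\<in>words A n. f (x # xs))"
    by (simp add: sum.cartesian_product split_beta')
  also have "\<dots> = (\<Sum>xs\<in>words A n. \<Sum>x\<in>A. f (x # xs))" by (rule sum.swap)
  finally show ?thesis .
qed

lemma sum_words_prod_list:
  fixes f :: "'a \<Rightarrow> real"
  assumes "finite A"
  shows "(\<Sum>xs\<in>words A n. prod_list (map f xs)) = (\<Sum>x\<in>A. f x) ^ n"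
  by (induction n) (simp_all add: sum_words_Suc[OF assms] sum_distrib_right[symmetric] sum_distrib_left[symmetric])

section \<open>Replica weights and their derivatives\<close>

locale gibbs =
  fixes S :: "'s set" and w :: "'s \<Rightarrow> real" and m :: real
  assumes finite_S: "finite S" and S_ne: "S \<noteq> {}" and w_pos: "\<And>s. s \<in> S \<Longrightarrow> 0 < w s"
    and m_pos: "0 < m" and m_less: "m < 1"
begin

definition pf :: "('s \<Rightarrow> real) \<Rightarrow> real" where
  "pf e = (\<Sum>s\<in>S. w s * exp (e s))"

definition pr :: "('s \<Rightarrow> real) \<Rightarrow> 's \<Rightarrow> real" where
  "pr e s = w s * exp (e s) / pf e"

text \<open>Joint weight of the replicas \<open>xs\<close> under the Gibbs measure tilted by the
  power \<open>m\<close> of the partition function. Left unnormalised: its Gaussian mean at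
  \<open>[]\<close> is the fractional moment itself, and its derivative is again a combination of
  such weights.\<close>

definition wt :: "('s \<Rightarrow> real) \<Rightarrow> 's list \<Rightarrow> real" where
  "wt e xs = pf e powr m * prod_list (map (pr e) xs)"

lemma pf_pos: "0 < pf e"
  unfolding pf_def by (rule sum_pos) (use finite_S S_ne w_pos in auto)

lemma pr_nonneg: "s \<in> S \<Longrightarrow> 0 \<le> pr e s"
  using pf_pos[of e] w_pos[of s] by (simp add: pr_def)

lemma sum_pr: "(\<Sum>s\<in>S. pr e s) = 1"
  using pf_pos[of e] by (simp add: pr_def sum_divide_distrib[symmetric] pf_def)

lemma pr_le_1: "s \<in> S \<Longrightarrow> pr e s \<le> 1"
  using sum_pr[of e] member_le_sum[of s S "pr e"] finite_S pr_nonneg by auto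

lemma prod_list_pr: "set xs \<subseteq> S \<Longrightarrow> 0 \<le> prod_list (map (pr e) xs) \<and> prod_list (map (pr e) xs) \<le> 1"
proof (induction xs)
  case (Cons x xs)
  then show ?case using pr_nonneg[of x e] pr_le_1[of x e] by (auto intro: mult_le_one)
qed simp

lemma wt_Cons: "wt e (x # xs) = wt e xs * pr e x"
  by (simp add: wt_def)

lemma sum_wt_Cons: "(\<Sum>x\<in>S. wt e (x # xs)) = wt e xs"
  by (simp add: wt_Cons sum_distrib_left[symmetric] sum_pr)

lemma wt_nonneg: "set xs \<subseteq> S \<Longrightarrow> 0 \<le> wt e xs"
  using prod_list_pr[of xs e] by (simp add: wt_def)

text \<open>The source of tameness: since \<open>m < 1\<close>, the power is at most the larger of 1
  and \<open>pf e\<close>, and \<open>pf\<close> of a linear field is a finite sum of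
  exponentials.\<close>

lemma wt_le: "set xs \<subseteq> S \<Longrightarrow> wt e xs \<le> 1 + pf e"
proof -
  assume xs: "set xs \<subseteq> S"
  have "wt e xs \<le> pf e powr m * 1"
    unfolding wt_def using prod_list_pr[OF xs, of e] by (intro mult_left_mono) auto
  also have "\<dots> \<le> 1 + pf e"
  proof (cases "pf e \<le> 1")
    case True
    then have "pf e powr m \<le> 1" using pf_pos[of e] m_pos by (simp add: powr_le1)
    then show ?thesis using pf_pos[of e] by simp
  next
    case False
    then have "pf e powr m \<le> pf e powr 1" using m_less by (intro powr_mono) auto
    then show ?thesis using pf_pos[of e] by simp
  qed
  finally show ?thesis .
qed

lemma pf_deriv:
  assumes "\<And>s. s \<in> S \<Longrightarrow> ((\<lambda>x. e x s) has_field_derivative e' s) (at x)"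
  shows "((\<lambda>x. pf (e x)) has_field_derivative pf (e x) * (\<Sum>t\<in>S. pr (e x) t * e' t)) (at x)"
proof -
  have "((\<lambda>x. pf (e x)) has_field_derivative (\<Sum>s\<in>S. w s * (exp (e x s) * e' s))) (at x)"
    unfolding pf_def by (auto intro!: derivative_eq_intros assms simp: mult_ac)
  also have "(\<Sum>s\<in>S. w s * (exp (e x s) * e' s)) = pf (e x) * (\<Sum>t\<in>S. pr (e x) t * e' t)"
    using pf_pos[of "e x"] by (simp add: sum_distrib_left pr_def mult.assoc)
  finally show ?thesis .
qed

lemma pr_deriv:
  assumes e: "\<And>s. s \<in> S \<Longrightarrow> ((\<lambda>x. e x s) has_field_derivative e' s) (at x)" and s: "s \<in> S"
  shows "((\<lambda>x. pr (e x) s) has_field_derivative pr (e x) s * (e' s - (\<Sum>t\<in>S. pr (e x) t * e' t))) (at x)"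
proof -
  let ?A = "\<Sum>t\<in>S. pr (e x) t * e' t"
  have "((\<lambda>x. w s * exp (e x s)) has_field_derivative w s * (exp (e x s) * e' s)) (at x)"
    by (intro DERIV_cmult DERIV_chain'[OF e[OF s] DERIV_exp])
  then have "((\<lambda>x. pr (e x) s) has_field_derivative
      (w s * (exp (e x s) * e' s) * pf (e x) - w s * exp (e x s) * (pf (e x) * ?A)) / (pf (e x) * pf (e x))) (at x)"
  proof -
    have eq: "(\<lambda>x. pr (e x) s) = (\<lambda>x. w s * exp (e x s) / pf (e x))" by (simp add: pr_def)
    assume d: "((\<lambda>x. w s * exp (e x s)) has_field_derivative w s * (exp (e x s) * e' s)) (at x)"
    show ?thesis unfolding eq
      by (rule DERIV_divide[OF d pf_deriv[OF e]]) (use pf_pos[of "e x"] in auto)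
  qed
  also have "(w s * (exp (e x s) * e' s) * pf (e x) - w s * exp (e x s) * (pf (e x) * ?A)) / (pf (e x) * pf (e x))
      = pr (e x) s * (e' s - ?A)"
  proof -
    have "(a * (b * c) * z - a * b * (z * A)) / (z * z) = a * b / z * (c - A)" if "z \<noteq> 0" for a b c z A :: real
      using that by (simp add: field_simps)
    from this[of "pf (e x)"] show ?thesis using pf_pos[of "e x"] by (simp only: pr_def less_imp_neq[symmetric] not_False_eq_True)
  qed
  finally show ?thesis .
qed

text \<open>Every replica subtracts one Gibbs average of \<open>e'\<close> through its
  normalisation, while the factor \<open>pf e powr m\<close> adds \<open>m\<close> of them. The
  coefficient \<open>real (length xs) - m\<close> reappears as \<open>n - m\<close> in the
  Ghirlanda-Guerra identities.\<close>

lemma wt_deriv: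
  assumes e: "\<And>s. s \<in> S \<Longrightarrow> ((\<lambda>x. e x s) has_field_derivative e' s) (at x)" and xs: "set xs \<subseteq> S"
  shows "((\<lambda>x. wt (e x) xs) has_field_derivative
     wt (e x) xs * (sum_list (map e' xs) - (real (length xs) - m) * (\<Sum>t\<in>S. pr (e x) t * e' t))) (at x)"
  using xs
proof (induction xs)
  case Nil
  have d: "((\<lambda>x. pf (e x) powr m) has_field_derivative
      m * pf (e x) powr (m - 1) * (pf (e x) * (\<Sum>t\<in>S. pr (e x) t * e' t))) (at x)"
    by (rule DERIV_chain2[OF has_real_derivative_powr[OF pf_pos] pf_deriv[OF e]])
  have P: "pf (e x) powr m = pf (e x) powr (m - 1) * pf (e x)"
    using pf_pos[of "e x"] powr_mult_base[of "pf (e x)" "m - 1"] by (simp add: mult.commute)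
  have eq: "m * pf (e x) powr (m - 1) * (pf (e x) * A) = wt (e x) [] * (sum_list (map e' []) - (real (length []) - m) * A)" for A
    unfolding wt_def P by simp
  have f: "(\<lambda>x. wt (e x) []) = (\<lambda>x. pf (e x) powr m)" by (simp add: wt_def)
  show ?case by (subst f) (rule DERIV_cong[OF d eq])
next
  case (Cons s xs)
  let ?A = "\<Sum>t\<in>S. pr (e x) t * e' t"
  have "((\<lambda>x. wt (e x) xs * pr (e x) s) has_field_derivative
      wt (e x) xs * (sum_list (map e' xs) - (real (length xs) - m) * ?A) * pr (e x) s
      + pr (e x) s * (e' s - ?A) * wt (e x) xs) (at x)"
    by (intro DERIV_mult Cons.IH pr_deriv e) (use Cons.prems in auto)
  also have "wt (e x) xs * (sum_list (map e' xs) - (real (length xs) - m) * ?A) * pr (e x) s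
      + pr (e x) s * (e' s - ?A) * wt (e x) xs
      = wt (e x) (s # xs) * (sum_list (map e' (s # xs)) - (real (length (s # xs)) - m) * ?A)"
    unfolding wt_Cons by (simp add: algebra_simps)
  finally show ?case by (simp add: wt_Cons)
qed

end

section \<open>Gaussian fields with finitely many coefficients\<close>

definition field :: "'k set \<Rightarrow> ('k \<Rightarrow> 's \<Rightarrow> real) \<Rightarrow> ('k \<Rightarrow> real) \<Rightarrow> 's \<Rightarrow> real" where
  "field J a g s = (\<Sum>j\<in>J. a j s * g j)"

text \<open>Covariance of two fields driven by the same \<open>g\<close>. Different coefficient
  families occur when a field depending on a parameter is paired with its derivative.\<close>

definition cov :: "'k set \<Rightarrow> ('k \<Rightarrow> 's \<Rightarrow> real) \<Rightarrow> ('k \<Rightarrow> 's \<Rightarrow> real) \<Rightarrow> 's \<Rightarrow> 's \<Rightarrow> real" where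
  "cov J a b s t = (\<Sum>j\<in>J. a j s * b j t)"

lemma measurable_field [measurable]: "(\<lambda>g. field J a g s) \<in> borel_measurable gauss"
  unfolding field_def by measurable

lemma tame_field [intro]: "tame (\<lambda>g. field J a g s)"
  unfolding field_def by (intro tame_sum tame_mult tame_const tame_component)

lemma tame_exp_field [intro]: "tame (\<lambda>g. exp (field J a g s))"
  unfolding field_def by (rule tame_exp_linear)

lemma tame_exp_abs: "finite J \<Longrightarrow> tame (\<lambda>g. exp (A * (\<Sum>j\<in>J. \<bar>g j\<bar>)))"
proof -
  assume J: "finite J"
  have "\<bar>exp (A * (\<Sum>j\<in>J. \<bar>g j\<bar>))\<bar> \<le> (1 + \<bar>A\<bar>) * exp ((1 + \<bar>A\<bar>) * (\<Sum>j\<in>J. \<bar>g j\<bar>))" for g :: "'a \<Rightarrow> real"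
  proof -
    have "A * (\<Sum>j\<in>J. \<bar>g j\<bar>) \<le> (1 + \<bar>A\<bar>) * (\<Sum>j\<in>J. \<bar>g j\<bar>)"
      by (intro mult_right_mono) (auto intro: sum_nonneg)
    then have "exp (A * (\<Sum>j\<in>J. \<bar>g j\<bar>)) \<le> exp ((1 + \<bar>A\<bar>) * (\<Sum>j\<in>J. \<bar>g j\<bar>))" by simp
    also have "\<dots> \<le> (1 + \<bar>A\<bar>) * exp ((1 + \<bar>A\<bar>) * (\<Sum>j\<in>J. \<bar>g j\<bar>))" by simp
    finally show ?thesis by simp
  qed
  then show ?thesis unfolding tame_def using J by (intro conjI exI[of _ J] exI[of _ "1 + \<bar>A\<bar>"]) auto
qed

lemma field_deriv:
  assumes "finite J" "i \<in> J"
  shows "((\<lambda>x. field J a (g(i := x)) s) has_field_derivative a i s) (at x)"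
proof -
  have "field J a (g(i := x)) s = a i s * x + (\<Sum>j\<in>J - {i}. a j s * g j)" for x
    unfolding field_def using assms by (subst sum.remove[of J i]) auto
  then show ?thesis by (auto intro!: derivative_eq_intros)
qed

context gibbs
begin

definition tw :: "'k set \<Rightarrow> ('k \<Rightarrow> 's \<Rightarrow> real) \<Rightarrow> 's list \<Rightarrow> real" where
  "tw J a xs = (\<integral>g. wt (field J a g) xs \<partial>gauss)"

lemma measurable_pf [measurable]: "(\<lambda>g. pf (field J a g)) \<in> borel_measurable gauss"
  unfolding pf_def by measurable

lemma measurable_pr [measurable]: "(\<lambda>g. pr (field J a g) s) \<in> borel_measurable gauss"
  unfolding pr_def by measurable

lemma measurable_wt [measurable]: "(\<lambda>g. wt (field J a g) xs) \<in> borel_measurable gauss"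
  by (induction xs) (simp_all add: wt_Cons, simp add: wt_def)

lemma tame_pf [intro]: "tame (\<lambda>g. pf (field J a g))"
  unfolding pf_def by (intro tame_sum tame_mult tame_const tame_exp_field)

lemma tame_wt [intro]: "set xs \<subseteq> S \<Longrightarrow> tame (\<lambda>g. wt (field J a g) xs)"
proof (rule tame_bound)
  show "tame (\<lambda>g. 1 + pf (field J a g))" by (intro tame_add tame_const tame_pf)
  show "set xs \<subseteq> S \<Longrightarrow> \<bar>wt (field J a g) xs\<bar> \<le> 1 + pf (field J a g)" for g
    using wt_nonneg[of xs "field J a g"] wt_le[of xs "field J a g"] by simp
qed simp

lemma tame_wt_Cons [intro]: "x \<in> S \<Longrightarrow> set xs \<subseteq> S \<Longrightarrow> tame (\<lambda>g. wt (field J a g) (x # xs))"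
  by (rule tame_wt) simp

lemma tw_nonneg: "set xs \<subseteq> S \<Longrightarrow> 0 \<le> tw J a xs"
  unfolding tw_def by (intro integral_nonneg_AE AE_I2 wt_nonneg)

lemma sum_tw_Cons:
  assumes "set xs \<subseteq> S"
  shows "(\<Sum>x\<in>S. tw J a (x # xs)) = tw J a xs"
proof -
  have "(\<Sum>x\<in>S. tw J a (x # xs)) = (\<integral>g. (\<Sum>x\<in>S. wt (field J a g) (x # xs)) \<partial>gauss)"
    unfolding tw_def
    by (rule Bochner_Integration.integral_sum[symmetric]) (use assms in \<open>auto intro!: integrable_tame\<close>)
  then show ?thesis by (simp add: sum_wt_Cons tw_def)
qed

lemma tw_Nil_pos: "0 < tw J a []"
proof -
  have pos: "0 < wt (field J a g) []" for g
    using pf_pos[of "field J a g"] by (simp add: wt_def)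
  have I: "integrable gauss (\<lambda>g. wt (field J a g) [])" by (rule integrable_tame) auto
  have "tw J a [] \<noteq> 0"
  proof
    assume "tw J a [] = 0"
    then have "AE g in gauss. wt (field J a g) [] = 0"
      unfolding tw_def using I pos
      by (subst (asm) integral_nonneg_eq_0_iff_AE) (auto intro: less_imp_le)
    then have "AE g in (gauss :: ('a \<Rightarrow> real) measure). False"
      by (rule AE_mp) (use pos in \<open>auto intro!: AE_I2 simp: less_imp_neq[symmetric]\<close>)
    then show False by (simp only: gauss.AE_const)
  qed
  then show ?thesis using tw_nonneg[of "[]" J a] by simp
qed

lemma wt_ibp:
  assumes J: "finite J" "i \<in> J" and xs: "set xs \<subseteq> S"
  shows "(\<integral>g. g i * wt (field J a g) xs \<partial>gauss)
    = sum_list (map (a i) xs) * tw J a xs - (real (length xs) - m) * (\<Sum>t\<in>S. a i t * tw J a (t # xs))"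
proof -
  let ?c = "sum_list (map (a i) xs)" and ?k = "real (length xs) - m"
  let ?F' = "\<lambda>g. wt (field J a g) xs * (?c - ?k * (\<Sum>t\<in>S. pr (field J a g) t * a i t))"
  have F'eq: "?F' g = ?c * wt (field J a g) xs - ?k * (\<Sum>t\<in>S. a i t * wt (field J a g) (t # xs))" for g
    by (simp add: wt_Cons right_diff_distrib sum_distrib_left sum_distrib_right mult_ac)
  have t: "tame (\<lambda>g. wt (field J a g) (t # xs))" if "t \<in> S" for t using that xs by auto
  have t': "tame (\<lambda>g. ?c * wt (field J a g) xs - ?k * (\<Sum>t\<in>S. a i t * wt (field J a g) (t # xs)))"
  proof -
    have "tame (\<lambda>g. ?c * wt (field J a g) xs + (- ?k) * (\<Sum>t\<in>S. a i t * wt (field J a g) (t # xs)))"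
      using xs by (intro tame_add tame_mult tame_const tame_sum tame_wt) auto
    then show ?thesis by (simp only: mult_minus_left diff_conv_add_uminus)
  qed
  have fd: "((\<lambda>x. field J a (g(i := x)) s) has_field_derivative a i s) (at x)" for g s x
    by (rule field_deriv[OF J])
  have wd: "((\<lambda>x. wt (field J a (g(i := x))) xs) has_field_derivative ?F' (g(i := x))) (at x)" for g x
    by (rule wt_deriv[OF fd xs])
  have pd: "isCont (\<lambda>x. pr (field J a (g(i := x))) t) x" if "t \<in> S" for g x t
    by (rule DERIV_isCont[OF pr_deriv[OF fd that]])
  have "(\<integral>g. g i * wt (field J a g) xs \<partial>gauss) = (\<integral>g. ?F' g \<partial>gauss)"
  proof (rule gauss_ibp[OF _ _ wd])
    show "tame (\<lambda>g. wt (field J a g) xs)" using xs by auto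
    show "tame ?F'" unfolding F'eq by (rule t')
    show "isCont (\<lambda>x. ?F' (g(i := x))) x" for g x
      by (intro continuous_intros DERIV_isCont[OF wd] pd) auto
  qed
  also have "\<dots> = ?c * tw J a xs - ?k * (\<Sum>t\<in>S. a i t * tw J a (t # xs))"
  proof -
    have "(\<integral>g. (\<Sum>t\<in>S. a i t * wt (field J a g) (t # xs)) \<partial>gauss) = (\<Sum>t\<in>S. a i t * tw J a (t # xs))"
      unfolding tw_def by (subst Bochner_Integration.integral_sum) (auto intro!: integrable_tame tame_mult t)
    then show ?thesis
      unfolding F'eq using xs
      by (subst Bochner_Integration.integral_diff)
         (auto intro!: integrable_tame tame_sum tame_mult t simp: tw_def)
  qed
  finally show ?thesis .
qed

text \<open>Gaussian integration by parts yields the covariance of \<open>y\<close> with each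
  replica already present, minus \<open>real (length xs) - m\<close> times the covariance with a
  fresh replica \<open>t\<close>.\<close>

lemma field_ibp:
  assumes J: "finite J" and xs: "set xs \<subseteq> S"
  shows "(\<integral>g. wt (field J a g) xs * field J d g y \<partial>gauss)
    = (\<Sum>x\<leftarrow>xs. cov J d a y x) * tw J a xs - (real (length xs) - m) * (\<Sum>t\<in>S. cov J d a y t * tw J a (t # xs))"
proof -
  have "(\<integral>g. wt (field J a g) xs * field J d g y \<partial>gauss)
      = (\<integral>g. (\<Sum>i\<in>J. d i y * (g i * wt (field J a g) xs)) \<partial>gauss)"
    unfolding field_def[of J d] by (simp add: sum_distrib_left sum_distrib_right mult_ac)
  also have "\<dots> = (\<Sum>i\<in>J. d i y * (\<integral>g. g i * wt (field J a g) xs \<partial>gauss))"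
    using xs by (subst Bochner_Integration.integral_sum) (auto intro!: integrable_tame)
  also have "\<dots> = (\<Sum>i\<in>J. d i y * (sum_list (map (a i) xs) * tw J a xs
      - (real (length xs) - m) * (\<Sum>t\<in>S. a i t * tw J a (t # xs))))"
    by (intro sum.cong refl arg_cong2[where f="(*)"] wt_ibp assms)
  also have "\<dots> = (\<Sum>i\<in>J. d i y * sum_list (map (a i) xs)) * tw J a xs
      - (real (length xs) - m) * (\<Sum>i\<in>J. \<Sum>t\<in>S. d i y * a i t * tw J a (t # xs))"
    by (simp add: right_diff_distrib sum_subtractf sum_distrib_left sum_distrib_right mult_ac)
  also have "(\<Sum>i\<in>J. d i y * sum_list (map (a i) xs)) = (\<Sum>x\<leftarrow>xs. cov J d a y x)"
    by (induction xs) (simp_all add: cov_def sum.distrib ring_distribs)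
  also have "(\<Sum>i\<in>J. \<Sum>t\<in>S. d i y * a i t * tw J a (t # xs)) = (\<Sum>t\<in>S. cov J d a y t * tw J a (t # xs))"
    by (subst sum.swap) (simp add: cov_def sum_distrib_right)
  finally show ?thesis .
qed

text \<open>\<open>field_ibp\<close> for a single replica. The factor \<open>1 - m\<close> of the
  two-replica term is what distinguishes moments near exponent 1 from those near 0.\<close>

lemma tw_deriv:
  fixes a a' :: "real \<Rightarrow> 'k \<Rightarrow> 's \<Rightarrow> real"
  assumes J: "finite J" and x: "lo < x" "x < hi"
    and d: "\<And>y j s. lo < y \<Longrightarrow> y < hi \<Longrightarrow> j \<in> J \<Longrightarrow> s \<in> S \<Longrightarrow> ((\<lambda>y. a y j s) has_field_derivative a' y j s) (at y)"
    and b: "\<And>y j s. lo < y \<Longrightarrow> y < hi \<Longrightarrow> j \<in> J \<Longrightarrow> s \<in> S \<Longrightarrow> \<bar>a y j s\<bar> \<le> A \<and> \<bar>a' y j s\<bar> \<le> A"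
  shows "((\<lambda>y. tw J (a y) []) has_field_derivative
     m * ((\<Sum>t\<in>S. cov J (a' x) (a x) t t * tw J (a x) [t])
        - (1 - m) * (\<Sum>t\<in>S. \<Sum>u\<in>S. cov J (a' x) (a x) t u * tw J (a x) [u, t]))) (at x)"
proof -
  let ?N = "\<lambda>g. \<Sum>j\<in>J. \<bar>g j\<bar>"
  let ?F' = "\<lambda>y g. m * (\<Sum>t\<in>S. wt (field J (a y) g) [t] * field J (a' y) g t)"
  \<comment> \<open>A bound uniform in the parameter: the weights sum to at most
    \<open>1 + pf\<close>, and all coefficients and their derivatives are at most
    \<open>A\<close>.\<close>
  let ?H = "\<lambda>g. (1 + (\<Sum>s\<in>S. w s * exp (A * ?N g))) * (A * ?N g)"
  have tH: "tame ?H"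
    using J by (intro tame_mult tame_add tame_const tame_sum tame_exp_abs tame_abs tame_component)
  have fb: "\<bar>field J c g s\<bar> \<le> A * ?N g" if "\<And>j. j \<in> J \<Longrightarrow> \<bar>c j s\<bar> \<le> A" for c g s
  proof -
    have "\<bar>field J c g s\<bar> \<le> (\<Sum>j\<in>J. \<bar>c j s\<bar> * \<bar>g j\<bar>)"
      unfolding field_def by (rule order.trans[OF sum_abs]) (simp add: abs_mult)
    also have "\<dots> \<le> (\<Sum>j\<in>J. A * \<bar>g j\<bar>)" by (intro sum_mono mult_right_mono that) auto
    finally show ?thesis by (simp add: sum_distrib_left)
  qed
  have "((\<lambda>y. \<integral>g. wt (field J (a y) g) [] \<partial>gauss) has_field_derivative (\<integral>g. ?F' x g \<partial>gauss)) (at x)"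
  proof (rule gauss_leibniz[OF x, where H="?H"])
    show "integrable gauss (\<lambda>g. wt (field J (a y) g) [])" for y by (rule integrable_tame) auto
    show "?F' x \<in> borel_measurable gauss" by measurable
    show "integrable gauss ?H" by (rule integrable_tame[OF tH])
    fix y g assume y: "lo < y" "y < hi"
    have fd: "((\<lambda>y. field J (a y) g s) has_field_derivative field J (a' y) g s) (at y)" if "s \<in> S" for s
      unfolding field_def by (auto intro!: derivative_eq_intros d y that)
    show "((\<lambda>y. wt (field J (a y) g) []) has_field_derivative ?F' y g) (at y)"
      by (rule DERIV_cong[OF wt_deriv[OF fd]]) (auto simp: wt_Cons sum_distrib_left sum_negf[symmetric] mult_ac)
    have "\<bar>\<Sum>t\<in>S. wt (field J (a y) g) [t] * field J (a' y) g t\<bar>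
        \<le> (\<Sum>t\<in>S. wt (field J (a y) g) [t] * (A * ?N g))"
    proof (rule order.trans[OF sum_abs], rule sum_mono)
      fix t assume t: "t \<in> S"
      show "\<bar>wt (field J (a y) g) [t] * field J (a' y) g t\<bar> \<le> wt (field J (a y) g) [t] * (A * ?N g)"
        unfolding abs_mult using wt_nonneg[of "[t]" "field J (a y) g"] t b[OF y]
        by (intro mult_mono fb) auto
    qed
    also have "\<dots> = wt (field J (a y) g) [] * (A * ?N g)"
      by (simp only: sum_distrib_right[symmetric] sum_wt_Cons)
    also have "\<dots> \<le> ?H g"
    proof (rule mult_right_mono)
      have "field J (a y) g s \<le> A * ?N g" if "s \<in> S" for s
        using fb[of "a y" s g] b[OF y _ that] by force
      then have "pf (field J (a y) g) \<le> (\<Sum>s\<in>S. w s * exp (A * ?N g))"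
        unfolding pf_def using w_pos by (intro sum_mono mult_left_mono) (auto intro: less_imp_le)
      then show "wt (field J (a y) g) [] \<le> 1 + (\<Sum>s\<in>S. w s * exp (A * ?N g))"
        using wt_le[of "[]" "field J (a y) g"] by simp
      \<comment> \<open>The sign of \<open>A\<close> follows from the coefficient bound unless
        \<open>J\<close> is empty, and then the sum is 0.\<close>
      show "0 \<le> A * ?N g"
      proof (cases "J = {}")
        case False
        then obtain j where "j \<in> J" by auto
        moreover obtain s where "s \<in> S" using S_ne by auto
        ultimately have "0 \<le> A" using b[OF y, of j s] by force
        then show ?thesis by (auto intro: sum_nonneg)
      qed simp
    qed
    finally have le: "\<bar>\<Sum>t\<in>S. wt (field J (a y) g) [t] * field J (a' y) g t\<bar> \<le> ?H g" .
    have "\<bar>?F' y g\<bar> = m * \<bar>\<Sum>t\<in>S. wt (field J (a y) g) [t] * field J (a' y) g t\<bar>"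
      using m_pos by (simp add: abs_mult)
    also have "\<dots> \<le> 1 * \<bar>\<Sum>t\<in>S. wt (field J (a y) g) [t] * field J (a' y) g t\<bar>"
      using m_less by (intro mult_right_mono) auto
    finally show "\<bar>?F' y g\<bar> \<le> ?H g" using le by simp
  qed
  also have "(\<integral>g. ?F' x g \<partial>gauss) = m * (\<Sum>t\<in>S. \<integral>g. wt (field J (a x) g) [t] * field J (a' x) g t \<partial>gauss)"
    by (subst integral_mult_right_zero, subst Bochner_Integration.integral_sum)
       (auto intro!: integrable_tame tame_mult tame_wt_Cons)
  also have "(\<Sum>t\<in>S. \<integral>g. wt (field J (a x) g) [t] * field J (a' x) g t \<partial>gauss)
      = (\<Sum>t\<in>S. cov J (a' x) (a x) t t * tw J (a x) [t] - (1 - m) * (\<Sum>u\<in>S. cov J (a' x) (a x) t u * tw J (a x) [u, t]))"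
    by (rule sum.cong[OF refl], subst field_ibp[OF J]) auto
  also have "\<dots> = (\<Sum>t\<in>S. cov J (a' x) (a x) t t * tw J (a x) [t])
        - (1 - m) * (\<Sum>t\<in>S. \<Sum>u\<in>S. cov J (a' x) (a x) t u * tw J (a x) [u, t])"
    by (simp add: sum_subtractf sum_distrib_left)
  finally show ?thesis by (simp only: tw_def)
qed

end

section \<open>Positivity of the overlap\<close>

definition avg :: "'s set \<Rightarrow> ('s list \<Rightarrow> real) \<Rightarrow> nat \<Rightarrow> ('s list \<Rightarrow> real) \<Rightarrow> real" where
  "avg S Q n f = (\<Sum>xs\<in>words S n. f xs * Q xs)"

text \<open>Consistent weights on lists of replicas: summing over the head returns the weight of the
  tail. A fresh replica is always consed on, so consistency in the head is the form in which it gets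
  used.\<close>

definition replica :: "'s set \<Rightarrow> ('s list \<Rightarrow> real) \<Rightarrow> bool" where
  "replica S Q \<longleftrightarrow> finite S \<and> Q [] = 1 \<and> (\<forall>xs. set xs \<subseteq> S \<longrightarrow> 0 \<le> Q xs)
     \<and> (\<forall>xs. set xs \<subseteq> S \<longrightarrow> (\<Sum>x\<in>S. Q (x # xs)) = Q xs)"

text \<open>Positive semidefiniteness is tested against lists, that is, with natural numbers as
  coefficients. In this form it limits how many replicas can have pairwise negative
  overlaps.\<close>

definition overlap_kernel :: "'s set \<Rightarrow> ('s \<Rightarrow> 's \<Rightarrow> real) \<Rightarrow> bool" where
  "overlap_kernel S R \<longleftrightarrow> (\<forall>s\<in>S. R s s = 1) \<and> (\<forall>s\<in>S. \<forall>t\<in>S. \<bar>R s t\<bar> \<le> 1 \<and> R s t = R t s)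
     \<and> (\<forall>xs. set xs \<subseteq> S \<longrightarrow> 0 \<le> (\<Sum>x\<leftarrow>xs. \<Sum>y\<leftarrow>xs. R x y))"

text \<open>The Ghirlanda--Guerra identities, in the form they take under a Gibbs measure tilted by the
  \<open>m\<close>-th power of the partition function; the new replica is the head of the list.\<close>

definition gg_defect :: "'s set \<Rightarrow> ('s list \<Rightarrow> real) \<Rightarrow> real \<Rightarrow> ('s \<Rightarrow> 's \<Rightarrow> real) \<Rightarrow> nat \<Rightarrow> nat
    \<Rightarrow> ('s list \<Rightarrow> real) \<Rightarrow> real" where
  "gg_defect S Q m C n l f =
     (real n - m) * avg S Q (Suc n) (\<lambda>ys. f (tl ys) * C (tl ys ! l) (hd ys))
     - avg S Q n (\<lambda>xs. f xs * ((\<Sum>x\<leftarrow>xs. C (xs ! l) x) - 1))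
     - (1 - m) * avg S Q n f * avg S Q 2 (\<lambda>ys. C (ys ! 1) (ys ! 0))"

text \<open>The error is uniform over the number of replicas and the test function. The 1 subtracted
  in \<open>gg_defect\<close> is the self-overlap, the term of the sum at which \<open>x\<close> is
  replica \<open>l\<close> itself.\<close>

definition gg :: "'s set \<Rightarrow> ('s list \<Rightarrow> real) \<Rightarrow> real \<Rightarrow> ('s \<Rightarrow> 's \<Rightarrow> real) \<Rightarrow> real \<Rightarrow> bool" where
  "gg S Q m C \<eta> \<longleftrightarrow> (\<forall>n l f. l < n \<longrightarrow> (\<forall>xs\<in>words S n. \<bar>f xs\<bar> \<le> 1) \<longrightarrow> \<bar>gg_defect S Q m C n l f\<bar> \<le> \<eta>)"

section \<open>Averages over replicas\<close>

lemma avg_cong: "(\<And>xs. xs \<in> words S n \<Longrightarrow> f xs = f' xs) \<Longrightarrow> avg S Q n f = avg S Q n f'"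
  unfolding avg_def by (intro sum.cong) auto

lemma avg_mono:
  assumes "replica S Q" "\<And>xs. xs \<in> words S n \<Longrightarrow> f xs \<le> f' xs"
  shows "avg S Q n f \<le> avg S Q n f'"
  unfolding avg_def using assms by (intro sum_mono mult_right_mono) (auto simp: replica_def words_def)

lemma avg_add: "avg S Q n (\<lambda>xs. f xs + f' xs) = avg S Q n f + avg S Q n f'"
  by (simp add: avg_def ring_distribs sum.distrib)

lemma avg_diff: "avg S Q n (\<lambda>xs. f xs - f' xs) = avg S Q n f - avg S Q n f'"
  by (simp add: avg_def ring_distribs sum_subtractf)

lemma avg_cmult: "avg S Q n (\<lambda>xs. c * f xs) = c * avg S Q n f"
  by (simp add: avg_def sum_distrib_left mult_ac)

lemma avg_sum: "avg S Q n (\<lambda>xs. \<Sum>i\<in>I. f i xs) = (\<Sum>i\<in>I. avg S Q n (f i))"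
  unfolding avg_def sum_distrib_right by (rule sum.swap)

lemma avg_tl:
  assumes "replica S Q"
  shows "avg S Q (Suc n) (\<lambda>ys. f (tl ys)) = avg S Q n f"
proof -
  have "avg S Q (Suc n) (\<lambda>ys. f (tl ys)) = (\<Sum>xs\<in>words S n. \<Sum>x\<in>S. f xs * Q (x # xs))"
    unfolding avg_def using assms by (subst sum_words_Suc) (auto simp: replica_def)
  also have "\<dots> = avg S Q n f"
    unfolding avg_def sum_distrib_left[symmetric] using assms
    by (intro sum.cong refl) (auto simp: replica_def words_def)
  finally show ?thesis .
qed

lemma avg_one:
  assumes "replica S Q"
  shows "avg S Q n (\<lambda>_. 1) = 1"
proof (induction n)
  case 0
  then show ?case using assms by (simp add: avg_def replica_def)
next
  case (Suc n)
  then show ?case using avg_tl[OF assms, of n "\<lambda>_. 1"] by simp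
qed

lemma avg_const: "replica S Q \<Longrightarrow> avg S Q n (\<lambda>_. c) = c"
  using avg_cmult[of S Q n c "\<lambda>_. 1"] by (simp add: avg_one)

text \<open>The defect is linear in \<open>C\<close> apart from the subtracted self-overlap 1, which
  for a combination ought to be the sum of the \<open>c k\<close>; the last term corrects
  this.\<close>

lemma gg_defect_sum:
  assumes "replica S Q"
  shows "gg_defect S Q m (\<lambda>s t. \<Sum>k\<in>I. c k * C k s t) n l f
    = (\<Sum>k\<in>I. c k * gg_defect S Q m (C k) n l f) + avg S Q n f * ((\<Sum>k\<in>I. c k) * - 1 + 1)"
proof -
  have 1: "avg S Q (Suc n) (\<lambda>ys. f (tl ys) * (\<Sum>k\<in>I. c k * C k (tl ys ! l) (hd ys)))
      = (\<Sum>k\<in>I. c k * avg S Q (Suc n) (\<lambda>ys. f (tl ys) * C k (tl ys ! l) (hd ys)))"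
    by (simp add: sum_distrib_left avg_sum avg_cmult[symmetric] mult_ac)
  have "(\<Sum>x\<leftarrow>xs. \<Sum>k\<in>I. c k * C k y x) = (\<Sum>k\<in>I. c k * (\<Sum>x\<leftarrow>xs. C k y x))" for xs y
    by (induction xs) (simp_all add: sum.distrib ring_distribs)
  then have "f xs * ((\<Sum>x\<leftarrow>xs. \<Sum>k\<in>I. c k * C k (xs ! l) x) - 1)
      = (\<Sum>k\<in>I. c k * (f xs * ((\<Sum>x\<leftarrow>xs. C k (xs ! l) x) - 1))) + ((\<Sum>k\<in>I. c k) - 1) * f xs" for xs
    by (simp add: right_diff_distrib left_diff_distrib sum_subtractf sum_distrib_left sum_distrib_right mult_ac)
  then have 2: "avg S Q n (\<lambda>xs. f xs * ((\<Sum>x\<leftarrow>xs. \<Sum>k\<in>I. c k * C k (xs ! l) x) - 1))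
      = (\<Sum>k\<in>I. c k * avg S Q n (\<lambda>xs. f xs * ((\<Sum>x\<leftarrow>xs. C k (xs ! l) x) - 1))) + ((\<Sum>k\<in>I. c k) - 1) * avg S Q n f"
    by (simp add: avg_add avg_sum avg_cmult)
  have 3: "avg S Q 2 (\<lambda>ys. \<Sum>k\<in>I. c k * C k (ys ! 1) (ys ! 0)) = (\<Sum>k\<in>I. c k * avg S Q 2 (\<lambda>ys. C k (ys ! 1) (ys ! 0)))"
    by (simp add: avg_sum avg_cmult)
  have alg: "(\<Sum>k\<in>I. c k * (p * A k - B k - q * D k)) = p * (\<Sum>k\<in>I. c k * A k) - (\<Sum>k\<in>I. c k * B k) - q * (\<Sum>k\<in>I. c k * D k)"
    for p q and A B D :: "_ \<Rightarrow> real"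
    by (simp add: right_diff_distrib sum_subtractf sum_distrib_left mult_ac)
  show ?thesis
    unfolding gg_defect_def 1 2 3 alg by (simp add: algebra_simps)
qed

lemma gg_defect_one: "replica S Q \<Longrightarrow> gg_defect S Q m (\<lambda>_ _. 1) n l f = 0"
proof -
  assume r: "replica S Q"
  have "avg S Q n (\<lambda>xs. f xs * ((\<Sum>x\<leftarrow>xs. 1) - 1)) = avg S Q n (\<lambda>xs. (real n - 1) * f xs)"
    by (rule avg_cong) (simp add: words_def sum_list_triv mult.commute)
  then have e: "avg S Q n (\<lambda>xs. f xs * ((\<Sum>x\<leftarrow>xs. 1) - 1)) = (real n - 1) * avg S Q n f"
    by (simp only: avg_cmult)
  show ?thesis
    unfolding gg_defect_def e by (simp add: avg_tl[OF r] avg_one[OF r] algebra_simps)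
qed

text \<open>From powers of the overlap to a polynomial \<open>h\<close>, at the price of the sum of
  its coefficients in absolute value. Exponent 0 is the constant kernel, whose defect is exactly
  zero.\<close>

lemma gg_polynomial:
  fixes c :: "nat \<Rightarrow> real"
  assumes r: "replica S Q" and g: "\<And>k. k \<in> {1..K} \<Longrightarrow> gg S Q m (\<lambda>s t. R s t ^ k) \<eta>"
    and \<eta>: "0 \<le> \<eta>" and l: "l < n" and f: "\<And>xs. xs \<in> words S n \<Longrightarrow> \<bar>f xs\<bar> \<le> 1"
    and h: "\<And>x. h x = (\<Sum>k\<le>K. c k * x ^ k)"
  shows "(real n - m) * avg S Q (Suc n) (\<lambda>ys. f (tl ys) * h (R (tl ys ! l) (hd ys)))
    \<le> avg S Q n (\<lambda>xs. f xs * ((\<Sum>x\<leftarrow>xs. h (R (xs ! l) x)) - h 1))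
      + (1 - m) * avg S Q n f * avg S Q 2 (\<lambda>ys. h (R (ys ! 1) (ys ! 0))) + (\<Sum>k\<le>K. \<bar>c k\<bar>) * \<eta>"
proof -
  have "\<bar>gg_defect S Q m (\<lambda>s t. h (R s t)) n l f - avg S Q n f * ((\<Sum>k\<le>K. c k) * - 1 + 1)\<bar>
      = \<bar>\<Sum>k\<le>K. c k * gg_defect S Q m (\<lambda>s t. R s t ^ k) n l f\<bar>"
    unfolding h gg_defect_sum[OF r] by simp
  also have "\<dots> \<le> (\<Sum>k\<le>K. \<bar>c k\<bar> * \<eta>)"
  proof (rule order.trans[OF sum_abs], rule sum_mono)
    fix k assume k: "k \<in> {..K}"
    have "\<bar>gg_defect S Q m (\<lambda>s t. R s t ^ k) n l f\<bar> \<le> \<eta>"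
    proof (cases "k = 0")
      case True
      then show ?thesis using gg_defect_one[OF r] \<eta> by simp
    next
      case False
      then show ?thesis using g[of k] k l f unfolding gg_def by auto
    qed
    then show "\<bar>c k * gg_defect S Q m (\<lambda>s t. R s t ^ k) n l f\<bar> \<le> \<bar>c k\<bar> * \<eta>"
      by (simp add: abs_mult mult_left_mono)
  qed
  finally have X: "\<bar>gg_defect S Q m (\<lambda>s t. h (R s t)) n l f - avg S Q n f * (h 1 * - 1 + 1)\<bar> \<le> (\<Sum>k\<le>K. \<bar>c k\<bar>) * \<eta>"
    by (simp only: h power_one mult_1_right sum_distrib_right)
  then have d: "gg_defect S Q m (\<lambda>s t. h (R s t)) n l f \<le> avg S Q n f * (1 - h 1) + (\<Sum>k\<le>K. \<bar>c k\<bar>) * \<eta>"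
    unfolding abs_le_iff by (simp add: right_diff_distrib)
  have "avg S Q n (\<lambda>xs. f xs * ((\<Sum>x\<leftarrow>xs. h (R (xs ! l) x)) - 1))
      = avg S Q n (\<lambda>xs. f xs * ((\<Sum>x\<leftarrow>xs. h (R (xs ! l) x)) - h 1) + (h 1 - 1) * f xs)"
    by (rule avg_cong) (simp add: algebra_simps)
  then have e: "avg S Q n (\<lambda>xs. f xs * ((\<Sum>x\<leftarrow>xs. h (R (xs ! l) x)) - 1))
      = avg S Q n (\<lambda>xs. f xs * ((\<Sum>x\<leftarrow>xs. h (R (xs ! l) x)) - h 1)) + (h 1 - 1) * avg S Q n f"
    by (simp only: avg_add avg_cmult)
  show ?thesis using d unfolding gg_defect_def e by (simp add: algebra_simps)
qed

text \<open>A polynomial stand-in for the indicator of overlaps above \<open>- d'\<close>, with the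
  transition placed between \<open>- d\<close> and \<open>- d'\<close>; the identities are available
  for polynomials only.\<close>

lemma ramp_polynomial:
  fixes d d' \<delta> :: real
  assumes "d' < d" "0 < \<delta>"
  obtains K and c :: "nat \<Rightarrow> real" where
    "\<And>x. \<bar>x\<bar> \<le> 1 \<Longrightarrow> 0 \<le> (\<Sum>k\<le>K. c k * x ^ k) \<and> (\<Sum>k\<le>K. c k * x ^ k) \<le> 1 + \<delta>"
    "\<And>x. \<bar>x\<bar> \<le> 1 \<Longrightarrow> x \<le> - d \<Longrightarrow> (\<Sum>k\<le>K. c k * x ^ k) \<le> \<delta>"
    "\<And>x. \<bar>x\<bar> \<le> 1 \<Longrightarrow> - d' \<le> x \<Longrightarrow> 1 \<le> (\<Sum>k\<le>K. c k * x ^ k)"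
proof -
  \<comment> \<open>The ramp is lifted by half of \<open>\<delta>\<close> and approximated within
    half of \<open>\<delta>\<close>, so that the bounds 0 and 1 from below hold exactly.\<close>
  define \<phi> where "\<phi> x = \<delta> / 2 + max 0 (min 1 ((x + d) / (d - d')))" for x :: real
  have c: "continuous_on {-1..1} \<phi>" unfolding \<phi>_def using assms by (intro continuous_intros) auto
  obtain q where q: "real_polynomial_function q" "\<And>x. x \<in> {-1..1} \<Longrightarrow> \<bar>\<phi> x - q x\<bar> < \<delta> / 2"
    using Stone_Weierstrass_real_polynomial_function[OF _ c, of "\<delta> / 2"] assms by auto
  obtain a K where aK: "q = (\<lambda>x. \<Sum>i\<le>K. a i * x ^ i)"
    using q(1) unfolding real_polynomial_function_iff_sum by blast
  have close: "\<bar>\<phi> x - (\<Sum>i\<le>K. a i * x ^ i)\<bar> < \<delta> / 2" if "\<bar>x\<bar> \<le> 1" for x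
    using q(2)[of x] that by (simp add: aK abs_le_iff)
  have b: "\<delta> / 2 \<le> \<phi> x \<and> \<phi> x \<le> 1 + \<delta> / 2" for x by (auto simp: \<phi>_def)
  have lo: "\<phi> x = \<delta> / 2" if "x \<le> - d" for x
  proof -
    have "(x + d) / (d - d') \<le> 0" using that assms by (simp add: divide_le_0_iff)
    then show ?thesis by (simp add: \<phi>_def)
  qed
  have hi: "\<phi> x = 1 + \<delta> / 2" if "- d' \<le> x" for x
  proof -
    have "1 \<le> (x + d) / (d - d')" using that assms by (simp add: le_divide_eq)
    then show ?thesis by (simp add: \<phi>_def)
  qed
  show thesis
  proof (rule that[where K=K and c=a])
    fix x :: real assume x: "\<bar>x\<bar> \<le> 1"
    show "0 \<le> (\<Sum>k\<le>K. a k * x ^ k) \<and> (\<Sum>k\<le>K. a k * x ^ k) \<le> 1 + \<delta>"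
      using close[OF x] b[of x] unfolding abs_less_iff by linarith
    show "x \<le> - d \<Longrightarrow> (\<Sum>k\<le>K. a k * x ^ k) \<le> \<delta>"
      using close[OF x] lo[of x] unfolding abs_less_iff by linarith
    show "- d' \<le> x \<Longrightarrow> 1 \<le> (\<Sum>k\<le>K. a k * x ^ k)"
      using close[OF x] hi[of x] unfolding abs_less_iff by linarith
  qed
qed

section \<open>Replicas with pairwise negative overlaps\<close>

definition low :: "('s \<Rightarrow> 's \<Rightarrow> real) \<Rightarrow> real \<Rightarrow> 's list \<Rightarrow> real" where
  "low R d xs = of_bool (sorted_wrt (\<lambda>x y. R x y \<le> - d) xs)"

lemma overlap_kernelD:
  assumes "overlap_kernel S R"
  shows "s \<in> S \<Longrightarrow> R s s = 1" "s \<in> S \<Longrightarrow> t \<in> S \<Longrightarrow> \<bar>R s t\<bar> \<le> 1" "s \<in> S \<Longrightarrow> t \<in> S \<Longrightarrow> R s t = R t s"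
    "set xs \<subseteq> S \<Longrightarrow> 0 \<le> (\<Sum>x\<leftarrow>xs. \<Sum>y\<leftarrow>xs. R x y)"
  using assms unfolding overlap_kernel_def by blast+

lemma low_sum_bound:
  assumes R: "overlap_kernel S R" and "set xs \<subseteq> S" "sorted_wrt (\<lambda>x y. R x y \<le> - d) xs"
  shows "(\<Sum>x\<leftarrow>xs. \<Sum>y\<leftarrow>xs. R x y) \<le> real (length xs) - real (length xs) * (real (length xs) - 1) * d"
  using assms(2,3)
proof (induction xs)
  case (Cons z xs)
  have z: "z \<in> S" and xs: "set xs \<subseteq> S" using Cons.prems by auto
  have "(\<Sum>y\<leftarrow>xs. R z y) \<le> (\<Sum>y\<leftarrow>xs. - d)"
    using Cons.prems by (intro sum_list_mono) auto
  then have 1: "(\<Sum>y\<leftarrow>xs. R z y) \<le> - (real (length xs) * d)" by (simp add: sum_list_triv)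
  have 2: "(\<Sum>x\<leftarrow>xs. R x z) = (\<Sum>y\<leftarrow>xs. R z y)"
    using xs z by (intro arg_cong[where f=sum_list] map_cong refl overlap_kernelD(3)[OF R]) auto
  have "(\<Sum>x\<leftarrow>z # xs. \<Sum>y\<leftarrow>z # xs. R x y) = R z z + (\<Sum>y\<leftarrow>xs. R z y) + ((\<Sum>x\<leftarrow>xs. R x z) + (\<Sum>x\<leftarrow>xs. \<Sum>y\<leftarrow>xs. R x y))"
    by (simp add: sum_list_addf)
  also have "\<dots> \<le> 1 + 2 * (- (real (length xs) * d)) + (real (length xs) - real (length xs) * (real (length xs) - 1) * d)"
    using 1 Cons.IH[OF xs] Cons.prems overlap_kernelD(1)[OF R z] unfolding 2 by simp
  finally show ?case by (simp add: algebra_simps)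
qed simp

text \<open>The self-overlap contributes exactly the subtracted \<open>h 1\<close>; all other
  overlaps in the row are at most \<open>- d\<close>, where \<open>h\<close> is at most
  \<open>\<delta>\<close>.\<close>

lemma low_row_sum:
  assumes R: "overlap_kernel S R" and xs: "set xs \<subseteq> S" "sorted_wrt (\<lambda>x y. R x y \<le> - d) xs"
    and l: "l < length xs" and h: "\<And>x. \<bar>x\<bar> \<le> 1 \<Longrightarrow> x \<le> - d \<Longrightarrow> h x \<le> (\<delta> :: real)"
  shows "(\<Sum>x\<leftarrow>xs. h (R (xs ! l) x)) - h 1 \<le> (real (length xs) - 1) * \<delta>"
proof -
  have nth: "xs ! i \<in> S" if "i < length xs" for i using that xs(1) by (auto simp: subset_iff)
  have "(\<Sum>x\<leftarrow>xs. h (R (xs ! l) x)) = (\<Sum>i<length xs. h (R (xs ! l) (xs ! i)))"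
    by (simp add: sum_list_sum_nth atLeast0LessThan)
  also have "\<dots> = h (R (xs ! l) (xs ! l)) + (\<Sum>i\<in>{..<length xs} - {l}. h (R (xs ! l) (xs ! i)))"
    using l by (subst sum.remove[of _ l]) auto
  also have "h (R (xs ! l) (xs ! l)) = h 1" using overlap_kernelD(1)[OF R nth[OF l]] by simp
  also have "(\<Sum>i\<in>{..<length xs} - {l}. h (R (xs ! l) (xs ! i))) \<le> (\<Sum>i\<in>{..<length xs} - {l}. \<delta>)"
  proof (rule sum_mono)
    fix i assume i: "i \<in> {..<length xs} - {l}"
    have "R (xs ! l) (xs ! i) \<le> - d"
    proof (cases "l < i")
      case True
      then show ?thesis using sorted_wrt_nth_less[OF xs(2)] i by auto
    next
      case False
      then have "R (xs ! i) (xs ! l) \<le> - d" using sorted_wrt_nth_less[OF xs(2), of i l] i l by auto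
      then show ?thesis using overlap_kernelD(3)[OF R, of "xs ! i" "xs ! l"] nth i l by auto
    qed
    then show "h (R (xs ! l) (xs ! i)) \<le> \<delta>"
      by (intro h overlap_kernelD(2)[OF R] nth l) (use i in auto)
  qed
  also have "\<dots> = (real (length xs) - 1) * \<delta>" using l by (simp add: of_nat_diff)
  finally show ?thesis by simp
qed

lemma low_range: "0 \<le> low R d xs" "low R d xs \<le> 1"
  by (auto simp: low_def)

lemma low_mono: "d' \<le> d \<Longrightarrow> low R d xs \<le> low R d' xs"
  unfolding low_def by (auto intro: sorted_wrt_mono_rel[rotated] simp: of_bool_def)

text \<open>Among \<open>n\<close> replicas with overlaps at most \<open>- d\<close>, the identities
  express the mean of \<open>h\<close> at the overlap of replica \<open>l\<close> with a fresh one.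
  The old replicas contribute only order \<open>\<delta>\<close>; the rest is
  \<open>(1 - m) / (real n - m)\<close> times the two-replica mean of \<open>h\<close>, at most
  \<open>1 + \<delta> - b\<close> because overlaps below \<open>- \<epsilon>\<close> have weight at
  least \<open>b\<close>. Summed over \<open>l\<close> this is about \<open>1 - b\<close>, so with a
  share of about \<open>b\<close> the fresh replica is negative against all the others.\<close>

lemma low_step:
  assumes rep: "replica S Q" and R: "overlap_kernel S R" and m: "0 < m" "m < 1"
    and g: "\<And>k. k \<in> {1..K} \<Longrightarrow> gg S Q m (\<lambda>s t. R s t ^ k) \<eta>" and \<eta>: "0 \<le> \<eta>"
    and n: "2 \<le> n" and d: "d' \<le> d" "d \<le> \<epsilon>" and \<delta>: "0 \<le> \<delta>" "2 * (2 * real n + 1) * \<delta> \<le> b"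
    and b: "b \<le> avg S Q 2 (low R \<epsilon>)" "0 < b"
    and h: "\<And>x. h x = (\<Sum>k\<le>K. c k * x ^ k)"
    and h1: "\<And>x. \<bar>x\<bar> \<le> 1 \<Longrightarrow> 0 \<le> h x \<and> h x \<le> 1 + \<delta>"
    and h2: "\<And>x. \<bar>x\<bar> \<le> 1 \<Longrightarrow> x \<le> - d \<Longrightarrow> h x \<le> \<delta>"
    and h3: "\<And>x. \<bar>x\<bar> \<le> 1 \<Longrightarrow> - d' \<le> x \<Longrightarrow> 1 \<le> h x"
  shows "avg S Q n (low R d) * b / 2 - 2 * ((\<Sum>k\<le>K. \<bar>c k\<bar>) * \<eta>) \<le> avg S Q (Suc n) (low R d')"
proof -
  let ?C = "(\<Sum>k\<le>K. \<bar>c k\<bar>) * \<eta>" and ?\<alpha> = "avg S Q n (low R d)"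
  let ?\<mu> = "avg S Q 2 (\<lambda>ys. h (R (ys ! 1) (ys ! 0)))"
  have "avg S Q n (\<lambda>_. 0) \<le> ?\<alpha>" by (rule avg_mono[OF rep]) (rule low_range)
  then have \<alpha>0: "0 \<le> ?\<alpha>" by (simp only: avg_const[OF rep])
  have C0: "0 \<le> ?C" using \<eta> by (intro mult_nonneg_nonneg sum_nonneg) auto
  have "avg S Q 2 (low R \<epsilon>) \<le> avg S Q 2 (\<lambda>_. 1)" by (rule avg_mono[OF rep]) (rule low_range)
  then have b1: "b \<le> 1" using b(1) by (simp only: avg_const[OF rep])
  have \<mu>: "?\<mu> \<le> 1 + \<delta> - b"
  proof -
    have "?\<mu> \<le> avg S Q 2 (\<lambda>ys. (1 + \<delta>) - low R \<epsilon> ys)"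
    proof (rule avg_mono[OF rep])
      fix ys assume "ys \<in> words S 2"
      then obtain y z where ys: "ys = [y, z]" "y \<in> S" "z \<in> S"
        by (auto simp: words_def numeral_2_eq_2 length_Suc_conv)
      have r: "R z y = R y z" "\<bar>R y z\<bar> \<le> 1" using overlap_kernelD(2,3)[OF R] ys by auto
      show "h (R (ys ! 1) (ys ! 0)) \<le> (1 + \<delta>) - low R \<epsilon> ys"
      proof (cases "R y z \<le> - \<epsilon>")
        case True
        then have "R y z \<le> - d" using d by simp
        then show ?thesis using h2[OF r(2)] True r by (simp add: ys low_def)
      next
        case False
        then show ?thesis using h1[OF r(2)] r by (simp add: ys low_def)
      qed
    qed
    also have "\<dots> = 1 + \<delta> - avg S Q 2 (low R \<epsilon>)"
      by (simp add: avg_diff avg_const[OF rep])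
    finally show ?thesis using b by simp
  qed
  have summand: "avg S Q (Suc n) (\<lambda>ys. low R d (tl ys) * h (R (tl ys ! l) (hd ys)))
      \<le> 2 * \<delta> * ?\<alpha> + (1 - m) / (real n - m) * (?\<alpha> * (1 + \<delta> - b)) + ?C / (real n - m)" if l: "l < n" for l
  proof -
    let ?T = "avg S Q (Suc n) (\<lambda>ys. low R d (tl ys) * h (R (tl ys ! l) (hd ys)))"
    have "(real n - m) * ?T
      \<le> avg S Q n (\<lambda>xs. low R d xs * ((\<Sum>x\<leftarrow>xs. h (R (xs ! l) x)) - h 1)) + (1 - m) * ?\<alpha> * ?\<mu> + ?C"
      by (rule gg_polynomial[OF rep g \<eta> l _ h]) (use low_range[of R d] in auto)
    also have "avg S Q n (\<lambda>xs. low R d xs * ((\<Sum>x\<leftarrow>xs. h (R (xs ! l) x)) - h 1))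
        \<le> avg S Q n (\<lambda>xs. ((real n - 1) * \<delta>) * low R d xs)"
    proof (rule avg_mono[OF rep])
      fix xs assume "xs \<in> words S n"
      then have xs: "set xs \<subseteq> S" "length xs = n" by (auto simp: words_def)
      show "low R d xs * ((\<Sum>x\<leftarrow>xs. h (R (xs ! l) x)) - h 1) \<le> ((real n - 1) * \<delta>) * low R d xs"
        using low_row_sum[OF R xs(1), of d l h \<delta>] h2 xs(2) l by (auto simp: low_def)
    qed
    also have "\<dots> = ((real n - 1) * \<delta>) * ?\<alpha>" by (rule avg_cmult)
    also have "(1 - m) * ?\<alpha> * ?\<mu> \<le> (1 - m) * ?\<alpha> * (1 + \<delta> - b)"
      using m \<alpha>0 by (intro mult_left_mono \<mu>) auto
    also have "((real n - 1) * \<delta>) * ?\<alpha> \<le> ((real n - m) * \<delta>) * ?\<alpha>"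
      using m \<delta> \<alpha>0 by (intro mult_right_mono) auto
    finally have "(real n - m) * ?T \<le> ((real n - m) * \<delta>) * ?\<alpha> + (1 - m) * ?\<alpha> * (1 + \<delta> - b) + ?C" by simp
    moreover have nm: "0 < real n - m" using n m by simp
    ultimately have "?T \<le> (((real n - m) * \<delta>) * ?\<alpha> + (1 - m) * ?\<alpha> * (1 + \<delta> - b) + ?C) / (real n - m)"
      by (subst pos_le_divide_eq) (auto simp: mult.commute)
    also have "\<dots> = \<delta> * ?\<alpha> + (1 - m) / (real n - m) * (?\<alpha> * (1 + \<delta> - b)) + ?C / (real n - m)"
      using nm by (simp add: add_divide_distrib mult.assoc)
    also have "\<dots> \<le> 2 * \<delta> * ?\<alpha> + (1 - m) / (real n - m) * (?\<alpha> * (1 + \<delta> - b)) + ?C / (real n - m)"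
      using \<delta> \<alpha>0 by simp
    finally show ?thesis .
  qed
  \<comment> \<open>Union bound: if the fresh head spoils the condition, its overlap with some
    replica \<open>l\<close> exceeds \<open>- d'\<close>, and the corresponding value of
    \<open>h\<close> is at least 1.\<close>
  have "?\<alpha> - (\<Sum>l<n. avg S Q (Suc n) (\<lambda>ys. low R d (tl ys) * h (R (tl ys ! l) (hd ys))))
      = avg S Q (Suc n) (\<lambda>ys. low R d (tl ys) - (\<Sum>l<n. low R d (tl ys) * h (R (tl ys ! l) (hd ys))))"
    by (simp add: avg_diff avg_sum avg_tl[OF rep])
  also have "\<dots> \<le> avg S Q (Suc n) (low R d')"
  proof (rule avg_mono[OF rep])
    fix ys assume "ys \<in> words S (Suc n)"
    then obtain y xs where ys: "ys = y # xs" "y \<in> S" "set xs \<subseteq> S" "length xs = n"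
      by (auto simp: words_def length_Suc_conv)
    have nth: "xs ! l \<in> S" if "l < n" for l using that ys by (auto simp: subset_iff)
    have hn: "0 \<le> h (R (xs ! l) y)" if "l < n" for l
      using h1 overlap_kernelD(2)[OF R nth[OF that] ys(2)] by blast
    show "low R d (tl ys) - (\<Sum>l<n. low R d (tl ys) * h (R (tl ys ! l) (hd ys))) \<le> low R d' ys"
    proof (cases "low R d xs = 1 \<and> low R d' ys = 0")
      case False
      have "low R d xs = 0 \<or> low R d xs = 1" "low R d' ys = 0 \<or> low R d' ys = 1" by (auto simp: low_def)
      moreover have "0 \<le> (\<Sum>l<n. h (R (xs ! l) y))" by (rule sum_nonneg) (use hn in auto)
      ultimately show ?thesis using False unfolding ys(1) by auto
    next
      case True
      have "low R d' xs = 1" using low_mono[OF d(1), of R xs] low_range(2)[of R d' xs] True by simp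
      then have "sorted_wrt (\<lambda>x y. R x y \<le> - d') xs" by (simp add: low_def)
      then obtain x where x: "x \<in> set xs" "\<not> R y x \<le> - d'" using True by (auto simp: ys low_def)
      then obtain l where l: "l < n" "x = xs ! l" using ys(4) by (auto simp: in_set_conv_nth)
      have "- d' \<le> R (xs ! l) y" using x l overlap_kernelD(3)[OF R nth[OF l(1)] ys(2)] by simp
      then have "1 \<le> h (R (xs ! l) y)" using h3 overlap_kernelD(2)[OF R nth[OF l(1)] ys(2)] by blast
      also have "\<dots> \<le> (\<Sum>l<n. h (R (xs ! l) y))"
        by (rule member_le_sum[of l "{..<n}" "\<lambda>l. h (R (xs ! l) y)"]) (use l hn in auto)
      finally show ?thesis using True by (simp add: ys(1))
    qed
  qed
  finally have "?\<alpha> \<le> (\<Sum>l<n. avg S Q (Suc n) (\<lambda>ys. low R d (tl ys) * h (R (tl ys ! l) (hd ys)))) + avg S Q (Suc n) (low R d')"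
    by simp
  also have "(\<Sum>l<n. avg S Q (Suc n) (\<lambda>ys. low R d (tl ys) * h (R (tl ys ! l) (hd ys))))
      \<le> (\<Sum>l<n. 2 * \<delta> * ?\<alpha> + (1 - m) / (real n - m) * (?\<alpha> * (1 + \<delta> - b)) + ?C / (real n - m))"
    by (intro sum_mono summand) auto
  also have "\<dots> = 2 * real n * \<delta> * ?\<alpha> + (real n * (1 - m) / (real n - m)) * (?\<alpha> * (1 + \<delta> - b)) + real n / (real n - m) * ?C"
    by (simp add: distrib_left mult_ac)
  \<comment> \<open>The \<open>n\<close> shares add up to at most one because
    \<open>m \<le> real n * m\<close>.\<close>
  also have "(real n * (1 - m) / (real n - m)) * (?\<alpha> * (1 + \<delta> - b)) \<le> 1 * (?\<alpha> * (1 + \<delta> - b))"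
  proof (rule mult_right_mono)
    have "m \<le> real n * m" using n m by simp
    then show "real n * (1 - m) / (real n - m) \<le> 1"
      using n m by (subst pos_divide_le_eq) (auto simp: algebra_simps)
    show "0 \<le> ?\<alpha> * (1 + \<delta> - b)" using \<alpha>0 b1 \<delta> by simp
  qed
  also have "real n / (real n - m) * ?C \<le> 2 * ?C"
    using n m by (intro mult_right_mono[OF _ C0]) (auto simp: pos_divide_le_eq)
  finally have "?\<alpha> * b - (2 * real n + 1) * \<delta> * ?\<alpha> - 2 * ?C \<le> avg S Q (Suc n) (low R d')"
    by (simp add: algebra_simps)
  moreover have "(2 * real n + 1) * \<delta> * ?\<alpha> \<le> b / 2 * ?\<alpha>"
    using \<delta> \<alpha>0 by (intro mult_right_mono) (auto simp: algebra_simps)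
  ultimately show ?thesis by (simp add: mult.commute)
qed

text \<open>Talagrand's positivity principle: otherwise arbitrarily many replicas with pairwise
  negative overlaps would occur with positive probability, contradicting positive definiteness.\<close>

lemma overlap_positivity:
  fixes \<epsilon> b :: real
  assumes \<epsilon>: "0 < \<epsilon>" and b: "0 < b"
  shows "\<exists>K \<eta>. 0 < \<eta> \<and> (\<forall>(S :: 's set) Q m R. replica S Q \<longrightarrow> overlap_kernel S R \<longrightarrow> 0 < m \<longrightarrow> m < 1 \<longrightarrow>
    (\<forall>k\<in>{1..K}. gg S Q m (\<lambda>s t. R s t ^ k) \<eta>) \<longrightarrow> avg S Q 2 (low R \<epsilon>) \<le> b)"
proof -
  \<comment> \<open>Starts at \<open>\<epsilon>\<close> for two replicas and decreases strictly,
    leaving room for a ramp at each step, yet stays above half of \<open>\<epsilon>\<close>.\<close>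
  define d where "d n = \<epsilon> / 2 + \<epsilon> / real n" for n :: nat
  define hyp where "hyp K \<eta> m R S Q \<longleftrightarrow> replica S Q \<and> overlap_kernel S R \<and> 0 < m \<and> m < 1 \<and>
      (\<forall>k\<in>{1..K}. gg S Q m (\<lambda>s t. R s t ^ k) \<eta>)"
    for K :: nat and \<eta> m :: real and S :: "'s set" and R Q
  have P: "\<exists>K \<eta> c. 0 < \<eta> \<and> 0 < c \<and> (\<forall>S Q m R. hyp K \<eta> m R S Q \<longrightarrow> b < avg S Q 2 (low R \<epsilon>)
      \<longrightarrow> c \<le> avg S Q n (low R (d n)))" if "2 \<le> n" for n
    using that
  proof (induction n rule: dec_induct)
    case base
    have "d 2 = \<epsilon>" by (simp add: d_def)
    then show ?case using b by (intro exI[of _ 0] exI[of _ 1] exI[of _ b]) auto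
  next
    case (step n)
    obtain K0 \<eta>0 c0 where IH: "0 < \<eta>0" "0 < c0" "\<And>S Q m R. hyp K0 \<eta>0 m R S Q \<Longrightarrow> b < avg S Q 2 (low R \<epsilon>)
        \<Longrightarrow> c0 \<le> avg S Q n (low R (d n))"
      using step.IH by blast
    define \<delta> where "\<delta> = b / (2 * (2 * real n + 1))"
    have \<delta>: "0 < \<delta>" "2 * (2 * real n + 1) * \<delta> \<le> b" using b by (auto simp: \<delta>_def)
    have dd: "d (Suc n) < d n" using \<epsilon> step.hyps by (simp add: d_def frac_less2)
    have dn: "d n \<le> \<epsilon>" using \<epsilon> step.hyps by (simp add: d_def field_simps)
    obtain K1 and c :: "nat \<Rightarrow> real" where c:
      "\<And>x. \<bar>x\<bar> \<le> 1 \<Longrightarrow> 0 \<le> (\<Sum>k\<le>K1. c k * x ^ k) \<and> (\<Sum>k\<le>K1. c k * x ^ k) \<le> 1 + \<delta>"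
      "\<And>x. \<bar>x\<bar> \<le> 1 \<Longrightarrow> x \<le> - d n \<Longrightarrow> (\<Sum>k\<le>K1. c k * x ^ k) \<le> \<delta>"
      "\<And>x. \<bar>x\<bar> \<le> 1 \<Longrightarrow> - d (Suc n) \<le> x \<Longrightarrow> 1 \<le> (\<Sum>k\<le>K1. c k * x ^ k)"
      by (rule ramp_polynomial[OF dd \<delta>(1)], rule that)
    let ?C = "\<Sum>k\<le>K1. \<bar>c k\<bar>"
    have C0: "0 \<le> ?C" by (rule sum_nonneg) auto
    have C1: "0 < ?C + 1" using C0 by linarith
    \<comment> \<open>Chosen so that the error \<open>2 * (?C * \<eta>)\<close> uses up at most half
      of the gain \<open>c0 * b / 2\<close>.\<close>
    define E where "E = c0 * b / (8 * (?C + 1))"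
    have E: "0 < E" unfolding E_def by (intro divide_pos_pos mult_pos_pos IH(2) b C1) simp
    define \<eta> where "\<eta> = min \<eta>0 E"
    have \<eta>: "0 < \<eta>" "\<eta> \<le> \<eta>0" "\<eta> \<le> E" using IH(1) E by (auto simp: \<eta>_def)
    have "?C * \<eta> \<le> (?C + 1) * E"
      using C0 \<eta> by (intro mult_mono) (linarith | simp)+
    also have "\<dots> = c0 * b / 8"
    proof -
      have "z * (c0 * b / (8 * z)) = c0 * b / 8" if "0 < z" for z using that by simp
      from this[OF C1] show ?thesis unfolding E_def .
    qed
    finally have C\<eta>: "?C * \<eta> \<le> c0 * b / 8" .
    have "c0 * b / 4 \<le> avg S Q (Suc n) (low R (d (Suc n)))"
      if H: "hyp (max K0 K1) \<eta> m R S Q" and bS: "b < avg S Q 2 (low R \<epsilon>)" for S Q m R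
    proof -
      have g: "gg S Q m (\<lambda>s t. R s t ^ k) \<eta>" if "k \<in> {1..max K0 K1}" for k using H that unfolding hyp_def by blast
      have H': "replica S Q" "overlap_kernel S R" "0 < m" "m < 1" using H by (auto simp: hyp_def)
      have "gg S Q m (\<lambda>s t. R s t ^ k) \<eta>0" if "k \<in> {1..K0}" for k
        using g[of k] that \<eta>(2) unfolding gg_def by fastforce
      then have "c0 \<le> avg S Q n (low R (d n))" using IH(3) H' bS unfolding hyp_def by blast
      then have "c0 * b / 2 \<le> avg S Q n (low R (d n)) * b / 2" using b by simp
      moreover have "avg S Q n (low R (d n)) * b / 2 - 2 * (?C * \<eta>) \<le> avg S Q (Suc n) (low R (d (Suc n)))"
      proof (rule low_step[OF H', where \<epsilon>=\<epsilon> and \<delta>=\<delta> and h="\<lambda>x. \<Sum>k\<le>K1. c k * x ^ k"])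
        show "gg S Q m (\<lambda>s t. R s t ^ k) \<eta>" if "k \<in> {1..K1}" for k by (rule g) (use that in auto)
      qed (use \<eta> step.hyps dd dn \<delta> bS b c in \<open>auto intro: less_imp_le\<close>)
      ultimately show ?thesis using C\<eta> by simp
    qed
    then show ?case using \<eta>(1) IH(2) b
      by (intro exI[of _ "max K0 K1"] exI[of _ \<eta>] exI[of _ "c0 * b / 4"]) auto
  qed
  \<comment> \<open>With this many replicas, \<open>n\<close> diagonal terms cannot balance
    \<open>n * (n - 1)\<close> overlaps below minus half of \<open>\<epsilon>\<close>, so positive
    semidefiniteness rules the event out.\<close>
  obtain n :: nat where n: "2 + 2 / \<epsilon> < real n" using reals_Archimedean2 by blast
  have "0 < 2 / \<epsilon>" using \<epsilon> by simp
  then have n2: "2 \<le> n" using n by linarith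
  obtain K \<eta> c where H: "0 < \<eta>" "0 < c" "\<And>S Q m R. hyp K \<eta> m R S Q \<Longrightarrow> b < avg S Q 2 (low R \<epsilon>)
      \<Longrightarrow> c \<le> avg S Q n (low R (d n))"
    using P[OF n2] by blast
  have zero: "low R (d n) xs = 0" if R: "overlap_kernel S R" and xs: "xs \<in> words S n" for S :: "'s set" and R xs
  proof (rule ccontr)
    assume "low R (d n) xs \<noteq> 0"
    then have "sorted_wrt (\<lambda>x y. R x y \<le> - d n) xs" by (simp add: low_def)
    from low_sum_bound[OF R _ this] overlap_kernelD(4)[OF R, of xs] xs
    have "0 \<le> real n - real n * (real n - 1) * d n" by (auto simp: words_def)
    moreover have "1 < (real n - 1) * d n"
    proof -
      have "1 < (real n - 1) * (\<epsilon> / 2)" using n \<epsilon> by (simp add: field_simps)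
      also have "\<dots> \<le> (real n - 1) * d n" using n2 \<epsilon> by (intro mult_left_mono) (auto simp: d_def)
      finally show ?thesis .
    qed
    then have "real n * 1 < real n * ((real n - 1) * d n)" using n2 by (intro mult_strict_left_mono) auto
    ultimately show False by (simp add: mult.assoc)
  qed
  have "avg S Q 2 (low R \<epsilon>) \<le> b" if h: "hyp K \<eta> m R S Q" for S Q m R
  proof (rule ccontr)
    assume "\<not> avg S Q 2 (low R \<epsilon>) \<le> b"
    then have "c \<le> avg S Q n (low R (d n))" using H(3) h by auto
    moreover have "avg S Q n (low R (d n)) = avg S Q n (\<lambda>_. 0)"
      by (rule avg_cong) (rule zero, use h in \<open>auto simp: hyp_def\<close>)
    ultimately show False using H(2) by (simp add: avg_def)
  qed
  then show ?thesis using H(1) unfolding hyp_def by blast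
qed

section \<open>The comparison inequality\<close>

lemma powr_bernoulli_concave:
  fixes z m :: real
  assumes "0 < z" "0 < m" "m < 1"
  shows "z powr m \<le> 1 + m * (z - 1)"
proof -
  have "z powr m * 1 powr (1 - m) \<le> m * z + (1 - m) * 1"
    by (rule Youngs_inequality_0) (use assms in auto)
  then show ?thesis by (simp add: algebra_simps)
qed

lemma exp_plus_exp_minus_ge: "2 + y\<^sup>2 \<le> exp y + exp (- y :: real)"
proof -
  have *: "2 + x\<^sup>2 \<le> exp x + exp (- x)" if x: "0 \<le> x" for x :: real
  proof -
    \<comment> \<open>The difference \<open>exp x + exp (- x) - 2\<close> is the square of
      \<open>exp u - exp (- u)\<close>, so the first-order bound
      \<open>x \<le> exp u - exp (- u)\<close> suffices.\<close>
    define u where "u = x / 2"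
    define q where "q = 1 + u + u\<^sup>2 / 2"
    have u: "0 \<le> u" using x by (simp add: u_def)
    have q: "1 \<le> q" "q \<le> exp u"
      using u exp_lower_Taylor_quadratic[OF u] by (auto simp: q_def)
    have "exp (- u) \<le> inverse q"
      unfolding exp_minus using q by (intro le_imp_inverse_le) auto
    moreover have "2 * u \<le> q - inverse q"
    proof -
      have "q * q - 1 - 2 * u * q = (u\<^sup>2 / 2)\<^sup>2" by (simp add: q_def power2_eq_square algebra_simps)
      then have "2 * u * q \<le> q * q - 1" using zero_le_power2[of "u\<^sup>2 / 2"] by linarith
      then show ?thesis using q(1) by (simp add: field_simps)
    qed
    ultimately have "x \<le> exp u - exp (- u)" using q(2) by (simp add: u_def)
    then have "x\<^sup>2 \<le> (exp u - exp (- u))\<^sup>2" using x by (intro power_mono)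
    also have "\<dots> = exp x + exp (- x) - 2"
      by (simp add: power2_eq_square algebra_simps mult_exp_exp u_def)
    finally show ?thesis by simp
  qed
  show ?thesis using *[of y] *[of "- y"] by (cases "0 \<le> y") auto
qed

section \<open>Perturbing fields and the Ghirlanda-Guerra identities\<close>

context gibbs
begin

lemma pf_shift: "pf (\<lambda>s. e s + u s) = pf e * (\<Sum>s\<in>S. pr e s * exp (u s))"
  using pf_pos[of e] by (simp add: pf_def[of "\<lambda>s. e s + u s"] pr_def sum_distrib_left exp_add mult_ac)

text \<open>Jensen's inequality for the concave power \<open>m\<close> under the Gibbs measure, via
  the tangent line at the mean \<open>?Y\<close>.\<close>

lemma wt_shift_ge: "(\<Sum>t\<in>S. wt e [t] * exp (m * u t)) \<le> wt (\<lambda>s. e s + u s) []"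
proof -
  let ?Y = "\<Sum>s\<in>S. pr e s * exp (u s)"
  have p: "0 < pr e s" if "s \<in> S" for s using w_pos[OF that] pf_pos[of e] by (simp add: pr_def)
  have Y: "0 < ?Y" by (rule sum_pos) (use finite_S S_ne p in auto)
  have "(\<Sum>t\<in>S. wt e [t] * exp (m * u t)) = (\<Sum>t\<in>S. pf e powr m * (pr e t * exp (u t) powr m))"
    by (simp add: wt_def powr_def mult.assoc)
  also have "\<dots> \<le> (\<Sum>t\<in>S. pf e powr m * (pr e t * (?Y powr m * (1 + m * (exp (u t) / ?Y - 1)))))"
  proof (intro sum_mono mult_left_mono)
    fix t
    have "exp (u t) powr m = ?Y powr m * (exp (u t) / ?Y) powr m"
      using Y by (simp add: powr_divide)
    also have "\<dots> \<le> ?Y powr m * (1 + m * (exp (u t) / ?Y - 1))"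
      using Y m_pos m_less by (intro mult_left_mono powr_bernoulli_concave) auto
    finally show "exp (u t) powr m \<le> ?Y powr m * (1 + m * (exp (u t) / ?Y - 1))" .
  qed (use pr_nonneg in auto)
  also have "\<dots> = pf e powr m * ?Y powr m * (\<Sum>t\<in>S. pr e t * (1 + m * (exp (u t) / ?Y - 1)))"
    by (simp add: sum_distrib_left mult_ac)
  also have "(\<Sum>t\<in>S. pr e t * (1 + m * (exp (u t) / ?Y - 1))) = (\<Sum>t\<in>S. (1 - m) * pr e t + m / ?Y * (pr e t * exp (u t)))"
    by (intro sum.cong refl) (simp add: algebra_simps)
  also have "\<dots> = (1 - m) * 1 + m / ?Y * ?Y"
    by (simp only: sum.distrib sum_distrib_left[symmetric] sum_pr)
  also have "\<dots> = 1" using Y by simp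
  also have "pf e powr m * ?Y powr m * 1 = wt (\<lambda>s. e s + u s) []"
    using Y pf_pos[of e] by (simp add: wt_def pf_shift powr_mult)
  finally show ?thesis .
qed

lemma sum_wt_words: "(\<Sum>xs\<in>words S n. wt e xs) = wt e []"
  by (induction n) (simp_all add: sum_words_Suc[OF finite_S] sum_wt_Cons)

lemma sum_wt_nth: "l < n \<Longrightarrow> (\<Sum>xs\<in>words S n. wt e xs * q (xs ! l)) = (\<Sum>t\<in>S. wt e [t] * q t)"
proof (induction n arbitrary: l)
  case (Suc n)
  show ?case
  proof (cases l)
    case 0
    have "(\<Sum>xs\<in>words S (Suc n). wt e xs * q (xs ! l)) = (\<Sum>xs\<in>words S n. wt e xs * (\<Sum>t\<in>S. pr e t * q t))"
      by (simp add: sum_words_Suc[OF finite_S] 0 wt_Cons sum_distrib_left mult_ac)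
    also have "\<dots> = wt e [] * (\<Sum>t\<in>S. pr e t * q t)"
      by (simp only: sum_distrib_right[symmetric] sum_wt_words)
    finally show ?thesis by (simp add: sum_distrib_left wt_Cons mult_ac)
  next
    case (Suc l')
    have "(\<Sum>xs\<in>words S (Suc n). wt e xs * q (xs ! l)) = (\<Sum>xs\<in>words S n. (\<Sum>x\<in>S. wt e (x # xs)) * q (xs ! l'))"
      by (simp add: sum_words_Suc[OF finite_S] Suc sum_distrib_right)
    then show ?thesis using Suc.IH[of l'] Suc.prems Suc by (simp add: sum_wt_Cons)
  qed
qed simp

lemma replica_tw: "replica S (\<lambda>xs. tw J a xs / tw J a [])"
  unfolding replica_def using finite_S tw_Nil_pos[of J a] tw_nonneg[of _ J a]
  by (auto simp: sum_divide_distrib[symmetric] sum_tw_Cons)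

lemma tame_wt_field: "set xs \<subseteq> S \<Longrightarrow> tame (\<lambda>g. wt (field J a g) xs * (field J d g y - \<gamma>) ^ k)"
proof -
  assume xs: "set xs \<subseteq> S"
  have "tame (\<lambda>g. field J d g y + - \<gamma>)" by (intro tame_add tame_field tame_const)
  then have "tame (\<lambda>g. (field J d g y - \<gamma>) ^ k)" by (induction k) auto
  then show ?thesis using xs by auto
qed

text \<open>Jensen's inequality turns near-maximality in the strength of a perturbation into an
  exponential moment bound, hence into concentration of the perturbing field.\<close>

lemma field_variance:
  assumes J: "finite J" and P: "0 < P"
    and near: "\<And>h. tw J (\<lambda>j s. a j s + h * d j s) [] \<le> tw J a [] * exp (m * \<gamma> * h + P * h\<^sup>2 + 1)"
  shows "(\<Sum>t\<in>S. \<integral>g. wt (field J a g) [t] * (field J d g t - \<gamma>)\<^sup>2 \<partial>gauss) \<le> 16 * P / m\<^sup>2 * tw J a []"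
proof -
  \<comment> \<open>The step at which the quadratic error equals 1, so that both exponential moments
    are at most \<open>exp 2\<close>.\<close>
  define h where "h = 1 / sqrt P"
  have h: "P * h\<^sup>2 = 1" using P by (simp add: h_def power_divide)
  let ?Y = "\<lambda>g t. field J d g t - \<gamma>"
  have fs: "field J (\<lambda>j s. a j s + k * d j s) g = (\<lambda>s. field J a g s + k * field J d g s)" for k g
    by (simp add: field_def ring_distribs sum.distrib sum_distrib_left mult_ac fun_eq_iff)
  have one: "(\<Sum>t\<in>S. wt (field J a g) [t] * exp (m * k * ?Y g t)) \<le> exp (- m * \<gamma> * k) * wt (field J (\<lambda>j s. a j s + k * d j s) g) []"
    for g k
  proof -
    have "(\<Sum>t\<in>S. wt (field J a g) [t] * exp (m * k * ?Y g t))
        = exp (- m * \<gamma> * k) * (\<Sum>t\<in>S. wt (field J a g) [t] * exp (m * (k * field J d g t)))"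
      unfolding sum_distrib_left
    proof (intro sum.cong refl)
      fix t
      have "exp (m * k * ?Y g t) = exp (- m * \<gamma> * k) * exp (m * (k * field J d g t))"
        unfolding mult_exp_exp by (rule arg_cong[where f=exp]) (simp add: algebra_simps)
      then show "wt (field J a g) [t] * exp (m * k * ?Y g t)
          = exp (- m * \<gamma> * k) * (wt (field J a g) [t] * exp (m * (k * field J d g t)))"
        by simp
    qed
    also have "\<dots> \<le> exp (- m * \<gamma> * k) * wt (field J (\<lambda>j s. a j s + k * d j s) g) []"
      unfolding fs by (intro mult_left_mono wt_shift_ge) auto
    finally show ?thesis .
  qed
  let ?s = "\<lambda>k g. exp (- m * \<gamma> * k) * wt (field J (\<lambda>j s. a j s + k * d j s) g) []"
  have pt: "2 * wt (field J a g) [] + (m * h)\<^sup>2 * (\<Sum>t\<in>S. wt (field J a g) [t] * (?Y g t)\<^sup>2) \<le> ?s h g + ?s (- h) g" for g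
  proof -
    have "2 * wt (field J a g) [] + (m * h)\<^sup>2 * (\<Sum>t\<in>S. wt (field J a g) [t] * (?Y g t)\<^sup>2)
        = (\<Sum>t\<in>S. wt (field J a g) [t] * (2 + (m * h * ?Y g t)\<^sup>2))"
    proof -
      have "(\<Sum>t\<in>S. W t * (2 + (c * y t)\<^sup>2)) = 2 * (\<Sum>t\<in>S. W t) + c\<^sup>2 * (\<Sum>t\<in>S. W t * (y t)\<^sup>2)"
        for W y :: "'s \<Rightarrow> real" and c
        by (simp add: distrib_left sum.distrib sum_distrib_left sum_distrib_right power_mult_distrib mult_ac)
      from this[of "\<lambda>t. wt (field J a g) [t]" "m * h" "?Y g"] show ?thesis
        using sum_wt_Cons[of "field J a g" "[]"] by (simp only:)
    qed
    also have "\<dots> \<le> (\<Sum>t\<in>S. wt (field J a g) [t] * (exp (m * h * ?Y g t) + exp (- (m * h * ?Y g t))))"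
      by (intro sum_mono mult_left_mono exp_plus_exp_minus_ge wt_nonneg) auto
    also have "\<dots> = (\<Sum>t\<in>S. wt (field J a g) [t] * exp (m * h * ?Y g t)) + (\<Sum>t\<in>S. wt (field J a g) [t] * exp (m * (- h) * ?Y g t))"
      by (simp add: ring_distribs sum.distrib)
    also have "\<dots> \<le> ?s h g + ?s (- h) g" by (intro add_mono one)
    finally show ?thesis .
  qed
  have tY: "tame (\<lambda>g. wt (field J a g) [t] * (?Y g t)\<^sup>2)" if "t \<in> S" for t
    by (rule tame_wt_field) (use that in auto)
  have "2 * tw J a [] + (m * h)\<^sup>2 * (\<Sum>t\<in>S. \<integral>g. wt (field J a g) [t] * (?Y g t)\<^sup>2 \<partial>gauss)
      = (\<integral>g. 2 * wt (field J a g) [] + (m * h)\<^sup>2 * (\<Sum>t\<in>S. wt (field J a g) [t] * (?Y g t)\<^sup>2) \<partial>gauss)"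
    by (subst Bochner_Integration.integral_add)
       (auto intro!: integrable_tame tame_mult tame_sum tY simp: tw_def Bochner_Integration.integral_sum[OF integrable_tame[OF tY]])
  also have "\<dots> \<le> (\<integral>g. ?s h g + ?s (- h) g \<partial>gauss)"
    by (intro integral_mono integrable_tame tame_add tame_mult tame_const tame_sum tY tame_wt pt) auto
  also have "\<dots> = exp (- m * \<gamma> * h) * tw J (\<lambda>j s. a j s + h * d j s) [] + exp (- m * \<gamma> * (- h)) * tw J (\<lambda>j s. a j s + (- h) * d j s) []"
    unfolding tw_def
    by (subst Bochner_Integration.integral_add) (auto intro!: integrable_tame tame_mult tame_wt)
  also have "\<dots> \<le> exp (- m * \<gamma> * h) * (tw J a [] * exp (m * \<gamma> * h + P * h\<^sup>2 + 1))
      + exp (- m * \<gamma> * (- h)) * (tw J a [] * exp (m * \<gamma> * (- h) + P * (- h)\<^sup>2 + 1))"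
    by (intro add_mono mult_left_mono near) auto
  also have "\<dots> = 2 * exp 2 * tw J a []"
  proof -
    have "exp (- m * \<gamma> * k) * (T * exp (m * \<gamma> * k + P * k\<^sup>2 + 1)) = exp 2 * T" if "P * k\<^sup>2 = 1" for k T
    proof -
      have "exp (- m * \<gamma> * k) * exp (m * \<gamma> * k + P * k\<^sup>2 + 1) = exp 2"
        unfolding mult_exp_exp by (rule arg_cong[where f=exp]) (simp add: that)
      then show ?thesis by (metis mult.assoc mult.commute)
    qed
    note e = this
    have h': "P * (- h)\<^sup>2 = 1" using h by simp
    show ?thesis unfolding e[OF h] e[OF h'] by simp
  qed
  \<comment> \<open>\<open>exp 1 \<le> 3\<close> gives 18; two of these cancel with the constant
    term on the left, which leaves the 16 of the statement.\<close>
  also have "\<dots> \<le> 18 * tw J a []"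
  proof -
    have "exp 2 = exp 1 * exp (1::real)" by (simp add: mult_exp_exp)
    also have "\<dots> \<le> 3 * 3" by (intro mult_mono exp_le) auto
    finally show ?thesis using tw_Nil_pos[of J a] by simp
  qed
  finally have "(m * h)\<^sup>2 * (\<Sum>t\<in>S. \<integral>g. wt (field J a g) [t] * (?Y g t)\<^sup>2 \<partial>gauss) \<le> 16 * tw J a []" by simp
  moreover have "(m * h)\<^sup>2 = m\<^sup>2 / P" using P by (simp add: h_def power_mult_distrib power_divide)
  moreover have "X \<le> 16 * P / m\<^sup>2 * T" if "m\<^sup>2 / P * X \<le> 16 * T" for X T
    using that P m_pos by (simp add: field_simps)
  ultimately show ?thesis by (simp only:)
qed

text \<open>Cauchy-Schwarz in the additive form
  \<open>\<bar>y\<bar> \<le> y\<^sup>2 / (2 * r) + r / 2\<close>, where \<open>r\<close> is the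
  square root of the variance bound in \<open>field_variance\<close>.\<close>

lemma field_deviation:
  assumes J: "finite J" and P: "0 < P"
    and near: "\<And>h. tw J (\<lambda>j s. a j s + h * d j s) [] \<le> tw J a [] * exp (m * \<gamma> * h + P * h\<^sup>2 + 1)"
    and l: "l < n" and f: "\<And>xs. xs \<in> words S n \<Longrightarrow> \<bar>f xs\<bar> \<le> 1"
  shows "\<bar>\<Sum>xs\<in>words S n. f xs * (\<integral>g. wt (field J a g) xs * (field J d g (xs ! l) - \<gamma>) \<partial>gauss)\<bar>
    \<le> 4 * sqrt P / m * tw J a []"
proof -
  define r where "r = 4 * sqrt P / m"
  have r: "0 < r" "r\<^sup>2 = 16 * P / m\<^sup>2" using P m_pos by (auto simp: r_def power_divide power_mult_distrib)
  let ?Y = "\<lambda>g t. field J d g t - \<gamma>"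
  have W: "set xs \<subseteq> S" if "xs \<in> words S n" for xs using that by (simp add: words_def)
  have t1: "tame (\<lambda>g. wt (field J a g) xs * ?Y g y)" if "set xs \<subseteq> S" for xs y
    using tame_wt_field[OF that, of J a d y \<gamma> 1] by simp
  have tY: "tame (\<lambda>g. wt (field J a g) [t] * (?Y g t)\<^sup>2)" if "t \<in> S" for t
    by (rule tame_wt_field) (use that in auto)
  have pt: "\<bar>\<Sum>xs\<in>words S n. f xs * (wt (field J a g) xs * ?Y g (xs ! l))\<bar>
      \<le> (\<Sum>t\<in>S. wt (field J a g) [t] * (?Y g t)\<^sup>2) / (2 * r) + r / 2 * wt (field J a g) []" for g
  proof -
    have "\<bar>\<Sum>xs\<in>words S n. f xs * (wt (field J a g) xs * ?Y g (xs ! l))\<bar> \<le> (\<Sum>xs\<in>words S n. wt (field J a g) xs * \<bar>?Y g (xs ! l)\<bar>)"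
    proof (rule order.trans[OF sum_abs], rule sum_mono)
      fix xs assume xs: "xs \<in> words S n"
      have "\<bar>f xs\<bar> * (wt (field J a g) xs * \<bar>?Y g (xs ! l)\<bar>) \<le> 1 * (wt (field J a g) xs * \<bar>?Y g (xs ! l)\<bar>)"
        using f[OF xs] wt_nonneg[OF W[OF xs], of "field J a g"] by (intro mult_right_mono) auto
      then show "\<bar>f xs * (wt (field J a g) xs * ?Y g (xs ! l))\<bar> \<le> wt (field J a g) xs * \<bar>?Y g (xs ! l)\<bar>"
        using wt_nonneg[OF W[OF xs], of "field J a g"] by (simp add: abs_mult)
    qed
    also have "\<dots> = (\<Sum>t\<in>S. wt (field J a g) [t] * \<bar>?Y g t\<bar>)" by (rule sum_wt_nth[OF l])
    also have "\<dots> \<le> (\<Sum>t\<in>S. wt (field J a g) [t] * ((?Y g t)\<^sup>2 / (2 * r) + r / 2))"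
    proof (intro sum_mono mult_left_mono wt_nonneg)
      fix t
      have "\<bar>y\<bar> \<le> y\<^sup>2 / (2 * r) + r / 2" for y
      proof -
        have "0 \<le> (\<bar>y\<bar> - r)\<^sup>2" by simp
        then have "2 * r * \<bar>y\<bar> \<le> y\<^sup>2 + r\<^sup>2" by (simp add: power2_diff mult_ac)
        then show ?thesis using r(1) by (simp add: field_simps power2_eq_square)
      qed
      then show "\<bar>?Y g t\<bar> \<le> (?Y g t)\<^sup>2 / (2 * r) + r / 2" .
    qed auto
    also have "\<dots> = (\<Sum>t\<in>S. wt (field J a g) [t] * (?Y g t)\<^sup>2) / (2 * r) + r / 2 * wt (field J a g) []"
      by (subst sum_wt_Cons[of _ "[]", symmetric])
         (simp add: distrib_left sum.distrib sum_distrib_left sum_divide_distrib mult_ac)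
    finally show ?thesis .
  qed
  have "(\<Sum>xs\<in>words S n. f xs * (\<integral>g. wt (field J a g) xs * ?Y g (xs ! l) \<partial>gauss))
      = (\<integral>g. (\<Sum>xs\<in>words S n. f xs * (wt (field J a g) xs * ?Y g (xs ! l))) \<partial>gauss)"
    by (subst Bochner_Integration.integral_sum) (auto intro!: integrable_tame tame_mult t1 W)
  also have "\<bar>\<dots>\<bar> \<le> (\<integral>g. \<bar>\<Sum>xs\<in>words S n. f xs * (wt (field J a g) xs * ?Y g (xs ! l))\<bar> \<partial>gauss)"
    by (rule integral_abs_bound)
  also have "\<dots> \<le> (\<integral>g. 1 / (2 * r) * (\<Sum>t\<in>S. wt (field J a g) [t] * (?Y g t)\<^sup>2) + r / 2 * wt (field J a g) [] \<partial>gauss)"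
  proof (rule integral_mono)
    have "tame (\<lambda>g. \<Sum>xs\<in>words S n. f xs * (wt (field J a g) xs * ?Y g (xs ! l)))"
      by (intro tame_sum tame_mult[OF tame_const] t1 W)
    then show "integrable gauss (\<lambda>g. \<bar>\<Sum>xs\<in>words S n. f xs * (wt (field J a g) xs * ?Y g (xs ! l))\<bar>)"
      by (intro integrable_tame tame_abs)
    have "tame (\<lambda>g. wt (field J a g) [])" by (rule tame_wt) simp
    then show "integrable gauss (\<lambda>g. 1 / (2 * r) * (\<Sum>t\<in>S. wt (field J a g) [t] * (?Y g t)\<^sup>2) + r / 2 * wt (field J a g) [])"
      by (intro integrable_tame tame_add tame_mult[OF tame_const] tame_sum tY)
    show "\<bar>\<Sum>xs\<in>words S n. f xs * (wt (field J a g) xs * ?Y g (xs ! l))\<bar>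
        \<le> 1 / (2 * r) * (\<Sum>t\<in>S. wt (field J a g) [t] * (?Y g t)\<^sup>2) + r / 2 * wt (field J a g) []" for g
      using pt[of g] by simp
  qed
  also have "\<dots> = 1 / (2 * r) * (\<Sum>t\<in>S. \<integral>g. wt (field J a g) [t] * (?Y g t)\<^sup>2 \<partial>gauss) + r / 2 * tw J a []"
  proof -
    have t0: "tame (\<lambda>g. wt (field J a g) [])" by (rule tame_wt) simp
    have i1: "integrable gauss (\<lambda>g. 1 / (2 * r) * (\<Sum>t\<in>S. wt (field J a g) [t] * (?Y g t)\<^sup>2))"
      by (intro integrable_tame tame_mult[OF tame_const] tame_sum tY)
    have i2: "integrable gauss (\<lambda>g. r / 2 * wt (field J a g) [])"
      by (intro integrable_tame tame_mult[OF tame_const] t0)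
    show ?thesis
      unfolding Bochner_Integration.integral_add[OF i1 i2] integral_mult_right_zero tw_def
      by (subst Bochner_Integration.integral_sum) (auto intro: integrable_tame[OF tY])
  qed
  also have "\<dots> \<le> 1 / (2 * r) * (r\<^sup>2 * tw J a []) + r / 2 * tw J a []"
    using field_variance[OF J P near] r by (intro add_right_mono mult_left_mono) auto
  also have "\<dots> = r * tw J a []" using r(1) by (simp add: power2_eq_square)
  finally show ?thesis by (simp add: r_def)
qed

text \<open>Integration by parts turns the correlation of \<open>f\<close> with the centred field
  into overlap averages that contain the unknown centre \<open>\<gamma>\<close>. One replica with
  \<open>f = 1\<close> determines \<open>\<gamma>\<close> up to the same error; eliminating it gives
  the identity and doubles the constant 4 to 8.\<close>

lemma tilted_gg:
  assumes J: "finite J" and P: "0 < P"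
    and near: "\<And>h. tw J (\<lambda>j s. a j s + h * d j s) [] \<le> tw J a [] * exp (m * \<gamma> * h + P * h\<^sup>2 + 1)"
    and X: "0 < X" and C: "\<And>s t. s \<in> S \<Longrightarrow> t \<in> S \<Longrightarrow> cov J d a s t = X * C s t" "\<And>s. s \<in> S \<Longrightarrow> C s s = 1"
  shows "gg S (\<lambda>xs. tw J a xs / tw J a []) m C (8 * sqrt P / (m * X))"
proof -
  let ?Q = "\<lambda>xs. tw J a xs / tw J a []"
  have T: "0 < tw J a []" by (rule tw_Nil_pos)
  \<comment> \<open>The correlation of \<open>f\<close> with the centred field at replica
    \<open>l\<close>, already integrated by parts and normalised.\<close>
  define I where "I n l f = X * avg S ?Q n (\<lambda>xs. f xs * (\<Sum>x\<leftarrow>xs. C (xs ! l) x))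
      - X * ((real n - m) * avg S ?Q (Suc n) (\<lambda>ys. f (tl ys) * C (tl ys ! l) (hd ys))) - \<gamma> * avg S ?Q n f" for n l f
  have bound: "\<bar>I n l f\<bar> \<le> 4 * sqrt P / m" if l: "l < n" and f: "\<And>xs. xs \<in> words S n \<Longrightarrow> \<bar>f xs\<bar> \<le> 1" for n l f
  proof -
    have S: "set xs \<subseteq> S \<and> length xs = n \<and> xs ! l \<in> S" if "xs \<in> words S n" for xs
      using that l by (auto simp: words_def subset_iff)
    have "(\<integral>g. wt (field J a g) xs * (field J d g (xs ! l) - \<gamma>) \<partial>gauss)
        = X * ((\<Sum>x\<leftarrow>xs. C (xs ! l) x) * tw J a xs) - X * ((real n - m) * (\<Sum>t\<in>S. C (xs ! l) t * tw J a (t # xs))) - \<gamma> * tw J a xs"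
      if xs: "xs \<in> words S n" for xs
    proof -
      have "(\<integral>g. wt (field J a g) xs * (field J d g (xs ! l) - \<gamma>) \<partial>gauss)
          = (\<integral>g. wt (field J a g) xs * field J d g (xs ! l) \<partial>gauss) - (\<integral>g. wt (field J a g) xs * \<gamma> \<partial>gauss)"
        unfolding right_diff_distrib
        by (rule Bochner_Integration.integral_diff)
           (use S[OF xs] in \<open>auto intro!: integrable_tame tame_mult tame_wt tame_field tame_const\<close>)
      also have "(\<integral>g. wt (field J a g) xs * \<gamma> \<partial>gauss) = \<gamma> * tw J a xs" by (simp add: tw_def)
      also have "(\<integral>g. wt (field J a g) xs * field J d g (xs ! l) \<partial>gauss)
          = (\<Sum>x\<leftarrow>xs. cov J d a (xs ! l) x) * tw J a xs - (real n - m) * (\<Sum>t\<in>S. cov J d a (xs ! l) t * tw J a (t # xs))"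
        using field_ibp[OF J, of xs a d "xs ! l"] S[OF xs] by simp
      also have "(\<Sum>x\<leftarrow>xs. cov J d a (xs ! l) x) = (\<Sum>x\<leftarrow>xs. X * C (xs ! l) x)"
        using S[OF xs] C(1) by (intro arg_cong[where f=sum_list] map_cong) auto
      also have "(\<Sum>t\<in>S. cov J d a (xs ! l) t * tw J a (t # xs)) = X * (\<Sum>t\<in>S. C (xs ! l) t * tw J a (t # xs))"
        using S[OF xs] C(1) by (auto simp: sum_distrib_left mult.assoc intro!: sum.cong)
      finally show ?thesis by (simp add: sum_list_const_mult mult_ac)
    qed
    then have "(\<Sum>xs\<in>words S n. f xs * (\<integral>g. wt (field J a g) xs * (field J d g (xs ! l) - \<gamma>) \<partial>gauss))
        = (\<Sum>xs\<in>words S n. f xs * (X * ((\<Sum>x\<leftarrow>xs. C (xs ! l) x) * tw J a xs)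
           - X * ((real n - m) * (\<Sum>t\<in>S. C (xs ! l) t * tw J a (t # xs))) - \<gamma> * tw J a xs))"
      by (intro sum.cong) auto
    also have "\<dots> = tw J a [] * I n l f"
      unfolding I_def avg_def sum_words_Suc[OF finite_S] using T
      by (simp add: right_diff_distrib sum_subtractf sum_distrib_left mult_ac)
    finally have eq: "(\<Sum>xs\<in>words S n. f xs * (\<integral>g. wt (field J a g) xs * (field J d g (xs ! l) - \<gamma>) \<partial>gauss)) = tw J a [] * I n l f" .
    have "\<bar>\<Sum>xs\<in>words S n. f xs * (\<integral>g. wt (field J a g) xs * (field J d g (xs ! l) - \<gamma>) \<partial>gauss)\<bar>
        \<le> 4 * sqrt P / m * tw J a []"
      by (rule field_deviation[OF J P near l f])
    then have "tw J a [] * \<bar>I n l f\<bar> \<le> 4 * sqrt P / m * tw J a []"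
      by (simp only: eq abs_mult abs_of_pos[OF T])
    then have "tw J a [] * \<bar>I n l f\<bar> \<le> tw J a [] * (4 * sqrt P / m)" by (simp only: mult.commute)
    then show ?thesis using T by (simp only: mult_le_cancel_left_pos)
  qed
  have "\<bar>gg_defect S ?Q m C n l f\<bar> \<le> 8 * sqrt P / (m * X)"
    if l: "l < n" and f: "\<forall>xs\<in>words S n. \<bar>f xs\<bar> \<le> 1" for n l f
  proof -
    have af: "\<bar>avg S ?Q n f\<bar> \<le> 1"
    proof -
      have "avg S ?Q n f \<le> avg S ?Q n (\<lambda>_. 1)" by (rule avg_mono[OF replica_tw]) (use f in force)
      moreover have "avg S ?Q n (\<lambda>_. - 1) \<le> avg S ?Q n f" by (rule avg_mono[OF replica_tw]) (use f in force)
      ultimately show ?thesis by (simp add: avg_const[OF replica_tw] abs_le_iff)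
    qed
    have e1: "avg S ?Q 1 (\<lambda>xs. 1 * (\<Sum>x\<leftarrow>xs. C (xs ! 0) x)) = avg S ?Q 1 (\<lambda>_. 1)"
      by (rule avg_cong) (auto simp: words_def length_Suc_conv C(2))
    have e2: "avg S ?Q (Suc 1) (\<lambda>ys. 1 * C (tl ys ! 0) (hd ys)) = avg S ?Q 2 (\<lambda>ys. C (ys ! 1) (ys ! 0))"
      unfolding numeral_2_eq_2 One_nat_def by (rule avg_cong) (auto simp: words_def length_Suc_conv)
    have I1: "I 1 0 (\<lambda>_. 1) = X - X * ((1 - m) * avg S ?Q 2 (\<lambda>ys. C (ys ! 1) (ys ! 0))) - \<gamma>"
      unfolding I_def e1 e2 by (simp add: avg_const[OF replica_tw])
    have e3: "avg S ?Q n (\<lambda>xs. f xs * ((\<Sum>x\<leftarrow>xs. C (xs ! l) x) - 1)) = avg S ?Q n (\<lambda>xs. f xs * (\<Sum>x\<leftarrow>xs. C (xs ! l) x)) - avg S ?Q n f"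
      unfolding right_diff_distrib by (simp add: avg_diff)
    \<comment> \<open>Here \<open>\<gamma>\<close> cancels between the general case and the
      one-replica case.\<close>
    have "X * gg_defect S ?Q m C n l f = avg S ?Q n f * I 1 0 (\<lambda>_. 1) - I n l f"
      unfolding gg_defect_def I1 e3 by (simp add: I_def algebra_simps)
    then have "X * \<bar>gg_defect S ?Q m C n l f\<bar> = \<bar>avg S ?Q n f * I 1 0 (\<lambda>_. 1) - I n l f\<bar>"
      using X by (metis abs_mult abs_of_pos)
    also have "\<dots> \<le> \<bar>avg S ?Q n f * I 1 0 (\<lambda>_. 1)\<bar> + \<bar>I n l f\<bar>" by (rule abs_triangle_ineq4)
    also have "\<dots> \<le> 1 * (4 * sqrt P / m) + 4 * sqrt P / m"
    proof (intro add_mono)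
      have b1: "\<bar>I 1 0 (\<lambda>_. 1)\<bar> \<le> 4 * sqrt P / m" by (rule bound) auto
      show "\<bar>avg S ?Q n f * I 1 0 (\<lambda>_. 1)\<bar> \<le> 1 * (4 * sqrt P / m)"
        unfolding abs_mult by (intro mult_mono af b1) auto
      show "\<bar>I n l f\<bar> \<le> 4 * sqrt P / m" by (rule bound[OF l]) (use f in blast)
    qed
    finally show ?thesis using X m_pos by (simp add: field_simps)
  qed
  then show ?thesis unfolding gg_def by blast
qed

end

section \<open>Averages of one and two replicas, bilinearity of the covariance\<close>

lemma avg_1: "finite S \<Longrightarrow> avg S Q 1 f = (\<Sum>t\<in>S. f [t] * Q [t])"
  unfolding avg_def One_nat_def by (simp add: sum_words_Suc)

lemma avg_2: "finite S \<Longrightarrow> avg S Q 2 f = (\<Sum>t\<in>S. \<Sum>u\<in>S. f [u, t] * Q [u, t])"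
  unfolding avg_def numeral_2_eq_2 by (simp add: sum_words_Suc)

lemma cov_sym: "cov J a b s t = cov J b a t s"
  by (simp add: cov_def mult.commute)

lemma cov_add_right: "cov J a (\<lambda>j s. b j s + c j s) s t = cov J a b s t + cov J a c s t"
  by (simp add: cov_def ring_distribs sum.distrib)

lemma cov_mult_right: "cov J a (\<lambda>j s. x * b j s) s t = x * cov J a b s t"
  by (simp add: cov_def sum_distrib_left mult_ac)

lemma cov_sum_right: "cov J a (\<lambda>j s. \<Sum>q\<in>I. b q j s) s t = (\<Sum>q\<in>I. cov J a (b q) s t)"
  unfolding cov_def sum_distrib_left by (rule sum.swap)

lemma cov_add_left: "cov J (\<lambda>j s. b j s + c j s) a s t = cov J b a s t + cov J c a s t"
  by (simp add: cov_def ring_distribs sum.distrib)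

lemma cov_mult_left: "cov J (\<lambda>j s. x * b j s) a s t = x * cov J b a s t"
  by (simp add: cov_def sum_distrib_left mult_ac)

text \<open>For nonnegative \<open>y\<close> the logarithmic derivative of \<open>T\<close> lies
  between 0 and \<open>2 * c * y\<close>; negative \<open>y\<close> is reached by
  reflection.\<close>

lemma log_growth_bound:
  fixes T \<kappa> :: "real \<Rightarrow> real"
  assumes d: "\<And>y. (T has_field_derivative c * y * \<kappa> y * T y) (at y)" and T: "\<And>y. 0 < T y"
    and \<kappa>: "\<And>y. 0 \<le> \<kappa> y \<and> \<kappa> y \<le> 2" and c: "0 \<le> c"
  shows "ln (T 0) \<le> ln (T y) \<and> ln (T y) \<le> ln (T 0) + c * y\<^sup>2"
proof -
  have *: "ln (U 0) \<le> ln (U y) \<and> ln (U y) \<le> ln (U 0) + c * y\<^sup>2"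
    if U: "\<And>y. (U has_field_derivative c * y * k y * U y) (at y)" "\<And>y. 0 < U y" "\<And>y. 0 \<le> k y \<and> k y \<le> 2"
      and y: "0 \<le> y" for U k :: "real \<Rightarrow> real" and y
  proof -
    have dl: "((\<lambda>y. ln (U y)) has_field_derivative c * y * k y) (at y)" for y
      by (rule DERIV_cong[OF DERIV_chain2[OF DERIV_ln[OF U(2)] U(1)]])
         (use U(2)[of y] in \<open>simp add: field_simps\<close>)
    have "ln (U 0) \<le> ln (U y)"
      by (rule DERIV_nonneg_imp_nondecreasing[OF y]) (use dl U(3) c in \<open>auto intro!: exI mult_nonneg_nonneg\<close>)
    moreover have "c * 0\<^sup>2 - ln (U 0) \<le> c * y\<^sup>2 - ln (U y)"
    proof (rule DERIV_nonneg_imp_nondecreasing[OF y])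
      fix x :: real assume x: "0 \<le> x"
      have "((\<lambda>y. c * y\<^sup>2 - ln (U y)) has_field_derivative c * (2 * x) - c * x * k x) (at x)"
        by (rule DERIV_cong[OF DERIV_diff[OF DERIV_cmult[OF DERIV_pow[of 2]] dl]]) simp
      moreover have "c * x * k x \<le> c * x * 2" using U(3) c x by (intro mult_left_mono) auto
      ultimately show "\<exists>y. ((\<lambda>y. c * y\<^sup>2 - ln (U y)) has_field_derivative y) (at x) \<and> 0 \<le> y"
        by (intro exI[of _ "c * (2 * x) - c * x * k x"]) auto
    qed
    ultimately show ?thesis by simp
  qed
  show ?thesis
  proof (cases "0 \<le> y")
    case True
    then show ?thesis using *[OF d T \<kappa>] by blast
  next
    case False
    have d': "((\<lambda>y. T (- y)) has_field_derivative c * y * \<kappa> (- y) * T (- y)) (at y)" for y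
      using DERIV_chain2[OF d[of "- y"] DERIV_minus[OF DERIV_ident]] by simp
    show ?thesis using *[OF d', of "- y"] T \<kappa> False by simp
  qed
qed

text \<open>The perturbations force the tilted Ghirlanda--Guerra identities at any approximate maximiser
  of the penalised free energy; taking the supremum over their strengths \<open>x\<close> replaces
  averaging over them.\<close>

locale interpolation = gibbs S w m
  for S :: "'s set" and w :: "'s \<Rightarrow> real" and m :: real +
  fixes J :: "'k set" and b c :: "'k \<Rightarrow> 's \<Rightarrow> real" and Bs :: "'b set" and R :: "'b \<Rightarrow> 's \<Rightarrow> 's \<Rightarrow> real"
    and d :: "'b \<times> nat \<Rightarrow> 'k \<Rightarrow> 's \<Rightarrow> real" and K :: nat and y \<eta> \<epsilon> p :: real
    and L :: "'b \<Rightarrow> real" and d0 e :: real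
  assumes J: "finite J" and Bs: "finite Bs"
    and R: "\<And>\<beta>. \<beta> \<in> Bs \<Longrightarrow> overlap_kernel S (R \<beta>)"
    and bc: "\<And>s t. s \<in> S \<Longrightarrow> t \<in> S \<Longrightarrow> cov J b c s t = 0"
    and db: "\<And>q s t. q \<in> Bs \<times> {1..K} \<Longrightarrow> s \<in> S \<Longrightarrow> t \<in> S \<Longrightarrow> cov J (d q) b s t = 0"
    and dc: "\<And>q s t. q \<in> Bs \<times> {1..K} \<Longrightarrow> s \<in> S \<Longrightarrow> t \<in> S \<Longrightarrow> cov J (d q) c s t = 0"
    and dd: "\<And>q q' s t. q \<in> Bs \<times> {1..K} \<Longrightarrow> q' \<in> Bs \<times> {1..K} \<Longrightarrow> s \<in> S \<Longrightarrow> t \<in> S \<Longrightarrow>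
      cov J (d q) (d q') s t = (if q = q' then y / m * R (fst q) s t ^ snd q else 0)"
    \<comment> \<open>The bound 4 keeps near-maximisers at strength at least one half; the second
      bound makes the resulting identity error, \<open>sqrt (512 / y)\<close>, at most
      \<open>\<eta>\<close>.\<close>
    and y: "4 \<le> y" "512 / \<eta>\<^sup>2 \<le> y" and \<eta>: "0 < \<eta>" and \<epsilon>: "0 \<le> \<epsilon>" and p: "0 \<le> p"
    and pos: "\<And>Q R. replica S Q \<Longrightarrow> overlap_kernel S R \<Longrightarrow> (\<And>k. k \<in> {1..K} \<Longrightarrow> gg S Q m (\<lambda>s t. R s t ^ k) \<eta>)
      \<Longrightarrow> avg S Q 2 (low R \<epsilon>) \<le> p"
    and L: "\<And>\<beta>. \<beta> \<in> Bs \<Longrightarrow> 0 \<le> L \<beta>"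
    and diag: "\<And>s. s \<in> S \<Longrightarrow> cov J c c s s - cov J b b s s \<le> d0"
    and off: "\<And>s t. s \<in> S \<Longrightarrow> t \<in> S \<Longrightarrow>
      - e - (\<Sum>\<beta>\<in>Bs. L \<beta> * max 0 (- R \<beta> s t)) \<le> cov J c c s t - cov J b b s t"
begin

section \<open>Penalised free energy along the path\<close>

definition Qs :: "('b \<times> nat) set" where "Qs = Bs \<times> {1..K}"

text \<open>A circular path between the uncorrelated fields \<open>b\<close> and \<open>c\<close>:
  unlike square-root weights it is smooth up to the endpoints, and the squares of the weights still
  sum to one. The perturbations stay fixed along it.\<close>

definition co :: "real \<Rightarrow> ('b \<times> nat \<Rightarrow> real) \<Rightarrow> 'k \<Rightarrow> 's \<Rightarrow> real" where
  "co \<theta> x j s = cos \<theta> * b j s + sin \<theta> * c j s + (\<Sum>q\<in>Qs. x q * d q j s)"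

definition fe :: "real \<Rightarrow> ('b \<times> nat \<Rightarrow> real) \<Rightarrow> real" where
  "fe \<theta> x = ln (tw J (co \<theta> x) [])"

text \<open>Centred at strength 1 and twice as steep as the growth \<open>y * (x q)\<^sup>2\<close>
  of \<open>fe\<close>, so the supremum is finite and near-maximisers keep away from strength
  0.\<close>

definition pen :: "('b \<times> nat \<Rightarrow> real) \<Rightarrow> real" where
  "pen x = 2 * y * (\<Sum>q\<in>Qs. (x q - 1)\<^sup>2)"

definition sfe :: "real \<Rightarrow> real" where
  "sfe \<theta> = (SUP x. fe \<theta> x - pen x)"

abbreviation qw :: "real \<Rightarrow> ('b \<times> nat \<Rightarrow> real) \<Rightarrow> 's list \<Rightarrow> real" where
  "qw \<theta> x xs \<equiv> tw J (co \<theta> x) xs / tw J (co \<theta> x) []"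

lemma finite_Qs: "finite Qs"
  unfolding Qs_def using Bs by simp

lemma y_pos: "0 < y" using y by simp

lemma cov_d_co:
  assumes "q \<in> Qs" "s \<in> S" "t \<in> S"
  shows "cov J (d q) (co \<theta> x) s t = x q * (y / m) * R (fst q) s t ^ snd q"
proof -
  have "cov J (d q) (co \<theta> x) s t = cos \<theta> * cov J (d q) b s t + sin \<theta> * cov J (d q) c s t + (\<Sum>q'\<in>Qs. x q' * cov J (d q) (d q') s t)"
    unfolding co_def[abs_def] by (simp only: cov_add_right cov_mult_right cov_sum_right)
  also have "(\<Sum>q'\<in>Qs. x q' * cov J (d q) (d q') s t) = (\<Sum>q'\<in>Qs. if q' = q then x q * (y / m) * R (fst q) s t ^ snd q else 0)"
    using assms dd unfolding Qs_def by (intro sum.cong refl) auto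
  also have "\<dots> = x q * (y / m) * R (fst q) s t ^ snd q" using assms(1) finite_Qs by simp
  finally show ?thesis using assms db dc unfolding Qs_def by simp
qed

lemma co_upd:
  assumes "q \<in> Qs"
  shows "co \<theta> (x(q := z)) j s = co \<theta> x j s + (z - x q) * d q j s"
proof -
  have "(\<Sum>q'\<in>Qs. (x(q := z)) q' * d q' j s) = z * d q j s + (\<Sum>q'\<in>Qs - {q}. x q' * d q' j s)"
    using assms finite_Qs by (subst sum.remove[of _ q]) auto
  moreover have "(\<Sum>q'\<in>Qs. x q' * d q' j s) = x q * d q j s + (\<Sum>q'\<in>Qs - {q}. x q' * d q' j s)"
    using assms finite_Qs by (subst sum.remove[of _ q]) auto
  ultimately show ?thesis by (simp add: co_def algebra_simps)
qed

lemma tw_pos: "0 < tw J (co \<theta> x) []"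
  by (rule tw_Nil_pos)

lemma tw_avg_1: "(\<Sum>t\<in>S. F t * tw J (co \<theta> x) [t]) = tw J (co \<theta> x) [] * avg S (qw \<theta> x) 1 (\<lambda>xs. F (xs ! 0))"
  unfolding avg_1[OF finite_S] using tw_pos[of \<theta> x] by (simp add: sum_distrib_left)

lemma tw_avg_2: "(\<Sum>t\<in>S. \<Sum>u\<in>S. F t u * tw J (co \<theta> x) [u, t])
    = tw J (co \<theta> x) [] * avg S (qw \<theta> x) 2 (\<lambda>ys. F (ys ! 1) (ys ! 0))"
  using tw_pos[of \<theta> x] by (simp add: avg_2[OF finite_S] sum_distrib_left)

lemma rep: "replica S (qw \<theta> x)" by (rule replica_tw)

lemma avg_abs_le:
  assumes "\<And>xs. xs \<in> words S n \<Longrightarrow> \<bar>f xs\<bar> \<le> B"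
  shows "\<bar>avg S (qw \<theta> x) n f\<bar> \<le> B"
proof -
  have "avg S (qw \<theta> x) n f \<le> avg S (qw \<theta> x) n (\<lambda>_. B)" by (rule avg_mono[OF rep]) (use assms in force)
  moreover have "avg S (qw \<theta> x) n (\<lambda>_. - B) \<le> avg S (qw \<theta> x) n f" by (rule avg_mono[OF rep]) (use assms in force)
  ultimately show ?thesis by (simp add: avg_const[OF rep] abs_le_iff)
qed

lemma bounded_coeffs: "\<exists>A. \<forall>j\<in>J. \<forall>s\<in>S. \<bar>F j s :: real\<bar> \<le> A"
proof -
  have "\<bar>F j s\<bar> \<le> (\<Sum>j\<in>J. \<Sum>s\<in>S. \<bar>F j s\<bar>)" if "j \<in> J" "s \<in> S" for j s
  proof -
    have "\<bar>F j s\<bar> \<le> (\<Sum>s\<in>S. \<bar>F j s\<bar>)" by (rule member_le_sum) (use that finite_S in auto)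
    also have "\<dots> \<le> (\<Sum>j\<in>J. \<Sum>s\<in>S. \<bar>F j s\<bar>)"
      by (rule member_le_sum[of j J "\<lambda>j. \<Sum>s\<in>S. \<bar>F j s\<bar>"]) (use that J in \<open>auto intro: sum_nonneg\<close>)
    finally show ?thesis .
  qed
  then show ?thesis by blast
qed

text \<open>The derivative of \<open>fe\<close> in the strength \<open>z\<close> is
  \<open>y * z\<close> times \<open>1 - (1 - m)\<close> times the mean of a power of the overlap;
  that factor lies between 0 and 2 because overlaps are bounded by 1.\<close>

lemma fe_strength:
  assumes q: "q \<in> Qs"
  shows "fe \<theta> (x(q := 0)) \<le> fe \<theta> (x(q := z)) \<and> fe \<theta> (x(q := z)) \<le> fe \<theta> (x(q := 0)) + y * z\<^sup>2"
proof -
  let ?T = "\<lambda>z. tw J (co \<theta> (x(q := z))) []"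
  define \<kappa> where "\<kappa> z = 1 - (1 - m) * avg S (qw \<theta> (x(q := z))) 2 (\<lambda>ys. R (fst q) (ys ! 1) (ys ! 0) ^ snd q)" for z
  have Rq: "overlap_kernel S (R (fst q))" using q R by (auto simp: Qs_def)
  have \<kappa>: "0 \<le> \<kappa> z \<and> \<kappa> z \<le> 2" for z
  proof -
    have "\<bar>avg S (qw \<theta> (x(q := z))) 2 (\<lambda>ys. R (fst q) (ys ! 1) (ys ! 0) ^ snd q)\<bar> \<le> 1"
    proof (rule avg_abs_le)
      fix ys assume "ys \<in> words S 2"
      then have "ys ! 1 \<in> S" "ys ! 0 \<in> S" by (auto simp: words_def numeral_2_eq_2 length_Suc_conv)
      then show "\<bar>R (fst q) (ys ! 1) (ys ! 0) ^ snd q\<bar> \<le> 1"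
        using overlap_kernelD(2)[OF Rq] by (simp add: power_abs power_le_one)
    qed
    then have "\<bar>(1 - m) * avg S (qw \<theta> (x(q := z))) 2 (\<lambda>ys. R (fst q) (ys ! 1) (ys ! 0) ^ snd q)\<bar> \<le> 1 * 1"
      unfolding abs_mult using m_pos m_less by (intro mult_mono) auto
    then show ?thesis unfolding \<kappa>_def by (simp add: abs_le_iff)
  qed
  have der: "(?T has_field_derivative y * z * \<kappa> z * ?T z) (at z)" for z
  proof -
    obtain A1 where A1: "\<forall>j\<in>J. \<forall>s\<in>S. \<bar>co \<theta> x j s\<bar> \<le> A1" using bounded_coeffs by blast
    obtain A2 where A2: "\<forall>j\<in>J. \<forall>s\<in>S. \<bar>d q j s\<bar> \<le> A2" using bounded_coeffs by blast
    let ?A = "A1 + (\<bar>z\<bar> + 1 + \<bar>x q\<bar>) * A2 + A2"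
    have "(?T has_field_derivative
     m * ((\<Sum>t\<in>S. cov J (d q) (co \<theta> (x(q := z))) t t * tw J (co \<theta> (x(q := z))) [t])
        - (1 - m) * (\<Sum>t\<in>S. \<Sum>u\<in>S. cov J (d q) (co \<theta> (x(q := z))) t u * tw J (co \<theta> (x(q := z))) [u, t]))) (at z)"
    proof (rule tw_deriv[OF J, where lo="z - 1" and hi="z + 1" and a'="\<lambda>_. d q" and A="?A"])
      show "((\<lambda>y. co \<theta> (x(q := y)) j s) has_real_derivative d q j s) (at v)" for v j s
        unfolding co_upd[OF q] by (auto intro!: derivative_eq_intros)
      fix v j s assume v: "z - 1 < v" "v < z + 1" "j \<in> J" "s \<in> S"
      have a: "\<bar>co \<theta> x j s\<bar> \<le> A1" "\<bar>d q j s\<bar> \<le> A2" using A1 A2 v by auto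
      have "\<bar>(v - x q) * d q j s\<bar> \<le> (\<bar>z\<bar> + 1 + \<bar>x q\<bar>) * A2"
        unfolding abs_mult using a v by (intro mult_mono) auto
      moreover have "0 \<le> (\<bar>z\<bar> + 1 + \<bar>x q\<bar>) * A2" "0 \<le> A1" using a by (auto intro!: mult_nonneg_nonneg)
      ultimately show "\<bar>co \<theta> (x(q := v)) j s\<bar> \<le> ?A \<and> \<bar>d q j s\<bar> \<le> ?A"
        unfolding co_upd[OF q] using a by linarith
    qed auto
    also have "(\<Sum>t\<in>S. cov J (d q) (co \<theta> (x(q := z))) t t * tw J (co \<theta> (x(q := z))) [t])
        = (\<Sum>t\<in>S. z * (y / m) * tw J (co \<theta> (x(q := z))) [t])"
      using overlap_kernelD(1)[OF Rq] by (intro sum.cong refl) (simp add: cov_d_co[OF q])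
    also have "\<dots> = z * (y / m) * ?T z"
      by (simp only: sum_distrib_left[symmetric] sum_tw_Cons empty_subsetI list.set)
    also have "(\<Sum>t\<in>S. \<Sum>u\<in>S. cov J (d q) (co \<theta> (x(q := z))) t u * tw J (co \<theta> (x(q := z))) [u, t])
        = (\<Sum>t\<in>S. \<Sum>u\<in>S. (z * (y / m) * R (fst q) t u ^ snd q) * tw J (co \<theta> (x(q := z))) [u, t])"
      by (intro sum.cong refl) (simp add: cov_d_co[OF q])
    also have "\<dots> = ?T z * avg S (qw \<theta> (x(q := z))) 2 (\<lambda>ys. z * (y / m) * R (fst q) (ys ! 1) (ys ! 0) ^ snd q)"
      by (rule tw_avg_2)
    also have "avg S (qw \<theta> (x(q := z))) 2 (\<lambda>ys. z * (y / m) * R (fst q) (ys ! 1) (ys ! 0) ^ snd q)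
        = z * (y / m) * avg S (qw \<theta> (x(q := z))) 2 (\<lambda>ys. R (fst q) (ys ! 1) (ys ! 0) ^ snd q)"
      by (rule avg_cmult)
    also have "m * (z * (y / m) * ?T z - (1 - m) * (?T z * (z * (y / m) * E))) = y * z * (1 - (1 - m) * E) * ?T z" for E
      using m_pos by (simp add: field_simps)
    finally show ?thesis unfolding \<kappa>_def .
  qed
  have "ln (?T 0) \<le> ln (?T z) \<and> ln (?T z) \<le> ln (?T 0) + y * z\<^sup>2"
    by (rule log_growth_bound[OF der tw_pos \<kappa>]) (use y_pos in simp)
  then show ?thesis by (simp add: fe_def)
qed

lemma fe_zero_bounds:
  "fe \<theta> (\<lambda>_. 0) \<le> fe \<theta> x \<and> fe \<theta> x \<le> fe \<theta> (\<lambda>_. 0) + y * (\<Sum>q\<in>Qs. (x q)\<^sup>2)"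
proof -
  have "I \<subseteq> Qs \<Longrightarrow> fe \<theta> (\<lambda>_. 0) \<le> fe \<theta> (\<lambda>q. if q \<in> I then x q else 0)
      \<and> fe \<theta> (\<lambda>q. if q \<in> I then x q else 0) \<le> fe \<theta> (\<lambda>_. 0) + y * (\<Sum>q\<in>I. (x q)\<^sup>2)" if "finite I" for I
    using that
  proof (induction I rule: finite_induct)
    case (insert q I)
    let ?x = "\<lambda>q. if q \<in> I then x q else 0"
    have e: "(\<lambda>r. if r \<in> insert q I then x r else 0) = ?x(q := x q)" "?x(q := 0) = ?x"
      using insert.hyps by auto
    have "fe \<theta> ?x \<le> fe \<theta> (?x(q := x q)) \<and> fe \<theta> (?x(q := x q)) \<le> fe \<theta> ?x + y * (x q)\<^sup>2"
      using fe_strength[of q \<theta> ?x "x q"] insert.prems unfolding e(2) by auto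
    then show ?case using insert unfolding e(1) by (auto simp: distrib_left)
  qed simp
  from this[OF finite_Qs] have "fe \<theta> (\<lambda>_. 0) \<le> fe \<theta> (\<lambda>q. if q \<in> Qs then x q else 0)
      \<and> fe \<theta> (\<lambda>q. if q \<in> Qs then x q else 0) \<le> fe \<theta> (\<lambda>_. 0) + y * (\<Sum>q\<in>Qs. (x q)\<^sup>2)" by simp
  moreover have "co \<theta> (\<lambda>q. if q \<in> Qs then x q else 0) = co \<theta> x"
    by (simp add: co_def fun_eq_iff cong: sum.cong)
  ultimately show ?thesis by (simp add: fe_def)
qed

lemma fe_pen_le: "fe \<theta> x - pen x \<le> fe \<theta> (\<lambda>_. 0) + 2 * y * real (card Qs)"
proof -
  have "fe \<theta> x - pen x \<le> fe \<theta> (\<lambda>_. 0) + (\<Sum>q\<in>Qs. y * (x q)\<^sup>2 - 2 * y * (x q - 1)\<^sup>2)"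
    using fe_zero_bounds[of \<theta> x] by (simp add: pen_def sum_subtractf sum_distrib_left)
  also have "(\<Sum>q\<in>Qs. y * (x q)\<^sup>2 - 2 * y * (x q - 1)\<^sup>2) \<le> (\<Sum>q\<in>Qs. 2 * y)"
  proof (rule sum_mono)
    fix q
    have "0 \<le> y * (x q - 2)\<^sup>2" using y_pos by simp
    then show "y * (x q)\<^sup>2 - 2 * y * (x q - 1)\<^sup>2 \<le> 2 * y" by (simp add: power2_eq_square algebra_simps)
  qed
  finally show ?thesis by (simp add: mult.commute)
qed

lemma bdd_fe: "bdd_above (range (\<lambda>x. fe \<theta> x - pen x))"
  by (rule bdd_aboveI[of _ "fe \<theta> (\<lambda>_. 0) + 2 * y * real (card Qs)"]) (use fe_pen_le in auto)

lemma sfe_upper: "fe \<theta> x - pen x \<le> sfe \<theta>"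
  unfolding sfe_def by (rule cSUP_upper[OF UNIV_I bdd_fe])

lemma sfe_least: "(\<And>x. fe \<theta> x - pen x \<le> B) \<Longrightarrow> sfe \<theta> \<le> B"
  unfolding sfe_def by (rule cSUP_least) auto

text \<open>Strength 1 is free of penalty and perturbations only raise \<open>fe\<close>; conversely
  each one raises the penalised value by at most \<open>2 * y\<close>, whatever the size of the
  system.\<close>

lemma sfe_bounds: "fe \<theta> (\<lambda>_. 0) \<le> sfe \<theta> \<and> sfe \<theta> \<le> fe \<theta> (\<lambda>_. 0) + 2 * y * real (card Qs)"
proof
  have "fe \<theta> (\<lambda>_. 1) - pen (\<lambda>_. 1) \<le> sfe \<theta>" by (rule sfe_upper)
  then show "fe \<theta> (\<lambda>_. 0) \<le> sfe \<theta>" using fe_zero_bounds[of \<theta> "\<lambda>_. 1"] by (simp add: pen_def)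
  show "sfe \<theta> \<le> fe \<theta> (\<lambda>_. 0) + 2 * y * real (card Qs)" by (rule sfe_least) (rule fe_pen_le)
qed

lemma pen_upd:
  assumes "q \<in> Qs"
  shows "pen (x(q := z)) = pen x + 2 * y * ((z - 1)\<^sup>2 - (x q - 1)\<^sup>2)"
proof -
  have "(\<Sum>q'\<in>Qs. ((x(q := z)) q' - 1)\<^sup>2) = (z - 1)\<^sup>2 + (\<Sum>q'\<in>Qs - {q}. (x q' - 1)\<^sup>2)"
    using assms finite_Qs by (subst sum.remove[of _ q]) auto
  moreover have "(\<Sum>q'\<in>Qs. (x q' - 1)\<^sup>2) = (x q - 1)\<^sup>2 + (\<Sum>q'\<in>Qs - {q}. (x q' - 1)\<^sup>2)"
    using assms finite_Qs by (subst sum.remove[of _ q]) auto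
  ultimately show ?thesis by (simp add: pen_def algebra_simps)
qed

text \<open>Below one half, resetting the strength to 1 lowers \<open>fe\<close> by at most
  \<open>y * (x q)\<^sup>2\<close> but saves the whole penalty. The net gain would exceed
  \<open>y / 4\<close>, hence 1.\<close>

lemma near_maximiser_strength:
  assumes near: "sfe \<theta> \<le> fe \<theta> x - pen x + 1" and q: "q \<in> Qs"
  shows "1 / 2 \<le> x q"
proof (rule ccontr)
  assume "\<not> 1 / 2 \<le> x q"
  then have x: "x q < 1 / 2" by simp
  have "fe \<theta> (x(q := 1)) - pen (x(q := 1)) \<le> fe \<theta> x - pen x + 1" using sfe_upper near order.trans by blast
  moreover have "fe \<theta> x \<le> fe \<theta> (x(q := 0)) + y * (x q)\<^sup>2"
    using fe_strength[OF q, of \<theta> x "x q"] by simp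
  moreover have "fe \<theta> (x(q := 0)) \<le> fe \<theta> (x(q := 1))" using fe_strength[OF q] by simp
  ultimately have "0 \<le> y * (x q)\<^sup>2 - 2 * y * (x q - 1)\<^sup>2 + 1"
    unfolding pen_upd[OF q] by (simp add: algebra_simps)
  also have "\<dots> = y * (2 - (x q - 2)\<^sup>2) + 1" by (simp add: power2_eq_square algebra_simps)
  also have "\<dots> < y * (- 1 / 4) + 1"
  proof -
    have "(3 / 2)\<^sup>2 < (2 - x q)\<^sup>2" by (rule power_strict_mono) (use x in auto)
    then have "2 - (x q - 2)\<^sup>2 < - 1 / 4" by (simp add: power2_eq_square algebra_simps)
    then have "y * (2 - (x q - 2)\<^sup>2) < y * (- 1 / 4)" using y_pos by (rule mult_strict_left_mono)
    then show ?thesis by simp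
  qed
  finally show False using y by simp
qed

text \<open>Near-maximality bounds \<open>fe\<close> in each perturbation direction by its value
  plus a quadratic. This is the hypothesis of \<open>tilted_gg\<close>, so the identities hold there
  and overlap positivity applies.\<close>

lemma near_maximiser_positivity:
  assumes near: "sfe \<theta> \<le> fe \<theta> x - pen x + 1" and \<beta>: "\<beta> \<in> Bs"
  shows "avg S (qw \<theta> x) 2 (\<lambda>ys. max 0 (- R \<beta> (ys ! 1) (ys ! 0))) \<le> \<epsilon> + p"
proof -
  have "avg S (qw \<theta> x) 2 (low (R \<beta>) \<epsilon>) \<le> p"
  proof (rule pos[OF rep R[OF \<beta>]])
    fix k assume k: "k \<in> {1..K}"
    let ?q = "(\<beta>, k)"
    have q: "?q \<in> Qs" using \<beta> k by (simp add: Qs_def)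
    have x: "1 / 2 \<le> x ?q" by (rule near_maximiser_strength[OF near q])
    \<comment> \<open>The change of penalty under \<open>x ?q + h\<close> has slope
      \<open>4 * y * (x ?q - 1)\<close> and quadratic coefficient \<open>2 * y\<close>; these become
      \<open>m * \<gamma>\<close> and \<open>P\<close>.\<close>
    have nm: "tw J (\<lambda>j s. co \<theta> x j s + h * d ?q j s) []
        \<le> tw J (co \<theta> x) [] * exp (m * (2 * (2 * y) * (x ?q - 1) / m) * h + 2 * y * h\<^sup>2 + 1)" for h
    proof -
      let ?x = "x(?q := x ?q + h)"
      have "co \<theta> ?x = (\<lambda>j s. co \<theta> x j s + h * d ?q j s)" by (simp add: co_upd[OF q] fun_eq_iff)
      then have "ln (tw J (\<lambda>j s. co \<theta> x j s + h * d ?q j s) []) = fe \<theta> ?x" by (simp add: fe_def)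
      also have "\<dots> \<le> fe \<theta> x + (pen ?x - pen x) + 1" using sfe_upper[of \<theta> ?x] near by linarith
      also have "pen ?x - pen x = m * (2 * (2 * y) * (x ?q - 1) / m) * h + 2 * y * h\<^sup>2"
      proof -
        have e: "m * (2 * (2 * y) * (x ?q - 1) / m) = 4 * y * (x ?q - 1)" using m_pos by simp
        show ?thesis unfolding pen_upd[OF q] e by (simp add: power2_eq_square algebra_simps)
      qed
      finally have "ln (tw J (\<lambda>j s. co \<theta> x j s + h * d ?q j s) [])
          \<le> ln (tw J (co \<theta> x) [] * exp (m * (2 * (2 * y) * (x ?q - 1) / m) * h + 2 * y * h\<^sup>2 + 1))"
        using tw_pos[of \<theta> x] by (simp add: ln_mult fe_def)
      then show ?thesis
        by (subst (asm) ln_le_cancel_iff) (use tw_Nil_pos tw_pos[of \<theta> x] in \<open>auto intro!: mult_pos_pos\<close>)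
    qed
    have X: "0 < x ?q * (y / m)" using x y_pos m_pos by simp
    have g: "gg S (qw \<theta> x) m (\<lambda>s t. R \<beta> s t ^ k) (8 * sqrt (2 * y) / (m * (x ?q * (y / m))))"
      by (rule tilted_gg[OF J _ nm X])
         (use y_pos cov_d_co[OF q] overlap_kernelD(1)[OF R[OF \<beta>]] in auto)
    have "8 * sqrt (2 * y) / (m * (x ?q * (y / m))) = 8 * sqrt (2 * y) / (x ?q * y)" using m_pos by simp
    also have "\<dots> \<le> 8 * sqrt (2 * y) / (1 / 2 * y)"
      using x y_pos by (intro divide_left_mono mult_right_mono mult_pos_pos) auto
    also have "\<dots> = sqrt (512 / y)"
    proof -
      have "8 * sqrt (2 * y) / (1 / 2 * y) = 16 * sqrt 2 * (sqrt y / y)" by (simp add: real_sqrt_mult)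
      also have "sqrt y / y = 1 / sqrt y" using y_pos by (simp add: real_div_sqrt field_simps)
      also have "16 * sqrt 2 = sqrt (16\<^sup>2 * 2)" by (simp only: real_sqrt_mult real_sqrt_power real_sqrt_abs) simp
      finally show ?thesis by (simp add: real_sqrt_divide)
    qed
    also have "\<dots> \<le> \<eta>"
    proof -
      have "512 \<le> y * \<eta>\<^sup>2" using y(2) \<eta> by (simp add: field_simps)
      then have "512 / y \<le> \<eta>\<^sup>2" using y_pos by (simp add: field_simps)
      then show ?thesis using \<eta> by (intro real_le_lsqrt) auto
    qed
    finally show "gg S (qw \<theta> x) m (\<lambda>s t. R \<beta> s t ^ k) \<eta>"
      using g unfolding gg_def by (meson order_trans)
  qed
  moreover have "avg S (qw \<theta> x) 2 (\<lambda>ys. max 0 (- R \<beta> (ys ! 1) (ys ! 0))) \<le> avg S (qw \<theta> x) 2 (\<lambda>ys. \<epsilon> + low (R \<beta>) \<epsilon> ys)"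
  proof (rule avg_mono[OF rep])
    fix ys assume "ys \<in> words S 2"
    then obtain s t where ys: "ys = [s, t]" "s \<in> S" "t \<in> S"
      by (auto simp: words_def numeral_2_eq_2 length_Suc_conv)
    have "\<bar>R \<beta> s t\<bar> \<le> 1" "R \<beta> t s = R \<beta> s t" using overlap_kernelD(2,3)[OF R[OF \<beta>]] ys by auto
    then show "max 0 (- R \<beta> (ys ! 1) (ys ! 0)) \<le> \<epsilon> + low (R \<beta>) \<epsilon> ys"
      using \<epsilon> by (auto simp: ys(1) low_def abs_le_iff)
  qed
  ultimately show ?thesis by (simp add: avg_add avg_const[OF rep])
qed

end

section \<open>Derivative along the path\<close>

context interpolation
begin

definition gap :: "'s \<Rightarrow> 's \<Rightarrow> real" where
  "gap s t = cov J c c s t - cov J b b s t"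

definition drift :: "real \<Rightarrow> ('b \<times> nat \<Rightarrow> real) \<Rightarrow> real" where
  "drift \<theta> x = avg S (qw \<theta> x) 1 (\<lambda>xs. gap (xs ! 0) (xs ! 0))
     - (1 - m) * avg S (qw \<theta> x) 2 (\<lambda>ys. gap (ys ! 1) (ys ! 0))"

definition rate :: real where
  "rate = d0 + (1 - m) * (e + (\<epsilon> + p) * (\<Sum>\<beta>\<in>Bs. L \<beta>))"

text \<open>The families \<open>b\<close>, \<open>c\<close> and the perturbations are mutually
  uncorrelated, so only the two self-covariances survive, with weights
  \<open>- sin \<theta> * cos \<theta>\<close> and
  \<open>sin \<theta> * cos \<theta>\<close>.\<close>

lemma cov_path:
  assumes "s \<in> S" "t \<in> S"
  shows "cov J (\<lambda>j s. - sin \<theta> * b j s + cos \<theta> * c j s) (co \<theta> x) s t = sin \<theta> * cos \<theta> * gap s t"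
proof -
  have "cov J b (d q) s t = 0" "cov J c (d q) s t = 0" if "q \<in> Qs" for q
    using that db[of q t s] dc[of q t s] assms cov_sym[of J b "d q" s t] cov_sym[of J c "d q" s t]
    unfolding Qs_def by auto
  moreover have "cov J c b s t = 0" using bc[of t s] assms cov_sym[of J c b s t] by simp
  moreover have "cov J b c s t = 0" using bc assms by simp
  ultimately show ?thesis
    unfolding co_def[abs_def] cov_add_left cov_mult_left
    by (simp add: cov_add_right cov_mult_right cov_sum_right gap_def algebra_simps)
qed

lemma fe_deriv: "((\<lambda>\<theta>. fe \<theta> x) has_field_derivative m * (sin \<theta> * cos \<theta> * drift \<theta> x)) (at \<theta>)"
proof -
  obtain A1 where A1: "\<forall>j\<in>J. \<forall>s\<in>S. \<bar>b j s\<bar> \<le> A1" using bounded_coeffs by blast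
  obtain A2 where A2: "\<forall>j\<in>J. \<forall>s\<in>S. \<bar>c j s\<bar> \<le> A2" using bounded_coeffs by blast
  obtain A3 where A3: "\<forall>j\<in>J. \<forall>s\<in>S. \<bar>\<Sum>q\<in>Qs. x q * d q j s\<bar> \<le> A3"
    using bounded_coeffs[of "\<lambda>j s. \<Sum>q\<in>Qs. x q * d q j s"] by blast
  have "((\<lambda>\<theta>. tw J (co \<theta> x) []) has_field_derivative
     m * ((\<Sum>t\<in>S. cov J (\<lambda>j s. - sin \<theta> * b j s + cos \<theta> * c j s) (co \<theta> x) t t * tw J (co \<theta> x) [t])
        - (1 - m) * (\<Sum>t\<in>S. \<Sum>u\<in>S. cov J (\<lambda>j s. - sin \<theta> * b j s + cos \<theta> * c j s) (co \<theta> x) t u * tw J (co \<theta> x) [u, t]))) (at \<theta>)"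
  proof (rule tw_deriv[OF J, where lo="\<theta> - 1" and hi="\<theta> + 1" and A="A1 + A2 + A3"
        and a'="\<lambda>\<theta> j s. - sin \<theta> * b j s + cos \<theta> * c j s"])
    show "((\<lambda>v. co v x j s) has_real_derivative - sin v * b j s + cos v * c j s) (at v)" for v j s
      unfolding co_def by (auto intro!: derivative_eq_intros)
    fix v j s assume "j \<in> J" "s \<in> S"
    then have a: "\<bar>b j s\<bar> \<le> A1" "\<bar>c j s\<bar> \<le> A2" "\<bar>\<Sum>q\<in>Qs. x q * d q j s\<bar> \<le> A3" using A1 A2 A3 by auto
    have s: "\<bar>k * r\<bar> \<le> \<bar>r\<bar>" if "\<bar>k\<bar> \<le> 1" for k r :: real
      using mult_right_mono[OF that, of "\<bar>r\<bar>"] by (simp add: abs_mult)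
    have "\<bar>cos v * b j s\<bar> \<le> A1" "\<bar>sin v * c j s\<bar> \<le> A2" "\<bar>- sin v * b j s\<bar> \<le> A1" "\<bar>cos v * c j s\<bar> \<le> A2"
      using a s[of "cos v" "b j s"] s[of "sin v" "c j s"] s[of "- sin v" "b j s"] s[of "cos v" "c j s"]
      by auto
    then show "\<bar>co v x j s\<bar> \<le> A1 + A2 + A3 \<and> \<bar>- sin v * b j s + cos v * c j s\<bar> \<le> A1 + A2 + A3"
      unfolding co_def using a by linarith
  qed auto
  also have "(\<Sum>t\<in>S. cov J (\<lambda>j s. - sin \<theta> * b j s + cos \<theta> * c j s) (co \<theta> x) t t * tw J (co \<theta> x) [t])
      = (\<Sum>t\<in>S. (sin \<theta> * cos \<theta> * gap t t) * tw J (co \<theta> x) [t])"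
    by (intro sum.cong refl) (simp only: cov_path)
  also have "\<dots> = tw J (co \<theta> x) [] * (sin \<theta> * cos \<theta> * avg S (qw \<theta> x) 1 (\<lambda>xs. gap (xs ! 0) (xs ! 0)))"
    unfolding tw_avg_1 by (simp only: avg_cmult)
  also have "(\<Sum>t\<in>S. \<Sum>u\<in>S. cov J (\<lambda>j s. - sin \<theta> * b j s + cos \<theta> * c j s) (co \<theta> x) t u * tw J (co \<theta> x) [u, t])
      = (\<Sum>t\<in>S. \<Sum>u\<in>S. (sin \<theta> * cos \<theta> * gap t u) * tw J (co \<theta> x) [u, t])"
    by (intro sum.cong refl) (simp only: cov_path)
  also have "\<dots> = tw J (co \<theta> x) [] * (sin \<theta> * cos \<theta> * avg S (qw \<theta> x) 2 (\<lambda>ys. gap (ys ! 1) (ys ! 0)))"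
    unfolding tw_avg_2 by (simp only: avg_cmult)
  finally have D: "((\<lambda>\<theta>. tw J (co \<theta> x) []) has_field_derivative
      tw J (co \<theta> x) [] * (m * (sin \<theta> * cos \<theta> * drift \<theta> x))) (at \<theta>)"
    by (rule DERIV_cong) (simp add: drift_def algebra_simps)
  show ?thesis
    unfolding fe_def
    by (rule DERIV_cong[OF DERIV_chain2[OF DERIV_ln[OF tw_pos] D]])
       (use tw_pos[of \<theta> x] in \<open>simp add: field_simps\<close>)
qed

lemma drift_bounded: "\<exists>M. 0 \<le> M \<and> (\<forall>\<theta> x. \<bar>drift \<theta> x\<bar> \<le> M)"
proof -
  define M where "M = (\<Sum>s\<in>S. \<Sum>t\<in>S. \<bar>gap s t\<bar>)"
  have M: "\<bar>gap s t\<bar> \<le> M" if "s \<in> S" "t \<in> S" for s t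
  proof -
    have "\<bar>gap s t\<bar> \<le> (\<Sum>t\<in>S. \<bar>gap s t\<bar>)" by (rule member_le_sum) (use that finite_S in auto)
    also have "\<dots> \<le> M"
      unfolding M_def by (rule member_le_sum[of s S "\<lambda>s. \<Sum>t\<in>S. \<bar>gap s t\<bar>"]) (use that finite_S in \<open>auto intro: sum_nonneg\<close>)
    finally show ?thesis .
  qed
  have "\<bar>drift \<theta> x\<bar> \<le> M + 1 * M" for \<theta> x
  proof -
    have "\<bar>avg S (qw \<theta> x) 1 (\<lambda>xs. gap (xs ! 0) (xs ! 0))\<bar> \<le> M"
      by (rule avg_abs_le) (auto simp: words_def length_Suc_conv intro!: M)
    moreover have "\<bar>avg S (qw \<theta> x) 2 (\<lambda>ys. gap (ys ! 1) (ys ! 0))\<bar> \<le> M"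
      by (rule avg_abs_le) (auto simp: words_def numeral_2_eq_2 length_Suc_conv intro!: M)
    then have "\<bar>(1 - m) * avg S (qw \<theta> x) 2 (\<lambda>ys. gap (ys ! 1) (ys ! 0))\<bar> \<le> 1 * M"
      unfolding abs_mult using m_pos m_less by (intro mult_mono) auto
    ultimately show ?thesis unfolding drift_def by linarith
  qed
  moreover have "0 \<le> M + 1 * M" unfolding M_def by (auto intro!: sum_nonneg)
  ultimately show ?thesis by blast
qed

text \<open>The lower bound on the off-diagonal gap is lost only where some overlap is negative, and
  at a near-maximiser the mean negative part of each overlap is at most
  \<open>\<epsilon> + p\<close>.\<close>

lemma drift_le:
  assumes near: "sfe \<theta> \<le> fe \<theta> x - pen x + 1"
  shows "drift \<theta> x \<le> rate"
proof -
  have 1: "avg S (qw \<theta> x) 1 (\<lambda>xs. gap (xs ! 0) (xs ! 0)) \<le> d0"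
  proof -
    have "avg S (qw \<theta> x) 1 (\<lambda>xs. gap (xs ! 0) (xs ! 0)) \<le> avg S (qw \<theta> x) 1 (\<lambda>_. d0)"
      by (rule avg_mono[OF rep]) (auto simp: words_def length_Suc_conv gap_def intro!: diag)
    then show ?thesis by (simp only: avg_const[OF rep])
  qed
  have 2: "- (e + (\<epsilon> + p) * (\<Sum>\<beta>\<in>Bs. L \<beta>)) \<le> avg S (qw \<theta> x) 2 (\<lambda>ys. gap (ys ! 1) (ys ! 0))"
  proof -
    have "(\<Sum>\<beta>\<in>Bs. L \<beta> * avg S (qw \<theta> x) 2 (\<lambda>ys. max 0 (- R \<beta> (ys ! 1) (ys ! 0)))) \<le> (\<Sum>\<beta>\<in>Bs. L \<beta> * (\<epsilon> + p))"
      by (intro sum_mono mult_left_mono near_maximiser_positivity near L)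
    then have "- (e + (\<epsilon> + p) * (\<Sum>\<beta>\<in>Bs. L \<beta>)) \<le> - e - (\<Sum>\<beta>\<in>Bs. L \<beta> * avg S (qw \<theta> x) 2 (\<lambda>ys. max 0 (- R \<beta> (ys ! 1) (ys ! 0))))"
      by (simp add: sum_distrib_left mult.commute)
    also have "\<dots> = avg S (qw \<theta> x) 2 (\<lambda>ys. - e - (\<Sum>\<beta>\<in>Bs. L \<beta> * max 0 (- R \<beta> (ys ! 1) (ys ! 0))))"
      by (simp add: avg_diff avg_const[OF rep] avg_sum avg_cmult)
    also have "\<dots> \<le> avg S (qw \<theta> x) 2 (\<lambda>ys. gap (ys ! 1) (ys ! 0))"
      by (rule avg_mono[OF rep]) (auto simp: words_def numeral_2_eq_2 length_Suc_conv gap_def intro!: off)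
    finally show ?thesis .
  qed
  have "(1 - m) * - (e + (\<epsilon> + p) * (\<Sum>\<beta>\<in>Bs. L \<beta>)) \<le> (1 - m) * avg S (qw \<theta> x) 2 (\<lambda>ys. gap (ys ! 1) (ys ! 0))"
    by (rule mult_left_mono[OF 2]) (use m_less in simp)
  then show ?thesis using 1 unfolding drift_def rate_def by linarith
qed

text \<open>Envelope argument: one almost optimal \<open>x\<close> at the right endpoint remains a
  near-maximiser on the whole short interval, so its drift is controlled throughout, and it competes
  in the supremum at the left endpoint.\<close>

lemma sfe_step:
  assumes \<theta>: "0 \<le> \<theta>1" "\<theta>1 \<le> \<theta>2" "\<theta>2 \<le> pi / 2" and M: "\<And>\<theta> x. \<bar>drift \<theta> x\<bar> \<le> M" "M * (\<theta>2 - \<theta>1) \<le> 1 / 4"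
    and \<delta>: "0 < \<delta>" "\<delta> \<le> 1 / 2"
  shows "sfe \<theta>2 - m * rate * (sin \<theta>2)\<^sup>2 / 2 \<le> sfe \<theta>1 - m * rate * (sin \<theta>1)\<^sup>2 / 2 + \<delta>"
proof -
  have M0: "0 \<le> M" using M(1)[of 0 "\<lambda>_. 0"] by simp
  have lip: "\<bar>fe \<theta>2 x - fe \<theta> x\<bar> \<le> 1 / 4" if "\<theta>1 \<le> \<theta>" "\<theta> \<le> \<theta>2" for x \<theta>
  proof -
    have "norm (fe \<theta>2 x - fe \<theta> x) \<le> M * norm (\<theta>2 - \<theta>)"
    proof (rule field_differentiable_bound[where S=UNIV])
      fix z :: real
      show "((\<lambda>\<theta>. fe \<theta> x) has_field_derivative m * (sin z * cos z * drift z x)) (at z within UNIV)"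
        using fe_deriv by simp
      have "\<bar>m * (sin z * cos z * drift z x)\<bar> \<le> 1 * (1 * 1 * M)"
        unfolding abs_mult using m_pos m_less M M0 by (intro mult_mono) auto
      then show "norm (m * (sin z * cos z * drift z x)) \<le> M" by simp
    qed auto
    also have "M * norm (\<theta>2 - \<theta>) \<le> M * (\<theta>2 - \<theta>1)" using M0 that by (intro mult_left_mono) auto
    finally show ?thesis using M(2) by simp
  qed
  obtain x where x: "sfe \<theta>2 - \<delta> < fe \<theta>2 x - pen x"
    using less_cSUP_iff[OF UNIV_not_empty bdd_fe, of "sfe \<theta>2 - \<delta>" \<theta>2] \<delta> unfolding sfe_def by auto
  \<comment> \<open>The tolerance 1 is spent as two quarters for moving between angles and
    \<open>\<delta> \<le> 1 / 2\<close> for the choice of \<open>x\<close>.\<close>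
  have near: "sfe \<theta> \<le> fe \<theta> x - pen x + 1" if \<theta>': "\<theta>1 \<le> \<theta>" "\<theta> \<le> \<theta>2" for \<theta>
  proof -
    have "sfe \<theta> \<le> sfe \<theta>2 + 1 / 4"
    proof (rule sfe_least)
      fix z show "fe \<theta> z - pen z \<le> sfe \<theta>2 + 1 / 4"
        using lip[OF \<theta>', of z] sfe_upper[of \<theta>2 z] by linarith
    qed
    then show ?thesis using x \<delta> lip[OF \<theta>', of x] by linarith
  qed
  have "fe \<theta>2 x - m * rate * (sin \<theta>2)\<^sup>2 / 2 \<le> fe \<theta>1 x - m * rate * (sin \<theta>1)\<^sup>2 / 2"
  proof (rule DERIV_nonpos_imp_nonincreasing[OF \<theta>(2)])
    fix z assume z: "\<theta>1 \<le> z" "z \<le> \<theta>2"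
    have "((\<lambda>\<theta>. fe \<theta> x - m * rate * (sin \<theta>)\<^sup>2 / 2) has_field_derivative
        m * (sin z * cos z * drift z x) - m * rate * (sin z * cos z)) (at z)"
      by (auto intro!: derivative_eq_intros fe_deriv)
    moreover have "m * (sin z * cos z * drift z x) - m * rate * (sin z * cos z) \<le> 0"
    proof -
      have "0 \<le> sin z" using z \<theta> by (intro sin_ge_zero) auto
      moreover have "0 \<le> cos z" using z \<theta> by (intro cos_ge_zero) auto
      ultimately have "(m * (sin z * cos z)) * drift z x \<le> (m * (sin z * cos z)) * rate"
        using m_pos by (intro mult_left_mono drift_le near z) auto
      then show ?thesis by (simp add: mult_ac)
    qed
    ultimately show "\<exists>y. ((\<lambda>\<theta>. fe \<theta> x - m * rate * (sin \<theta>)\<^sup>2 / 2) has_field_derivative y) (at z) \<and> y \<le> 0" by blast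
  qed
  then show ?thesis using x sfe_upper[of \<theta>1 x] by linarith
qed

lemma sfe_comparison: "sfe (pi / 2) \<le> sfe 0 + m * rate / 2"
proof -
  obtain M where M: "0 \<le> M" "\<And>\<theta> x. \<bar>drift \<theta> x\<bar> \<le> M" using drift_bounded by blast
  \<comment> \<open>So many pieces of the quarter circle make \<open>M\<close> times the step length
    at most one quarter.\<close>
  obtain n :: nat where n: "2 * pi * M + 1 < real n" using reals_Archimedean2 by blast
  have "0 \<le> 2 * pi * M" using M(1) by simp
  then have n0: "0 < real n" using n by linarith
  define t where "t i = real i * (pi / 2) / real n" for i
  have step: "M * (t (Suc i) - t i) \<le> 1 / 4" for i
  proof -
    have "t (Suc i) - t i = (pi / 2) / real n" by (simp add: t_def add_divide_distrib ring_distribs)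
    moreover have "M * ((pi / 2) / real n) \<le> 1 / 4" using n n0 by (simp add: field_simps)
    ultimately show ?thesis by simp
  qed
  have *: "sfe (t i) - m * rate * (sin (t i))\<^sup>2 / 2 \<le> sfe 0 + real i * \<delta>" if "i \<le> n" "0 < \<delta>" "\<delta> \<le> 1 / 2" for i \<delta>
    using that(1)
  proof (induction i)
    case 0
    then show ?case by (simp add: t_def)
  next
    case (Suc i)
    have "t (Suc i) \<le> t n" unfolding t_def using Suc.prems n0
      by (intro divide_right_mono mult_right_mono) auto
    also have "t n = pi / 2" using n0 by (simp add: t_def)
    finally have "t (Suc i) \<le> pi / 2" .
    moreover have "0 \<le> t i" "t i \<le> t (Suc i)" unfolding t_def using n0
      by (auto intro!: divide_right_mono mult_right_mono)
    ultimately have "sfe (t (Suc i)) - m * rate * (sin (t (Suc i)))\<^sup>2 / 2 \<le> sfe (t i) - m * rate * (sin (t i))\<^sup>2 / 2 + \<delta>"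
      using sfe_step[OF _ _ _ M(2) step] that by blast
    then show ?case using Suc by (simp add: algebra_simps)
  qed
  have "sfe (pi / 2) - m * rate / 2 \<le> sfe 0 + \<gamma>" if "0 < \<gamma>" for \<gamma>
  proof -
    define \<delta> where "\<delta> = min (1 / 2) (\<gamma> / real n)"
    have \<delta>: "0 < \<delta>" "\<delta> \<le> 1 / 2" "\<delta> \<le> \<gamma> / real n" using that n0 unfolding \<delta>_def by (auto simp: min_def)
    have "real n * \<delta> \<le> \<gamma>" using \<delta>(3) n0 by (simp add: field_simps)
    moreover have tn: "t n = pi / 2" using n0 by (simp add: t_def)
    have "sfe (pi / 2) - m * rate * (sin (pi / 2))\<^sup>2 / 2 \<le> sfe 0 + real n * \<delta>"
      using *[OF order.refl \<delta>(1,2)] unfolding tn .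
    ultimately show ?thesis by simp
  qed
  then have "sfe (pi / 2) - m * rate / 2 \<le> sfe 0" by (rule field_le_epsilon)
  then show ?thesis by simp
qed

text \<open>The suprema at both endpoints are traded for unperturbed free energies by
  \<open>sfe_bounds\<close>; there are \<open>K\<close> perturbations for every kernel in
  \<open>Bs\<close>.\<close>

lemma comparison:
  "ln (tw J c []) \<le> ln (tw J b []) + m * (d0 + (1 - m) * (e + (\<epsilon> + p) * (\<Sum>\<beta>\<in>Bs. L \<beta>))) / 2
    + 2 * y * (real K * real (card Bs))"
proof -
  have "co 0 (\<lambda>_. 0) = b" "co (pi / 2) (\<lambda>_. 0) = c" by (auto simp: co_def fun_eq_iff)
  then have "ln (tw J c []) = fe (pi / 2) (\<lambda>_. 0)" "ln (tw J b []) = fe 0 (\<lambda>_. 0)" by (simp_all add: fe_def)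
  moreover have "real (card Qs) = real K * real (card Bs)" by (simp add: Qs_def card_cartesian_product)
  ultimately show ?thesis
    using sfe_comparison sfe_bounds[of "pi / 2"] sfe_bounds[of 0] unfolding rate_def by simp
qed

end

section \<open>Spin configurations and overlaps\<close>

definition zsum :: "'s set \<Rightarrow> ('s \<Rightarrow> real) \<Rightarrow> 'k set \<Rightarrow> ('k \<Rightarrow> 's \<Rightarrow> real) \<Rightarrow> ('k \<Rightarrow> real) \<Rightarrow> real" where
  "zsum S w I a g = (\<Sum>s\<in>S. w s * exp (field I a g s))"

definition moment :: "real \<Rightarrow> 's set \<Rightarrow> ('s \<Rightarrow> real) \<Rightarrow> 'k set \<Rightarrow> ('k \<Rightarrow> 's \<Rightarrow> real) \<Rightarrow> real" where
  "moment m S w I a = (\<integral>g. zsum S w I a g powr m \<partial>gauss)"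

lemma measurable_zsum [measurable]: "zsum S w I a \<in> borel_measurable gauss"
  unfolding zsum_def by measurable

lemma (in gibbs) tw_Nil: "tw I a [] = moment m S w I a"
  by (simp add: tw_def moment_def wt_def zsum_def pf_def)

lemma tame_zsum_powr:
  assumes "finite S" "S \<noteq> {}" "\<forall>s\<in>S. 0 < w s" "0 < m" "m < 1"
  shows "tame (\<lambda>g. zsum S w J a g powr m)"
proof -
  interpret gibbs S w m using assms by unfold_locales auto
  have "tame (\<lambda>g. wt (field J a g) [])" by (rule tame_wt) simp
  then show ?thesis by (simp add: wt_def zsum_def pf_def)
qed

text \<open>Overlap over a set \<open>A\<close> of sites: the whole system in the comparison with
  independent fields, a single block in the proof that the limit exists.\<close>

definition ovl :: "nat set \<Rightarrow> real list \<Rightarrow> real list \<Rightarrow> real" where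
  "ovl A \<sigma> \<tau> = (\<Sum>i\<in>A. \<sigma> ! i * \<tau> ! i) / real (card A)"

lemma sum_list_sum: "(\<Sum>x\<leftarrow>xs. \<Sum>i\<in>A. f x i) = (\<Sum>i\<in>A. \<Sum>x\<leftarrow>xs. f x i :: real)"
  by (induction xs) (simp_all add: sum.distrib)

lemma overlap_kernel_ovl:
  assumes A: "finite A" "A \<noteq> {}" and S: "\<And>\<sigma> i. \<sigma> \<in> S \<Longrightarrow> i \<in> A \<Longrightarrow> \<sigma> ! i \<in> {-1, 1}"
  shows "overlap_kernel S (ovl A)"
proof -
  have c: "0 < real (card A)" using A by (simp add: card_gt_0_iff)
  have sq: "\<sigma> ! i * \<sigma> ! i = 1" if "\<sigma> \<in> S" "i \<in> A" for \<sigma> i using S[OF that] by auto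
  show ?thesis
    unfolding overlap_kernel_def
  proof (intro conjI ballI allI impI)
    fix s assume "s \<in> S"
    then show "ovl A s s = 1" using c by (simp add: ovl_def sq)
  next
    fix s t assume st: "s \<in> S" "t \<in> S"
    have "\<bar>\<Sum>i\<in>A. s ! i * t ! i\<bar> \<le> (\<Sum>i\<in>A. 1)"
    proof (rule order.trans[OF sum_abs], rule sum_mono)
      fix i assume "i \<in> A"
      then show "\<bar>s ! i * t ! i\<bar> \<le> 1" using S[OF st(1), of i] S[OF st(2), of i] by auto
    qed
    then show "\<bar>ovl A s t\<bar> \<le> 1" using c by (simp add: ovl_def)
    show "ovl A s t = ovl A t s" by (simp add: ovl_def mult.commute)
  next
    fix xs
    have "(\<Sum>x\<leftarrow>xs. \<Sum>y\<leftarrow>xs. ovl A x y) = (\<Sum>i\<in>A. (\<Sum>x\<leftarrow>xs. x ! i) * (\<Sum>y\<leftarrow>xs. y ! i)) / real (card A)"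
    proof -
      have r: "(\<Sum>y\<leftarrow>xs. ovl A x y) = (\<Sum>i\<in>A. x ! i * (\<Sum>y\<leftarrow>xs. y ! i)) / real (card A)" for x
        unfolding ovl_def sum_divide_distrib sum_list_sum
        by (intro sum.cong refl) (simp add: sum_list_const_mult[symmetric] divide_inverse sum_list_mult_const[symmetric])
      show ?thesis
        unfolding r sum_divide_distrib sum_list_sum
        by (intro sum.cong refl) (simp only: times_divide_eq_right[symmetric] sum_list_mult_const)
    qed
    also have "0 \<le> \<dots>" by (intro divide_nonneg_nonneg sum_nonneg) auto
    finally show "0 \<le> (\<Sum>x\<leftarrow>xs. \<Sum>y\<leftarrow>xs. ovl A x y)" .
  qed
qed

section \<open>Spin monomials and powers of overlaps\<close>

definition monomial :: "real list \<Rightarrow> nat list \<Rightarrow> real" where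
  "monomial \<sigma> is = prod_list (map (\<lambda>i. \<sigma> ! i) is)"

text \<open>Independent Gaussians attached to the index words of length \<open>k\<close> thus give a
  field whose covariance is a power of the overlap. Both the Hamiltonian and the perturbations are
  built this way.\<close>

lemma sum_words_monomial:
  assumes "finite A"
  shows "(\<Sum>is\<in>words A k. monomial \<sigma> is * monomial \<tau> is) = (\<Sum>i\<in>A. \<sigma> ! i * \<tau> ! i) ^ k"
proof -
  have "monomial \<sigma> is * monomial \<tau> is = prod_list (map (\<lambda>i. \<sigma> ! i * \<tau> ! i) is)" for "is"
    by (induction "is") (simp_all add: monomial_def)
  then show ?thesis by (simp add: sum_words_prod_list[OF assms])
qed

lemma cov_Plus:
  assumes "finite I" "finite J"
  shows "cov (I <+> J) (case_sum a a') (case_sum b b') s t = cov I a b s t + cov J a' b' s t"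
  unfolding cov_def by (subst sum.Plus[OF assms]) simp

lemma field_Plus:
  assumes "finite I" "finite J"
  shows "field (I <+> J) (case_sum a a') g s = field I a (\<lambda>i. g (Inl i)) s + field J a' (\<lambda>i. g (Inr i)) s"
  unfolding field_def by (subst sum.Plus[OF assms]) simp

lemma cov_zero [simp]: "cov I (\<lambda>_ _. 0) b s t = 0" "cov I a (\<lambda>_ _. 0) s t = 0"
  by (simp_all add: cov_def)

lemma field_zero [simp]: "field I (\<lambda>_ _. 0) g s = 0"
  by (simp add: field_def)

lemma moment_reindex:
  assumes "inj f" "\<And>g s. s \<in> S \<Longrightarrow> field J a' g s = field I a (\<lambda>i. g (f i)) s"
  shows "moment m S w J a' = moment m S w I a"
proof -
  have "zsum S w J a' g = zsum S w I a (\<lambda>i. g (f i))" for g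
    using assms(2) by (simp add: zsum_def)
  then show ?thesis
    unfolding moment_def using integral_gauss_reindex[OF assms(1), of "\<lambda>g. zsum S w I a g powr m"] by simp
qed

text \<open>The abstract comparison with its perturbations realised. The cost \<open>A\<close> per
  block is fixed before the system is, hence negligible once divided by a large number of
  sites.\<close>

lemma spin_comparison:
  fixes m \<epsilon> :: real
  assumes m: "0 < m" "m < 1" and \<epsilon>: "0 < \<epsilon>"
  shows "\<exists>A\<ge>0. \<forall>(S :: real list set) w (I :: 'i set) (J :: 'j set) b c Bs L d0 e.
    finite S \<longrightarrow> S \<noteq> {} \<longrightarrow> (\<forall>s\<in>S. 0 < w s) \<longrightarrow> finite I \<longrightarrow> finite J \<longrightarrow> finite Bs \<longrightarrow>
    (\<forall>B\<in>Bs. finite B \<and> B \<noteq> {} \<and> 0 \<le> L B \<and> (\<forall>\<sigma>\<in>S. \<forall>i\<in>B. \<sigma> ! i \<in> {-1, 1})) \<longrightarrow>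
    (\<forall>s\<in>S. cov J c c s s - cov I b b s s \<le> d0) \<longrightarrow>
    (\<forall>s\<in>S. \<forall>t\<in>S. - e - (\<Sum>B\<in>Bs. L B * max 0 (- ovl B s t)) \<le> cov J c c s t - cov I b b s t) \<longrightarrow>
    ln (moment m S w J c) \<le> ln (moment m S w I b)
      + m * (d0 + (1 - m) * (e + \<epsilon> * (\<Sum>B\<in>Bs. L B))) / 2 + A * real (card Bs)"
proof -
  \<comment> \<open>One half of \<open>\<epsilon>\<close> is the threshold for negative overlaps,
    the other half their probability.\<close>
  have "0 < \<epsilon> / 2" using \<epsilon> by simp
  from overlap_positivity[OF this this] obtain K \<eta> where H: "0 < \<eta> \<and> (\<forall>(S :: real list set) Q m R.
      replica S Q \<longrightarrow> overlap_kernel S R \<longrightarrow> 0 < m \<longrightarrow> m < 1 \<longrightarrow>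
      (\<forall>k\<in>{1..K}. gg S Q m (\<lambda>s t. R s t ^ k) \<eta>) \<longrightarrow> avg S Q 2 (low R (\<epsilon> / 2)) \<le> \<epsilon> / 2)"
    by (elim exE)
  then have \<eta>: "0 < \<eta>" by (rule conjunct1)
  have pos: "avg S Q 2 (low R (\<epsilon> / 2)) \<le> \<epsilon> / 2"
    if "replica S Q" "overlap_kernel S R" "0 < m" "m < 1" "\<forall>k\<in>{1..K}. gg S Q m (\<lambda>s t. R s t ^ k) \<eta>"
    for S :: "real list set" and Q m R
    using conjunct2[OF H] that by blast
  define y where "y = max 4 (512 / \<eta>\<^sup>2)"
  have y: "4 \<le> y" "512 / \<eta>\<^sup>2 \<le> y" by (auto simp: y_def)
  show ?thesis
  proof (rule exI[of _ "2 * y * real K"], intro conjI allI impI)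
    show "0 \<le> 2 * y * real K" using y by simp
    fix S :: "real list set" and w :: "real list \<Rightarrow> real" and I :: "'i set" and J :: "'j set" and b c Bs L d0 e
    assume fS: "finite S" "S \<noteq> {}" "\<forall>s\<in>S. 0 < w s" and fI: "finite I" and fJ: "finite J" and fB: "finite Bs"
      and B: "\<forall>B\<in>Bs. finite B \<and> B \<noteq> {} \<and> 0 \<le> L B \<and> (\<forall>\<sigma>\<in>S. \<forall>i\<in>B. \<sigma> ! i \<in> {-1, 1})"
      and diag: "\<forall>s\<in>S. cov J c c s s - cov I b b s s \<le> d0"
      and off: "\<forall>s\<in>S. \<forall>t\<in>S. - e - (\<Sum>B\<in>Bs. L B * max 0 (- ovl B s t)) \<le> cov J c c s t - cov I b b s t"
    interpret gibbs S w m using fS m by unfold_locales auto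
    \<comment> \<open>One Gaussian for each block, each power up to \<open>K\<close> and each index
      word over that block; together with \<open>I\<close> and \<open>J\<close> in a disjoint sum
      this makes all families independent.\<close>
    define W where "W = Sigma (Bs \<times> {1..K}) (\<lambda>q. words (fst q) (snd q))"
    define JJ where "JJ = I <+> (J <+> W)"
    define b' :: "'i + 'j + (nat set \<times> nat) \<times> nat list \<Rightarrow> real list \<Rightarrow> real"
      where "b' = case_sum b (case_sum (\<lambda>_ _. 0) (\<lambda>_ _. 0))"
    define c' :: "'i + 'j + (nat set \<times> nat) \<times> nat list \<Rightarrow> real list \<Rightarrow> real"
      where "c' = case_sum (\<lambda>_ _. 0) (case_sum c (\<lambda>_ _. 0))"
    \<comment> \<open>The normalisation makes the covariance exactly \<open>y / m\<close> times the
      power of the block overlap.\<close>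
    define d0' :: "nat set \<times> nat \<Rightarrow> (nat set \<times> nat) \<times> nat list \<Rightarrow> real list \<Rightarrow> real"
      where "d0' q = (\<lambda>(q', is) s. if q' = q then sqrt (y / m / real (card (fst q)) ^ snd q) * monomial s is else 0)" for q
    define d' :: "nat set \<times> nat \<Rightarrow> 'i + 'j + (nat set \<times> nat) \<times> nat list \<Rightarrow> real list \<Rightarrow> real"
      where "d' q = case_sum (\<lambda>_ _. 0) (case_sum (\<lambda>_ _. 0) (d0' q))" for q
    have fW: "finite W" unfolding W_def using fB B by (intro finite_SigmaI) (auto intro!: finite_words)
    have fin: "finite (J <+> W)" using fJ fW by simp
    have dd0: "cov W (d0' q) (d0' q') s t = (if q = q' then y / m * ovl (fst q) s t ^ snd q else 0)"
      if q: "q \<in> Bs \<times> {1..K}" "q' \<in> Bs \<times> {1..K}" for q q' s t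
    proof -
      let ?z = "\<lambda>q. y / m / real (card (fst q)) ^ snd q"
      have fq: "finite (fst q)" using q(1) B by auto
      have z: "0 \<le> ?z q" for q using y m by simp
      have fin_words: "\<forall>r\<in>Bs \<times> {1..K}. finite (words (fst r) (snd r))" using B by (auto intro!: finite_words)
      have "cov W (d0' q) (d0' q') s t
          = (\<Sum>r\<in>Bs \<times> {1..K}. \<Sum>is\<in>words (fst r) (snd r). d0' q (r, is) s * d0' q' (r, is) t)"
        unfolding cov_def W_def by (subst sum.Sigma) (use fB fin_words in auto)
      also have "\<dots> = (\<Sum>r\<in>Bs \<times> {1..K}. if r = q then (if q = q' then y / m * ovl (fst q) s t ^ snd q else 0) else 0)"
      proof (rule sum.cong[OF refl])
        fix r
        have "(\<Sum>is\<in>words (fst q) (snd q). (sqrt (?z q) * monomial s is) * (sqrt (?z q) * monomial t is))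
            = (sqrt (?z q) * sqrt (?z q)) * (\<Sum>is\<in>words (fst q) (snd q). monomial s is * monomial t is)"
          unfolding sum_distrib_left by (intro sum.cong refl) (simp only: mult_ac)
        also have "sqrt (?z q) * sqrt (?z q) = ?z q" by (subst real_sqrt_mult_self) (rule abs_of_nonneg[OF z])
        also have "?z q * (\<Sum>is\<in>words (fst q) (snd q). monomial s is * monomial t is) = y / m * ovl (fst q) s t ^ snd q"
          by (simp add: sum_words_monomial[OF fq] ovl_def power_divide)
        finally have "(\<Sum>is\<in>words (fst q) (snd q). d0' q (q, is) s * d0' q (q, is) t) = y / m * ovl (fst q) s t ^ snd q"
          by (simp add: d0'_def)
        then show "(\<Sum>is\<in>words (fst r) (snd r). d0' q (r, is) s * d0' q' (r, is) t)
            = (if r = q then (if q = q' then y / m * ovl (fst q) s t ^ snd q else 0) else 0)"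
          by (cases "r = q") (auto simp: d0'_def)
      qed
      also have "\<dots> = (if q = q' then y / m * ovl (fst q) s t ^ snd q else 0)"
        using q(1) fB by (subst sum.delta) auto
      finally show ?thesis .
    qed
    have cv: "cov JJ (case_sum a1 (case_sum a2 a3)) (case_sum b1 (case_sum b2 b3)) s t
        = cov I a1 b1 s t + cov J a2 b2 s t + cov W a3 b3 s t" for a1 a2 a3 b1 b2 b3 s t
      unfolding JJ_def cov_Plus[OF fI fin] cov_Plus[OF fJ fW] by simp
    interpret interpolation S w m JJ b' c' Bs ovl d' K y \<eta> "\<epsilon> / 2" "\<epsilon> / 2" L d0 e
    proof unfold_locales
      show "finite JJ" unfolding JJ_def using fI fin by simp
      show "finite Bs" by fact
      show "overlap_kernel S (ovl \<beta>)" if "\<beta> \<in> Bs" for \<beta>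
        by (rule overlap_kernel_ovl) (use that B in auto)
      show "cov JJ (d' q) (d' q') s t = (if q = q' then y / m * ovl (fst q) s t ^ snd q else 0)"
        if "q \<in> Bs \<times> {1..K}" "q' \<in> Bs \<times> {1..K}" for q q' s t
        unfolding d'_def cv using dd0[OF that] by simp
      show "avg S Q 2 (low R (\<epsilon> / 2)) \<le> \<epsilon> / 2" if "replica S Q" "overlap_kernel S R"
        "\<And>k. k \<in> {1..K} \<Longrightarrow> gg S Q m (\<lambda>s t. R s t ^ k) \<eta>" for Q R
        using pos that m by blast
      show "cov JJ c' c' s s - cov JJ b' b' s s \<le> d0" if "s \<in> S" for s
        unfolding c'_def b'_def cv using diag that by simp
      show "- e - (\<Sum>\<beta>\<in>Bs. L \<beta> * max 0 (- ovl \<beta> s t)) \<le> cov JJ c' c' s t - cov JJ b' b' s t"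
        if "s \<in> S" "t \<in> S" for s t
        unfolding c'_def b'_def cv using off that by simp
      show "cov JJ b' c' s t = 0" for s t unfolding b'_def c'_def cv by simp
      show "cov JJ (d' q) b' s t = 0" for q s t unfolding b'_def d'_def cv by simp
      show "cov JJ (d' q) c' s t = 0" for q s t unfolding c'_def d'_def cv by simp
    qed (use y \<eta> \<epsilon> B in auto)
    have "moment m S w JJ c' = moment m S w J c"
      by (rule moment_reindex[where f="\<lambda>i. Inr (Inl i)"])
         (auto simp: inj_def JJ_def c'_def field_Plus[OF fI fin] field_Plus[OF fJ fW])
    moreover have "moment m S w JJ b' = moment m S w I b"
      by (rule moment_reindex[where f=Inl])
         (auto simp: JJ_def b'_def field_Plus[OF fI fin] field_Plus[OF fJ fW])
    ultimately show "ln (moment m S w J c) \<le> ln (moment m S w I b)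
        + m * (d0 + (1 - m) * (e + \<epsilon> * (\<Sum>B\<in>Bs. L B))) / 2 + 2 * y * real K * real (card Bs)"
      using comparison unfolding tw_Nil by (simp add: mult.assoc)
  qed
qed

section \<open>The p-spin partition function\<close>

lemma words_eq_tuples: "tuples p N = words {..<N} p"
  by (simp add: tuples_def words_def)

lemma words_eq_spins: "spins N = words {-1, 1} N"
  by (simp add: spins_def words_def)

lemma disorder_eq_gauss: "disorder = gauss"
  by (simp add: disorder_def gauss_def)

lemma finite_spins: "finite (spins N)"
  by (simp add: words_eq_spins finite_words)

lemma spins_nonempty: "spins N \<noteq> {}"
proof -
  have "replicate N 1 \<in> spins N" by (auto simp: spins_def)
  then show ?thesis by blast
qed

lemma spins_nth: "\<sigma> \<in> spins N \<Longrightarrow> i < N \<Longrightarrow> \<sigma> ! i \<in> {-1, 1}"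
  by (auto simp: spins_def dest: nth_mem)

definition hc :: "nat \<Rightarrow> nat \<Rightarrow> real \<Rightarrow> nat list \<Rightarrow> real list \<Rightarrow> real" where
  "hc p N \<beta> is \<sigma> = \<beta> / sqrt 2 * real N powr (- (real p - 1) / 2) * monomial \<sigma> is"

abbreviation uw :: "nat \<Rightarrow> real list \<Rightarrow> real" where
  "uw N \<equiv> (\<lambda>_. 2 powr (- real N))"

definition zN :: "nat \<Rightarrow> nat \<Rightarrow> real \<Rightarrow> (nat list \<Rightarrow> real) \<Rightarrow> real" where
  "zN p N \<beta> = zsum (spins N) (uw N) (words {..<N} p) (hc p N \<beta>)"

definition en :: "nat \<Rightarrow> nat \<Rightarrow> real \<Rightarrow> real" where
  "en p N \<beta> = (\<integral>g. ln (zN p N \<beta> g) \<partial>gauss)"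

lemma monomial_eq: "length is = p \<Longrightarrow> monomial \<sigma> is = (\<Prod>k<p. \<sigma> ! (is ! k))"
proof (induction "is" arbitrary: p)
  case (Cons i "is")
  then show ?case
    by (cases p) (auto simp: monomial_def prod.lessThan_Suc_shift simp del: prod.lessThan_Suc)
qed (simp add: monomial_def)

lemma field_hc: "field (words {..<N} p) (hc p N \<beta>) g \<sigma> = \<beta> / sqrt 2 * hamiltonian p N g \<sigma>"
proof -
  have "(\<Sum>is\<in>words {..<N} p. monomial \<sigma> is * g is) = (\<Sum>is\<in>words {..<N} p. g is * (\<Prod>k<p. \<sigma> ! (is ! k)))"
    by (intro sum.cong refl) (simp add: words_def monomial_eq mult.commute)
  moreover have "field (words {..<N} p) (hc p N \<beta>) g \<sigma>
      = \<beta> / sqrt 2 * real N powr (- (real p - 1) / 2) * (\<Sum>is\<in>words {..<N} p. monomial \<sigma> is * g is)"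
    unfolding field_def hc_def sum_distrib_left by (intro sum.cong refl) (simp only: mult.assoc)
  ultimately show ?thesis
    unfolding hamiltonian_def words_eq_tuples by (simp only: mult.assoc)
qed

lemma free_energy_N_eq: "free_energy_N p N \<beta> g = ln (zN p N \<beta> g) / real N"
  by (simp add: free_energy_N_def zN_def zsum_def field_hc)

lemma hc_scale: "1 \<le> N \<Longrightarrow> 1 \<le> p \<Longrightarrow> (real N powr (- (real p - 1) / 2))\<^sup>2 * real N ^ p = real N"
proof -
  assume N: "1 \<le> N" and p: "1 \<le> p"
  have a: "(real N powr (- (real p - 1) / 2))\<^sup>2 = real N powr (- (real p - 1))"
    using N by (simp add: power2_eq_square powr_add[symmetric])
  have b: "real N ^ p = real N powr real p"
    using N by (simp add: powr_realpow)
  have "real N powr (- (real p - 1)) * real N powr real p = real N powr 1"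
    unfolding powr_add[symmetric] by simp
  then show ?thesis unfolding a b using N by simp
qed

text \<open>Formulated for any site set of size \<open>N\<close>, so that it serves the full system
  and the shifted blocks alike.\<close>

lemma cov_hc_card:
  assumes B: "finite B" "card B = N" and N: "1 \<le> N" "1 \<le> p"
  shows "cov (words B p) (hc p N \<beta>) (hc p N \<beta>) \<sigma> \<tau> = \<beta>\<^sup>2 / 2 * real N * ovl B \<sigma> \<tau> ^ p"
proof -
  let ?s = "real N powr (- (real p - 1) / 2)"
  have X: "(\<Sum>i\<in>B. \<sigma> ! i * \<tau> ! i) = real N * ovl B \<sigma> \<tau>" using B N by (simp add: ovl_def)
  have "cov (words B p) (hc p N \<beta>) (hc p N \<beta>) \<sigma> \<tau>
      = (\<beta> / sqrt 2 * ?s)\<^sup>2 * (\<Sum>is\<in>words B p. monomial \<sigma> is * monomial \<tau> is)"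
    unfolding cov_def hc_def sum_distrib_left by (intro sum.cong refl) (simp add: power2_eq_square mult_ac)
  also have "\<dots> = (\<beta> / sqrt 2)\<^sup>2 * (?s\<^sup>2 * (real N * ovl B \<sigma> \<tau>) ^ p)"
    unfolding power_mult_distrib[of "\<beta> / sqrt 2" ?s] sum_words_monomial[OF B(1)] X by simp
  also have "\<dots> = \<beta>\<^sup>2 / 2 * (?s\<^sup>2 * real N ^ p) * ovl B \<sigma> \<tau> ^ p"
    by (simp add: power_mult_distrib power_divide)
  finally show ?thesis by (simp only: hc_scale[OF N])
qed

lemmas cov_hc = cov_hc_card[OF finite_lessThan card_lessThan]

section \<open>Concentration of the log partition function\<close>

lemma zsum_pos: "finite S \<Longrightarrow> S \<noteq> {} \<Longrightarrow> \<forall>s\<in>S. 0 < w s \<Longrightarrow> 0 < zsum S w I a g"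
  unfolding zsum_def by (intro sum_pos) auto

lemma zN_pos: "0 < zN p N \<beta> g"
  unfolding zN_def by (rule zsum_pos) (auto simp: finite_spins spins_nonempty)

text \<open>The derivative of the log partition function in the \<open>j\<close>-th Gaussian is a
  Gibbs average of \<open>a j\<close>, hence bounded by \<open>c j\<close>.\<close>

lemma coord_lipschitz_ln_zsum:
  assumes S: "finite S" "S \<noteq> {}" "\<forall>s\<in>S. 0 < w s" and J: "finite J"
    and c: "\<And>j s. j \<in> J \<Longrightarrow> s \<in> S \<Longrightarrow> \<bar>a j s\<bar> \<le> c j"
  shows "coord_lipschitz J c (\<lambda>g. ln (zsum S w J a g))"
proof -
  interpret gibbs S w "1/2" using S by unfold_locales auto
  have z: "zsum S w J a g = pf (field J a g)" for g by (simp add: zsum_def pf_def)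
  obtain s0 where s0: "s0 \<in> S" using S by auto
  show ?thesis
    unfolding coord_lipschitz_def
  proof (intro conjI ballI allI impI)
    show "finite J" by fact
    show "(\<lambda>g. ln (zsum S w J a g)) \<in> borel_measurable gauss" by measurable
    show "0 \<le> c j" if "j \<in> J" for j using c[OF that s0] by linarith
    show "ln (zsum S w J a g) = ln (zsum S w J a g')" if "\<forall>j\<in>J. g j = g' j" for g g'
      using that by (simp add: zsum_def field_def)
    fix g j u v assume j: "j \<in> J"
    have d: "((\<lambda>x. ln (zsum S w J a (g(j := x)))) has_field_derivative
        (\<Sum>t\<in>S. pr (field J a (g(j := x))) t * a j t)) (at x)" for x
      unfolding z
      by (rule DERIV_cong[OF DERIV_chain2[OF DERIV_ln[OF pf_pos] pf_deriv[OF field_deriv[OF J j]]]])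
         (use pf_pos[of "field J a (g(j := x))"] in \<open>simp del: fun_upd_apply\<close>)
    have "norm (ln (zsum S w J a (g(j := u))) - ln (zsum S w J a (g(j := v)))) \<le> c j * norm (u - v)"
    proof (rule field_differentiable_bound[where S=UNIV])
      show "((\<lambda>x. ln (zsum S w J a (g(j := x)))) has_field_derivative
        (\<Sum>t\<in>S. pr (field J a (g(j := x))) t * a j t)) (at x within UNIV)" for x using d by simp
      fix x
      have "\<bar>\<Sum>t\<in>S. pr (field J a (g(j := x))) t * a j t\<bar> \<le> (\<Sum>t\<in>S. pr (field J a (g(j := x))) t * c j)"
        by (rule order.trans[OF sum_abs], rule sum_mono)
           (use pr_nonneg c[OF j] in \<open>auto simp: abs_mult intro!: mult_left_mono\<close>)
      also have "\<dots> = c j" by (simp only: sum_distrib_right[symmetric] sum_pr mult_1_left)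
      finally show "norm (\<Sum>t\<in>S. pr (field J a (g(j := x))) t * a j t) \<le> c j" by simp
    qed auto
    then show "\<bar>ln (zsum S w J a (g(j := u))) - ln (zsum S w J a (g(j := v)))\<bar> \<le> c j * \<bar>u - v\<bar>" by simp
  qed
qed

lemma exp_mean_le:
  fixes X :: "('i \<Rightarrow> real) \<Rightarrow> real"
  assumes "integrable gauss X" "integrable gauss (\<lambda>g. exp (X g))"
  shows "exp (\<integral>g. X g \<partial>gauss) \<le> (\<integral>g. exp (X g) \<partial>gauss)"
proof -
  let ?E = "\<integral>g. X g \<partial>gauss"
  have "exp ?E = (\<integral>g. exp ?E * (1 + (X g - ?E)) \<partial>gauss)"
    using assms(1) by (simp add: gauss.prob_space[simplified])
  also have "\<dots> \<le> (\<integral>g. exp (X g) \<partial>gauss)"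
  proof (rule integral_mono)
    fix g
    have "exp ?E * (1 + (X g - ?E)) \<le> exp ?E * exp (X g - ?E)" by (intro mult_left_mono exp_ge_add_one_self) auto
    then show "exp ?E * (1 + (X g - ?E)) \<le> exp (X g)" by (simp add: mult_exp_exp)
  qed (use assms in auto)
  finally show ?thesis .
qed

text \<open>Jensen's inequality below and Gaussian concentration above. With \<open>V\<close> of
  order N, small \<open>m\<close> recovers the mean logarithm up to order \<open>m\<close> per
  site.\<close>

lemma moment_bounds:
  assumes S: "finite S" "S \<noteq> {}" "\<forall>s\<in>S. 0 < w s" and m: "0 < m" "m < 1"
    and X: "coord_lipschitz J c (\<lambda>g. ln (zsum S w J a g))" and V: "(\<Sum>j\<in>J. (c j)\<^sup>2) \<le> V"
  shows "m * (\<integral>g. ln (zsum S w J a g) \<partial>gauss) \<le> ln (moment m S w J a)"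
    and "ln (moment m S w J a) \<le> m * (\<integral>g. ln (zsum S w J a g) \<partial>gauss) + m\<^sup>2 * V"
    and "0 < moment m S w J a"
proof -
  interpret gibbs S w m using S m by unfold_locales auto
  let ?E = "\<integral>g. ln (zsum S w J a g) \<partial>gauss"
  have e: "zsum S w J a g powr m = exp (m * ln (zsum S w J a g))" for g
    using zsum_pos[OF S, of J a g] by (simp add: powr_def)
  show pos: "0 < moment m S w J a" using tw_Nil_pos[of J a] by (simp add: tw_Nil)
  have iX: "integrable gauss (\<lambda>g. ln (zsum S w J a g))" by (rule integrable_tame[OF coord_lipschitz_tame[OF X]])
  have "tame (\<lambda>g. wt (field J a g) [])" by (rule tame_wt) simp
  then have "integrable gauss (\<lambda>g. zsum S w J a g powr m)"
    by (auto dest: integrable_tame simp: wt_def zsum_def pf_def)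
  then have ie: "integrable gauss (\<lambda>g. exp (m * ln (zsum S w J a g)))" by (simp only: e)
  have M: "moment m S w J a = (\<integral>g. exp (m * ln (zsum S w J a g)) \<partial>gauss)" by (simp only: moment_def e)
  have "exp (m * ?E) \<le> moment m S w J a"
    using exp_mean_le[OF _ ie] iX by (simp add: M)
  then show "m * ?E \<le> ln (moment m S w J a)" using pos by (simp add: ln_ge_iff)
  have "ennreal (moment m S w J a) = (\<integral>\<^sup>+g. ennreal (exp (m * ln (zsum S w J a g))) \<partial>gauss)"
    unfolding M by (rule nn_integral_eq_integral[symmetric, OF ie]) simp
  also have "\<dots> \<le> ennreal (exp (m * ?E + m\<^sup>2 * (\<Sum>j\<in>J. (c j)\<^sup>2)))"
    by (rule gauss_concentration[OF X])
  finally have "moment m S w J a \<le> exp (m * ?E + m\<^sup>2 * (\<Sum>j\<in>J. (c j)\<^sup>2))" by simp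
  also have "\<dots> \<le> exp (m * ?E + m\<^sup>2 * V)" using V by (auto intro: mult_left_mono)
  finally have "ln (moment m S w J a) \<le> ln (exp (m * ?E + m\<^sup>2 * V))" using pos by (subst ln_le_cancel_iff) auto
  then show "ln (moment m S w J a) \<le> m * ?E + m\<^sup>2 * V" by simp
qed

definition hcb :: "nat \<Rightarrow> nat \<Rightarrow> real \<Rightarrow> real" where
  "hcb p N \<beta> = \<bar>\<beta>\<bar> / sqrt 2 * real N powr (- (real p - 1) / 2)"

lemma abs_monomial: "\<sigma> \<in> spins N \<Longrightarrow> set is \<subseteq> {..<N} \<Longrightarrow> \<bar>monomial \<sigma> is\<bar> = 1"
proof (induction "is")
  case (Cons i "is")
  then show ?case using spins_nth[of \<sigma> N i] by (auto simp: monomial_def abs_mult)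
qed (simp add: monomial_def)

lemma coord_lipschitz_zN: "coord_lipschitz (words {..<N} p) (\<lambda>_. hcb p N \<beta>) (\<lambda>g. ln (zN p N \<beta> g))"
  unfolding zN_def
proof (rule coord_lipschitz_ln_zsum)
  show "finite (words {..<N} p)" by (simp add: finite_words)
  show "\<bar>hc p N \<beta> j s\<bar> \<le> hcb p N \<beta>" if "j \<in> words {..<N} p" "s \<in> spins N" for j s
    using that by (simp add: hc_def hcb_def abs_mult words_def abs_monomial)
qed (auto simp: finite_spins spins_nonempty)

lemma card_words: "finite A \<Longrightarrow> card (words A n) = card A ^ n"
  unfolding words_def using card_lists_length_eq[of A n] by (simp add: conj_commute)

lemma sum_hcb:
  assumes "1 \<le> N" "1 \<le> p"
  shows "(\<Sum>j\<in>words {..<N} p. (hcb p N \<beta>)\<^sup>2) = \<beta>\<^sup>2 / 2 * real N"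
proof -
  have "(\<Sum>j\<in>words {..<N} p. (hcb p N \<beta>)\<^sup>2) = \<beta>\<^sup>2 / 2 * ((real N powr (- (real p - 1) / 2))\<^sup>2 * real N ^ p)"
    by (simp add: card_words hcb_def power_mult_distrib power_divide)
  then show ?thesis by (simp only: hc_scale[OF assms])
qed

lemma zN_tail:
  assumes N: "1 \<le> N" "1 \<le> p" and \<beta>: "0 < \<beta>" and t: "0 \<le> t"
  shows "measure gauss {g. ln (zN p N \<beta> g) \<ge> en p N \<beta> + real N * t} \<le> exp (- real N * (t\<^sup>2 / (2 * \<beta>\<^sup>2)))"
    and "measure gauss {g. ln (zN p N \<beta> g) \<le> en p N \<beta> - real N * t} \<le> exp (- real N * (t\<^sup>2 / (2 * \<beta>\<^sup>2)))"
proof -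
  have V: "(\<Sum>j\<in>words {..<N} p. (hcb p N \<beta>)\<^sup>2) \<le> \<beta>\<^sup>2 / 2 * real N" by (simp only: sum_hcb[OF N])
  have V0: "0 < \<beta>\<^sup>2 / 2 * real N" using N \<beta> by simp
  have e: "- (real N * t)\<^sup>2 / (4 * (\<beta>\<^sup>2 / 2 * real N)) = - real N * (t\<^sup>2 / (2 * \<beta>\<^sup>2))"
    using N \<beta> by (simp add: field_simps power2_eq_square)
  show "measure gauss {g. ln (zN p N \<beta> g) \<ge> en p N \<beta> + real N * t} \<le> exp (- real N * (t\<^sup>2 / (2 * \<beta>\<^sup>2)))"
    "measure gauss {g. ln (zN p N \<beta> g) \<le> en p N \<beta> - real N * t} \<le> exp (- real N * (t\<^sup>2 / (2 * \<beta>\<^sup>2)))"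
    using gauss_tail_bound[OF coord_lipschitz_zN V V0, of "real N * t"] N t unfolding e en_def by auto
qed

text \<open>Exponential tails and Borel-Cantelli upgrade convergence of the means to almost sure
  convergence, and uniqueness of limits then resolves the definite description in
  \<open>free_energy\<close>.\<close>

lemma free_energy_eqI:
  assumes p: "1 \<le> p" and \<beta>: "0 < \<beta>" and lim: "(\<lambda>N. en p N \<beta> / real N) \<longlonglongrightarrow> c"
  shows "free_energy p \<beta> = c"
proof -
  have dev: "AE g in gauss. \<forall>\<^sub>F N in sequentially. \<bar>ln (zN p N \<beta> g) - en p N \<beta>\<bar> < real N / real (Suc k)" for k
  proof -
    define r where "r = (1 / real (Suc k))\<^sup>2 / (2 * \<beta>\<^sup>2)"
    have r: "0 < r" using \<beta> by (simp add: r_def)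
    define A where "A N = {g \<in> space gauss. real N / real (Suc k) \<le> \<bar>ln (zN p N \<beta> g) - en p N \<beta>\<bar>}" for N
    have m [measurable]: "zN p N \<beta> \<in> borel_measurable gauss" for N unfolding zN_def by measurable
    have A: "A N \<in> sets gauss" for N unfolding A_def by measurable
    have le: "measure gauss (A N) \<le> 2 * exp (- r) ^ N" if N: "1 \<le> N" for N
    proof -
      let ?U = "{g \<in> space gauss. ln (zN p N \<beta> g) \<ge> en p N \<beta> + real N * (1 / real (Suc k))}"
      let ?L = "{g \<in> space gauss. ln (zN p N \<beta> g) \<le> en p N \<beta> - real N * (1 / real (Suc k))}"
      have UL: "?U \<in> sets gauss" "?L \<in> sets gauss" by measurable
      have "A N \<subseteq> ?U \<union> ?L" unfolding A_def by (auto simp: abs_if split: if_splits)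
      then have "measure gauss (A N) \<le> measure gauss (?U \<union> ?L)"
        by (rule gauss.finite_measure_mono) (use UL in auto)
      also have "\<dots> \<le> measure gauss ?U + measure gauss ?L"
        by (rule measure_Un_le) (use UL in auto)
      also have "\<dots> \<le> exp (- real N * r) + exp (- real N * r)"
        unfolding r_def using zN_tail[OF N p \<beta>, of "1 / real (Suc k)"] by (intro add_mono) simp_all
      also have "\<dots> = 2 * exp (- r) ^ N" by (simp add: exp_of_nat_mult[symmetric])
      finally show ?thesis .
    qed
    have "summable (\<lambda>N. 2 * exp (- r) ^ N)" using r by (intro summable_mult summable_geometric) auto
    then have "summable (\<lambda>N. measure gauss (A N))"
      by (rule summable_comparison_test'[where N=1]) (use le in auto)
    then have "AE g in gauss. \<forall>\<^sub>F N in sequentially. g \<in> space gauss - A N"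
      by (intro borel_cantelli_AE1 A) (auto simp: gauss.emeasure_eq_measure)
    then show ?thesis
      by eventually_elim (auto elim!: eventually_mono simp: A_def not_le)
  qed
  have conv: "AE g in gauss. (\<lambda>N. free_energy_N p N \<beta> g) \<longlonglongrightarrow> c"
  proof -
    have "AE g in gauss. \<forall>k. \<forall>\<^sub>F N in sequentially. \<bar>ln (zN p N \<beta> g) - en p N \<beta>\<bar> < real N / real (Suc k)"
      using dev by (simp add: AE_all_countable)
    then show ?thesis
    proof eventually_elim
      fix g assume H: "\<forall>k. \<forall>\<^sub>F N in sequentially. \<bar>ln (zN p N \<beta> g) - en p N \<beta>\<bar> < real N / real (Suc k)"
      have "(\<lambda>N. free_energy_N p N \<beta> g - en p N \<beta> / real N) \<longlonglongrightarrow> 0"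
      proof (rule LIMSEQ_I)
        fix r :: real assume r: "0 < r"
        obtain k where k: "1 / real (Suc k) < r" using nat_approx_posE[OF r] by (metis of_nat_Suc)
        have "\<forall>\<^sub>F N in sequentially. norm (free_energy_N p N \<beta> g - en p N \<beta> / real N - 0) < r"
          using H[rule_format, of k] eventually_ge_at_top[of 1]
        proof eventually_elim
          case (elim N)
          have "norm (free_energy_N p N \<beta> g - en p N \<beta> / real N - 0) = \<bar>ln (zN p N \<beta> g) - en p N \<beta>\<bar> / real N"
            by (simp add: free_energy_N_eq diff_divide_distrib[symmetric])
          also have "\<dots> < real N / real (Suc k) / real N" using elim by (intro divide_strict_right_mono) auto
          also have "\<dots> < r" using elim k by simp
          finally show ?case .
        qed
        then show "\<exists>no. \<forall>n\<ge>no. norm (free_energy_N p n \<beta> g - en p n \<beta> / real n - 0) < r"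
          by (simp add: eventually_sequentially)
      qed
      from tendsto_add[OF this lim] show "(\<lambda>N. free_energy_N p N \<beta> g) \<longlonglongrightarrow> c" by simp
    qed
  qed
  show ?thesis
    unfolding free_energy_def disorder_eq_gauss
  proof (rule the_equality[where P="\<lambda>c. AE g in gauss. (\<lambda>N. free_energy_N p N \<beta> g) \<longlonglongrightarrow> c", OF conv])
    fix c' assume "AE g in gauss. (\<lambda>N. free_energy_N p N \<beta> g) \<longlonglongrightarrow> c'"
    with conv have "AE g in (gauss :: (nat list \<Rightarrow> real) measure). c' = c"
      by eventually_elim (blast intro: LIMSEQ_unique)
    then show "c' = c" by (simp only: gauss.AE_const)
  qed
qed

section \<open>The replica symmetric functional\<close>

lemma integral_gauss_component:
  fixes f :: "real \<Rightarrow> real"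
  assumes "tame (\<lambda>g :: 'i \<Rightarrow> real. f (g i))"
  shows "(\<integral>g. f (g i) \<partial>(gauss :: ('i \<Rightarrow> real) measure)) = (\<integral>x. f x \<partial>std_gauss)"
  by (subst integral_gauss_split(1)[where i=i, OF integrable_tame[OF assms]]) (simp add: gauss.prob_space[simplified])

lemma tame_component_bound:
  fixes f :: "real \<Rightarrow> real"
  assumes [measurable]: "f \<in> borel_measurable borel" and b: "\<And>x. \<bar>f x\<bar> \<le> C * exp (C * \<bar>x\<bar>)"
  shows "tame (\<lambda>g. f (g i))"
proof (rule tame_bound)
  show "tame (\<lambda>g. C * exp (C * (\<Sum>j\<in>{i}. \<bar>g j\<bar>)))" by (intro tame_mult tame_const tame_exp_abs) simp
  show "\<bar>f (g i)\<bar> \<le> C * exp (C * (\<Sum>j\<in>{i}. \<bar>g j\<bar>))" for g using b by simp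
qed measurable

text \<open>Heat equation: differentiating under the integral gives the mean of
  \<open>z * f' (y * z)\<close>, and integration by parts trades the factor \<open>z\<close> for a
  second derivative and a factor \<open>y\<close>.\<close>

lemma std_gauss_scale_deriv:
  fixes f f' f'' :: "real \<Rightarrow> real"
  assumes d: "\<And>x. (f has_field_derivative f' x) (at x)" "\<And>x. (f' has_field_derivative f'' x) (at x)"
    and c: "\<And>x. isCont f'' x"
    and b: "\<And>x. \<bar>f x\<bar> \<le> C * exp (C * \<bar>x\<bar>)" "\<And>x. \<bar>f' x\<bar> \<le> C * exp (C * \<bar>x\<bar>)" "\<And>x. \<bar>f'' x\<bar> \<le> C * exp (C * \<bar>x\<bar>)"
  shows "((\<lambda>y. \<integral>z. f (y * z) \<partial>std_gauss) has_field_derivative y * (\<integral>z. f'' (y * z) \<partial>std_gauss)) (at y)"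
proof -
  have C0: "0 \<le> C" using b(1)[of 0] by simp
  have cont: "isCont f x" "isCont f' x" for x using d DERIV_isCont by blast+
  have m [measurable]: "f \<in> borel_measurable borel" "f' \<in> borel_measurable borel" "f'' \<in> borel_measurable borel"
    using cont c by (auto intro!: borel_measurable_continuous_onI continuous_at_imp_continuous_on)
  let ?D = "\<lambda>y. C + C * \<bar>y\<bar>"
  have scale: "C * exp (C * \<bar>y * z\<bar>) \<le> ?D y * exp (?D y * \<bar>z\<bar>)" for y z
  proof (rule mult_mono)
    have "C * \<bar>y * z\<bar> = (C * \<bar>y\<bar>) * \<bar>z\<bar>" by (simp add: abs_mult)
    also have "\<dots> \<le> ?D y * \<bar>z\<bar>" using C0 by (intro mult_right_mono) auto
    finally show "exp (C * \<bar>y * z\<bar>) \<le> exp (?D y * \<bar>z\<bar>)" by simp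
  qed (use C0 in auto)
  \<comment> \<open>The one-dimensional law is taken as \<open>gauss\<close> over the index type
    \<open>unit\<close>, so that \<open>gauss_leibniz\<close> applies.\<close>
  have tf: "tame (\<lambda>g :: unit \<Rightarrow> real. f (y * g ()))" for y
    by (rule tame_component_bound[where f="\<lambda>z. f (y * z)" and C="?D y"]) (auto intro: order.trans[OF b(1) scale])
  let ?H = "\<lambda>g :: unit \<Rightarrow> real. \<bar>g ()\<bar> * (C * exp ((C * (\<bar>y\<bar> + 1)) * (\<Sum>j\<in>{()}. \<bar>g j\<bar>)))"
  have "((\<lambda>y. \<integral>g. f (y * g ()) \<partial>(gauss :: (unit \<Rightarrow> real) measure)) has_field_derivative
      (\<integral>g. g () * f' (y * g ()) \<partial>gauss)) (at y)"
  proof (rule gauss_leibniz[where lo="y - 1" and hi="y + 1" and H="?H"])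
    show "integrable gauss (\<lambda>g. f (v * g ()))" for v by (rule integrable_tame[OF tf])
    show "(\<lambda>g. g () * f' (y * g ())) \<in> borel_measurable gauss" by measurable
    show "((\<lambda>v. f (v * g ())) has_real_derivative g () * f' (v * g ())) (at v)" for v and g :: "unit \<Rightarrow> real"
      by (rule DERIV_cong[OF DERIV_chain2[OF d(1) DERIV_cmult_right[OF DERIV_ident]]]) simp
    show "integrable gauss ?H"
      by (intro integrable_tame tame_mult tame_abs tame_component tame_const tame_exp_abs) simp
    fix v and g :: "unit \<Rightarrow> real" assume v: "y - 1 < v" "v < y + 1"
    have "\<bar>f' (v * g ())\<bar> \<le> C * exp (C * \<bar>v * g ()\<bar>)" by (rule b)
    also have "\<dots> \<le> C * exp ((C * (\<bar>y\<bar> + 1)) * \<bar>g ()\<bar>)"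
    proof -
      have "\<bar>v\<bar> * \<bar>g ()\<bar> \<le> (\<bar>y\<bar> + 1) * \<bar>g ()\<bar>" using v by (intro mult_right_mono) auto
      then have "C * (\<bar>v\<bar> * \<bar>g ()\<bar>) \<le> C * ((\<bar>y\<bar> + 1) * \<bar>g ()\<bar>)" using C0 by (rule mult_left_mono)
      then show ?thesis using C0 by (intro mult_left_mono) (auto simp: abs_mult mult.assoc)
    qed
    finally show "\<bar>g () * f' (v * g ())\<bar> \<le> ?H g"
      by (simp add: abs_mult mult_left_mono)
  qed auto
  moreover have "(\<integral>g. f (y * g ()) \<partial>(gauss :: (unit \<Rightarrow> real) measure)) = (\<integral>z. f (y * z) \<partial>std_gauss)" for y
    by (rule integral_gauss_component[OF tf])
  moreover have "(\<integral>g. g () * f' (y * g ()) \<partial>(gauss :: (unit \<Rightarrow> real) measure)) = y * (\<integral>z. f'' (y * z) \<partial>std_gauss)"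
  proof -
    have t: "tame (\<lambda>g :: unit \<Rightarrow> real. g () * f' (y * g ()))"
      by (intro tame_mult tame_component tame_component_bound[where f="\<lambda>z. f' (y * z)" and C="?D y"])
         (auto intro: order.trans[OF b(2) scale])
    have "(\<integral>g. g () * f' (y * g ()) \<partial>(gauss :: (unit \<Rightarrow> real) measure)) = (\<integral>z. z * f' (y * z) \<partial>std_gauss)"
      by (rule integral_gauss_component[OF t])
    also have "\<dots> = (\<integral>z. y * f'' (y * z) \<partial>std_gauss)"
    proof (rule std_gauss_ibp[where C="(1 + \<bar>y\<bar>) * ?D y"])
      show "((\<lambda>z. f' (y * z)) has_real_derivative y * f'' (y * z)) (at z)" for z
        by (rule DERIV_cong[OF DERIV_chain2[OF d(2) DERIV_cmult[OF DERIV_ident]]]) simp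
      show "isCont (\<lambda>z. y * f'' (y * z)) z" for z
        by (intro continuous_intros isCont_o2[OF _ c])
      have big: "k * (?D y * exp (?D y * \<bar>z\<bar>)) \<le> (1 + \<bar>y\<bar>) * ?D y * exp ((1 + \<bar>y\<bar>) * ?D y * \<bar>z\<bar>)"
        if "0 \<le> k" "k \<le> 1 + \<bar>y\<bar>" for k z
      proof -
        have D0: "0 \<le> ?D y" using C0 by simp
        have "1 * ?D y \<le> (1 + \<bar>y\<bar>) * ?D y" using D0 by (intro mult_right_mono) auto
        then have "?D y * \<bar>z\<bar> \<le> (1 + \<bar>y\<bar>) * ?D y * \<bar>z\<bar>" by (intro mult_right_mono) auto
        then have "k * ?D y * exp (?D y * \<bar>z\<bar>) \<le> ((1 + \<bar>y\<bar>) * ?D y) * exp ((1 + \<bar>y\<bar>) * ?D y * \<bar>z\<bar>)"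
          using that D0 by (intro mult_mono) (auto intro: mult_nonneg_nonneg)
        then show ?thesis by (simp add: mult.assoc)
      qed
      show "\<bar>f' (y * z)\<bar> \<le> (1 + \<bar>y\<bar>) * ?D y * exp ((1 + \<bar>y\<bar>) * ?D y * \<bar>z\<bar>)" for z
        using order.trans[OF order.trans[OF b(2)[of "y * z"] scale] big[of 1 z, simplified]] by simp
      show "\<bar>y * f'' (y * z)\<bar> \<le> (1 + \<bar>y\<bar>) * ?D y * exp ((1 + \<bar>y\<bar>) * ?D y * \<bar>z\<bar>)" for z
      proof -
        have "\<bar>y * f'' (y * z)\<bar> \<le> \<bar>y\<bar> * (?D y * exp (?D y * \<bar>z\<bar>))"
          unfolding abs_mult by (intro mult_left_mono order.trans[OF b(3) scale]) auto
        also have "\<dots> \<le> (1 + \<bar>y\<bar>) * ?D y * exp ((1 + \<bar>y\<bar>) * ?D y * \<bar>z\<bar>)" by (rule big) auto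
        finally show ?thesis .
      qed
    qed
    finally show ?thesis by simp
  qed
  ultimately show ?thesis by simp
qed

definition lncosh :: "real \<Rightarrow> real" where "lncosh x = ln (cosh x)"

definition sechm :: "real \<Rightarrow> real" where
  "sechm y = (\<integral>z. 1 / cosh (y * z) \<partial>std_gauss)"

text \<open>\<open>rho\<close> as a function of the field strength
  \<open>y = \<beta> * sqrt (xi' p s)\<close>; it results from
  \<open>(tanh x)\<^sup>2 * cosh x = cosh x - 1 / cosh x\<close>.\<close>

definition hh :: "real \<Rightarrow> real" where
  "hh y = 1 - exp (- y\<^sup>2 / 2) * sechm y"

definition At :: "real \<Rightarrow> real" where
  "At y = exp (- y\<^sup>2 / 2) * (\<integral>z. cosh (y * z) * lncosh (y * z) \<partial>std_gauss)"

section \<open>Hyperbolic functions under the Gaussian law\<close>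

lemma cosh_le_exp_abs: "cosh x \<le> exp \<bar>x::real\<bar>"
proof -
  have "exp x \<le> exp \<bar>x\<bar>" "exp (- x) \<le> exp \<bar>x\<bar>" by auto
  then have "exp x + exp (- x) \<le> 2 * exp \<bar>x\<bar>" by linarith
  then show ?thesis by (simp add: cosh_def)
qed

lemma abs_sinh_le_cosh: "\<bar>sinh x\<bar> \<le> cosh (x::real)"
  using exp_ge_zero[of x] exp_ge_zero[of "- x"] by (simp add: sinh_def cosh_def abs_le_iff)

lemma lncosh_nonneg: "0 \<le> lncosh x"
  unfolding lncosh_def using cosh_real_ge_1[of x] by simp

lemma lncosh_le: "lncosh x \<le> \<bar>x\<bar>"
proof -
  have "ln (cosh x) \<le> ln (exp \<bar>x\<bar>)" by (subst ln_le_cancel_iff) (auto intro: cosh_le_exp_abs)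
  then show ?thesis by (simp add: lncosh_def)
qed

lemma exp_lncosh: "exp (lncosh x) = cosh x"
  by (simp add: lncosh_def)

lemma cosh_powr: "cosh x powr m = exp (m * lncosh x)"
  by (simp add: powr_def lncosh_def)

lemma measurable_lncosh [measurable]: "lncosh \<in> borel_measurable borel"
  unfolding lncosh_def[abs_def] by (intro borel_measurable_continuous_onI continuous_intros) auto

lemma measurable_cosh [measurable]: "(cosh :: real \<Rightarrow> real) \<in> borel_measurable borel"
  by (intro borel_measurable_continuous_onI continuous_intros)

lemma lncosh_deriv: "(lncosh has_field_derivative tanh x) (at x)"
  unfolding lncosh_def[abs_def] by (auto intro!: derivative_eq_intros simp: tanh_def)

lemma integrable_exp_bound_scaled:
  fixes f :: "real \<Rightarrow> real"
  assumes "f \<in> borel_measurable borel" "\<And>x. \<bar>f x\<bar> \<le> A * exp (B * \<bar>x\<bar>)"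
  shows "integrable std_gauss f"
proof (rule Bochner_Integration.integrable_bound)
  show "integrable std_gauss (\<lambda>x. A * exp (B * \<bar>x\<bar>))" using integrable_exp_abs_std_gauss by auto
  show "AE x in std_gauss. norm (f x) \<le> norm (A * exp (B * \<bar>x\<bar>))"
    using order.trans[OF assms(2) abs_ge_self] by (intro AE_I2) simp
qed (use assms in \<open>simp add: measurable_from_std_gauss\<close>)

lemma integrable_cosh: "integrable std_gauss (\<lambda>z. cosh (y * z))"
  by (rule integrable_exp_bound_scaled[where A=1 and B="\<bar>y\<bar>"])
     (use cosh_le_exp_abs in \<open>auto simp: abs_mult[symmetric]\<close>)

lemma integrable_sech: "integrable std_gauss (\<lambda>z. 1 / cosh (y * z))"
  by (rule integrable_exp_bound_scaled[where A=1 and B=0]) (auto simp: cosh_real_ge_1)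

lemma integral_cosh: "(\<integral>z. cosh (y * z) \<partial>std_gauss) = exp (y\<^sup>2 / 2)"
proof -
  have "(\<integral>z. cosh (y * z) \<partial>std_gauss) = (\<integral>z. 1 / 2 * exp (y * z) + 1 / 2 * exp (- y * z) \<partial>std_gauss)"
    by (intro Bochner_Integration.integral_cong refl) (simp add: cosh_def)
  also have "\<dots> = exp (y\<^sup>2 / 2)"
    using integral_exp_std_gauss[of y] integral_exp_std_gauss[of "- y"]
      integrable_exp_std_gauss[of y] integrable_exp_std_gauss[of "- y"] by simp
  finally show ?thesis .
qed

lemma rho_eq_hh:
  assumes "0 \<le> s"
  shows "rho p \<beta> s = hh (\<beta> * sqrt (xi' p s))"
proof -
  let ?y = "\<beta> * sqrt (xi' p s)"
  have x0: "0 \<le> xi' p s" using assms by (simp add: xi'_def)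
  have y2: "?y\<^sup>2 = \<beta>\<^sup>2 * xi' p s" using x0 by (simp add: power_mult_distrib)
  have e: "(tanh x)\<^sup>2 * cosh x = cosh x - 1 / cosh (x::real)" for x
  proof -
    have "(tanh x)\<^sup>2 * cosh x = (sinh x)\<^sup>2 / cosh x" by (simp add: tanh_def power2_eq_square)
    also have "(sinh x)\<^sup>2 = (cosh x)\<^sup>2 - 1" by (simp add: cosh_square_eq)
    also have "((cosh x)\<^sup>2 - 1) / cosh x = cosh x - 1 / cosh x" by (simp add: power2_eq_square diff_divide_distrib)
    finally show ?thesis .
  qed
  have "rho p \<beta> s = (\<integral>g. cosh (?y * g) - 1 / cosh (?y * g) \<partial>std_gauss) * exp (- ?y\<^sup>2 / 2)"
  proof -
    have "\<beta> * g * sqrt (xi' p s) = ?y * g" for g by simp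
    then show ?thesis unfolding rho_def y2 by (simp only: e) simp
  qed
  also have "(\<integral>g. cosh (?y * g) - 1 / cosh (?y * g) \<partial>std_gauss) = exp (?y\<^sup>2 / 2) - sechm ?y"
    unfolding sechm_def by (subst Bochner_Integration.integral_diff[OF integrable_cosh integrable_sech]) (simp only: integral_cosh)
  finally show ?thesis by (simp add: hh_def algebra_simps mult_exp_exp)
qed

lemma sechm_pos: "0 < sechm y" and sechm_ge: "exp (- y\<^sup>2 / 2) \<le> sechm y" and sechm_le: "sechm y \<le> 1"
proof -
  let ?c = "exp (y\<^sup>2 / 2)"
  \<comment> \<open>Jensen's inequality for the reciprocal: its tangent line is taken at
    \<open>?c\<close>, which is the mean of \<open>cosh (y * z)\<close>.\<close>
  have "1 / ?c = (\<integral>z. 2 / ?c - cosh (y * z) / ?c\<^sup>2 \<partial>std_gauss)"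
  proof -
    have "(\<integral>z. 2 / ?c - cosh (y * z) / ?c\<^sup>2 \<partial>std_gauss) = 2 / ?c - ?c / ?c\<^sup>2"
      using integrable_cosh[of y] integral_cosh[of y] by (simp add: std_gauss.prob_space[simplified])
    also have "\<dots> = 1 / ?c" by (simp add: power2_eq_square diff_divide_distrib[symmetric])
    finally show ?thesis by simp
  qed
  also have "\<dots> \<le> sechm y"
    unfolding sechm_def
  proof (rule integral_mono)
    fix z
    have "0 \<le> (?c - cosh (y * z))\<^sup>2" by simp
    then have "2 * ?c * cosh (y * z) - (cosh (y * z))\<^sup>2 \<le> ?c\<^sup>2" unfolding power2_diff by linarith
    then show "2 / ?c - cosh (y * z) / ?c\<^sup>2 \<le> 1 / cosh (y * z)"
      by (simp add: field_simps power2_eq_square)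
  qed (use integrable_cosh integrable_sech in auto)
  finally have "1 / ?c \<le> sechm y" .
  moreover have "exp (- y\<^sup>2 / 2) = 1 / ?c" using exp_minus[of "y\<^sup>2 / 2"] by (simp add: inverse_eq_divide)
  ultimately show ge: "exp (- y\<^sup>2 / 2) \<le> sechm y" by (simp only:)
  show "0 < sechm y" using ge exp_gt_zero[of "- y\<^sup>2 / 2"] by linarith
  have "sechm y \<le> (\<integral>z. 1 \<partial>std_gauss)"
    unfolding sechm_def by (rule integral_mono[OF integrable_sech]) (auto simp: cosh_real_ge_1)
  then show "sechm y \<le> 1" by (simp add: std_gauss.prob_space[simplified])
qed

lemma sechm_antimono:
  assumes "0 \<le> x" "x \<le> y"
  shows "sechm y \<le> sechm x"
  unfolding sechm_def
proof (rule integral_mono[OF integrable_sech integrable_sech])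
  fix z
  have "cosh (x * z) \<le> cosh (y * z)"
  proof -
    have "cosh \<bar>x * z\<bar> \<le> cosh \<bar>y * z\<bar>"
      using assms by (subst cosh_real_nonneg_le_iff) (auto simp: abs_mult intro: mult_right_mono)
    then show ?thesis by simp
  qed
  then show "1 / cosh (y * z) \<le> 1 / cosh (x * z)" by (intro divide_left_mono) auto
qed

text \<open>Both factors of the subtracted product decrease in \<open>y\<close>; the exponential one
  does so strictly.\<close>

lemma hh_strict_mono:
  assumes "0 \<le> x" "x < y"
  shows "hh x < hh y"
proof -
  have "exp (- y\<^sup>2 / 2) < exp (- x\<^sup>2 / 2)" using power_strict_mono[of x y 2] assms by simp
  then have "exp (- y\<^sup>2 / 2) * sechm y < exp (- x\<^sup>2 / 2) * sechm y" using sechm_pos by simp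
  also have "\<dots> \<le> exp (- x\<^sup>2 / 2) * sechm x" using sechm_antimono[of x y] assms by simp
  finally show ?thesis by (simp add: hh_def)
qed

lemma hh_le_square: "hh y \<le> y\<^sup>2"
proof -
  have "exp (- y\<^sup>2 / 2) * exp (- y\<^sup>2 / 2) \<le> exp (- y\<^sup>2 / 2) * sechm y" by (intro mult_left_mono sechm_ge) auto
  then have "hh y \<le> 1 - exp (- y\<^sup>2)" by (simp add: hh_def mult_exp_exp)
  also have "\<dots> \<le> y\<^sup>2" using exp_ge_add_one_self[of "- y\<^sup>2"] by simp
  finally show ?thesis .
qed

lemma hh_ge: "1 - exp (- y\<^sup>2 / 2) \<le> hh y"
  using mult_left_mono[OF sechm_le, of "exp (- y\<^sup>2 / 2)" y] by (simp add: hh_def)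

lemma sechm_isCont: "isCont sechm y"
  unfolding continuous_at_sequentially
proof (intro allI impI)
  fix X assume X: "X \<longlonglongrightarrow> y"
  show "(sechm \<circ> X) \<longlonglongrightarrow> sechm y"
    unfolding sechm_def comp_def
  proof (rule integral_dominated_convergence[where w="\<lambda>_. 1"])
    show "AE z in std_gauss. (\<lambda>i. 1 / cosh (X i * z)) \<longlonglongrightarrow> 1 / cosh (y * z)"
      by (intro AE_I2 tendsto_intros X) auto
    show "AE z in std_gauss. norm (1 / cosh (X i * z)) \<le> 1" for i
      by (intro AE_I2) (auto simp: cosh_real_ge_1)
  qed (use integrable_sech in auto)
qed

lemma hh_isCont: "isCont hh y"
  unfolding hh_def[abs_def] by (intro continuous_intros sechm_isCont) auto

text \<open>For \<open>?f = cosh * lncosh\<close> the second derivative is \<open>?f\<close> plus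
  \<open>2 * cosh - 1 / cosh\<close>. By the heat equation the \<open>?f\<close> part cancels
  against the derivative of the Gaussian prefactor, and the remainder is \<open>1 + hh y\<close>
  times \<open>y\<close>.\<close>

lemma At_deriv: "(At has_field_derivative y * (1 + hh y)) (at y)"
proof -
  let ?f = "\<lambda>x. cosh x * lncosh x" and ?f' = "\<lambda>x. sinh x * lncosh x + sinh x"
    and ?f'' = "\<lambda>x. cosh x * lncosh x + (2 * cosh x - 1 / cosh x :: real)"
  have d1: "(?f has_field_derivative ?f' x) (at x)" for x
    by (rule DERIV_cong[OF DERIV_mult[OF _ lncosh_deriv]]) (auto intro!: derivative_eq_intros simp: tanh_def)
  have d2: "(?f' has_field_derivative ?f'' x) (at x)" for x
  proof -
    have eq: "tanh x * sinh x = cosh x - 1 / cosh x"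
    proof -
      have "tanh x * sinh x = (sinh x)\<^sup>2 / cosh x" by (simp add: tanh_def power2_eq_square)
      also have "(sinh x)\<^sup>2 = (cosh x)\<^sup>2 - 1" by (simp add: cosh_square_eq)
      also have "((cosh x)\<^sup>2 - 1) / cosh x = cosh x - 1 / cosh x" by (simp add: power2_eq_square diff_divide_distrib)
      finally show ?thesis .
    qed
    have "(?f' has_field_derivative (cosh x * lncosh x + tanh x * sinh x) + cosh x) (at x)"
      by (intro DERIV_add DERIV_mult lncosh_deriv) (auto intro!: derivative_eq_intros)
    then show ?thesis by (rule DERIV_cong) (simp add: eq)
  qed
  have b1: "\<bar>lncosh x\<bar> \<le> exp \<bar>x\<bar>" for x
    using lncosh_nonneg[of x] lncosh_le[of x] abs_le_exp[of x] by linarith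
  have c1: "\<bar>cosh x\<bar> \<le> exp \<bar>x\<bar>" "\<bar>sinh x\<bar> \<le> exp \<bar>x\<bar>" for x :: real
    using cosh_le_exp_abs[of x] abs_sinh_le_cosh[of x] by auto
  have e2: "exp \<bar>x\<bar> * exp \<bar>x\<bar> \<le> exp (4 * \<bar>x\<bar>)" "exp \<bar>x\<bar> \<le> exp (4 * \<bar>x\<bar>)" "1 \<le> exp (4 * \<bar>x\<bar>)" for x :: real
    by (auto simp: mult_exp_exp)
  have p1: "\<bar>cosh x * lncosh x\<bar> \<le> exp (4 * \<bar>x\<bar>)" "\<bar>sinh x * lncosh x\<bar> \<le> exp (4 * \<bar>x\<bar>)" for x
    unfolding abs_mult by (rule order.trans[OF mult_mono[OF c1(1) b1] e2(1)]; simp)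
      (rule order.trans[OF mult_mono[OF c1(2) b1] e2(1)]; simp)
  have "((\<lambda>y. \<integral>z. ?f (y * z) \<partial>std_gauss) has_field_derivative y * (\<integral>z. ?f'' (y * z) \<partial>std_gauss)) (at y)"
  proof (rule std_gauss_scale_deriv[OF d1 d2, where C=4])
    have "isCont lncosh x" for x by (rule DERIV_isCont[OF lncosh_deriv])
    then show "isCont ?f'' x" for x by (intro continuous_intros) auto
    show "\<bar>?f x\<bar> \<le> 4 * exp (4 * \<bar>x\<bar>)" for x using p1(1)[of x] e2(3)[of x] by linarith
    show "\<bar>?f' x\<bar> \<le> 4 * exp (4 * \<bar>x\<bar>)" for x using p1(2)[of x] c1(2)[of x] e2(2,3)[of x] by linarith
    show "\<bar>?f'' x\<bar> \<le> 4 * exp (4 * \<bar>x\<bar>)" for x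
    proof -
      have "1 / cosh x \<le> 1" "0 \<le> 1 / cosh x" using cosh_real_ge_1[of x] by auto
      then show ?thesis using p1(1)[of x] c1(1)[of x] e2(2,3)[of x] cosh_real_ge_1[of x] by linarith
    qed
  qed
  moreover have "((\<lambda>y. exp (- y\<^sup>2 / 2)) has_field_derivative (- y * exp (- y\<^sup>2 / 2))) (at y)"
    by (auto intro!: derivative_eq_intros)
  ultimately have "(At has_field_derivative (- y * exp (- y\<^sup>2 / 2)) * (\<integral>z. ?f (y * z) \<partial>std_gauss)
      + (y * (\<integral>z. ?f'' (y * z) \<partial>std_gauss)) * exp (- y\<^sup>2 / 2)) (at y)"
    unfolding At_def[abs_def] by (intro DERIV_mult)
  moreover have "(\<integral>z. ?f'' (y * z) \<partial>std_gauss) = (\<integral>z. ?f (y * z) \<partial>std_gauss) + (2 * exp (y\<^sup>2 / 2) - sechm y)"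
  proof -
    have i: "integrable std_gauss (\<lambda>z. ?f (y * z))"
    proof (rule integrable_exp_bound_scaled[where A=1 and B="4 * \<bar>y\<bar>"])
      show "\<bar>?f (y * z)\<bar> \<le> 1 * exp (4 * \<bar>y\<bar> * \<bar>z\<bar>)" for z using p1(1)[of "y * z"] by (simp add: abs_mult mult.assoc)
    qed measurable
    have i2: "integrable std_gauss (\<lambda>z. 2 * cosh (y * z) - 1 / cosh (y * z))"
      using integrable_cosh integrable_sech by auto
    have "(\<integral>z. 2 * cosh (y * z) - 1 / cosh (y * z) \<partial>std_gauss) = 2 * exp (y\<^sup>2 / 2) - sechm y"
      unfolding sechm_def using integrable_cosh[of y] integrable_sech[of y]
      by (subst Bochner_Integration.integral_diff) (auto simp: integral_cosh)
    then show ?thesis by (subst Bochner_Integration.integral_add[OF i i2]) simp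
  qed
  moreover have "(- y * E) * F + (y * (F + (2 * E' - s))) * E = y * (1 + (1 - E * s))" if "E * E' = 1" for E E' F s
  proof -
    have "(- y * E) * F + (y * (F + (2 * E' - s))) * E = y * (2 * (E * E') - E * s)" by (simp add: algebra_simps)
    then show ?thesis by (simp add: that)
  qed
  from this[of "exp (- y\<^sup>2 / 2)" "exp (y\<^sup>2 / 2)" "\<integral>z. ?f (y * z) \<partial>std_gauss" "sechm y"]
  have "(- y * exp (- y\<^sup>2 / 2)) * (\<integral>z. ?f (y * z) \<partial>std_gauss)
      + (y * ((\<integral>z. ?f (y * z) \<partial>std_gauss) + (2 * exp (y\<^sup>2 / 2) - sechm y))) * exp (- y\<^sup>2 / 2) = y * (1 + hh y)"
    by (simp add: mult_exp_exp hh_def)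
  ultimately show ?thesis by simp
qed

section \<open>The functional as an antiderivative\<close>

definition theta :: "nat \<Rightarrow> real \<Rightarrow> real" where
  "theta p u = u * xi' p u - xi p u"

definition PhiRS :: "nat \<Rightarrow> real \<Rightarrow> real \<Rightarrow> real" where
  "PhiRS p \<beta> u = At (\<beta> * sqrt (xi' p u)) - \<beta>\<^sup>2 / 2 * (xi' p u + theta p u)"

lemma xi_deriv: "2 \<le> p \<Longrightarrow> (xi p has_field_derivative xi' p s) (at s)"
  unfolding xi_def[abs_def] xi'_def by (auto intro!: derivative_eq_intros)

lemma xi'_deriv: "2 \<le> p \<Longrightarrow> (xi' p has_field_derivative xi'' p s) (at s)"
  unfolding xi'_def[abs_def] xi''_def
  by (auto intro!: derivative_eq_intros simp: of_nat_diff numeral_2_eq_2)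

lemma theta_deriv: "2 \<le> p \<Longrightarrow> (theta p has_field_derivative s * xi'' p s) (at s)"
  unfolding theta_def[abs_def]
  by (rule DERIV_cong[OF DERIV_diff[OF DERIV_mult[OF DERIV_ident xi'_deriv] xi_deriv]]) auto

lemma theta_eq: "1 \<le> p \<Longrightarrow> theta p u = (real p - 1) * u ^ p / 2"
  by (cases p) (auto simp: theta_def xi_def xi'_def field_simps)

lemma At_0: "At 0 = 0"
  by (simp add: At_def lncosh_def)

lemma PhiRS_integral:
  assumes p: "2 \<le> p" and \<beta>: "0 < \<beta>" and r: "0 \<le> r"
  shows "((\<lambda>s. xi'' p s * (rho p \<beta> s - s)) has_integral (2 / \<beta>\<^sup>2 * PhiRS p \<beta> r)) {0..r}"
proof -
  have cx: "continuous_on A (xi p)" "continuous_on A (xi' p)" "continuous_on A (theta p)" for A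
    using p DERIV_isCont[OF xi_deriv] DERIV_isCont[OF xi'_deriv] DERIV_isCont[OF theta_deriv]
    by (auto intro!: continuous_at_imp_continuous_on)
  have cA: "continuous_on UNIV At"
    using DERIV_isCont[OF At_deriv] by (auto intro!: continuous_at_imp_continuous_on)
  have z: "xi' p 0 = 0" "theta p 0 = 0" using p by (simp_all add: xi'_def theta_def xi_def)
  have "((\<lambda>s. \<beta>\<^sup>2 / 2 * (xi'' p s * (rho p \<beta> s - s))) has_integral (PhiRS p \<beta> r - PhiRS p \<beta> 0)) {0..r}"
  \<comment> \<open>The interior version is used because \<open>sqrt (xi' p s)\<close> need not be
    differentiable at 0, for instance when \<open>p = 2\<close>.\<close>
  proof (rule fundamental_theorem_of_calculus_interior[OF r])
    show "continuous_on {0..r} (PhiRS p \<beta>)"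
      unfolding PhiRS_def[abs_def] by (intro continuous_intros continuous_on_compose2[OF cA] cx) auto
    fix s assume s: "s \<in> {0<..<r}"
    have x0: "0 < xi' p s" using s p by (simp add: xi'_def)
    let ?y = "\<beta> * sqrt (xi' p s)"
    have dy: "((\<lambda>s. \<beta> * sqrt (xi' p s)) has_field_derivative \<beta> * (inverse (sqrt (xi' p s)) / 2 * xi'' p s)) (at s)"
      by (intro DERIV_cmult DERIV_chain2[OF DERIV_real_sqrt[OF x0] xi'_deriv[OF p]])
    have dA: "((\<lambda>s. At (\<beta> * sqrt (xi' p s))) has_field_derivative
        ?y * (1 + hh ?y) * (\<beta> * (inverse (sqrt (xi' p s)) / 2 * xi'' p s))) (at s)"
      by (rule DERIV_chain2[OF At_deriv dy])
    have d: "(PhiRS p \<beta> has_field_derivative ?y * (1 + hh ?y) * (\<beta> * (inverse (sqrt (xi' p s)) / 2 * xi'' p s))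
        - \<beta>\<^sup>2 / 2 * (xi'' p s + s * xi'' p s)) (at s)"
      unfolding PhiRS_def[abs_def]
      by (intro DERIV_diff dA DERIV_cmult DERIV_add xi'_deriv theta_deriv p)
    have e: "?y * (1 + hh ?y) * (\<beta> * (inverse (sqrt (xi' p s)) / 2 * xi'' p s))
        = \<beta>\<^sup>2 / 2 * (xi'' p s * (1 + hh ?y))"
    proof -
      have "(\<beta> * q) * h * (\<beta> * (inverse q / 2 * x)) = \<beta>\<^sup>2 / 2 * (x * h)" if "q \<noteq> 0" for q h x
        using that by (simp add: field_simps power2_eq_square)
      then show ?thesis using x0 by simp
    qed
    have r: "rho p \<beta> s = hh ?y" using s by (intro rho_eq_hh) auto
    have alg: "c * (x * (1 + h)) - c * (x + s * x) = c * (x * (h - s))" for c x h :: real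
      by (simp add: algebra_simps)
    show "(PhiRS p \<beta> has_vector_derivative \<beta>\<^sup>2 / 2 * (xi'' p s * (rho p \<beta> s - s))) (at s)"
      unfolding has_real_derivative_iff_has_vector_derivative[symmetric]
      by (rule DERIV_cong[OF d]) (simp only: e r alg)
  qed
  from has_integral_mult_right[OF this, of "2 / \<beta>\<^sup>2"] show ?thesis
    using \<beta> by (simp add: PhiRS_def[of p \<beta> 0] z At_0)
qed

section \<open>Moments of cosh with exponent near one and near zero\<close>

lemma exp_minus_le_quadratic:
  fixes x :: real
  assumes "0 \<le> x"
  shows "exp (- x) \<le> 1 - x + x\<^sup>2 / 2"
proof -
  have q: "1 + x + x\<^sup>2 / 2 \<le> exp x" by (rule exp_lower_Taylor_quadratic[OF assms])
  have p: "0 \<le> 1 - x + x\<^sup>2 / 2" using zero_le_power2[of "x - 1"] by (simp add: power2_diff)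
  \<comment> \<open>The claimed bound times the quadratic Taylor polynomial of \<open>exp x\<close>
    is one plus a square, and that polynomial is at most \<open>exp x\<close>.\<close>
  have "1 \<le> 1 + (x\<^sup>2 / 2)\<^sup>2" by simp
  also have "\<dots> = (1 - x + x\<^sup>2 / 2) * (1 + x + x\<^sup>2 / 2)" by (simp add: power2_eq_square algebra_simps)
  also have "\<dots> \<le> (1 - x + x\<^sup>2 / 2) * exp x" by (intro mult_left_mono q p)
  finally have "exp (- x) * 1 \<le> exp (- x) * ((1 - x + x\<^sup>2 / 2) * exp x)" by (intro mult_left_mono) auto
  also have "\<dots> = (1 - x + x\<^sup>2 / 2) * (exp (- x) * exp x)" by simp
  also have "\<dots> = 1 - x + x\<^sup>2 / 2" by (simp add: mult_exp_exp)
  finally show ?thesis by simp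
qed

lemma exp_le_quadratic:
  fixes x :: real
  assumes "0 \<le> x"
  shows "exp x \<le> 1 + x + x\<^sup>2 * exp x"
proof -
  have a: "exp x - 1 \<le> x * exp x"
  proof -
    have "(1 - x) * exp x \<le> exp (- x) * exp x" using exp_ge_add_one_self[of "- x"] by (intro mult_right_mono) auto
    then show ?thesis by (simp add: mult_exp_exp algebra_simps)
  qed
  have "exp x - 1 - x \<le> x * exp x - x * 1" using a by simp
  also have "\<dots> = x * (exp x - 1)" by (simp add: algebra_simps)
  also have "\<dots> \<le> x * (x * exp x)" using assms by (intro mult_left_mono a)
  finally show ?thesis by (simp add: power2_eq_square)
qed

lemma integrable_cosh_lncosh: "integrable std_gauss (\<lambda>z. cosh (y * z) * lncosh (y * z) ^ k)"
proof (rule integrable_exp_bound_scaled[where A=1 and B="(1 + real k) * \<bar>y\<bar>"])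
  fix z
  have b: "lncosh x \<le> exp \<bar>x\<bar>" for x using lncosh_le[of x] abs_le_exp[of x] by linarith
  have "cosh (y * z) * lncosh (y * z) ^ k \<le> exp \<bar>y * z\<bar> * exp \<bar>y * z\<bar> ^ k"
    by (intro mult_mono power_mono cosh_le_exp_abs b lncosh_nonneg) (auto simp: lncosh_nonneg)
  also have "\<dots> = exp ((1 + real k) * \<bar>y\<bar> * \<bar>z\<bar>)"
    by (simp add: exp_of_nat_mult[symmetric] mult_exp_exp abs_mult algebra_simps)
  finally show "\<bar>cosh (y * z) * lncosh (y * z) ^ k\<bar> \<le> 1 * exp ((1 + real k) * \<bar>y\<bar> * \<bar>z\<bar>)"
    by (simp add: abs_mult lncosh_nonneg)
qed measurable

lemma cosh_moment_pos: "0 < m \<Longrightarrow> m < 1 \<Longrightarrow> 1 \<le> (\<integral>z. cosh (y * z + k) powr m \<partial>std_gauss)"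
  and integrable_cosh_powr: "0 < m \<Longrightarrow> m < 1 \<Longrightarrow> integrable std_gauss (\<lambda>z. cosh (y * z + k) powr m)"
proof -
  assume m: "0 < m" "m < 1"
  have "cosh x powr m \<le> exp \<bar>x\<bar>" for x
  proof -
    have "m * lncosh x \<le> 1 * \<bar>x\<bar>" using m lncosh_le[of x] lncosh_nonneg[of x] by (intro mult_mono) auto
    then show ?thesis by (simp add: cosh_powr)
  qed
  note b = this
  show i: "integrable std_gauss (\<lambda>z. cosh (y * z + k) powr m)"
  proof (rule integrable_exp_bound_scaled[where A="exp \<bar>k\<bar>" and B="\<bar>y\<bar>"])
    fix z
    have "cosh (y * z + k) powr m \<le> exp \<bar>y * z + k\<bar>" by (rule b)
    also have "\<dots> \<le> exp (\<bar>k\<bar> + \<bar>y\<bar> * \<bar>z\<bar>)" using abs_triangle_ineq[of "y * z" k] by (simp add: abs_mult)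
    finally show "\<bar>cosh (y * z + k) powr m\<bar> \<le> exp \<bar>k\<bar> * exp (\<bar>y\<bar> * \<bar>z\<bar>)" by (simp add: mult_exp_exp)
  qed measurable
  have "(\<integral>z. 1 \<partial>std_gauss) \<le> (\<integral>z. cosh (y * z + k) powr m \<partial>std_gauss)"
    by (rule integral_mono) (use i m in \<open>auto simp: cosh_powr lncosh_nonneg\<close>)
  then show "1 \<le> (\<integral>z. cosh (y * z + k) powr m \<partial>std_gauss)" by (simp add: std_gauss.prob_space[simplified])
qed

text \<open>The derivative of the moment in its exponent at 1 is the mean of
  \<open>cosh * lncosh\<close>, which relative to the mean of \<open>cosh\<close> is
  \<open>At y\<close>. The second-order constant may depend on \<open>y\<close>, as a single field
  strength is used in the upper bound.\<close>

lemma cosh_moment_near_one: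
  "\<exists>B\<ge>0. \<forall>\<eta>. 0 < \<eta> \<longrightarrow> \<eta> < 1 \<longrightarrow> ln (\<integral>z. cosh (y * z) powr (1 - \<eta>) \<partial>std_gauss) \<le> y\<^sup>2 / 2 - \<eta> * At y + \<eta>\<^sup>2 * B"
proof (intro exI conjI allI impI)
  let ?B = "exp (- y\<^sup>2 / 2) * (\<integral>z. cosh (y * z) * lncosh (y * z) ^ 2 \<partial>std_gauss) / 2"
  show "0 \<le> ?B" by (auto intro!: integral_nonneg_AE mult_nonneg_nonneg)
  fix \<eta> :: real assume \<eta>: "0 < \<eta>" "\<eta> < 1"
  let ?M = "\<integral>z. cosh (y * z) powr (1 - \<eta>) \<partial>std_gauss"
  have i1: "integrable std_gauss (\<lambda>z. cosh (y * z) * lncosh (y * z))" using integrable_cosh_lncosh[of y 1] by simp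
  have i2: "integrable std_gauss (\<lambda>z. cosh (y * z) * lncosh (y * z) ^ 2)" by (rule integrable_cosh_lncosh)
  have "?M \<le> (\<integral>z. cosh (y * z) - \<eta> * (cosh (y * z) * lncosh (y * z)) + \<eta>\<^sup>2 / 2 * (cosh (y * z) * lncosh (y * z) ^ 2) \<partial>std_gauss)"
  proof (rule integral_mono)
    show "integrable std_gauss (\<lambda>z. cosh (y * z) powr (1 - \<eta>))" using integrable_cosh_powr[of "1 - \<eta>" y 0] \<eta> by simp
    show "integrable std_gauss (\<lambda>z. cosh (y * z) - \<eta> * (cosh (y * z) * lncosh (y * z)) + \<eta>\<^sup>2 / 2 * (cosh (y * z) * lncosh (y * z) ^ 2))"
      using integrable_cosh i1 i2 by auto
    fix z
    let ?l = "lncosh (y * z)"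
    have "cosh (y * z) powr (1 - \<eta>) = cosh (y * z) * exp (- (\<eta> * ?l))"
    proof -
      have "cosh (y * z) powr (1 - \<eta>) = exp (?l + - (\<eta> * ?l))" by (simp add: cosh_powr algebra_simps)
      then show ?thesis by (simp only: exp_add exp_lncosh)
    qed
    also have "\<dots> \<le> cosh (y * z) * (1 - \<eta> * ?l + (\<eta> * ?l)\<^sup>2 / 2)"
      using \<eta> lncosh_nonneg by (intro mult_left_mono exp_minus_le_quadratic) auto
    finally show "cosh (y * z) powr (1 - \<eta>) \<le> cosh (y * z) - \<eta> * (cosh (y * z) * ?l) + \<eta>\<^sup>2 / 2 * (cosh (y * z) * ?l ^ 2)"
      by (simp add: power_mult_distrib algebra_simps)
  qed
  also have "\<dots> = exp (y\<^sup>2 / 2) - \<eta> * (\<integral>z. cosh (y * z) * lncosh (y * z) \<partial>std_gauss)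
      + \<eta>\<^sup>2 / 2 * (\<integral>z. cosh (y * z) * lncosh (y * z) ^ 2 \<partial>std_gauss)"
    using integrable_cosh[of y] i1 i2 by (simp add: integral_cosh)
  also have "\<dots> = exp (y\<^sup>2 / 2) * (1 + (- \<eta> * At y + \<eta>\<^sup>2 * ?B))"
  proof -
    have "E - \<eta> * F + \<eta>\<^sup>2 / 2 * G = E * (1 + (- \<eta> * (E' * F) + \<eta>\<^sup>2 * (E' * G / 2)))" if "E * E' = 1" for E E' F G
    proof -
      have "E * (1 + (- \<eta> * (E' * F) + \<eta>\<^sup>2 * (E' * G / 2))) = E - \<eta> * ((E * E') * F) + \<eta>\<^sup>2 / 2 * ((E * E') * G)"
        by (simp add: algebra_simps)
      then show ?thesis by (simp add: that)
    qed
    then show ?thesis unfolding At_def by (simp add: mult_exp_exp)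
  qed
  also have "\<dots> \<le> exp (y\<^sup>2 / 2) * exp (- \<eta> * At y + \<eta>\<^sup>2 * ?B)" by (intro mult_left_mono exp_ge_add_one_self) auto
  finally have "?M \<le> exp (y\<^sup>2 / 2 - \<eta> * At y + \<eta>\<^sup>2 * ?B)" by (simp add: mult_exp_exp algebra_simps)
  moreover have "1 \<le> ?M" using cosh_moment_pos[of "1 - \<eta>" y 0] \<eta> by simp
  ultimately have "ln ?M \<le> ln (exp (y\<^sup>2 / 2 - \<eta> * At y + \<eta>\<^sup>2 * ?B))" by (subst ln_le_cancel_iff) auto
  then show "ln ?M \<le> y\<^sup>2 / 2 - \<eta> * At y + \<eta>\<^sup>2 * ?B" by simp
qed

text \<open>The weight \<open>cosh (y * z)\<close> is half the sum of two exponential tilts,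
  exchanged by reflection; tilting by \<open>exp (y * z)\<close> shifts \<open>z\<close> by
  \<open>y\<close> and hence the argument by \<open>y\<^sup>2\<close>. So \<open>At\<close> also
  describes a field in the presence of a planted spin.\<close>

lemma integral_lncosh_shift:
  assumes "k = y\<^sup>2 \<or> k = - y\<^sup>2"
  shows "(\<integral>z. lncosh (y * z + k) \<partial>std_gauss) = At y"
proof -
  have lb: "\<bar>exp (c * z) * lncosh (y * z)\<bar> \<le> 1 * exp ((\<bar>c\<bar> + \<bar>y\<bar>) * \<bar>z\<bar>)" for c z
  proof -
    have "lncosh (y * z) \<le> exp \<bar>y * z\<bar>" using lncosh_le[of "y * z"] abs_le_exp[of "y * z"] by linarith
    moreover have "c * z \<le> \<bar>c\<bar> * \<bar>z\<bar>" by (metis abs_ge_self abs_mult)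
    ultimately have "exp (c * z) * lncosh (y * z) \<le> exp (\<bar>c\<bar> * \<bar>z\<bar>) * exp (\<bar>y * z\<bar>)"
      by (intro mult_mono) (auto simp: lncosh_nonneg)
    then show ?thesis by (simp add: abs_mult lncosh_nonneg mult_exp_exp algebra_simps)
  qed
  have i: "integrable std_gauss (\<lambda>z. exp (c * z) * lncosh (y * z))" for c
    by (rule integrable_exp_bound_scaled[OF _ lb]) measurable
  have r: "(\<integral>z. exp (- y * z) * lncosh (y * z) \<partial>std_gauss) = (\<integral>z. exp (y * z) * lncosh (y * z) \<partial>std_gauss)"
    using std_gauss_reflect[of "\<lambda>z. exp (y * z) * lncosh (y * z)"] by (simp add: lncosh_def)
  have "(\<integral>z. cosh (y * z) * lncosh (y * z) \<partial>std_gauss)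
      = (\<integral>z. 1 / 2 * (exp (y * z) * lncosh (y * z)) + 1 / 2 * (exp (- y * z) * lncosh (y * z)) \<partial>std_gauss)"
    by (intro Bochner_Integration.integral_cong refl) (simp add: cosh_def algebra_simps)
  also have "\<dots> = (\<integral>z. exp (y * z) * lncosh (y * z) \<partial>std_gauss)"
    using i[of y] i[of "- y"] r by simp
  also have "\<dots> = exp (y\<^sup>2 / 2) * (\<integral>z. lncosh (y * (z + y)) \<partial>std_gauss)"
    by (rule std_gauss_shift) measurable
  finally have "At y = exp (- y\<^sup>2 / 2) * exp (y\<^sup>2 / 2) * (\<integral>z. lncosh (y * (z + y)) \<partial>std_gauss)"
    by (simp add: At_def)
  then have plus: "At y = (\<integral>z. lncosh (y * z + y\<^sup>2) \<partial>std_gauss)"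
    by (simp add: mult_exp_exp power2_eq_square algebra_simps)
  have "lncosh (y * - z + y\<^sup>2) = lncosh (y * z - y\<^sup>2)" for z
    unfolding lncosh_def using cosh_minus[of "y * z - y\<^sup>2"] by (simp add: algebra_simps)
  then have "(\<integral>z. lncosh (y * z - y\<^sup>2) \<partial>std_gauss) = (\<integral>z. lncosh (y * z + y\<^sup>2) \<partial>std_gauss)"
    using std_gauss_reflect[of "\<lambda>z. lncosh (y * z + y\<^sup>2)"] by simp
  then show ?thesis using assms plus by auto
qed

text \<open>Expansion at exponent 0, where the linear coefficient is the mean of
  \<open>lncosh\<close>, again \<open>At y\<close> because of the shift \<open>k\<close>. The error
  is uniform over \<open>\<bar>y\<bar> \<le> Y\<close>, since the field strength will vary with the
  overlap.\<close>

lemma cosh_moment_near_zero: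
  assumes m: "0 < m" "m < 1" and y: "\<bar>y\<bar> \<le> Y" and k: "k = y\<^sup>2 \<or> k = - y\<^sup>2"
  shows "(\<integral>z. cosh (y * z + k) powr m \<partial>std_gauss) \<le> exp (m * At y + m\<^sup>2 * (4 * exp (4 * Y\<^sup>2)))"
proof -
  have Y0: "0 \<le> Y" using y by linarith
  have kY: "\<bar>k\<bar> \<le> Y\<^sup>2" using k y by (auto simp: power_mono abs_le_square_iff[symmetric] Y0)
  have lb: "lncosh (y * z + k) \<le> Y\<^sup>2 + Y * \<bar>z\<bar>" for z
  proof -
    have "\<bar>y * z + k\<bar> \<le> \<bar>y\<bar> * \<bar>z\<bar> + \<bar>k\<bar>" using abs_triangle_ineq[of "y * z" k] by (simp add: abs_mult)
    moreover have "\<bar>y\<bar> * \<bar>z\<bar> \<le> Y * \<bar>z\<bar>" using y by (intro mult_right_mono) auto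
    ultimately show ?thesis using lncosh_le[of "y * z + k"] kY by linarith
  qed
  have il: "integrable std_gauss (\<lambda>z. lncosh (y * z + k))"
  proof (rule integrable_exp_bound_scaled[where A="exp (Y\<^sup>2)" and B=Y])
    fix z
    have "lncosh (y * z + k) \<le> exp (Y\<^sup>2 + Y * \<bar>z\<bar>)" using lb[of z] exp_ge_add_one_self[of "Y\<^sup>2 + Y * \<bar>z\<bar>"] by linarith
    then show "\<bar>lncosh (y * z + k)\<bar> \<le> exp (Y\<^sup>2) * exp (Y * \<bar>z\<bar>)" by (simp add: lncosh_nonneg mult_exp_exp)
  qed measurable
  \<comment> \<open>From \<open>l\<^sup>2 / 2 \<le> exp l\<close> and
    \<open>l \<le> Y\<^sup>2 + Y * \<bar>z\<bar>\<close> for \<open>l = lncosh (y * z + k)\<close>;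
    integrating the remaining exponential gives the 4 in the statement.\<close>
  let ?c = "2 * m\<^sup>2 * exp (2 * Y\<^sup>2)"
  have "(\<integral>z. cosh (y * z + k) powr m \<partial>std_gauss) \<le> (\<integral>z. 1 + m * lncosh (y * z + k) + ?c * exp (2 * Y * \<bar>z\<bar>) \<partial>std_gauss)"
  proof (rule integral_mono)
    show "integrable std_gauss (\<lambda>z. cosh (y * z + k) powr m)" by (rule integrable_cosh_powr[OF m])
    show "integrable std_gauss (\<lambda>z. 1 + m * lncosh (y * z + k) + ?c * exp (2 * Y * \<bar>z\<bar>))"
      using il integrable_exp_abs_std_gauss[of "2 * Y"] by auto
    fix z
    let ?l = "lncosh (y * z + k)"
    have l: "0 \<le> ?l" by (rule lncosh_nonneg)
    have "cosh (y * z + k) powr m \<le> 1 + m * ?l + (m * ?l)\<^sup>2 * exp (m * ?l)"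
      unfolding cosh_powr using m l by (intro exp_le_quadratic) auto
    also have "(m * ?l)\<^sup>2 * exp (m * ?l) \<le> (m\<^sup>2 * (2 * exp ?l)) * exp ?l"
    proof (intro mult_mono)
      have "?l\<^sup>2 / 2 \<le> exp ?l" using exp_lower_Taylor_quadratic[OF l] l by linarith
      then show "(m * ?l)\<^sup>2 \<le> m\<^sup>2 * (2 * exp ?l)" unfolding power_mult_distrib by (intro mult_left_mono) auto
      show "exp (m * ?l) \<le> exp ?l" using m l mult_right_mono[of m 1 ?l] by simp
    qed auto
    also have "\<dots> = 2 * m\<^sup>2 * exp (2 * ?l)" by (simp add: mult_exp_exp)
    also have "\<dots> \<le> 2 * m\<^sup>2 * exp (2 * (Y\<^sup>2 + Y * \<bar>z\<bar>))" using lb[of z] by (intro mult_left_mono) auto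
    also have "\<dots> = ?c * exp (2 * Y * \<bar>z\<bar>)" by (simp add: mult_exp_exp algebra_simps)
    finally show "cosh (y * z + k) powr m \<le> 1 + m * ?l + ?c * exp (2 * Y * \<bar>z\<bar>)" by simp
  qed
  also have "\<dots> = 1 + m * At y + ?c * (\<integral>z. exp (2 * Y * \<bar>z\<bar>) \<partial>std_gauss)"
    using il integrable_exp_abs_std_gauss[of "2 * Y"]
    by (simp add: std_gauss.prob_space[simplified] integral_lncosh_shift[OF k])
  also have "(\<integral>z. exp (2 * Y * \<bar>z\<bar>) \<partial>std_gauss) \<le> 2 * exp ((2 * Y)\<^sup>2 / 2)"
  proof -
    have "ennreal (\<integral>z. exp (2 * Y * \<bar>z\<bar>) \<partial>std_gauss) \<le> ennreal (2 * exp ((2 * Y)\<^sup>2 / 2))"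
      using nn_integral_exp_abs_std_gauss[of "2 * Y"]
      by (subst nn_integral_eq_integral[symmetric, OF integrable_exp_abs_std_gauss]) auto
    then show ?thesis by (subst (asm) ennreal_le_iff) auto
  qed
  also have "1 + m * At y + ?c * (2 * exp ((2 * Y)\<^sup>2 / 2)) = 1 + (m * At y + m\<^sup>2 * (4 * exp (4 * Y\<^sup>2)))"
    by (simp add: mult_exp_exp power_mult_distrib)
  also have "\<dots> \<le> exp (m * At y + m\<^sup>2 * (4 * exp (4 * Y\<^sup>2)))" by (rule exp_ge_add_one_self)
  finally show ?thesis using m by simp
qed

section \<open>Upper bound\<close>

lemma sum_words_prod:
  fixes f :: "nat \<Rightarrow> 'a \<Rightarrow> real"
  assumes "finite A"
  shows "(\<Sum>\<sigma>\<in>words A N. \<Prod>i<N. f i (\<sigma> ! i)) = (\<Prod>i<N. \<Sum>x\<in>A. f i x)"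
proof (induction N arbitrary: f)
  case (Suc N)
  have "(\<Sum>\<sigma>\<in>words A (Suc N). \<Prod>i<Suc N. f i (\<sigma> ! i))
      = (\<Sum>xs\<in>words A N. \<Sum>x\<in>A. f 0 x * (\<Prod>i<N. f (Suc i) (xs ! i)))"
    unfolding sum_words_Suc[OF assms] prod.lessThan_Suc_shift by simp
  also have "\<dots> = (\<Sum>x\<in>A. f 0 x) * (\<Sum>xs\<in>words A N. \<Prod>i<N. f (Suc i) (xs ! i))"
    by (simp add: sum_distrib_right[symmetric] sum_distrib_left)
  also have "\<dots> = (\<Prod>i<Suc N. \<Sum>x\<in>A. f i x)"
    unfolding Suc.IH[of "\<lambda>i. f (Suc i)"] prod.lessThan_Suc_shift by simp
  finally show ?case .
qed simp

lemma sum_spins_exp: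
  "(\<Sum>\<sigma>\<in>spins N. 2 powr (- real N) * exp (\<Sum>i<N. t i * \<sigma> ! i)) = (\<Prod>i<N. cosh (t i))"
proof -
  have "2 powr (- real N) * exp (\<Sum>i<N. t i * \<sigma> ! i) = (\<Prod>i<N. 1 / 2 * exp (t i * \<sigma> ! i))" for \<sigma>
  proof -
    have "2 powr (- real N) = (1 / 2) ^ N"
      by (simp add: powr_minus powr_realpow power_one_over inverse_eq_divide)
    then show ?thesis by (simp only: exp_sum[OF finite_lessThan] prod.distrib prod_constant card_lessThan)
  qed
  then have "(\<Sum>\<sigma>\<in>spins N. 2 powr (- real N) * exp (\<Sum>i<N. t i * \<sigma> ! i))
      = (\<Prod>i<N. \<Sum>x\<in>{-1, 1}. 1 / 2 * exp (t i * x))"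
    unfolding words_eq_spins by (simp only: sum_words_prod[OF finite.insertI[OF finite.insertI[OF finite.emptyI]], of "\<lambda>i x. 1 / 2 * exp (t i * x)"])
  also have "\<dots> = (\<Prod>i<N. cosh (t i))"
    by (intro prod.cong refl) (simp add: cosh_def add.commute)
  finally show ?thesis .
qed

lemma tame_prod:
  assumes "\<And>i. i \<in> I \<Longrightarrow> tame (F i)"
  shows "tame (\<lambda>g. \<Prod>i\<in>I. F i g)"
  using assms by (induction I rule: infinite_finite_induct) auto

lemma integral_prod_gauss:
  fixes \<phi> :: "'i \<Rightarrow> real \<Rightarrow> real"
  assumes "finite I" and t: "\<And>i. i \<in> I \<Longrightarrow> tame (\<lambda>g. \<phi> i (g i))"
  shows "(\<integral>g. (\<Prod>i\<in>I. \<phi> i (g i)) \<partial>gauss) = (\<Prod>i\<in>I. \<integral>x. \<phi> i x \<partial>std_gauss)"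
  using assms
proof (induction I rule: finite_induct)
  case empty
  then show ?case by (simp add: gauss.prob_space[simplified])
next
  case (insert j I)
  have "tame (\<lambda>g. \<Prod>i\<in>insert j I. \<phi> i (g i))" by (rule tame_prod) (use insert.prems in auto)
  then have "(\<integral>g. (\<Prod>i\<in>insert j I. \<phi> i (g i)) \<partial>gauss)
      = (\<integral>g. \<integral>x. (\<Prod>i\<in>insert j I. \<phi> i ((g(j := x)) i)) \<partial>std_gauss \<partial>gauss)"
    by (intro integral_gauss_split integrable_tame)
  also have "\<dots> = (\<integral>g. (\<integral>x. \<phi> j x \<partial>std_gauss) * (\<Prod>i\<in>I. \<phi> i (g i)) \<partial>gauss)"
  proof (intro Bochner_Integration.integral_cong refl)
    fix g :: "'i \<Rightarrow> real"
    have "(\<Prod>i\<in>insert j I. \<phi> i ((g(j := x)) i)) = \<phi> j x * (\<Prod>i\<in>I. \<phi> i (g i))" for x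
      using insert.hyps by (auto intro!: prod.cong)
    then show "(\<integral>x. (\<Prod>i\<in>insert j I. \<phi> i ((g(j := x)) i)) \<partial>std_gauss)
        = (\<integral>x. \<phi> j x \<partial>std_gauss) * (\<Prod>i\<in>I. \<phi> i (g i))" by simp
  qed
  also have "\<dots> = (\<integral>x. \<phi> j x \<partial>std_gauss) * (\<Prod>i\<in>I. \<integral>x. \<phi> i x \<partial>std_gauss)"
    using insert by simp
  finally show ?case using insert.hyps by simp
qed

definition fld :: "real \<Rightarrow> nat \<Rightarrow> real list \<Rightarrow> real" where
  "fld a i \<sigma> = a * \<sigma> ! i"

lemma tame_cosh_powr:
  assumes "0 < m" "m < 1"
  shows "tame (\<lambda>g. cosh (a * g i + k) powr m)"
proof (rule tame_bound)
  show "tame (\<lambda>g. exp \<bar>k\<bar> * exp (\<bar>a\<bar> * (\<Sum>j\<in>{i}. \<bar>g j\<bar>)))" by (intro tame_mult tame_const tame_exp_abs) simp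
  fix g :: "'a \<Rightarrow> real"
  have "m * lncosh (a * g i + k) \<le> 1 * \<bar>a * g i + k\<bar>"
    using assms lncosh_le lncosh_nonneg by (intro mult_mono) auto
  also have "\<dots> \<le> \<bar>k\<bar> + \<bar>a\<bar> * \<bar>g i\<bar>" using abs_triangle_ineq[of "a * g i" k] by (simp add: abs_mult)
  finally show "\<bar>cosh (a * g i + k) powr m\<bar> \<le> exp \<bar>k\<bar> * exp (\<bar>a\<bar> * (\<Sum>j\<in>{i}. \<bar>g j\<bar>))"
    by (simp add: cosh_powr mult_exp_exp)
qed measurable

lemma prod_powr_nonneg:
  fixes f :: "'a \<Rightarrow> real"
  assumes "\<And>i. i \<in> I \<Longrightarrow> 0 < f i"
  shows "(\<Prod>i\<in>I. f i) powr m = (\<Prod>i\<in>I. f i powr m)"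
  using assms by (induction I rule: infinite_finite_induct) (auto simp: powr_mult prod_pos less_imp_le)

text \<open>On \<open>S\<close> the linear statistic equals \<open>c\<close>, so the tilt by
  \<open>v\<close> compensated by \<open>exp (- c)\<close> changes nothing there. Once it is
  inserted the sum is extended to all configurations, where it factorises over sites;
  \<open>v\<close> acts as a Lagrange multiplier for the constraint.\<close>

lemma moment_field_restricted:
  assumes m: "0 < m" "m < 1" and S: "S \<subseteq> spins N" "S \<noteq> {}"
    and u: "\<And>\<tau>. \<tau> \<in> S \<Longrightarrow> (\<Sum>i<N. v i * \<tau> ! i) = c"
  shows "moment m S (uw N) {..<N} (fld a)
    \<le> exp (- m * c) * (\<Prod>i<N. \<integral>z. cosh (a * z + v i) powr m \<partial>std_gauss)"
proof -
  have fS: "finite S" using S finite_spins finite_subset by blast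
  interpret gibbs S "uw N" m using m S fS by unfold_locales auto
  have le: "zsum S (uw N) {..<N} (fld a) g powr m \<le> exp (- m * c) * (\<Prod>i<N. cosh (a * g i + v i) powr m)" for g
  proof -
    have "zsum S (uw N) {..<N} (fld a) g = (\<Sum>\<tau>\<in>S. exp (- c) * (2 powr (- real N) * exp (\<Sum>i<N. (a * g i + v i) * \<tau> ! i)))"
      unfolding zsum_def
    proof (rule sum.cong[OF refl])
      fix \<tau> assume "\<tau> \<in> S"
      have "field {..<N} (fld a) g \<tau> = - c + (\<Sum>i<N. (a * g i + v i) * \<tau> ! i)"
        using u[OF \<open>\<tau> \<in> S\<close>] by (simp add: field_def fld_def ring_distribs sum.distrib mult_ac)
      then show "uw N \<tau> * exp (field {..<N} (fld a) g \<tau>)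
          = exp (- c) * (2 powr (- real N) * exp (\<Sum>i<N. (a * g i + v i) * \<tau> ! i))"
        by (simp only: exp_add mult.left_commute)
    qed
    also have "\<dots> \<le> (\<Sum>\<tau>\<in>spins N. exp (- c) * (2 powr (- real N) * exp (\<Sum>i<N. (a * g i + v i) * \<tau> ! i)))"
      by (rule sum_mono2) (use S finite_spins in auto)
    also have "\<dots> = exp (- c) * (\<Prod>i<N. cosh (a * g i + v i))"
      by (simp only: sum_spins_exp[symmetric] sum_distrib_left)
    finally have "zsum S (uw N) {..<N} (fld a) g powr m \<le> (exp (- c) * (\<Prod>i<N. cosh (a * g i + v i))) powr m"
      using m zsum_pos[OF fS S(2), of "uw N" "{..<N}" "fld a" g] by (intro powr_mono2) auto
    also have "\<dots> = exp (- m * c) * (\<Prod>i<N. cosh (a * g i + v i) powr m)"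
    proof -
      have P: "(\<Prod>i<N. cosh (a * g i + v i)) powr m = (\<Prod>i<N. cosh (a * g i + v i) powr m)"
        by (rule prod_powr_nonneg) simp
      have E: "exp (- c) powr m = exp (- m * c)" by (simp add: powr_def)
      have "(exp (- c) * (\<Prod>i<N. cosh (a * g i + v i))) powr m = exp (- c) powr m * (\<Prod>i<N. cosh (a * g i + v i)) powr m"
        by (rule powr_mult)
      then show ?thesis by (simp only: P E)
    qed
    finally show ?thesis .
  qed
  have t: "tame (\<lambda>g. \<Prod>i<N. cosh (a * g i + v i) powr m)"
    by (rule tame_prod) (rule tame_cosh_powr[OF m])
  have "moment m S (uw N) {..<N} (fld a) \<le> (\<integral>g. exp (- m * c) * (\<Prod>i<N. cosh (a * g i + v i) powr m) \<partial>gauss)"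
    unfolding moment_def
  proof (rule integral_mono)
    show "integrable gauss (\<lambda>g. zsum S (uw N) {..<N} (fld a) g powr m)"
      by (intro integrable_tame tame_zsum_powr fS S(2) m) simp
    show "integrable gauss (\<lambda>g. exp (- m * c) * (\<Prod>i<N. cosh (a * g i + v i) powr m))"
      using integrable_tame[OF t] by simp
  qed (rule le)
  also have "\<dots> = exp (- m * c) * (\<Prod>i<N. \<integral>z. cosh (a * z + v i) powr m \<partial>std_gauss)"
  proof -
    have "(\<integral>g. (\<Prod>i<N. cosh (a * g i + v i) powr m) \<partial>gauss) = (\<Prod>i<N. \<integral>z. cosh (a * z + v i) powr m \<partial>std_gauss)"
      by (rule integral_prod_gauss[OF finite_lessThan tame_cosh_powr[OF m]])
    then show ?thesis by (simp only: integral_mult_right_zero)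
  qed
  finally show ?thesis .
qed

lemma cov_fld: "1 \<le> N \<Longrightarrow> cov {..<N} (fld a) (fld a) \<sigma> \<tau> = a\<^sup>2 * real N * ovl {..<N} \<sigma> \<tau>"
proof -
  assume "1 \<le> N"
  then have "real N * ovl {..<N} \<sigma> \<tau> = (\<Sum>i<N. \<sigma> ! i * \<tau> ! i)" by (simp add: ovl_def)
  moreover have "cov {..<N} (fld a) (fld a) \<sigma> \<tau> = a\<^sup>2 * (\<Sum>i<N. \<sigma> ! i * \<tau> ! i)"
    unfolding cov_def fld_def sum_distrib_left by (intro sum.cong refl) (simp add: power2_eq_square mult_ac)
  ultimately show ?thesis by (simp only: mult.assoc)
qed

lemma power_tangent:
  fixes x q :: real
  assumes "0 \<le> x" "0 \<le> q"
  shows "q ^ p + real p * q ^ (p - 1) * (x - q) \<le> x ^ p"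
proof (induction p)
  case (Suc p)
  have qp: "q * (real p * q ^ (p - 1)) = real p * q ^ p" by (cases p) auto
  have "q ^ Suc p + real (Suc p) * q ^ (Suc p - 1) * (x - q)
      = x * q ^ p + (real p * q ^ p) * (x - q)" by (simp add: algebra_simps)
  also have "\<dots> = x * q ^ p + q * (real p * q ^ (p - 1)) * (x - q)" unfolding qp ..
  also have "\<dots> \<le> x * q ^ p + x * (real p * q ^ (p - 1)) * (x - q)"
  proof -
    have "0 \<le> (real p * q ^ (p - 1)) * (x - q)\<^sup>2" using assms by simp
    then show ?thesis by (simp add: power2_eq_square algebra_simps)
  qed
  also have "\<dots> = x * (q ^ p + real p * q ^ (p - 1) * (x - q))" by (simp add: algebra_simps)
  also have "\<dots> \<le> x * x ^ p" using assms by (intro mult_left_mono Suc.IH)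
  finally show ?case by simp
qed simp

lemma spins_ovl:
  assumes "1 \<le> N" "\<sigma> \<in> spins N" "\<tau> \<in> spins N"
  shows "\<bar>ovl {..<N} \<sigma> \<tau>\<bar> \<le> 1" "ovl {..<N} \<sigma> \<sigma> = 1"
proof -
  have "overlap_kernel (spins N) (ovl {..<N})"
    by (rule overlap_kernel_ovl) (use assms spins_nth in \<open>auto simp: lessThan_empty_iff\<close>)
  then show "\<bar>ovl {..<N} \<sigma> \<tau>\<bar> \<le> 1" "ovl {..<N} \<sigma> \<sigma> = 1"
    by (rule overlap_kernelD(2)[OF _ assms(2,3)], rule overlap_kernelD(1)[OF _ assms(2)])
qed

definition rs :: "nat \<Rightarrow> real \<Rightarrow> real \<Rightarrow> real" where
  "rs p \<beta> q = \<beta> * sqrt (xi' p q)"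

lemma rs_square: "0 \<le> q \<Longrightarrow> (rs p \<beta> q)\<^sup>2 = \<beta>\<^sup>2 * xi' p q"
  by (simp add: rs_def power_mult_distrib xi'_def)

text \<open>For a nonnegative overlap \<open>R\<close>, convexity puts \<open>xi\<close> above its
  tangent at \<open>q\<close>, so \<open>xi p R - xi' p q * R\<close> is at least
  \<open>- theta p q\<close>. For negative \<open>R\<close> the same bound holds up to the negative
  part of \<open>R\<close>, an error the positivity principle reduces to
  \<open>\<epsilon>\<close>.\<close>

lemma model_comparison:
  assumes p: "2 \<le> p" and m: "0 < m" "m < 1" and \<epsilon>: "0 < \<epsilon>"
  shows "\<exists>A\<ge>0. \<forall>N S q. 1 \<le> N \<longrightarrow> S \<subseteq> spins N \<longrightarrow> S \<noteq> {} \<longrightarrow> 0 \<le> q \<longrightarrow> q \<le> 1 \<longrightarrow>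
    ln (moment m S (uw N) (words {..<N} p) (hc p N \<beta>)) \<le> ln (moment m S (uw N) {..<N} (fld (rs p \<beta> q)))
      + m * real N * (\<beta>\<^sup>2 / 4 - (rs p \<beta> q)\<^sup>2 / 2 + (1 - m) * (\<beta>\<^sup>2 * theta p q) / 2 + \<epsilon>) + A"
proof -
  \<comment> \<open>Compensates the coefficient \<open>\<beta>\<^sup>2 / 2 * real N\<close> in front
    of the negative part; the added 1 keeps the denominator positive.\<close>
  define \<epsilon>' where "\<epsilon>' = \<epsilon> / (\<beta>\<^sup>2 + 1)"
  have \<epsilon>': "0 < \<epsilon>'" using \<epsilon> by (simp add: \<epsilon>'_def add_nonneg_pos)
  obtain A where A: "0 \<le> A" "\<forall>(S :: real list set) w (I :: nat set) (J :: nat list set) b c Bs L d0 e.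
    finite S \<longrightarrow> S \<noteq> {} \<longrightarrow> (\<forall>s\<in>S. 0 < w s) \<longrightarrow> finite I \<longrightarrow> finite J \<longrightarrow> finite Bs \<longrightarrow>
    (\<forall>B\<in>Bs. finite B \<and> B \<noteq> {} \<and> 0 \<le> L B \<and> (\<forall>\<sigma>\<in>S. \<forall>i\<in>B. \<sigma> ! i \<in> {-1, 1})) \<longrightarrow>
    (\<forall>s\<in>S. cov J c c s s - cov I b b s s \<le> d0) \<longrightarrow>
    (\<forall>s\<in>S. \<forall>t\<in>S. - e - (\<Sum>B\<in>Bs. L B * max 0 (- ovl B s t)) \<le> cov J c c s t - cov I b b s t) \<longrightarrow>
    ln (moment m S w J c) \<le> ln (moment m S w I b)
      + m * (d0 + (1 - m) * (e + \<epsilon>' * (\<Sum>B\<in>Bs. L B))) / 2 + A * real (card Bs)"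
    using spin_comparison[OF m \<epsilon>'] by (elim exE conjE)
  show ?thesis
  proof (intro exI[of _ A] conjI allI impI A(1))
    fix N :: nat and S and q :: real
    assume N: "1 \<le> N" and S: "S \<subseteq> spins N" "S \<noteq> {}" and q: "0 \<le> q" "q \<le> 1"
    let ?a = "rs p \<beta> q" and ?L = "\<lambda>_ :: nat set. \<beta>\<^sup>2 / 2 * real N"
    have th: "theta p q = (real p - 1) * q ^ p / 2" by (rule theta_eq) (use p in simp)
    have th0: "0 \<le> theta p q" unfolding th using p q by auto
    have a2: "?a\<^sup>2 = \<beta>\<^sup>2 / 2 * (real p * q ^ (p - 1))" using q by (simp add: rs_square xi'_def)
    have qq: "q * q ^ (p - 1) = q ^ p" using p by (cases p) auto
    have p1: "1 \<le> p" using p by simp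
    have dg: "cov (words {..<N} p) (hc p N \<beta>) (hc p N \<beta>) s s - cov {..<N} (fld ?a) (fld ?a) s s \<le> real N * (\<beta>\<^sup>2 / 2 - ?a\<^sup>2)"
      if "s \<in> S" for s
      using spins_ovl(2)[OF N, of s s] that S by (auto simp: cov_hc[OF N p1] cov_fld[OF N] algebra_simps)
    have off: "- (real N * (\<beta>\<^sup>2 * theta p q)) - (\<Sum>B\<in>{{..<N}}. ?L B * max 0 (- ovl B s t))
        \<le> cov (words {..<N} p) (hc p N \<beta>) (hc p N \<beta>) s t - cov {..<N} (fld ?a) (fld ?a) s t"
      if "s \<in> S" "t \<in> S" for s t
    proof -
      let ?R = "ovl {..<N} s t"
      have R: "\<bar>?R\<bar> \<le> 1" using spins_ovl(1)[OF N] that S by blast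
      have eq: "cov (words {..<N} p) (hc p N \<beta>) (hc p N \<beta>) s t - cov {..<N} (fld ?a) (fld ?a) s t
          = \<beta>\<^sup>2 / 2 * real N * (?R ^ p - real p * q ^ (p - 1) * ?R)"
        unfolding cov_hc[OF N p1] cov_fld[OF N] a2 by (simp add: algebra_simps)
      have "- ((real p - 1) * q ^ p) - max 0 (- ?R) \<le> ?R ^ p - real p * q ^ (p - 1) * ?R"
      proof (cases "0 \<le> ?R")
        case True
        have "q ^ p + real p * q ^ (p - 1) * (?R - q) = real p * q ^ (p - 1) * ?R - (real p - 1) * q ^ p"
          by (simp add: qq[symmetric] algebra_simps)
        then show ?thesis using power_tangent[OF True q(1), of p] True by simp
      next
        case False
        have "\<bar>?R ^ p\<bar> \<le> \<bar>?R\<bar> ^ 1" unfolding power_abs using R p by (intro power_decreasing) auto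
        moreover have "0 \<le> real p * q ^ (p - 1) * (- ?R)" using q False by (intro mult_nonneg_nonneg) auto
        moreover have "0 \<le> (real p - 1) * q ^ p" using p q by auto
        ultimately show ?thesis using False by (simp add: abs_le_iff)
      qed
      then have "(\<beta>\<^sup>2 / 2 * real N) * (- ((real p - 1) * q ^ p) - max 0 (- ?R)) \<le> (\<beta>\<^sup>2 / 2 * real N) * (?R ^ p - real p * q ^ (p - 1) * ?R)"
        by (intro mult_left_mono) auto
      moreover have "- (real N * (\<beta>\<^sup>2 * theta p q)) - (\<Sum>B\<in>{{..<N}}. ?L B * max 0 (- ovl B s t))
          = (\<beta>\<^sup>2 / 2 * real N) * (- ((real p - 1) * q ^ p) - max 0 (- ?R))"
        unfolding th by (simp add: right_diff_distrib)
      ultimately show ?thesis unfolding eq by (simp only:)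
    qed
    have "ln (moment m S (uw N) (words {..<N} p) (hc p N \<beta>)) \<le> ln (moment m S (uw N) {..<N} (fld ?a))
      + m * (real N * (\<beta>\<^sup>2 / 2 - ?a\<^sup>2) + (1 - m) * (real N * (\<beta>\<^sup>2 * theta p q) + \<epsilon>' * (\<Sum>B\<in>{{..<N}}. ?L B))) / 2
      + A * real (card {{..<N}})"
    proof (rule A(2)[rule_format])
      show "finite S" using S finite_spins finite_subset by blast
      show "finite (words {..<N} p)" by (simp add: finite_words)
      show "finite B \<and> B \<noteq> {} \<and> 0 \<le> ?L B \<and> (\<forall>\<sigma>\<in>S. \<forall>i\<in>B. \<sigma> ! i \<in> {-1, 1})" if "B \<in> {{..<N}}" for B
        using that N S spins_nth by (auto simp: lessThan_empty_iff)
    qed (use S dg off in auto)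
    also have "m * (real N * (\<beta>\<^sup>2 / 2 - ?a\<^sup>2) + (1 - m) * (real N * (\<beta>\<^sup>2 * theta p q) + \<epsilon>' * (\<Sum>B\<in>{{..<N}}. ?L B))) / 2
        = m * real N * (\<beta>\<^sup>2 / 4 - ?a\<^sup>2 / 2 + (1 - m) * (\<beta>\<^sup>2 * theta p q) / 2 + (1 - m) * (\<epsilon>' * \<beta>\<^sup>2) / 4)"
      by (simp add: field_simps)
    also have "\<dots> \<le> m * real N * (\<beta>\<^sup>2 / 4 - ?a\<^sup>2 / 2 + (1 - m) * (\<beta>\<^sup>2 * theta p q) / 2 + \<epsilon>)"
    proof (intro mult_left_mono add_left_mono)
      have b0: "0 < \<beta>\<^sup>2 + 1" by (simp add: add_nonneg_pos)
      have e: "\<epsilon>' * \<beta>\<^sup>2 \<le> \<epsilon>"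
        unfolding \<epsilon>'_def using \<epsilon> b0 by (simp add: pos_divide_le_eq algebra_simps)
      have "(1 - m) * (\<epsilon>' * \<beta>\<^sup>2) \<le> 1 * \<epsilon>" using m e \<epsilon>' \<epsilon> by (intro mult_mono) auto
      then show "(1 - m) * (\<epsilon>' * \<beta>\<^sup>2) / 4 \<le> \<epsilon>" using \<epsilon> by simp
    qed (use m in auto)
    finally show "ln (moment m S (uw N) (words {..<N} p) (hc p N \<beta>)) \<le> ln (moment m S (uw N) {..<N} (fld (rs p \<beta> q)))
      + m * real N * (\<beta>\<^sup>2 / 4 - (rs p \<beta> q)\<^sup>2 / 2 + (1 - m) * (\<beta>\<^sup>2 * theta p q) / 2 + \<epsilon>) + A" by simp
  qed
qed

lemma en_le_moment:
  assumes "1 \<le> N" "1 \<le> p" "0 < m" "m < 1"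
  shows "m * en p N \<beta> \<le> ln (moment m (spins N) (uw N) (words {..<N} p) (hc p N \<beta>))"
    and "ln (moment m (spins N) (uw N) (words {..<N} p) (hc p N \<beta>)) \<le> m * en p N \<beta> + m\<^sup>2 * (\<beta>\<^sup>2 / 2 * real N)"
  unfolding en_def zN_def
  using moment_bounds[OF finite_spins spins_nonempty _ assms(3,4) coord_lipschitz_zN[unfolded zN_def], where V="\<beta>\<^sup>2 / 2 * real N"]
    sum_hcb[OF assms(1,2), of \<beta>] by auto

text \<open>With \<open>m = 1 - \<eta>\<close> the field strength drops out at order zero, leaving
  \<open>\<beta>\<^sup>2 / 4\<close>, and the coefficient of \<open>\<eta>\<close> is minus
  \<open>PhiRS p \<beta> u\<close>: a positive value is a gain of first order against an error of
  second order.\<close>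

theorem en_strict_upper:
  assumes p: "2 \<le> p" and \<beta>: "0 < \<beta>" and u: "0 \<le> u" "u \<le> 1" and Phi: "0 < PhiRS p \<beta> u"
  shows "\<exists>\<delta>>0. \<forall>\<^sub>F N in sequentially. en p N \<beta> / real N \<le> \<beta>\<^sup>2 / 4 - \<delta>"
proof -
  let ?a = "rs p \<beta> u" and ?\<Phi> = "PhiRS p \<beta> u"
  obtain B where B: "0 \<le> B" "\<And>\<eta>. 0 < \<eta> \<Longrightarrow> \<eta> < 1 \<Longrightarrow>
      ln (\<integral>z. cosh (?a * z) powr (1 - \<eta>) \<partial>std_gauss) \<le> ?a\<^sup>2 / 2 - \<eta> * At ?a + \<eta>\<^sup>2 * B"
    using cosh_moment_near_one[of ?a] by blast
  \<comment> \<open>Makes the second-order term \<open>\<eta> * (\<eta> * B)\<close> at most half of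
    the gain; the value one half keeps \<open>m\<close> inside the unit interval.\<close>
  define \<eta> where "\<eta> = min (1 / 2) (?\<Phi> / (2 * (B + 1)))"
  have \<eta>: "0 < \<eta>" "\<eta> < 1" "\<eta> * B \<le> ?\<Phi> / 2"
  proof -
    show "0 < \<eta>" "\<eta> < 1" using Phi B unfolding \<eta>_def by (auto simp: min_def)
    have "\<eta> * B \<le> \<eta> * (B + 1)" using \<open>0 < \<eta>\<close> by simp
    also have "\<dots> \<le> ?\<Phi> / (2 * (B + 1)) * (B + 1)" using B by (intro mult_right_mono) (auto simp: \<eta>_def)
    also have "\<dots> = ?\<Phi> / 2"
    proof -
      have "X / (2 * z) * z = X / 2" if "0 < z" for X z :: real using that by simp
      from this[of "B + 1" ?\<Phi>] show ?thesis using B(1) by linarith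
    qed
    finally show "\<eta> * B \<le> ?\<Phi> / 2" .
  qed
  define m where "m = 1 - \<eta>"
  have m: "0 < m" "m < 1" using \<eta> by (auto simp: m_def)
  \<comment> \<open>An eighth of the gain, spent once on the comparison error and once on the
    constant \<open>A / m\<close> divided by \<open>N\<close>.\<close>
  define \<epsilon> where "\<epsilon> = \<eta> * ?\<Phi> / 8"
  have \<epsilon>: "0 < \<epsilon>" using \<eta> Phi by (simp add: \<epsilon>_def)
  obtain A where A: "0 \<le> A" "\<And>N S q. 1 \<le> N \<Longrightarrow> S \<subseteq> spins N \<Longrightarrow> S \<noteq> {} \<Longrightarrow> 0 \<le> q \<Longrightarrow> q \<le> 1 \<Longrightarrow>
    ln (moment m S (uw N) (words {..<N} p) (hc p N \<beta>)) \<le> ln (moment m S (uw N) {..<N} (fld (rs p \<beta> q)))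
      + m * real N * (\<beta>\<^sup>2 / 4 - (rs p \<beta> q)\<^sup>2 / 2 + (1 - m) * (\<beta>\<^sup>2 * theta p q) / 2 + \<epsilon>) + A"
    using model_comparison[OF p m \<epsilon>, of \<beta>] by blast
  have th0: "0 \<le> \<beta>\<^sup>2 * theta p u" using p u by (auto simp: theta_eq)
  have Phi_eq: "?\<Phi> = At ?a - ?a\<^sup>2 / 2 - \<beta>\<^sup>2 * theta p u / 2"
    unfolding PhiRS_def rs_square[OF u(1)] by (simp add: rs_def algebra_simps)
  have bound: "en p N \<beta> \<le> real N * (\<beta>\<^sup>2 / 4 - \<eta> * ?\<Phi> / 2 + \<epsilon>) + A / m" if N: "1 \<le> N" for N
  proof -
    let ?I = "\<integral>z. cosh (?a * z) powr m \<partial>std_gauss"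
    have I1: "1 \<le> ?I" using cosh_moment_pos[OF m, of ?a 0] by simp
    have "moment m (spins N) (uw N) {..<N} (fld ?a) \<le> exp (- m * 0) * (\<Prod>i<N. \<integral>z. cosh (?a * z + 0) powr m \<partial>std_gauss)"
      by (rule moment_field_restricted[OF m order.refl spins_nonempty]) simp
    then have "moment m (spins N) (uw N) {..<N} (fld ?a) \<le> ?I ^ N" by simp
    moreover have "0 < moment m (spins N) (uw N) {..<N} (fld ?a)"
    proof -
      interpret gibbs "spins N" "uw N" m using m finite_spins spins_nonempty by unfold_locales auto
      show ?thesis using tw_Nil_pos[of "{..<N}" "fld ?a"] by (simp add: tw_Nil)
    qed
    ultimately have "ln (moment m (spins N) (uw N) {..<N} (fld ?a)) \<le> ln (?I ^ N)" using I1 by (subst ln_le_cancel_iff) auto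
    also have "\<dots> = real N * ln ?I" using I1 by (simp add: ln_realpow)
    also have "\<dots> \<le> real N * (?a\<^sup>2 / 2 - \<eta> * At ?a + \<eta>\<^sup>2 * B)"
      using B(2)[OF \<eta>(1,2)] by (intro mult_left_mono) (auto simp: m_def)
    finally have "m * en p N \<beta> \<le> real N * (?a\<^sup>2 / 2 - \<eta> * At ?a + \<eta>\<^sup>2 * B)
        + m * real N * (\<beta>\<^sup>2 / 4 - ?a\<^sup>2 / 2 + (1 - m) * (\<beta>\<^sup>2 * theta p u) / 2 + \<epsilon>) + A"
      using A(2)[OF N order.refl spins_nonempty u] en_le_moment(1)[OF N _ m, of p \<beta>] p by linarith
    also have "\<dots> = real N * (m * (\<beta>\<^sup>2 / 4 + \<epsilon>) - \<eta> * ?\<Phi> + \<eta> * (\<eta> * B) - \<eta>\<^sup>2 * (\<beta>\<^sup>2 * theta p u) / 2) + A"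
      unfolding Phi_eq by (simp add: m_def field_simps power2_eq_square)
    also have "\<dots> \<le> real N * (m * (\<beta>\<^sup>2 / 4 + \<epsilon>) - \<eta> * ?\<Phi> / 2) + A"
    proof -
      have "\<eta> * (\<eta> * B) \<le> \<eta> * (?\<Phi> / 2)" using \<eta> by (intro mult_left_mono) auto
      moreover have "0 \<le> \<eta>\<^sup>2 * (\<beta>\<^sup>2 * theta p u) / 2" using th0 by simp
      ultimately have "m * (\<beta>\<^sup>2 / 4 + \<epsilon>) - \<eta> * ?\<Phi> + \<eta> * (\<eta> * B) - \<eta>\<^sup>2 * (\<beta>\<^sup>2 * theta p u) / 2
          \<le> m * (\<beta>\<^sup>2 / 4 + \<epsilon>) - \<eta> * ?\<Phi> / 2" by (simp add: field_simps)
      then show ?thesis by (intro add_right_mono mult_left_mono) auto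
    qed
    also have "\<dots> \<le> real N * (m * (\<beta>\<^sup>2 / 4 + \<epsilon>) - m * (\<eta> * ?\<Phi> / 2)) + A"
    proof -
      have "m * (\<eta> * ?\<Phi> / 2) \<le> 1 * (\<eta> * ?\<Phi> / 2)" using m \<eta> Phi by (intro mult_right_mono) auto
      then show ?thesis by (intro add_right_mono mult_left_mono) auto
    qed
    also have "\<dots> = m * (real N * (\<beta>\<^sup>2 / 4 - \<eta> * ?\<Phi> / 2 + \<epsilon>) + A / m)" using m by (simp add: field_simps)
    finally show ?thesis using m by simp
  qed
  have "(\<lambda>N. A / m / real N) \<longlonglongrightarrow> 0" by (rule lim_const_over_n)
  then have "\<forall>\<^sub>F N in sequentially. A / m / real N < \<epsilon>" using \<epsilon> by (rule order_tendstoD)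
  then have "\<forall>\<^sub>F N in sequentially. en p N \<beta> / real N \<le> \<beta>\<^sup>2 / 4 - \<eta> * ?\<Phi> / 4"
    using eventually_ge_at_top[of 1]
  proof eventually_elim
    case (elim N)
    have "en p N \<beta> / real N \<le> (real N * (\<beta>\<^sup>2 / 4 - \<eta> * ?\<Phi> / 2 + \<epsilon>) + A / m) / real N"
      using bound[of N] elim by (intro divide_right_mono) auto
    also have "\<dots> = \<beta>\<^sup>2 / 4 - \<eta> * ?\<Phi> / 2 + \<epsilon> + A / m / real N" using elim by (simp add: add_divide_distrib)
    finally show ?case using elim(1) unfolding \<epsilon>_def by linarith
  qed
  then show ?thesis using \<eta> Phi by (intro exI[of _ "\<eta> * ?\<Phi> / 4"]) auto
qed

section \<open>Lower bound\<close>

lemma gauss_shift: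
  fixes G :: "('i \<Rightarrow> real) \<Rightarrow> real"
  assumes J: "finite J" and [measurable]: "G \<in> borel_measurable gauss" and G: "\<And>g. 0 \<le> G g"
  shows "(\<integral>g. exp (\<Sum>j\<in>J. a j * g j) * G g \<partial>gauss)
    = exp ((\<Sum>j\<in>J. (a j)\<^sup>2) / 2) * (\<integral>g. G (\<lambda>j. if j \<in> J then g j + a j else g j) \<partial>gauss)"
proof -
  have T: "(\<lambda>g j. if j \<in> J then g j + a j else g j) \<in> measurable gauss gauss"
    by (rule measurable_into_gauss) (auto intro!: measurable_If_restrict_space_iff[THEN iffD2] simp: if_distrib split: if_splits)
  have [measurable]: "(\<lambda>g. G (\<lambda>j. if j \<in> J then g j + a j else g j)) \<in> borel_measurable gauss"
    by (rule measurable_compose[OF T]) measurable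
  have "(\<integral>g. exp (\<Sum>j\<in>J. a j * g j) * G g \<partial>gauss) = enn2real (\<integral>\<^sup>+g. ennreal (exp (\<Sum>j\<in>J. a j * g j) * G g) \<partial>gauss)"
    by (rule integral_eq_nn_integral) (auto simp: G)
  also have "(\<integral>\<^sup>+g. ennreal (exp (\<Sum>j\<in>J. a j * g j) * G g) \<partial>gauss)
      = (\<integral>\<^sup>+g. ennreal (exp (\<Sum>j\<in>J. a j * g j)) * ennreal (G g) \<partial>gauss)"
    by (simp add: ennreal_mult' G)
  also have "\<dots> = ennreal (exp ((\<Sum>j\<in>J. (a j)\<^sup>2) / 2)) * (\<integral>\<^sup>+g. ennreal (G (\<lambda>j. if j \<in> J then g j + a j else g j)) \<partial>gauss)"
    by (rule nn_gauss_shift[OF J]) measurable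
  also have "enn2real \<dots> = exp ((\<Sum>j\<in>J. (a j)\<^sup>2) / 2) * enn2real (\<integral>\<^sup>+g. ennreal (G (\<lambda>j. if j \<in> J then g j + a j else g j)) \<partial>gauss)"
    by (simp add: enn2real_mult)
  also have "enn2real (\<integral>\<^sup>+g. ennreal (G (\<lambda>j. if j \<in> J then g j + a j else g j)) \<partial>gauss)
      = (\<integral>g. G (\<lambda>j. if j \<in> J then g j + a j else g j) \<partial>gauss)"
    by (rule integral_eq_nn_integral[symmetric]) (auto simp: G)
  finally show ?thesis .
qed

lemma field_shift:
  "field J h (\<lambda>j. if j \<in> J then g j + h j \<sigma> else g j) s = field J h g s + cov J h h s \<sigma>"
  unfolding field_def cov_def sum.distrib[symmetric] by (intro sum.cong refl) (simp add: algebra_simps)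

text \<open>Weighting by the exponential of the field at \<open>\<sigma>\<close> adds to the field
  at \<open>s\<close> its covariance with \<open>\<sigma>\<close>. When this is constant on
  \<open>S\<close>, as on a level of the overlap, it factors out of the partition function.\<close>

lemma tilted_moment:
  assumes J: "finite J" and S: "\<And>s. s \<in> S \<Longrightarrow> 0 \<le> w s" and C: "\<And>s. s \<in> S \<Longrightarrow> cov J h h s \<sigma> = C"
  shows "(\<integral>g. exp (field J h g \<sigma>) * zsum S w J h g powr m \<partial>gauss)
    = exp (cov J h h \<sigma> \<sigma> / 2 + m * C) * moment m S w J h"
proof -
  have z: "zsum S w J h (\<lambda>j. if j \<in> J then g j + h j \<sigma> else g j) = exp C * zsum S w J h g" for g
    unfolding zsum_def field_shift sum_distrib_left by (intro sum.cong refl) (simp add: C exp_add mult_ac)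
  have "(\<integral>g. exp (field J h g \<sigma>) * zsum S w J h g powr m \<partial>gauss)
      = exp ((\<Sum>j\<in>J. (h j \<sigma>)\<^sup>2) / 2) * (\<integral>g. zsum S w J h (\<lambda>j. if j \<in> J then g j + h j \<sigma> else g j) powr m \<partial>gauss)"
    unfolding field_def by (rule gauss_shift[OF J]) auto
  also have "(\<Sum>j\<in>J. (h j \<sigma>)\<^sup>2) = cov J h h \<sigma> \<sigma>" by (simp add: cov_def power2_eq_square)
  also have "(\<integral>g. zsum S w J h (\<lambda>j. if j \<in> J then g j + h j \<sigma> else g j) powr m \<partial>gauss) = exp (m * C) * moment m S w J h"
    unfolding z moment_def powr_mult by (simp add: exp_powr_real mult.commute)
  finally show ?thesis by (simp add: exp_add)
qed

lemma sum_uw: "(\<Sum>\<sigma>\<in>spins N. uw N \<sigma>) = 1"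
proof -
  have "card (spins N) = 2 ^ N" unfolding words_eq_spins by (subst card_words) (auto simp: card_insert_if numeral_2_eq_2)
  then show ?thesis by (simp add: powr_minus powr_realpow)
qed

lemma cov_hc_diag: "1 \<le> N \<Longrightarrow> 1 \<le> p \<Longrightarrow> \<sigma> \<in> spins N \<Longrightarrow>
  cov (words {..<N} p) (hc p N \<beta>) (hc p N \<beta>) \<sigma> \<sigma> = \<beta>\<^sup>2 / 2 * real N"
  by (simp add: cov_hc spins_ovl)

lemma integral_zN:
  assumes N: "1 \<le> N" "1 \<le> p"
  shows "(\<integral>g. zN p N \<beta> g \<partial>gauss) = exp (\<beta>\<^sup>2 * real N / 4)" and "integrable gauss (zN p N \<beta>)"
proof -
  have i: "integrable gauss (\<lambda>g. uw N \<sigma> * exp (field (words {..<N} p) (hc p N \<beta>) g \<sigma>))" for \<sigma>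
    by (intro integrable_tame tame_mult tame_const tame_exp_field)
  show "integrable gauss (zN p N \<beta>)"
    unfolding zN_def zsum_def[abs_def] using i by (intro Bochner_Integration.integrable_sum) auto
  have e: "(\<integral>g. exp (field (words {..<N} p) (hc p N \<beta>) g \<sigma>) \<partial>gauss) = exp (\<beta>\<^sup>2 * real N / 4)" if "\<sigma> \<in> spins N" for \<sigma>
  proof -
    have "(\<integral>g. exp (field (words {..<N} p) (hc p N \<beta>) g \<sigma>) * 1 \<partial>gauss) = exp ((\<Sum>j\<in>words {..<N} p. (hc p N \<beta> j \<sigma>)\<^sup>2) / 2) * (\<integral>g. 1 \<partial>(gauss :: (nat list \<Rightarrow> real) measure))"
      unfolding field_def by (rule gauss_shift) (auto simp: finite_words)
    also have "(\<Sum>j\<in>words {..<N} p. (hc p N \<beta> j \<sigma>)\<^sup>2) = \<beta>\<^sup>2 / 2 * real N"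
      using cov_hc_diag[OF N that, of \<beta>] by (simp add: cov_def power2_eq_square)
    finally show ?thesis by (simp add: gauss.prob_space[simplified])
  qed
  have "(\<integral>g. zN p N \<beta> g \<partial>gauss) = (\<Sum>\<sigma>\<in>spins N. uw N \<sigma> * exp (\<beta>\<^sup>2 * real N / 4))"
    unfolding zN_def zsum_def using i by (subst Bochner_Integration.integral_sum) (auto simp: e)
  also have "\<dots> = exp (\<beta>\<^sup>2 * real N / 4)" using sum_uw[of N] by (simp only: sum_distrib_right[symmetric] mult_1_left)
  finally show "(\<integral>g. zN p N \<beta> g \<partial>gauss) = exp (\<beta>\<^sup>2 * real N / 4)" .
qed

lemma en_upper: "1 \<le> N \<Longrightarrow> 1 \<le> p \<Longrightarrow> en p N \<beta> \<le> \<beta>\<^sup>2 * real N / 4"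
proof -
  assume N: "1 \<le> N" "1 \<le> p"
  have i: "integrable gauss (\<lambda>g. exp (ln (zN p N \<beta> g)))" using integral_zN(2)[OF N, of \<beta>] by (simp add: zN_pos)
  have "exp (en p N \<beta>) \<le> (\<integral>g. exp (ln (zN p N \<beta> g)) \<partial>gauss)"
    unfolding en_def by (rule exp_mean_le[OF integrable_tame[OF coord_lipschitz_tame[OF coord_lipschitz_zN]] i])
  then show ?thesis using integral_zN(1)[OF N, of \<beta>] by (simp add: zN_pos)
qed

section \<open>Levels of the overlap with the planted configuration\<close>

definition level :: "nat \<Rightarrow> real list \<Rightarrow> real \<Rightarrow> real list set" where
  "level N \<sigma> k = {\<tau> \<in> spins N. (\<Sum>i<N. \<sigma> ! i * \<tau> ! i) = k}"

text \<open>The scalar product is \<open>N\<close> minus twice the Hamming distance. With so few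
  levels, splitting by overlap costs only a polynomial factor.\<close>

lemma card_levels:
  assumes "\<sigma> \<in> spins N"
  shows "card ((\<lambda>\<tau>. \<Sum>i<N. \<sigma> ! i * \<tau> ! i) ` spins N) \<le> N + 1"
proof -
  have "(\<lambda>\<tau>. \<Sum>i<N. \<sigma> ! i * \<tau> ! i) ` spins N \<subseteq> (\<lambda>j. real N - 2 * real j) ` {..N}"
  proof safe
    fix \<tau> assume \<tau>: "\<tau> \<in> spins N"
    define D where "D = {i \<in> {..<N}. \<sigma> ! i \<noteq> \<tau> ! i}"
    have "card D \<le> card {..<N}" by (rule card_mono) (auto simp: D_def)
    moreover have "(\<Sum>i<N. \<sigma> ! i * \<tau> ! i) = (\<Sum>i<N. 1 - 2 * (if \<sigma> ! i \<noteq> \<tau> ! i then 1 else 0))"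
      using spins_nth[OF assms] spins_nth[OF \<tau>] by (intro sum.cong refl) fastforce
    moreover have "\<dots> = real N - 2 * real (card D)"
      unfolding sum_subtractf sum_distrib_left[symmetric] D_def by (simp add: sum.If_cases Int_def)
    ultimately show "(\<Sum>i<N. \<sigma> ! i * \<tau> ! i) \<in> (\<lambda>j. real N - 2 * real j) ` {..N}" by auto
  qed
  then have "card ((\<lambda>\<tau>. \<Sum>i<N. \<sigma> ! i * \<tau> ! i) ` spins N) \<le> card ((\<lambda>j. real N - 2 * real j) ` {..N})"
    by (intro card_mono) auto
  also have "\<dots> \<le> card {..N}" by (rule card_image_le) simp
  finally show ?thesis by simp
qed

text \<open>The restricted moment is compared with independent fields of strength
  \<open>rs p \<beta> q\<close>, where \<open>q\<close> is the absolute overlap, and the constraint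
  becomes a field along \<open>\<sigma>\<close> by \<open>moment_field_restricted\<close>. Collected
  over all terms, the exponent per site is \<open>m * PhiRS p \<beta> q\<close> plus errors of size
  \<open>m * (m * C + \<epsilon>)\<close>. The constant is that of
  \<open>cosh_moment_near_zero\<close> for the largest field strength, reached at
  \<open>q = 1\<close>.\<close>

lemma level_moment:
  assumes p: "2 \<le> p" and \<beta>: "0 < \<beta>" and Phi: "\<And>q. 0 \<le> q \<Longrightarrow> q \<le> 1 \<Longrightarrow> PhiRS p \<beta> q \<le> 0"
    and m: "0 < m" "m < 1" and \<epsilon>: "0 < \<epsilon>"
  shows "\<exists>A. \<forall>N \<sigma> k. 1 \<le> N \<longrightarrow> \<sigma> \<in> spins N \<longrightarrow> level N \<sigma> k \<noteq> {} \<longrightarrow>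
    exp (m * (\<beta>\<^sup>2 / 2 * real N * (k / real N) ^ p) - m * (\<beta>\<^sup>2 * real N / 4))
      * moment m (level N \<sigma> k) (uw N) (words {..<N} p) (hc p N \<beta>)
    \<le> exp (m * real N * (m * (4 * exp (4 * (\<beta>\<^sup>2 * real p / 2))) + \<epsilon>) + A)"
proof -
  let ?C = "4 * exp (4 * (\<beta>\<^sup>2 * real p / 2))"
  obtain A where A: "0 \<le> A" "\<And>N S q. 1 \<le> N \<Longrightarrow> S \<subseteq> spins N \<Longrightarrow> S \<noteq> {} \<Longrightarrow> 0 \<le> q \<Longrightarrow> q \<le> 1 \<Longrightarrow>
    ln (moment m S (uw N) (words {..<N} p) (hc p N \<beta>)) \<le> ln (moment m S (uw N) {..<N} (fld (rs p \<beta> q)))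
      + m * real N * (\<beta>\<^sup>2 / 4 - (rs p \<beta> q)\<^sup>2 / 2 + (1 - m) * (\<beta>\<^sup>2 * theta p q) / 2 + \<epsilon>) + A"
    using model_comparison[OF p m \<epsilon>, of \<beta>] by blast
  have p1: "1 \<le> p" using p by simp
  show ?thesis
  \<comment> \<open>The extra 1 pays for the factor 2 in the case of an odd \<open>p\<close> and a
    negative overlap.\<close>
  proof (intro exI[of _ "A + 1"] allI impI)
    fix N :: nat and \<sigma> :: "real list" and k :: real
    assume N: "1 \<le> N" and \<sigma>: "\<sigma> \<in> spins N" and ne: "level N \<sigma> k \<noteq> {}"
    let ?S = "level N \<sigma> k" and ?u = "k / real N"
    let ?M = "moment m ?S (uw N) (words {..<N} p) (hc p N \<beta>)"
    have sub: "?S \<subseteq> spins N" by (auto simp: level_def)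
    have fS: "finite ?S" using sub finite_spins finite_subset by blast
    have u: "\<bar>?u\<bar> \<le> 1"
    proof -
      obtain \<tau> where "\<tau> \<in> spins N" "(\<Sum>i<N. \<sigma> ! i * \<tau> ! i) = k" using ne by (auto simp: level_def)
      then show ?thesis using spins_ovl(1)[OF N \<sigma>, of \<tau>] by (simp add: ovl_def)
    qed
    have mpos: "0 < moment m ?S (uw N) J a" for J :: "'k set" and a
    proof -
      interpret gibbs ?S "uw N" m using m fS ne by unfold_locales auto
      show ?thesis using tw_Nil_pos[of J a] by (simp add: tw_Nil)
    qed
    have C0: "0 \<le> m * real N * (m * ?C + \<epsilon>)" using m \<epsilon> by (intro mult_nonneg_nonneg add_nonneg_nonneg) auto
    show "exp (m * (\<beta>\<^sup>2 / 2 * real N * ?u ^ p) - m * (\<beta>\<^sup>2 * real N / 4)) * ?M \<le> exp (m * real N * (m * ?C + \<epsilon>) + (A + 1))"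
    proof (cases "0 \<le> ?u \<or> even p")
      case True
      define q where "q = \<bar>?u\<bar>"
      have q: "0 \<le> q" "q \<le> 1" using u by (auto simp: q_def)
      have uq: "?u ^ p = q ^ p" unfolding q_def using True by (metis abs_of_nonneg power_even_abs)
      define a where "a = rs p \<beta> q"
      \<comment> \<open>For even \<open>p\<close> a negative overlap is treated like its absolute
        value, with the field pointing against \<open>\<sigma>\<close>.\<close>
      define s where "s = (if 0 \<le> ?u then 1 else - 1 :: real)"
      have sk: "s * k = q * real N" using N by (auto simp: s_def q_def abs_if field_simps)
      have a2: "a\<^sup>2 = \<beta>\<^sup>2 / 2 * (real p * q ^ (p - 1))" using q by (simp add: a_def rs_square xi'_def)
      have qq: "q * q ^ (p - 1) = q ^ p" using p by (cases p) auto
      have th: "theta p q = (real p - 1) * q ^ p / 2" by (rule theta_eq[OF p1])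
      have th0: "0 \<le> \<beta>\<^sup>2 * theta p q" unfolding th using p q by auto
      have aq: "a\<^sup>2 * q = \<beta>\<^sup>2 * theta p q + \<beta>\<^sup>2 / 2 * q ^ p"
        unfolding a2 th by (simp add: qq[symmetric] field_simps)
      have Phi_eq: "PhiRS p \<beta> q = At a - a\<^sup>2 / 2 - \<beta>\<^sup>2 * theta p q / 2"
        unfolding PhiRS_def a_def rs_square[OF q(1)] by (simp add: rs_def algebra_simps)
      have aY: "\<bar>a\<bar> \<le> sqrt (\<beta>\<^sup>2 * real p / 2)"
      proof (rule real_le_rsqrt[of "\<bar>a\<bar>", simplified])
        have "\<beta>\<^sup>2 / 2 * (real p * q ^ (p - 1)) \<le> \<beta>\<^sup>2 / 2 * (real p * 1)"
          using q by (intro mult_left_mono power_le_one) auto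
        then show "a\<^sup>2 \<le> \<beta>\<^sup>2 * real p / 2" unfolding a2 by simp
      qed
      have Y2: "(sqrt (\<beta>\<^sup>2 * real p / 2))\<^sup>2 = \<beta>\<^sup>2 * real p / 2" by simp
      have "moment m ?S (uw N) {..<N} (fld a) \<le> exp (- m * (a\<^sup>2 * q * real N)) * (\<Prod>i<N. \<integral>z. cosh (a * z + s * a\<^sup>2 * \<sigma> ! i) powr m \<partial>std_gauss)"
      proof (rule moment_field_restricted[OF m sub ne])
        fix \<tau> assume "\<tau> \<in> ?S"
        then have "(\<Sum>i<N. s * a\<^sup>2 * \<sigma> ! i * \<tau> ! i) = s * a\<^sup>2 * k" by (simp add: level_def mult.assoc flip: sum_distrib_left)
        also have "\<dots> = a\<^sup>2 * (s * k)" by simp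
        finally show "(\<Sum>i<N. s * a\<^sup>2 * \<sigma> ! i * \<tau> ! i) = a\<^sup>2 * q * real N" unfolding sk by simp
      qed
      also have "(\<Prod>i<N. \<integral>z. cosh (a * z + s * a\<^sup>2 * \<sigma> ! i) powr m \<partial>std_gauss) \<le> (\<Prod>i<N. exp (m * At a + m\<^sup>2 * ?C))"
      proof (rule prod_mono, safe)
        fix i assume "i < N"
        then have "s * a\<^sup>2 * \<sigma> ! i = a\<^sup>2 \<or> s * a\<^sup>2 * \<sigma> ! i = - a\<^sup>2" using spins_nth[OF \<sigma>, of i] by (auto simp: s_def)
        from cosh_moment_near_zero[OF m aY this]
        show "(\<integral>z. cosh (a * z + s * a\<^sup>2 * \<sigma> ! i) powr m \<partial>std_gauss) \<le> exp (m * At a + m\<^sup>2 * ?C)" unfolding Y2 .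
      qed (simp add: integral_nonneg_AE)
      also have "\<dots> = exp (real N * (m * At a + m\<^sup>2 * ?C))" by (simp add: exp_of_nat_mult)
      finally have "moment m ?S (uw N) {..<N} (fld a) \<le> exp (- m * (a\<^sup>2 * q * real N)) * exp (real N * (m * At a + m\<^sup>2 * ?C))" by simp
      then have "moment m ?S (uw N) {..<N} (fld a) \<le> exp (- m * (a\<^sup>2 * q * real N) + real N * (m * At a + m\<^sup>2 * ?C))"
        by (simp only: exp_add)
      then have "ln (moment m ?S (uw N) {..<N} (fld a)) \<le> - m * (a\<^sup>2 * q * real N) + real N * (m * At a + m\<^sup>2 * ?C)"
        using mpos[of "{..<N}" "fld a"] by (subst (asm) ln_le_cancel_iff[symmetric]) auto
      then have "ln ?M \<le> - m * (a\<^sup>2 * q * real N) + real N * (m * At a + m\<^sup>2 * ?C)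
          + m * real N * (\<beta>\<^sup>2 / 4 - a\<^sup>2 / 2 + (1 - m) * (\<beta>\<^sup>2 * theta p q) / 2 + \<epsilon>) + A"
        using A(2)[OF N sub ne q] unfolding a_def by linarith
      then have "m * (\<beta>\<^sup>2 / 2 * real N * ?u ^ p) - m * (\<beta>\<^sup>2 * real N / 4) + ln ?M
          \<le> m * (\<beta>\<^sup>2 / 2 * real N * q ^ p) - m * (\<beta>\<^sup>2 * real N / 4)
          + (- m * (a\<^sup>2 * q * real N) + real N * (m * At a + m\<^sup>2 * ?C)
          + m * real N * (\<beta>\<^sup>2 / 4 - a\<^sup>2 / 2 + (1 - m) * (\<beta>\<^sup>2 * theta p q) / 2 + \<epsilon>) + A)"
        unfolding uq by linarith
      also have "\<dots> = m * real N * (PhiRS p \<beta> q + (m * ?C + \<epsilon>) - m * (\<beta>\<^sup>2 * theta p q) / 2) + A"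
        unfolding aq Phi_eq by (simp add: field_simps power2_eq_square)
      also have "\<dots> \<le> m * real N * (m * ?C + \<epsilon>) + A"
      proof (intro add_right_mono mult_left_mono)
        have "0 \<le> m * (\<beta>\<^sup>2 * theta p q)" by (rule mult_nonneg_nonneg[OF less_imp_le[OF m(1)] th0])
        then show "PhiRS p \<beta> q + (m * ?C + \<epsilon>) - m * (\<beta>\<^sup>2 * theta p q) / 2 \<le> m * ?C + \<epsilon>"
          using Phi[OF q] by linarith
      qed (use m in auto)
      finally have "exp (m * (\<beta>\<^sup>2 / 2 * real N * ?u ^ p) - m * (\<beta>\<^sup>2 * real N / 4) + ln ?M) \<le> exp (m * real N * (m * ?C + \<epsilon>) + (A + 1))"
        by simp
      then show ?thesis unfolding exp_add[of _ "ln ?M"] using mpos[of "words {..<N} p" "hc p N \<beta>"] by simp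
    next
      \<comment> \<open>For odd \<open>p\<close> and negative overlap the planted shift is not
        positive, so the crude bound of \<open>x powr m\<close> by \<open>1 + x\<close> and the mean
        of the partition function suffice.\<close>
      case False
      then have "?u ^ p \<le> 0" using p1 by (simp add: power_le_zero_eq)
      then have u0: "m * (\<beta>\<^sup>2 / 2 * real N * ?u ^ p) \<le> 0" using m by (intro mult_nonneg_nonpos) auto
      let ?c = "exp (\<beta>\<^sup>2 * real N / 4)"
      have le: "zsum ?S (uw N) (words {..<N} p) (hc p N \<beta>) g powr m \<le> exp (m * (\<beta>\<^sup>2 * real N / 4)) * (1 + zN p N \<beta> g / ?c)" for g
      proof -
        let ?x = "zN p N \<beta> g / ?c"
        have x: "0 < ?x" by (simp add: zN_pos)
        have "zsum ?S (uw N) (words {..<N} p) (hc p N \<beta>) g \<le> ?c * ?x"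
          unfolding zN_def zsum_def using sub by (auto intro!: sum_mono2 finite_spins)
        then have "zsum ?S (uw N) (words {..<N} p) (hc p N \<beta>) g powr m \<le> (?c * ?x) powr m"
          using m zsum_pos[OF fS ne, of "uw N" "words {..<N} p" "hc p N \<beta>" g] by (intro powr_mono2) auto
        also have "\<dots> = exp (m * (\<beta>\<^sup>2 * real N / 4)) * ?x powr m" unfolding powr_mult by (simp add: exp_powr_real mult.commute)
        also have "?x powr m \<le> 1 + ?x"
        proof (cases "?x \<le> 1")
          case True
          then have "?x powr m \<le> 1" using powr_mono2[of m ?x 1] m x by simp
          then show ?thesis using x by linarith
        next
          case False
          then have "?x powr m \<le> ?x powr 1" using m by (intro powr_mono) auto
          then show ?thesis using x by simp
        qed
        finally show ?thesis by simp
      qed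
      have "?M \<le> (\<integral>g. exp (m * (\<beta>\<^sup>2 * real N / 4)) * (1 + zN p N \<beta> g / ?c) \<partial>gauss)"
        unfolding moment_def
      proof (rule integral_mono)
        show "integrable gauss (\<lambda>g. zsum ?S (uw N) (words {..<N} p) (hc p N \<beta>) g powr m)"
          by (intro integrable_tame tame_zsum_powr fS ne m) simp
        show "integrable gauss (\<lambda>g. exp (m * (\<beta>\<^sup>2 * real N / 4)) * (1 + zN p N \<beta> g / ?c))"
          using integral_zN(2)[OF N p1, of \<beta>] by auto
      qed (rule le)
      also have "\<dots> = exp (m * (\<beta>\<^sup>2 * real N / 4)) * 2"
        using integral_zN[OF N p1, of \<beta>] by (simp add: gauss.prob_space[simplified])
      finally have M: "?M \<le> exp (m * (\<beta>\<^sup>2 * real N / 4)) * 2" .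
      have "exp (m * (\<beta>\<^sup>2 / 2 * real N * ?u ^ p) - m * (\<beta>\<^sup>2 * real N / 4)) * ?M
          \<le> exp (- (m * (\<beta>\<^sup>2 * real N / 4))) * (exp (m * (\<beta>\<^sup>2 * real N / 4)) * 2)"
        using u0 M mpos[of "words {..<N} p" "hc p N \<beta>"] by (intro mult_mono) auto
      also have "\<dots> = 2" by (simp add: exp_minus)
      also have "\<dots> \<le> exp (1 :: real)" using exp_ge_add_one_self[of 1] by simp
      also have "\<dots> \<le> exp (m * real N * (m * ?C + \<epsilon>) + (A + 1))" using C0 A(1) by simp
      finally show ?thesis .
    qed
  qed
qed

lemma eventually_poly_exp:
  assumes "0 < c" "0 < (B :: real)"
  shows "\<forall>\<^sub>F N in sequentially. (real N + 1)\<^sup>2 * exp (A - c * real N) \<le> B"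
proof -
  have "filterlim (\<lambda>N. c * real N) at_top sequentially"
    by (rule filterlim_tendsto_pos_mult_at_top[OF tendsto_const assms(1) filterlim_real_sequentially])
  from filterlim_compose[OF tendsto_power_div_exp_0[of 2] this]
  have l: "(\<lambda>N. (c * real N)\<^sup>2 / exp (c * real N)) \<longlonglongrightarrow> 0" .
  have "0 < B * c\<^sup>2 / (4 * exp A)" using assms by simp
  with l have "\<forall>\<^sub>F N in sequentially. (c * real N)\<^sup>2 / exp (c * real N) < B * c\<^sup>2 / (4 * exp A)"
    by (rule order_tendstoD)
  then show ?thesis using eventually_ge_at_top[of 1]
  proof eventually_elim
    case (elim N)
    have "(real N + 1)\<^sup>2 \<le> (2 * real N)\<^sup>2" using elim by (intro power_mono) auto
    then have "(real N + 1)\<^sup>2 * exp (A - c * real N) \<le> (2 * real N)\<^sup>2 * exp (A - c * real N)" by (rule mult_right_mono) simp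
    also have "\<dots> = (4 * exp A / c\<^sup>2) * ((c * real N)\<^sup>2 / exp (c * real N))"
      using assms by (simp add: exp_diff field_simps)
    also have "\<dots> \<le> (4 * exp A / c\<^sup>2) * (B * c\<^sup>2 / (4 * exp A))" using elim(1) by (intro mult_left_mono) auto
    also have "\<dots> = B" using assms by simp
    finally show ?case .
  qed
qed

text \<open>Large values of the partition function are traded for fractional moments: the planted
  configuration \<open>\<sigma>\<close> comes from a change of measure, and splitting by the overlap with \<open>\<sigma>\<close> leaves
  moments of restricted partition functions that the comparison bounds by \<open>PhiRS \<le> 0\<close>.\<close>

lemma partition_function_not_small:
  assumes p: "2 \<le> p" and \<beta>: "0 < \<beta>" and Phi: "\<And>q. 0 \<le> q \<Longrightarrow> q \<le> 1 \<Longrightarrow> PhiRS p \<beta> q \<le> 0"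
    and \<delta>: "0 < \<delta>"
  shows "\<forall>\<^sub>F N in sequentially. exp (- \<delta> * real N) / 4 \<le> measure gauss {g. \<beta>\<^sup>2 * real N / 4 - ln 4 \<le> ln (zN p N \<beta> g)}"
proof -
  define C where "C = 4 * exp (4 * (\<beta>\<^sup>2 * real p / 2))"
  have C: "0 < C" by (simp add: C_def)
  \<comment> \<open>Small enough that the second-order cost \<open>m * C\<close> is at most a
    quarter of \<open>\<delta>\<close>; the total exponent of a level then stays below
    \<open>m * \<delta> / 2\<close> per site.\<close>
  define m where "m = min (1 / 2) (\<delta> / (4 * C))"
  have m: "0 < m" "m < 1" using \<delta> C by (auto simp: m_def)
  have "m * C \<le> \<delta> / (4 * C) * C" using C by (intro mult_right_mono) (auto simp: m_def)
  then have mC: "m * C + \<delta> / 4 \<le> \<delta> / 2" using C by simp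
  have p1: "1 \<le> p" using p by simp
  have "\<exists>A. \<forall>N \<sigma> k. 1 \<le> N \<longrightarrow> \<sigma> \<in> spins N \<longrightarrow> level N \<sigma> k \<noteq> {} \<longrightarrow>
    exp (m * (\<beta>\<^sup>2 / 2 * real N * (k / real N) ^ p) - m * (\<beta>\<^sup>2 * real N / 4))
      * moment m (level N \<sigma> k) (uw N) (words {..<N} p) (hc p N \<beta>)
    \<le> exp (m * real N * (m * C + \<delta> / 4) + A)"
    using level_moment[OF p \<beta> Phi m, of "\<delta> / 4"] \<delta> unfolding C_def by simp
  then obtain A where A: "\<And>N \<sigma> k. 1 \<le> N \<Longrightarrow> \<sigma> \<in> spins N \<Longrightarrow> level N \<sigma> k \<noteq> {} \<Longrightarrow>
    exp (m * (\<beta>\<^sup>2 / 2 * real N * (k / real N) ^ p) - m * (\<beta>\<^sup>2 * real N / 4))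
      * moment m (level N \<sigma> k) (uw N) (words {..<N} p) (hc p N \<beta>)
    \<le> exp (m * real N * (m * C + \<delta> / 4) + A)" by blast
  have "\<forall>\<^sub>F N in sequentially. (real N + 1)\<^sup>2 * exp (A - m * \<delta> / 2 * real N) \<le> 1 / 2"
    by (rule eventually_poly_exp) (use m \<delta> in auto)
  then show ?thesis using eventually_ge_at_top[of 1]
  proof eventually_elim
    case (elim N)
    then have N: "1 \<le> N" and small: "(real N + 1)\<^sup>2 * exp (A - m * \<delta> / 2 * real N) \<le> 1 / 2" by auto
    let ?J = "words {..<N} p" and ?h = "hc p N \<beta>"
    \<comment> \<open>Normalises the partition function to mean one: \<open>L\<close> is the density
      of the planted law.\<close>
    define c where "c = exp (- (\<beta>\<^sup>2 * real N / 4))"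
    have c0: "0 < c" by (simp add: c_def)
    define L where "L g = c * zN p N \<beta> g" for g
    define lev where "lev \<sigma> = (\<lambda>\<tau>. \<Sum>i<N. \<sigma> ! i * \<tau> ! i) ` spins N" for \<sigma> :: "real list"
    define X where "X \<sigma> k g = zsum (level N \<sigma> k) (uw N) ?J ?h g" for \<sigma> k g
    \<comment> \<open>If \<open>L g\<close> exceeds \<open>exp (\<delta> * real N)\<close>, then for
      each \<open>\<sigma>\<close> one of at most \<open>N + 1\<close> levels carries at least
      \<open>1 / b\<close>. Its term in \<open>T\<close> is then at least 1, so \<open>T\<close>
      dominates \<open>L\<close> there.\<close>
    define b where "b = (real N + 1) * exp (- \<delta> * real N)"
    have b0: "0 < b" by (simp add: b_def)
    define T where "T g = (\<Sum>\<sigma>\<in>spins N. uw N \<sigma> * (c * exp (field ?J ?h g \<sigma>)) * (\<Sum>k\<in>lev \<sigma>. (b * (c * X \<sigma> k g)) powr m))" for g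
    define E where "E = {g. \<beta>\<^sup>2 * real N / 4 - ln 4 \<le> ln (zN p N \<beta> g)}"
    have flev: "finite (lev \<sigma>)" for \<sigma> by (simp add: lev_def finite_spins)
    have level_ne: "level N \<sigma> k \<noteq> {}" if "k \<in> lev \<sigma>" for \<sigma> k using that by (auto simp: lev_def level_def)
    have level_fin: "finite (level N \<sigma> k)" for \<sigma> k by (simp add: level_def finite_spins)
    have Xpos: "0 < X \<sigma> k g" if "k \<in> lev \<sigma>" for \<sigma> k g
      unfolding X_def by (rule zsum_pos[OF level_fin level_ne[OF that]]) simp
    have Lsum: "L g = (\<Sum>k\<in>lev \<sigma>. c * X \<sigma> k g)" for \<sigma> g
    proof -
      have "zN p N \<beta> g = (\<Sum>k\<in>lev \<sigma>. X \<sigma> k g)"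
        unfolding zN_def X_def zsum_def lev_def level_def by (rule sum.image_gen[OF finite_spins])
      then show ?thesis by (simp add: L_def sum_distrib_left)
    qed
    have T0: "0 \<le> T g" for g unfolding T_def using c0 by (intro sum_nonneg mult_nonneg_nonneg) auto
    \<comment> \<open>Three cases: off \<open>E\<close> the value is below one quarter; on
      \<open>E\<close> it is at most \<open>exp (\<delta> * real N)\<close>, or else dominated by
      \<open>T\<close>.\<close>
    have split: "L g \<le> 1 / 4 + exp (\<delta> * real N) * indicator E g + T g" for g
    proof (cases "g \<in> E")
      case False
      then have "ln (zN p N \<beta> g) < \<beta>\<^sup>2 * real N / 4 - ln 4" by (simp add: E_def)
      then have "exp (ln (zN p N \<beta> g)) \<le> exp (\<beta>\<^sup>2 * real N / 4 - ln 4)" by simp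
      then have "L g \<le> c * exp (\<beta>\<^sup>2 * real N / 4 - ln 4)" using c0 by (simp add: L_def zN_pos)
      also have "\<dots> = 1 / 4" by (simp add: c_def exp_diff exp_minus)
      finally show ?thesis using T0[of g] False by simp
    next
      case True
      show ?thesis
      proof (cases "L g \<le> exp (\<delta> * real N)")
        case True
        then show ?thesis using T0[of g] \<open>g \<in> E\<close> by simp
      next
        case False
        have one: "1 \<le> (\<Sum>k\<in>lev \<sigma>. (b * (c * X \<sigma> k g)) powr m)" if \<sigma>: "\<sigma> \<in> spins N" for \<sigma>
        proof -
          have "\<exists>k\<in>lev \<sigma>. exp (\<delta> * real N) / (real N + 1) \<le> c * X \<sigma> k g"
          proof (rule ccontr)
            assume "\<not> ?thesis"
            then have "(\<Sum>k\<in>lev \<sigma>. c * X \<sigma> k g) \<le> (\<Sum>k\<in>lev \<sigma>. exp (\<delta> * real N) / (real N + 1))"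
              by (intro sum_mono) (auto simp: not_le less_imp_le)
            also have "\<dots> = real (card (lev \<sigma>)) * (exp (\<delta> * real N) / (real N + 1))" by simp
            also have "\<dots> \<le> (real N + 1) * (exp (\<delta> * real N) / (real N + 1))"
              using card_levels[OF \<sigma>] by (intro mult_right_mono) (auto simp: lev_def)
            also have "\<dots> = exp (\<delta> * real N)" by simp
            finally show False using False Lsum[of g \<sigma>] by simp
          qed
          then obtain k where k: "k \<in> lev \<sigma>" "exp (\<delta> * real N) / (real N + 1) \<le> c * X \<sigma> k g" by blast
          have "1 = b * (exp (\<delta> * real N) / (real N + 1))" by (simp add: b_def exp_minus)
          also have "\<dots> \<le> b * (c * X \<sigma> k g)" using k(2) b0 by (intro mult_left_mono) auto
          finally have "1 \<le> (b * (c * X \<sigma> k g)) powr m" using m by (intro ge_one_powr_ge_zero) auto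
          also have "\<dots> \<le> (\<Sum>k\<in>lev \<sigma>. (b * (c * X \<sigma> k g)) powr m)"
            by (rule member_le_sum[OF k(1) _ flev]) simp
          finally show ?thesis .
        qed
        have "L g = (\<Sum>\<sigma>\<in>spins N. uw N \<sigma> * (c * exp (field ?J ?h g \<sigma>)) * 1)"
          unfolding L_def zN_def zsum_def sum_distrib_left by (intro sum.cong refl) simp
        also have "\<dots> \<le> T g" unfolding T_def using one c0 by (intro sum_mono mult_left_mono) auto
        finally have "L g \<le> T g" .
        moreover have "0 \<le> exp (\<delta> * real N) * indicator E g" by simp
        ultimately show ?thesis by linarith
      qed
    qed
    have it: "integrable gauss (\<lambda>g. exp (field ?J ?h g \<sigma>) * X \<sigma> k g powr m)" if "k \<in> lev \<sigma>" for \<sigma> k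
      unfolding X_def by (intro integrable_tame tame_mult tame_exp_field tame_zsum_powr level_fin level_ne[OF that] m) auto
    define y where "y \<sigma> k = uw N \<sigma> * c * (b * c) powr m" for \<sigma> :: "real list" and k :: real
    have T_eq: "T g = (\<Sum>\<sigma>\<in>spins N. \<Sum>k\<in>lev \<sigma>. y \<sigma> k * (exp (field ?J ?h g \<sigma>) * X \<sigma> k g powr m))" for g
      unfolding T_def y_def powr_mult sum_distrib_left by (intro sum.cong refl) (simp add: mult_ac)
    have iT: "integrable gauss T"
      unfolding T_eq[abs_def] using it by (intro Bochner_Integration.integrable_sum integrable_mult_right) auto
    have ET: "(\<integral>g. T g \<partial>gauss) \<le> 1 / 2"
    proof -
      have "(\<integral>g. T g \<partial>gauss) = (\<Sum>\<sigma>\<in>spins N. \<Sum>k\<in>lev \<sigma>. y \<sigma> k * (\<integral>g. exp (field ?J ?h g \<sigma>) * X \<sigma> k g powr m \<partial>gauss))"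
        unfolding T_eq
        using it by (subst Bochner_Integration.integral_sum Bochner_Integration.integral_sum;
            (intro Bochner_Integration.integrable_sum integrable_mult_right sum.cong refl)?)+ auto
      also have "\<dots> \<le> (\<Sum>\<sigma>\<in>spins N. \<Sum>k\<in>lev \<sigma>. uw N \<sigma> * (b powr m * exp (m * real N * (\<delta> / 2) + A)))"
      proof (intro sum_mono)
        fix \<sigma> k assume \<sigma>: "\<sigma> \<in> spins N" and k: "k \<in> lev \<sigma>"
        let ?M = "moment m (level N \<sigma> k) (uw N) ?J ?h"
        have cv: "cov ?J ?h ?h s \<sigma> = \<beta>\<^sup>2 / 2 * real N * (k / real N) ^ p" if "s \<in> level N \<sigma> k" for s
          unfolding cov_hc[OF N p1] using that by (simp add: level_def ovl_def mult.commute)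
        have "(\<integral>g. exp (field ?J ?h g \<sigma>) * X \<sigma> k g powr m \<partial>gauss)
            = exp (cov ?J ?h ?h \<sigma> \<sigma> / 2 + m * (\<beta>\<^sup>2 / 2 * real N * (k / real N) ^ p)) * ?M"
          unfolding X_def by (rule tilted_moment) (auto simp: finite_words cv)
        also have "cov ?J ?h ?h \<sigma> \<sigma> / 2 = \<beta>\<^sup>2 * real N / 4" using cov_hc_diag[OF N p1 \<sigma>, of \<beta>] by simp
        finally have I: "(\<integral>g. exp (field ?J ?h g \<sigma>) * X \<sigma> k g powr m \<partial>gauss)
            = exp (\<beta>\<^sup>2 * real N / 4 + m * (\<beta>\<^sup>2 / 2 * real N * (k / real N) ^ p)) * ?M" .
        have cm: "c powr m = exp (- (m * (\<beta>\<^sup>2 * real N / 4)))" by (simp add: c_def exp_powr_real mult.commute)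
        have e: "c * (exp (- (m * (\<beta>\<^sup>2 * real N / 4))) * exp (\<beta>\<^sup>2 * real N / 4 + m * (\<beta>\<^sup>2 / 2 * real N * (k / real N) ^ p)))
            = exp (m * (\<beta>\<^sup>2 / 2 * real N * (k / real N) ^ p) - m * (\<beta>\<^sup>2 * real N / 4))"
          unfolding c_def exp_add[symmetric] by (simp add: algebra_simps)
        have "y \<sigma> k * (\<integral>g. exp (field ?J ?h g \<sigma>) * X \<sigma> k g powr m \<partial>gauss)
            = uw N \<sigma> * (b powr m * (c * (exp (- (m * (\<beta>\<^sup>2 * real N / 4))) * exp (\<beta>\<^sup>2 * real N / 4 + m * (\<beta>\<^sup>2 / 2 * real N * (k / real N) ^ p))) * ?M))"
          unfolding I y_def powr_mult cm by (simp only: mult_ac)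
        also have "\<dots> \<le> uw N \<sigma> * (b powr m * exp (m * real N * (m * C + \<delta> / 4) + A))"
          unfolding e using A[OF N \<sigma> level_ne[OF k]] by (intro mult_left_mono) auto
        also have "\<dots> \<le> uw N \<sigma> * (b powr m * exp (m * real N * (\<delta> / 2) + A))"
          using mC m by (intro mult_left_mono) (auto intro!: mult_left_mono)
        finally show "y \<sigma> k * (\<integral>g. exp (field ?J ?h g \<sigma>) * X \<sigma> k g powr m \<partial>gauss)
            \<le> uw N \<sigma> * (b powr m * exp (m * real N * (\<delta> / 2) + A))" .
      qed
      also have "\<dots> = (\<Sum>\<sigma>\<in>spins N. uw N \<sigma> * (real (card (lev \<sigma>)) * (b powr m * exp (m * real N * (\<delta> / 2) + A))))"
        by (intro sum.cong refl) simp
      also have "\<dots> \<le> (\<Sum>\<sigma>\<in>spins N. uw N \<sigma> * ((real N + 1) * (((real N + 1) * exp (- (m * \<delta> * real N))) * exp (m * real N * (\<delta> / 2) + A))))"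
      proof (intro sum_mono mult_left_mono mult_mono)
        show "real (card (lev \<sigma>)) \<le> real N + 1" if "\<sigma> \<in> spins N" for \<sigma> using card_levels[OF that] by (simp add: lev_def)
        have "b powr m = (real N + 1) powr m * exp (- (m * \<delta> * real N))"
          unfolding b_def powr_mult by (simp add: exp_powr_real mult_ac)
        also have "(real N + 1) powr m \<le> (real N + 1) powr 1" using m by (intro powr_mono) auto
        finally show "b powr m \<le> (real N + 1) * exp (- (m * \<delta> * real N))" by simp
      qed auto
      also have "\<dots> = (real N + 1) * (((real N + 1) * exp (- (m * \<delta> * real N))) * exp (m * real N * (\<delta> / 2) + A))"
        using sum_uw[of N] by (simp only: sum_distrib_right[symmetric] mult_1_left)
      also have "\<dots> = (real N + 1)\<^sup>2 * (exp (- (m * \<delta> * real N)) * exp (m * real N * (\<delta> / 2) + A))"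
        by (simp add: power2_eq_square mult_ac)
      also have "exp (- (m * \<delta> * real N)) * exp (m * real N * (\<delta> / 2) + A) = exp (A - m * \<delta> / 2 * real N)"
        unfolding exp_add[symmetric] by (simp add: field_simps)
      finally show ?thesis using small by linarith
    qed
    have ET': "E \<in> sets gauss"
    proof -
      have [measurable]: "zN p N \<beta> \<in> borel_measurable gauss" unfolding zN_def by measurable
      have "{g \<in> space gauss. \<beta>\<^sup>2 * real N / 4 - ln 4 \<le> ln (zN p N \<beta> g)} \<in> sets gauss" by measurable
      then show ?thesis by (simp add: E_def)
    qed
    have iE: "integrable gauss (\<lambda>g. exp (\<delta> * real N) * indicator E g :: real)"
      using ET' by (intro integrable_mult_right integrable_real_indicator) (auto simp: gauss.emeasure_finite less_top[symmetric])
    \<comment> \<open>Of the total mass 1, the constant and \<open>T\<close> account for at most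
      three quarters; the last quarter has to come from \<open>E\<close>.\<close>
    have "1 = (\<integral>g. L g \<partial>gauss)"
      unfolding L_def using integral_zN[OF N p1, of \<beta>] by (simp add: c_def exp_minus)
    also have "\<dots> \<le> (\<integral>g. 1 / 4 + exp (\<delta> * real N) * indicator E g + T g \<partial>gauss)"
    proof (rule integral_mono)
      show "integrable gauss L" unfolding L_def[abs_def] using integral_zN(2)[OF N p1, of \<beta>] by simp
      show "integrable gauss (\<lambda>g. 1 / 4 + exp (\<delta> * real N) * indicator E g + T g)"
        using iE iT by simp
    qed (rule split)
    also have "\<dots> = (\<integral>g. 1 / 4 + exp (\<delta> * real N) * indicator E g \<partial>gauss) + (\<integral>g. T g \<partial>gauss)"
      using iE iT by (intro Bochner_Integration.integral_add) auto
    also have "(\<integral>g. 1 / 4 + exp (\<delta> * real N) * indicator E g \<partial>gauss) = 1 / 4 + exp (\<delta> * real N) * measure gauss E"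
      using iE ET' by (simp add: gauss.prob_space[simplified])
    finally have "1 / 4 \<le> exp (\<delta> * real N) * measure gauss E" using ET by linarith
    then have "exp (- \<delta> * real N) * (1 / 4) \<le> exp (- \<delta> * real N) * (exp (\<delta> * real N) * measure gauss E)"
      by (rule mult_left_mono) simp
    also have "\<dots> = measure gauss E" by (simp add: exp_minus)
    finally show ?case unfolding E_def by simp
  qed
qed

text \<open>If the mean fell short of the annealed value by \<open>2 * t\<close> per site, the event
  of \<open>partition_function_not_small\<close> would be a deviation of size \<open>t\<close> per
  site, and concentration would make it rarer than that lemma permits.\<close>

theorem en_limit_replica_symmetric:
  assumes p: "2 \<le> p" and \<beta>: "0 < \<beta>" and Phi: "\<And>q. 0 \<le> q \<Longrightarrow> q \<le> 1 \<Longrightarrow> PhiRS p \<beta> q \<le> 0"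
  shows "(\<lambda>N. en p N \<beta> / real N) \<longlonglongrightarrow> \<beta>\<^sup>2 / 4"
proof (rule tendstoI)
  fix e :: real assume e: "0 < e"
  define t where "t = e / 4"
  have t: "0 < t" using e by (simp add: t_def)
  \<comment> \<open>Half of the concentration rate for deviations \<open>t\<close>, so the two
    exponential bounds contradict each other for large \<open>N\<close>.\<close>
  define \<delta> where "\<delta> = t\<^sup>2 / (4 * \<beta>\<^sup>2)"
  have \<delta>: "0 < \<delta>" using t \<beta> by (simp add: \<delta>_def)
  have p1: "1 \<le> p" using p by simp
  have ev: "\<forall>\<^sub>F N in sequentially. ln 4 < r * real N" if "0 < r" for r :: real
    using filterlim_tendsto_pos_mult_at_top[OF tendsto_const that filterlim_real_sequentially]
    by (simp add: filterlim_at_top_dense)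
  have "\<forall>\<^sub>F N in sequentially. exp (- \<delta> * real N) / 4 \<le> measure gauss {g. \<beta>\<^sup>2 * real N / 4 - ln 4 \<le> ln (zN p N \<beta> g)}"
    using partition_function_not_small[OF p \<beta> _ \<delta>] Phi by blast
  then show "\<forall>\<^sub>F N in sequentially. dist (en p N \<beta> / real N) (\<beta>\<^sup>2 / 4) < e"
    using ev[OF t] ev[OF \<delta>] eventually_ge_at_top[of 1]
  proof eventually_elim
    case (elim N)
    have N: "1 \<le> N" by fact
    have "\<beta>\<^sup>2 * real N / 4 - 2 * t * real N \<le> en p N \<beta>"
    proof (rule ccontr)
      assume "\<not> ?thesis"
      then have lt: "en p N \<beta> + real N * t \<le> \<beta>\<^sup>2 * real N / 4 - ln 4" using elim(2) by (simp add: algebra_simps)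
      have [measurable]: "zN p N \<beta> \<in> borel_measurable gauss" unfolding zN_def by measurable
      have "exp (- \<delta> * real N) / 4 \<le> measure gauss {g. \<beta>\<^sup>2 * real N / 4 - ln 4 \<le> ln (zN p N \<beta> g)}" by fact
      also have "\<dots> \<le> measure gauss {g. ln (zN p N \<beta> g) \<ge> en p N \<beta> + real N * t}"
      proof (rule gauss.finite_measure_mono)
        have "{g \<in> space gauss. ln (zN p N \<beta> g) \<ge> en p N \<beta> + real N * t} \<in> sets gauss" by measurable
        then show "{g. ln (zN p N \<beta> g) \<ge> en p N \<beta> + real N * t} \<in> sets gauss" by simp
      qed (use lt in auto)
      also have "\<dots> \<le> exp (- real N * (t\<^sup>2 / (2 * \<beta>\<^sup>2)))" by (rule zN_tail(1)[OF N p1 \<beta>]) (use t in simp)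
      also have "- real N * (t\<^sup>2 / (2 * \<beta>\<^sup>2)) = - \<delta> * real N - \<delta> * real N" by (simp add: \<delta>_def)
      also have "exp \<dots> = exp (- \<delta> * real N) * exp (- \<delta> * real N)" by (simp add: exp_add[symmetric])
      finally have "exp (- \<delta> * real N) * (1 / 4) \<le> exp (- \<delta> * real N) * exp (- \<delta> * real N)" by simp
      then have "1 / 4 \<le> exp (- \<delta> * real N)" by (subst (asm) mult_le_cancel_left_pos) auto
      also have "\<dots> < exp (- ln 4)" using elim(3) by simp
      also have "\<dots> = 1 / 4" by (simp add: exp_minus)
      finally show False by simp
    qed
    then have "real N * (\<beta>\<^sup>2 / 4 - 2 * t) \<le> en p N \<beta>" by (simp add: algebra_simps)
    then have lo: "\<beta>\<^sup>2 / 4 - 2 * t \<le> en p N \<beta> / real N" using N by (simp add: pos_le_divide_eq mult.commute)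
    have hi: "en p N \<beta> / real N \<le> \<beta>\<^sup>2 / 4"
      using en_upper[OF N p1, of \<beta>] N by (simp add: pos_divide_le_eq)
    show ?case using lo hi e unfolding dist_real_def t_def by linarith
  qed
qed

section \<open>Existence of the limit\<close>

lemma sum_words_append:
  fixes f :: "'a list \<Rightarrow> real"
  assumes "finite A"
  shows "(\<Sum>zs\<in>words A (n1 + n2). f zs) = (\<Sum>xs\<in>words A n1. \<Sum>ys\<in>words A n2. f (xs @ ys))"
proof (induction n1 arbitrary: f)
  case (Suc n1)
  have "(\<Sum>zs\<in>words A (Suc n1 + n2). f zs) = (\<Sum>xs\<in>words A n1. \<Sum>ys\<in>words A n2. \<Sum>x\<in>A. f (x # xs @ ys))"
    by (simp add: sum_words_Suc[OF assms] Suc.IH)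
  also have "\<dots> = (\<Sum>xs\<in>words A n1. \<Sum>x\<in>A. \<Sum>ys\<in>words A n2. f (x # xs @ ys))"
    by (intro sum.cong refl sum.swap)
  also have "\<dots> = (\<Sum>xs\<in>words A (Suc n1). \<Sum>ys\<in>words A n2. f (xs @ ys))"
    by (simp add: sum_words_Suc[OF assms])
  finally show ?case .
qed simp

text \<open>The first \<open>r\<close> sites stay without interaction; they absorb the remainder of
  \<open>N\<close> modulo \<open>M\<close>.\<close>

definition block :: "nat \<Rightarrow> nat \<Rightarrow> nat \<Rightarrow> nat set" where
  "block M r j = {r + j * M..<r + j * M + M}"

definition blocks :: "nat \<Rightarrow> nat \<Rightarrow> nat \<Rightarrow> nat \<Rightarrow> nat list set" where
  "blocks p M r k = (\<Union>j<k. words (block M r j) p)"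

lemma block_disjoint: "j \<noteq> j' \<Longrightarrow> block M r j \<inter> block M r j' = {}"
proof -
  have "block M r a \<inter> block M r b = {}" if "a < b" for a b
  proof -
    have "a * M + M \<le> b * M" using mult_le_mono1[of "Suc a" b M] that by simp
    then show ?thesis by (auto simp: block_def)
  qed
  then show "j \<noteq> j' \<Longrightarrow> block M r j \<inter> block M r j' = {}" by (metis inf_commute nat_neq_iff)
qed

lemma block_subset: "j < k \<Longrightarrow> block M r j \<subseteq> {..<r + k * M}"
proof -
  assume "j < k"
  then have "j * M + M \<le> k * M" using mult_le_mono1[of "Suc j" k M] by simp
  then show ?thesis by (auto simp: block_def)
qed

lemma words_block_disjoint:
  assumes "1 \<le> p" "j \<noteq> j'"
  shows "words (block M r j) p \<inter> words (block M r j') p = {}"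
proof -
  have False if w: "is \<in> words (block M r j) p" "is \<in> words (block M r j') p" for "is"
  proof -
    obtain x where "x \<in> set is" using w assms(1) by (cases "is") (auto simp: words_def)
    then show False using w block_disjoint[OF assms(2), of M r] by (auto simp: words_def)
  qed
  then show ?thesis by blast
qed

lemma finite_blocks: "finite (blocks p M r k)"
  by (simp add: blocks_def finite_words block_def)

lemma words_blocks: "is \<in> blocks p M r k \<Longrightarrow> set is \<subseteq> {..<r + k * M}"
  using block_subset by (fastforce simp: blocks_def words_def)

lemma sum_blocks:
  assumes "1 \<le> p"
  shows "(\<Sum>is\<in>blocks p M r k. f is) = (\<Sum>j<k. \<Sum>is\<in>words (block M r j) p. f is :: real)"
  unfolding blocks_def
  by (rule sum.UNION_disjoint) (auto simp: finite_words block_def words_block_disjoint[OF assms, unfolded block_def])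

lemma cov_blocks:
  assumes M: "1 \<le> M" and p: "1 \<le> p"
  shows "cov (blocks p M r k) (hc p M \<beta>) (hc p M \<beta>) \<sigma> \<tau> = (\<Sum>j<k. \<beta>\<^sup>2 / 2 * real M * ovl (block M r j) \<sigma> \<tau> ^ p)"
  using cov_hc_card[OF _ _ M p, of "block M r _" \<beta> \<sigma> \<tau>] unfolding cov_def sum_blocks[OF p]
  by (intro sum.cong refl) (simp add: block_def)

lemma monomial_append:
  "set is \<subseteq> {..<length xs} \<Longrightarrow> monomial (xs @ ys) is = monomial xs is"
  "monomial (xs @ ys) (map (\<lambda>i. i + length xs) is) = monomial ys is"
  unfolding monomial_def map_map
  by (intro arg_cong[where f=prod_list] map_cong refl; auto simp: nth_append)+

lemma field_blocks_append:
  assumes p: "1 \<le> p" and xs: "xs \<in> spins (r + k * M)"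
  shows "field (blocks p M r (Suc k)) (hc p M \<beta>) g (xs @ ys)
    = field (blocks p M r k) (hc p M \<beta>) g xs + field (words {..<M} p) (hc p M \<beta>) (\<lambda>is. g (map (\<lambda>i. i + (r + k * M)) is)) ys"
proof -
  let ?N = "r + k * M"
  have l: "length xs = ?N" using xs by (simp add: spins_def)
  have 1: "(\<Sum>is\<in>blocks p M r k. hc p M \<beta> is (xs @ ys) * g is) = field (blocks p M r k) (hc p M \<beta>) g xs"
    unfolding field_def using words_blocks l by (intro sum.cong refl) (simp add: hc_def monomial_append(1))
  have "bij_betw (map (\<lambda>i. i + ?N)) (words {..<M} p) (words (block M r k) p)"
  proof (rule bij_betw_byWitness[where f'="map (\<lambda>i. i - ?N)"])
    show "\<forall>is\<in>words {..<M} p. map (\<lambda>i. i - ?N) (map (\<lambda>i. i + ?N) is) = is" by (simp add: comp_def)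
    show "\<forall>is\<in>words (block M r k) p. map (\<lambda>i. i + ?N) (map (\<lambda>i. i - ?N) is) = is"
      by (auto simp: words_def block_def comp_def subset_iff intro!: map_idI)
    show "map (\<lambda>i. i - ?N) ` words (block M r k) p \<subseteq> words {..<M} p"
    proof safe
      fix "is" assume w: "is \<in> words (block M r k) p"
      then have "\<And>i. i \<in> set is \<Longrightarrow> i - ?N < M" by (fastforce simp: words_def block_def)
      with w show "map (\<lambda>i. i - ?N) is \<in> words {..<M} p" by (auto simp: words_def)
    qed
  qed (auto simp: words_def block_def subset_iff)
  then have "(\<Sum>is\<in>words (block M r k) p. hc p M \<beta> is (xs @ ys) * g is)
      = (\<Sum>is\<in>words {..<M} p. hc p M \<beta> (map (\<lambda>i. i + ?N) is) (xs @ ys) * g (map (\<lambda>i. i + ?N) is))"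
    by (rule sum.reindex_bij_betw[symmetric])
  also have "\<dots> = field (words {..<M} p) (hc p M \<beta>) (\<lambda>is. g (map (\<lambda>i. i + ?N) is)) ys"
    unfolding field_def hc_def using monomial_append(2)[of xs ys] l by simp
  finally show ?thesis
    using 1 unfolding field_def sum_blocks[OF p] by (simp add: field_def[symmetric])
qed

lemma zsum_blocks_Suc:
  assumes p: "1 \<le> p"
  shows "zsum (spins (r + Suc k * M)) (uw (r + Suc k * M)) (blocks p M r (Suc k)) (hc p M \<beta>) g
    = zsum (spins (r + k * M)) (uw (r + k * M)) (blocks p M r k) (hc p M \<beta>) g
      * zN p M \<beta> (\<lambda>is. g (map (\<lambda>i. i + (r + k * M)) is))"
proof -
  let ?N = "r + k * M" and ?g = "\<lambda>is. g (map (\<lambda>i. i + (r + k * M)) is)"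
  have N: "r + Suc k * M = ?N + M" by simp
  have e: "2 powr (- real (?N + M)) = 2 powr (- real ?N) * 2 powr (- real M)"
    unfolding powr_add[symmetric] by simp
  have "zsum (spins (?N + M)) (uw (?N + M)) (blocks p M r (Suc k)) (hc p M \<beta>) g
      = (\<Sum>xs\<in>spins ?N. \<Sum>ys\<in>spins M. 2 powr (- real (?N + M)) * exp (field (blocks p M r (Suc k)) (hc p M \<beta>) g (xs @ ys)))"
    unfolding zsum_def words_eq_spins by (rule sum_words_append) simp
  also have "\<dots> = (\<Sum>xs\<in>spins ?N. \<Sum>ys\<in>spins M. (2 powr (- real ?N) * exp (field (blocks p M r k) (hc p M \<beta>) g xs))
      * (2 powr (- real M) * exp (field (words {..<M} p) (hc p M \<beta>) ?g ys)))"
    by (intro sum.cong refl, subst e, subst field_blocks_append[OF p], assumption) (simp only: exp_add mult_ac)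
  also have "\<dots> = zsum (spins ?N) (uw ?N) (blocks p M r k) (hc p M \<beta>) g * zN p M \<beta> ?g"
    unfolding zN_def zsum_def by (simp only: sum_product)
  finally show ?thesis unfolding N .
qed

lemma coord_lipschitz_blocks:
  "coord_lipschitz (blocks p M r k) (\<lambda>_. hcb p M \<beta>) (\<lambda>g. ln (zsum (spins (r + k * M)) (uw (r + k * M)) (blocks p M r k) (hc p M \<beta>) g))"
proof (rule coord_lipschitz_ln_zsum[OF finite_spins spins_nonempty _ finite_blocks])
  fix j s assume "j \<in> blocks p M r k" "s \<in> spins (r + k * M)"
  then have "\<bar>monomial s j\<bar> = 1" using abs_monomial words_blocks by blast
  then show "\<bar>hc p M \<beta> j s\<bar> \<le> hcb p M \<beta>" by (simp add: hc_def hcb_def abs_mult)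
qed simp

text \<open>The blocks carry independent copies of the system of size \<open>M\<close>, and the idle
  \<open>r\<close> sites contribute a factor 1 because \<open>uw\<close> sums to one.\<close>

lemma integral_ln_blocks:
  assumes p: "1 \<le> p"
  shows "(\<integral>g. ln (zsum (spins (r + k * M)) (uw (r + k * M)) (blocks p M r k) (hc p M \<beta>) g) \<partial>gauss) = real k * en p M \<beta>"
proof (induction k)
  case 0
  then show ?case using sum_uw[of r] by (simp add: zsum_def blocks_def field_def)
next
  case (Suc k)
  let ?Z = "\<lambda>k g. zsum (spins (r + k * M)) (uw (r + k * M)) (blocks p M r k) (hc p M \<beta>) g"
  let ?f = "map (\<lambda>i. i + (r + k * M))"
  have i: "integrable gauss (\<lambda>g. ln (?Z k g))" for k
    by (rule integrable_tame[OF coord_lipschitz_tame[OF coord_lipschitz_blocks]])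
  have "ln (?Z (Suc k) g) = ln (?Z k g) + ln (zN p M \<beta> (\<lambda>is. g (?f is)))" for g
  proof -
    have "0 < ?Z k g" by (rule zsum_pos[OF finite_spins spins_nonempty]) simp
    then show ?thesis using zN_pos unfolding zsum_blocks_Suc[OF p] by (intro ln_mult_pos) auto
  qed
  note eq = this
  have "ln (zN p M \<beta> (\<lambda>is. g (?f is))) = ln (?Z (Suc k) g) - ln (?Z k g)" for g unfolding eq by simp
  then have i2: "integrable gauss (\<lambda>g. ln (zN p M \<beta> (\<lambda>is. g (?f is))))" using i[of "Suc k"] i[of k] by simp
  have "(\<integral>g. ln (?Z (Suc k) g) \<partial>gauss) = (\<integral>g. ln (?Z k g) \<partial>gauss) + (\<integral>g. ln (zN p M \<beta> (\<lambda>is. g (?f is))) \<partial>gauss)"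
    unfolding eq by (rule Bochner_Integration.integral_add[OF i i2])
  also have "(\<integral>g. ln (zN p M \<beta> (\<lambda>is. g (?f is))) \<partial>gauss) = en p M \<beta>"
    unfolding en_def by (rule integral_gauss_reindex) (auto intro!: inj_mapI coord_lipschitzD(2)[OF coord_lipschitz_zN] simp: inj_def)
  finally show ?case unfolding Suc.IH by (simp add: algebra_simps)
qed

text \<open>Taking \<open>\<bar>y\<bar>\<close> or \<open>max 0 y\<close> according to the parity of \<open>p\<close> reduces the claim to the
  convexity of \<open>y\<^sup>p\<close> on the half-line; negative block overlaps are only controlled up to
  the error that the positivity principle makes negligible.\<close>

lemma block_convexity:
  fixes R :: real and x :: "nat \<Rightarrow> real"
  assumes p: "1 \<le> p" and N: "0 < real r + real k * real M" and R: "(real r + real k * real M) * R = \<rho> + (\<Sum>j<k. real M * x j)"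
    and \<rho>: "\<bar>\<rho>\<bar> \<le> real r" and x: "\<And>j. j < k \<Longrightarrow> \<bar>x j\<bar> \<le> 1"
  shows "(real r + real k * real M) * R ^ p \<le> real r + (\<Sum>j<k. real M * (x j ^ p + max 0 (- x j)))"
proof -
  let ?N = "real r + real k * real M"
  define f where "f y = (if even p then \<bar>y\<bar> else max 0 y)" for y :: real
  have f0: "0 \<le> f y" for y by (simp add: f_def)
  have Rp: "R ^ p \<le> f R ^ p"
  proof (cases "even p")
    case True
    then show ?thesis by (simp add: f_def power_even_abs)
  next
    case False
    show ?thesis
    proof (cases "0 \<le> R")
      case True
      then show ?thesis using False by (simp add: f_def)
    next
      case R: False
      then have "R ^ p \<le> 0" using False p by (simp add: power_le_zero_eq)
      then show ?thesis using zero_le_power[OF f0[of R], of p] by linarith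
    qed
  qed
  have xp: "f (x j) ^ p \<le> x j ^ p + max 0 (- x j)" if "j < k" for j
  proof (cases "even p")
    case True
    then show ?thesis by (simp add: f_def power_even_abs)
  next
    case False
    show ?thesis
    proof (cases "0 \<le> x j")
      case True
      then show ?thesis using False by (simp add: f_def)
    next
      case neg: False
      have "\<bar>x j ^ p\<bar> \<le> \<bar>x j\<bar> ^ 1" unfolding power_abs using x[OF that] p by (intro power_decreasing) auto
      then show ?thesis using neg False p by (simp add: f_def abs_le_iff power_0_left)
    qed
  qed
  \<comment> \<open>The function \<open>f\<close> is sublinear, so its value at the average overlap
    is at most the average of its values; the idle sites count with at most 1 each.\<close>
  have lin: "?N * f R \<le> real r + (\<Sum>j<k. real M * f (x j))"
  proof -
    have NR: "?N * f R = f (?N * R)" using N by (simp add: f_def abs_mult max_mult_distrib_left)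
    have S0: "0 \<le> (\<Sum>j<k. real M * f (x j))" using f0 by (intro sum_nonneg mult_nonneg_nonneg) auto
    have "?N * R \<le> real r + (\<Sum>j<k. real M * f (x j))"
      unfolding R using \<rho> by (intro add_mono sum_mono mult_left_mono) (auto simp: f_def abs_le_iff)
    moreover have "- (?N * R) \<le> real r + (\<Sum>j<k. real M * f (x j))" if "even p"
    proof -
      have "- (?N * R) = - \<rho> + (\<Sum>j<k. real M * (- x j))" unfolding R by (simp add: sum_negf)
      also have "\<dots> \<le> real r + (\<Sum>j<k. real M * f (x j))"
        using \<rho> that by (intro add_mono sum_mono mult_left_mono) (auto simp: f_def abs_le_iff)
      finally show ?thesis .
    qed
    ultimately show ?thesis unfolding NR using S0 by (auto simp: f_def abs_if)
  qed
  \<comment> \<open>Jensen's inequality by tangent lines at \<open>f R\<close>: the linear parts add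
    up to a nonnegative multiple of the slack in \<open>lin\<close>.\<close>
  have tan: "real M * (f R ^ p + real p * f R ^ (p - 1) * (y - f R)) \<le> real M * y ^ p" if "0 \<le> y" for y
    using power_tangent[OF that f0] by (intro mult_left_mono) auto
  have tan1: "real r * (f R ^ p + real p * f R ^ (p - 1) * (1 - f R)) \<le> real r * 1"
    using power_tangent[of 1 "f R" p] f0 by (intro mult_left_mono) auto
  have "?N * f R ^ p \<le> ?N * f R ^ p + real p * f R ^ (p - 1) * ((real r + (\<Sum>j<k. real M * f (x j))) - ?N * f R)"
    using lin f0 by (intro le_add_same_cancel1[THEN iffD2] mult_nonneg_nonneg) auto
  also have "\<dots> = real r * (f R ^ p + real p * f R ^ (p - 1) * (1 - f R))
      + (\<Sum>j<k. real M * (f R ^ p + real p * f R ^ (p - 1) * (f (x j) - f R)))"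
    by (simp add: algebra_simps sum.distrib sum_distrib_left sum_subtractf)
  also have "\<dots> \<le> real r * 1 + (\<Sum>j<k. real M * f (x j) ^ p)"
    by (intro add_mono tan1 sum_mono tan f0)
  also have "\<dots> \<le> real r + (\<Sum>j<k. real M * (x j ^ p + max 0 (- x j)))"
    using xp by (intro add_mono sum_mono mult_left_mono) auto
  finally have "?N * f R ^ p \<le> real r + (\<Sum>j<k. real M * (x j ^ p + max 0 (- x j)))" .
  moreover have "?N * R ^ p \<le> ?N * f R ^ p" using Rp N by (intro mult_left_mono) auto
  ultimately show ?thesis by linarith
qed

text \<open>Comparison of the blocks with the full system: the diagonal covariances decrease and
  \<open>block_convexity\<close> bounds the off-diagonal ones. Returning from moments to mean
  logarithms costs the term with \<open>m\<close>, and the idle sites cost the term with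
  \<open>r\<close>.\<close>

lemma en_block_bound:
  assumes p: "1 \<le> p" and m: "0 < m" "m < 1" and \<epsilon>: "0 < \<epsilon>"
  shows "\<exists>A\<ge>0. \<forall>M r k. 1 \<le> M \<longrightarrow> 1 \<le> r + k * M \<longrightarrow>
    real k * en p M \<beta> \<le> en p (r + k * M) \<beta> + real (r + k * M) * (m * \<beta>\<^sup>2 / 2 + \<epsilon> * \<beta>\<^sup>2 / 4) + \<beta>\<^sup>2 * real r / 4 + A * real k / m"
proof -
  obtain A where A: "0 \<le> A" "\<forall>(S :: real list set) w (I :: nat list set) (J :: nat list set) b c Bs L d0 e.
    finite S \<longrightarrow> S \<noteq> {} \<longrightarrow> (\<forall>s\<in>S. 0 < w s) \<longrightarrow> finite I \<longrightarrow> finite J \<longrightarrow> finite Bs \<longrightarrow>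
    (\<forall>B\<in>Bs. finite B \<and> B \<noteq> {} \<and> 0 \<le> L B \<and> (\<forall>\<sigma>\<in>S. \<forall>i\<in>B. \<sigma> ! i \<in> {-1, 1})) \<longrightarrow>
    (\<forall>s\<in>S. cov J c c s s - cov I b b s s \<le> d0) \<longrightarrow>
    (\<forall>s\<in>S. \<forall>t\<in>S. - e - (\<Sum>B\<in>Bs. L B * max 0 (- ovl B s t)) \<le> cov J c c s t - cov I b b s t) \<longrightarrow>
    ln (moment m S w J c) \<le> ln (moment m S w I b)
      + m * (d0 + (1 - m) * (e + \<epsilon> * (\<Sum>B\<in>Bs. L B))) / 2 + A * real (card Bs)"
    using spin_comparison[OF m \<epsilon>] by (elim exE conjE)
  show ?thesis
  proof (intro exI[of _ A] conjI allI impI A(1))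
    fix M r k :: nat
    assume M: "1 \<le> M" and N1: "1 \<le> r + k * M"
    let ?N = "r + k * M" and ?J = "blocks p M r k" and ?Bs = "block M r ` {..<k}"
    let ?L = "\<lambda>_ :: nat set. \<beta>\<^sup>2 / 2 * real M" and ?I = "words {..<?N} p"
    have fin: "finite (block M r j)" for j by (simp add: block_def)
    have ne: "block M r j \<noteq> {}" for j using M by (auto simp: block_def)
    have inj: "inj_on (block M r) {..<k}"
      by (rule inj_onI) (metis block_disjoint inf.idem ne)
    have sumBs: "(\<Sum>B\<in>?Bs. f B) = (\<Sum>j<k. f (block M r j))" for f :: "nat set \<Rightarrow> real"
      by (simp add: sum.reindex[OF inj])
    have card: "card ?Bs = k" by (simp add: card_image[OF inj])
    have sp: "\<sigma> ! i \<in> {-1, 1}" if "\<sigma> \<in> spins ?N" "j < k" "i \<in> block M r j" for \<sigma> i j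
      using spins_nth[OF that(1)] block_subset[OF that(2), of M r] that(3) by blast
    have ker: "overlap_kernel (spins ?N) (ovl (block M r j))" if "j < k" for j
      by (rule overlap_kernel_ovl[OF fin ne]) (rule sp[OF _ that])
    have SL: "(\<Sum>B\<in>?Bs. ?L B) = \<beta>\<^sup>2 / 2 * (real k * real M)" unfolding sumBs by simp
    have dg: "cov ?J (hc p M \<beta>) (hc p M \<beta>) s s - cov ?I (hc p ?N \<beta>) (hc p ?N \<beta>) s s \<le> 0" if s: "s \<in> spins ?N" for s
    proof -
      have "cov ?J (hc p M \<beta>) (hc p M \<beta>) s s = \<beta>\<^sup>2 / 2 * (real k * real M)"
        unfolding cov_blocks[OF M p] using overlap_kernelD(1)[OF ker s] by simp
      moreover have "\<beta>\<^sup>2 / 2 * (real k * real M) \<le> \<beta>\<^sup>2 / 2 * real ?N" by (intro mult_left_mono) auto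
      ultimately show ?thesis unfolding cov_hc_diag[OF N1 p s] by simp
    qed
    have off: "- (\<beta>\<^sup>2 / 2 * real r) - (\<Sum>B\<in>?Bs. ?L B * max 0 (- ovl B s t))
        \<le> cov ?J (hc p M \<beta>) (hc p M \<beta>) s t - cov ?I (hc p ?N \<beta>) (hc p ?N \<beta>) s t"
      if s: "s \<in> spins ?N" and t: "t \<in> spins ?N" for s t
    proof -
      let ?R = "ovl {..<?N} s t" and ?x = "\<lambda>j. ovl (block M r j) s t"
      have "(real r + real k * real M) * ?R ^ p \<le> real r + (\<Sum>j<k. real M * (?x j ^ p + max 0 (- ?x j)))"
      proof (rule block_convexity[OF p])
        have "0 < real (r + k * M)" using N1 by (subst of_nat_0_less_iff) linarith
        then show pos: "0 < real r + real k * real M" by (simp only: of_nat_add of_nat_mult)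
        have NR: "(real r + real k * real M) * ?R = (\<Sum>i<?N. s ! i * t ! i)"
          using less_imp_neq[OF pos] by (simp add: ovl_def)
        have x: "real M * ?x j = (\<Sum>i\<in>block M r j. s ! i * t ! i)" for j
          using M by (simp add: ovl_def) (simp add: block_def)
        have "(\<Sum>i<r + l * M. s ! i * t ! i) = (\<Sum>i<r. s ! i * t ! i) + (\<Sum>j<l. \<Sum>i\<in>block M r j. s ! i * t ! i)" for l
        proof (induction l)
          case (Suc l)
          have "{..<r + Suc l * M} = {..<r + l * M} \<union> block M r l" by (auto simp: block_def)
          moreover have "(\<Sum>i\<in>{..<r + l * M} \<union> block M r l. s ! i * t ! i) = (\<Sum>i<r + l * M. s ! i * t ! i) + (\<Sum>i\<in>block M r l. s ! i * t ! i)"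
            by (rule sum.union_disjoint) (auto simp: block_def)
          ultimately show ?case using Suc.IH by (simp only: sum.lessThan_Suc add.assoc)
        qed simp
        then show "(real r + real k * real M) * ?R = (\<Sum>i<r. s ! i * t ! i) + (\<Sum>j<k. real M * ?x j)"
          unfolding NR x .
        have "\<bar>\<Sum>i<r. s ! i * t ! i\<bar> \<le> (\<Sum>i<r. \<bar>s ! i * t ! i\<bar>)" by (rule sum_abs)
        also have "\<dots> = (\<Sum>i<r. 1)"
        proof (intro sum.cong refl)
          fix i assume "i \<in> {..<r}"
          then have "s ! i \<in> {-1, 1}" "t ! i \<in> {-1, 1}" using spins_nth[OF s, of i] spins_nth[OF t, of i] by auto
          then show "\<bar>s ! i * t ! i\<bar> = 1" by auto
        qed
        finally show "\<bar>\<Sum>i<r. s ! i * t ! i\<bar> \<le> real r" by simp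
        show "\<bar>?x j\<bar> \<le> 1" if "j < k" for j using overlap_kernelD(2)[OF ker[OF that] s t] .
      qed
      then have "\<beta>\<^sup>2 / 2 * ((real r + real k * real M) * ?R ^ p) \<le> \<beta>\<^sup>2 / 2 * (real r + (\<Sum>j<k. real M * (?x j ^ p + max 0 (- ?x j))))"
        by (rule mult_left_mono) simp
      also have "\<dots> = \<beta>\<^sup>2 / 2 * real r + (\<Sum>j<k. \<beta>\<^sup>2 / 2 * real M * ?x j ^ p) + (\<Sum>j<k. \<beta>\<^sup>2 / 2 * real M * max 0 (- ?x j))"
        by (simp only: distrib_left sum.distrib sum_distrib_left mult.assoc add.assoc)
      finally show ?thesis unfolding cov_blocks[OF M p] cov_hc[OF N1 p] sumBs by (simp add: mult.assoc)
    qed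
    have "ln (moment m (spins ?N) (uw ?N) ?J (hc p M \<beta>)) \<le> ln (moment m (spins ?N) (uw ?N) ?I (hc p ?N \<beta>))
        + m * (0 + (1 - m) * (\<beta>\<^sup>2 / 2 * real r + \<epsilon> * (\<Sum>B\<in>?Bs. ?L B))) / 2 + A * real (card ?Bs)"
    proof (rule A(2)[rule_format])
      show "finite ?I" by (simp add: finite_words)
      show "finite B \<and> B \<noteq> {} \<and> 0 \<le> ?L B \<and> (\<forall>\<sigma>\<in>spins ?N. \<forall>i\<in>B. \<sigma> ! i \<in> {-1, 1})" if "B \<in> ?Bs" for B
        using that fin ne sp by fastforce
    qed (use dg off finite_spins spins_nonempty finite_blocks in auto)
    moreover have "m * (real k * en p M \<beta>) \<le> ln (moment m (spins ?N) (uw ?N) ?J (hc p M \<beta>))"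
      using moment_bounds(1)[OF finite_spins spins_nonempty _ m coord_lipschitz_blocks[of p M r k \<beta>] order.refl]
      unfolding integral_ln_blocks[OF p] by simp
    moreover have "(1 - m) * (\<beta>\<^sup>2 / 2 * real r + \<epsilon> * (\<Sum>B\<in>?Bs. ?L B)) \<le> \<beta>\<^sup>2 / 2 * real r + \<epsilon> * (\<beta>\<^sup>2 / 2 * real ?N)"
    proof -
      have "\<epsilon> * (\<Sum>B\<in>?Bs. ?L B) \<le> \<epsilon> * (\<beta>\<^sup>2 / 2 * real ?N)" unfolding SL using \<epsilon> by (intro mult_left_mono) auto
      moreover have "0 \<le> \<epsilon> * (\<Sum>B\<in>?Bs. ?L B)" unfolding SL using \<epsilon> by simp
      moreover have "0 \<le> \<beta>\<^sup>2 / 2 * real r" by simp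
      ultimately have "(1 - m) * (\<beta>\<^sup>2 / 2 * real r + \<epsilon> * (\<Sum>B\<in>?Bs. ?L B)) \<le> 1 * (\<beta>\<^sup>2 / 2 * real r + \<epsilon> * (\<beta>\<^sup>2 / 2 * real ?N))"
        using m by (intro mult_mono[of "1 - m" 1] add_left_mono add_nonneg_nonneg) linarith+
      then show ?thesis by simp
    qed
    then have "m * (0 + (1 - m) * (\<beta>\<^sup>2 / 2 * real r + \<epsilon> * (\<Sum>B\<in>?Bs. ?L B))) / 2 \<le> m * (\<beta>\<^sup>2 / 2 * real r + \<epsilon> * (\<beta>\<^sup>2 / 2 * real ?N)) / 2"
      using m by (intro divide_right_mono mult_left_mono) auto
    ultimately have "m * (real k * en p M \<beta>) \<le> m * en p ?N \<beta> + m\<^sup>2 * (\<beta>\<^sup>2 / 2 * real ?N)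
        + m * (\<beta>\<^sup>2 / 2 * real r + \<epsilon> * (\<beta>\<^sup>2 / 2 * real ?N)) / 2 + A * real k"
      using en_le_moment(2)[OF N1 p m, of \<beta>] unfolding card by linarith
    also have "\<dots> = m * (en p ?N \<beta> + real ?N * (m * \<beta>\<^sup>2 / 2 + \<epsilon> * \<beta>\<^sup>2 / 4) + \<beta>\<^sup>2 * real r / 4 + A * real k / m)"
    proof -
      have A: "A * real k = m * (A * real k / m)" using m by simp
      have "m\<^sup>2 * (\<beta>\<^sup>2 / 2 * n) + m * (\<beta>\<^sup>2 / 2 * real r + \<epsilon> * (\<beta>\<^sup>2 / 2 * n)) / 2
          = m * (n * (m * \<beta>\<^sup>2 / 2 + \<epsilon> * \<beta>\<^sup>2 / 4)) + m * (\<beta>\<^sup>2 * real r / 4)" for n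
        by (simp add: field_simps power2_eq_square)
      from this[of "real ?N"] show ?thesis unfolding distrib_left[of m] using A by linarith
    qed
    finally show "real k * en p M \<beta> \<le> en p ?N \<beta> + real ?N * (m * \<beta>\<^sup>2 / 2 + \<epsilon> * \<beta>\<^sup>2 / 4) + \<beta>\<^sup>2 * real r / 4 + A * real k / m"
      using m by (subst (asm) mult_le_cancel_left_pos) auto
  qed
qed

lemma en_almost_superadditive:
  assumes p: "1 \<le> p" and \<eta>: "0 < \<eta>"
  shows "\<exists>M0\<ge>1. \<forall>M\<ge>M0. \<forall>\<^sub>F N in sequentially. en p M \<beta> / real M - \<eta> \<le> en p N \<beta> / real N"
proof -
  \<comment> \<open>Makes both errors that are proportional to \<open>N\<close> add up to at most a
    quarter of \<open>\<eta>\<close> per site when \<open>\<epsilon>\<close> is also taken to be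
    \<open>m\<close>.\<close>
  define m where "m = min (1 / 2) (\<eta> / (4 * (\<beta>\<^sup>2 + 1)))"
  have b0: "0 < \<beta>\<^sup>2 + 1" by (simp add: add_nonneg_pos)
  have m: "0 < m" "m < 1" using \<eta> b0 by (auto simp: m_def)
  define \<epsilon> where "\<epsilon> = m"
  have "m * \<beta>\<^sup>2 \<le> \<eta> / (4 * (\<beta>\<^sup>2 + 1)) * (\<beta>\<^sup>2 + 1)" using m by (intro mult_mono) (auto simp: m_def)
  also have "\<dots> = \<eta> / 4"
  proof -
    have "X / (4 * z) * z = X / 4" if "0 < z" for X z :: real using that by simp
    from this[OF b0] show ?thesis .
  qed
  finally have mb: "m * \<beta>\<^sup>2 / 2 + m * \<beta>\<^sup>2 / 4 \<le> \<eta> / 4" using \<eta> by simp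
  obtain A where A: "0 \<le> A" "\<And>M r k. 1 \<le> M \<Longrightarrow> 1 \<le> r + k * M \<Longrightarrow>
    real k * en p M \<beta> \<le> en p (r + k * M) \<beta> + real (r + k * M) * (m * \<beta>\<^sup>2 / 2 + m * \<beta>\<^sup>2 / 4) + \<beta>\<^sup>2 * real r / 4 + A * real k / m"
    using en_block_bound[OF p m m(1), of \<beta>] by blast
  \<comment> \<open>The cost \<open>A / m\<close> is paid once per block, so long blocks bring it
    down to a quarter of \<open>\<eta>\<close> per site.\<close>
  obtain M0 :: nat where M0: "4 * A / (m * \<eta>) \<le> real M0" using real_arch_simple by blast
  show ?thesis
  proof (intro exI[of _ "max 1 M0"] conjI allI impI)
    fix M assume "max 1 M0 \<le> M"
    then have M: "1 \<le> M" and MA: "4 * A / (m * \<eta>) \<le> real M" using M0 by auto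
    have A4: "A / m \<le> \<eta> / 4 * real M" using MA m \<eta> by (simp add: field_simps)
    have "(\<lambda>N. \<beta>\<^sup>2 * real M / real N) \<longlonglongrightarrow> 0" by (rule lim_const_over_n)
    then have "\<forall>\<^sub>F N in sequentially. \<beta>\<^sup>2 * real M / real N < \<eta> / 2" using \<eta> by (intro order_tendstoD) auto
    then show "\<forall>\<^sub>F N in sequentially. en p M \<beta> / real M - \<eta> \<le> en p N \<beta> / real N"
      using eventually_ge_at_top[of 1]
    proof eventually_elim
      case (elim N)
      define k r where "k = N div M" and "r = N mod M"
      have N: "N = r + k * M" "1 \<le> r + k * M" using elim by (auto simp: k_def r_def)
      have r: "real r \<le> real M" using M by (simp add: r_def less_imp_le)
      let ?x = "en p M \<beta> / real M" and ?n = "real N"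
      have n0: "0 < ?n" using elim by simp
      have nk: "?n = real r + real k * real M" using N(1) by simp
      have "en p M \<beta> \<le> \<beta>\<^sup>2 / 4 * real M" using en_upper[OF M p, of \<beta>] by simp
      then have x4: "?x \<le> \<beta>\<^sup>2 / 4" using M by (simp add: pos_divide_le_eq)
      have kx: "real k * en p M \<beta> = (?n - real r) * ?x" using M unfolding nk by simp
      have rx: "real r * ?x \<le> real M * (\<beta>\<^sup>2 / 4)"
      proof -
        have "real r * ?x \<le> real r * (\<beta>\<^sup>2 / 4)" using x4 by (intro mult_left_mono) auto
        also have "\<dots> \<le> real M * (\<beta>\<^sup>2 / 4)" using r by (intro mult_right_mono) auto
        finally show ?thesis .
      qed
      have Ak: "A * real k / m \<le> \<eta> / 4 * ?n"
      proof -
        have "A * real k / m = A / m * real k" by simp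
        also have "\<dots> \<le> \<eta> / 4 * real M * real k" using A4 by (intro mult_right_mono) auto
        also have "\<dots> = \<eta> / 4 * (real k * real M)" by simp
        also have "\<dots> \<le> \<eta> / 4 * ?n" using \<eta> unfolding nk by (intro mult_left_mono) auto
        finally show ?thesis .
      qed
      have r4: "\<beta>\<^sup>2 * real r / 4 \<le> real M * (\<beta>\<^sup>2 / 4)" using mult_left_mono[OF r, of "\<beta>\<^sup>2"] by (simp add: mult.commute)
      have small: "real M * (\<beta>\<^sup>2 / 4) + real M * (\<beta>\<^sup>2 / 4) \<le> \<eta> / 4 * ?n"
      proof -
        have "\<beta>\<^sup>2 * real M \<le> \<eta> / 2 * ?n" using elim(1) n0 by (simp add: pos_divide_less_eq less_imp_le)
        then show ?thesis by (simp add: mult.commute)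
      qed
      have "?n * (m * \<beta>\<^sup>2 / 2 + m * \<beta>\<^sup>2 / 4) \<le> ?n * (\<eta> / 4)" using mb by (intro mult_left_mono) auto
      moreover have "(?n - real r) * ?x \<le> en p N \<beta> + ?n * (m * \<beta>\<^sup>2 / 2 + m * \<beta>\<^sup>2 / 4) + \<beta>\<^sup>2 * real r / 4 + A * real k / m"
        using A(2)[OF M N(2)] unfolding kx[symmetric] N(1)[symmetric] .
      moreover have "(?n - real r) * ?x = ?n * ?x - real r * ?x" by (simp only: left_diff_distrib)
      moreover have "?n * (\<eta> / 4) + (\<eta> / 4 * ?n + \<eta> / 4 * ?n) \<le> ?n * \<eta>" using n0 \<eta> by simp
      ultimately have "?n * ?x - ?n * \<eta> \<le> en p N \<beta>" using rx Ak r4 small by linarith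
      then have "?n * (?x - \<eta>) \<le> en p N \<beta>" by (simp only: right_diff_distrib)
      then show ?case using n0 by (simp add: pos_le_divide_eq mult.commute)
    qed
  qed simp
qed

text \<open>A Fekete argument: each late term is, up to a small loss, an eventual lower bound for
  the sequence. Together with boundedness this forces a subsequential limit to be the limit.\<close>

theorem en_convergent:
  assumes p: "1 \<le> p"
  shows "convergent (\<lambda>N. en p N \<beta> / real N)"
proof -
  let ?x = "\<lambda>N. en p N \<beta> / real N"
  have up: "\<forall>\<^sub>F N in sequentially. ?x N \<le> \<beta>\<^sup>2 / 4"
    using eventually_ge_at_top[of 1]
    by eventually_elim (use en_upper[OF _ p, of _ \<beta>] in \<open>simp add: pos_divide_le_eq\<close>)
  obtain M1 where "\<forall>\<^sub>F N in sequentially. ?x M1 - 1 \<le> ?x N"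
    using en_almost_superadditive[OF p, of 1 \<beta>] by auto
  with up have "\<forall>\<^sub>F N in sequentially. norm (?x N) \<le> max 1 (max (\<beta>\<^sup>2 / 4) (- (?x M1 - 1)))"
    by eventually_elim (auto simp: abs_le_iff le_max_iff_disj)
  then have "Bseq ?x" unfolding Bfun_def by (intro exI[of _ "max 1 (max (\<beta>\<^sup>2 / 4) (- (?x M1 - 1)))"]) auto
  then have "bounded (range ?x)" by (simp add: Bseq_eq_bounded)
  then obtain l r where r: "strict_mono r" and l: "(?x \<circ> r) \<longlonglongrightarrow> l"
    using bounded_imp_convergent_subsequence by blast
  have "?x \<longlonglongrightarrow> l"
  proof (rule tendstoI)
    fix e :: real assume e: "0 < e"
    obtain M0 where M0: "\<And>M. M0 \<le> M \<Longrightarrow> \<forall>\<^sub>F N in sequentially. ?x M - e / 4 \<le> ?x N"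
      using en_almost_superadditive[OF p, of "e / 4" \<beta>] e by auto
    have near: "\<forall>\<^sub>F n in sequentially. \<bar>?x (r n) - l\<bar> < e / 4"
      using tendstoD[OF l, of "e / 4"] e by (simp add: dist_real_def comp_def)
    then have "\<forall>\<^sub>F n in sequentially. \<bar>?x (r n) - l\<bar> < e / 4 \<and> M0 \<le> n"
      using eventually_ge_at_top by (rule eventually_conj)
    then obtain n where n: "\<bar>?x (r n) - l\<bar> < e / 4" "M0 \<le> n" using eventually_happens' sequentially_bot by blast
    have "M0 \<le> r n" using n(2) seq_suble[OF r, of n] by linarith
    from M0[OF this] have lo: "\<forall>\<^sub>F N in sequentially. l - e / 2 \<le> ?x N"
      by eventually_elim (use n(1) in linarith)
    have hi: "?x M < l + e" if M: "M0 \<le> M" for M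
    proof -
      have "\<forall>\<^sub>F n in sequentially. ?x M - e / 4 \<le> ?x (r n)"
        by (rule eventually_compose_filterlim[OF M0[OF M] filterlim_subseq[OF r]])
      with near have "\<forall>\<^sub>F n in sequentially. ?x M - e / 4 \<le> l + e / 4"
        by eventually_elim linarith
      then show ?thesis using e by simp
    qed
    show "\<forall>\<^sub>F N in sequentially. dist (?x N) l < e"
      using lo eventually_ge_at_top[of M0]
    proof eventually_elim
      case (elim N)
      then show ?case using hi[of N] e unfolding dist_real_def by linarith
    qed
  qed
  then show ?thesis by (auto simp: convergent_def)
qed

section \<open>Characterisation of the replica symmetric phase\<close>

lemma xi''_pos: "2 \<le> p \<Longrightarrow> 0 < s \<Longrightarrow> 0 < xi'' p s"
  and xi''_nonneg: "2 \<le> p \<Longrightarrow> 0 \<le> s \<Longrightarrow> 0 \<le> xi'' p s"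
  by (simp_all add: xi''_def)

lemma rs_integral_eq:
  assumes "2 \<le> p" "0 < \<beta>" "0 \<le> r"
  shows "integral {0..r} (\<lambda>s. xi'' p s * (rho p \<beta> s - s)) = 2 / \<beta>\<^sup>2 * PhiRS p \<beta> r"
  by (rule integral_unique[OF PhiRS_integral[OF assms]])

lemma xi'_0: "2 \<le> p \<Longrightarrow> xi' p 0 = 0"
  and theta_0: "2 \<le> p \<Longrightarrow> theta p 0 = 0"
  by (simp_all add: theta_def xi_def xi'_def power_0_left)

lemma pos_mult_sign:
  fixes c x :: real
  assumes "0 < c"
  shows "c * x \<le> 0 \<longleftrightarrow> x \<le> 0" "c * x < 0 \<longleftrightarrow> x < 0" "0 < c * x \<longleftrightarrow> 0 < x"
  using assms by (auto simp: mult_le_0_iff mult_less_0_iff zero_less_mult_iff)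

lemma PhiRS_0: "2 \<le> p \<Longrightarrow> PhiRS p \<beta> 0 = 0"
  by (simp add: PhiRS_def At_0 theta_0 xi'_0)

text \<open>The condition at 0 is automatic since \<open>PhiRS\<close> vanishes there. For
  necessity, the strict upper bound concerns the means only, and \<open>en_convergent\<close>
  carries it over to \<open>free_energy\<close>.\<close>

lemma free_energy_eq_iff:
  assumes p: "2 \<le> p" and \<beta>: "0 < \<beta>"
  shows "free_energy p \<beta> = \<beta>\<^sup>2 / 4 \<longleftrightarrow> (\<forall>r\<in>{0<..1}. PhiRS p \<beta> r \<le> 0)"
proof
  have p1: "1 \<le> p" using p by simp
  show "free_energy p \<beta> = \<beta>\<^sup>2 / 4" if R: "\<forall>r\<in>{0<..1}. PhiRS p \<beta> r \<le> 0"
  proof (rule free_energy_eqI[OF p1 \<beta>], rule en_limit_replica_symmetric[OF p \<beta>])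
    show "PhiRS p \<beta> q \<le> 0" if "0 \<le> q" "q \<le> 1" for q
      using R that PhiRS_0[OF p, of \<beta>] by (cases "q = 0") auto
  qed
  show "\<forall>r\<in>{0<..1}. PhiRS p \<beta> r \<le> 0" if F: "free_energy p \<beta> = \<beta>\<^sup>2 / 4"
  proof (rule ccontr)
    assume "\<not> ?thesis"
    then have "\<exists>r. 0 \<le> r \<and> r \<le> 1 \<and> 0 < PhiRS p \<beta> r" by (meson greaterThanAtMost_iff less_imp_le not_le)
    then obtain r where r: "0 \<le> r" "r \<le> 1" "0 < PhiRS p \<beta> r" by blast
    obtain \<delta> where \<delta>: "0 < \<delta>" "\<forall>\<^sub>F N in sequentially. en p N \<beta> / real N \<le> \<beta>\<^sup>2 / 4 - \<delta>"
      using en_strict_upper[OF p \<beta> r] by blast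
    obtain l where l: "(\<lambda>N. en p N \<beta> / real N) \<longlonglongrightarrow> l"
      using en_convergent[OF p1, of \<beta>] by (auto simp: convergent_def)
    have "l \<le> \<beta>\<^sup>2 / 4 - \<delta>" by (rule tendsto_upperbound[OF l \<delta>(2)]) simp
    then show False using free_energy_eqI[OF p1 \<beta> l] F \<delta>(1) by simp
  qed
qed

text \<open>The difference of the two integrals has a continuous nonnegative integrand, because
  \<open>hh\<close> increases; at \<open>r\<close> itself it is strictly positive, so the integral
  is too.\<close>

lemma rs_condition_strict:
  assumes p: "2 \<le> p" and \<beta>: "0 < \<beta>'" "\<beta>' < \<beta>" and r: "0 < r" and c: "PhiRS p \<beta> r \<le> 0"
  shows "PhiRS p \<beta>' r < 0"
proof -
  let ?f = "\<lambda>\<beta> s. xi'' p s * (rho p \<beta> s - s)"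
  let ?h = "\<lambda>\<beta> s. hh (\<beta> * sqrt (xi' p s))"
  let ?d = "\<lambda>s. xi'' p s * (?h \<beta> s - ?h \<beta>' s)"
  have b: "0 < \<beta>" using \<beta> by simp
  have I: "(?f \<beta> has_integral 2 / \<beta>\<^sup>2 * PhiRS p \<beta> r) {0..r}"
    "(?f \<beta>' has_integral 2 / \<beta>'\<^sup>2 * PhiRS p \<beta>' r) {0..r}"
    using PhiRS_integral p \<beta> b r by auto
  have D: "(?d has_integral 2 / \<beta>\<^sup>2 * PhiRS p \<beta> r - 2 / \<beta>'\<^sup>2 * PhiRS p \<beta>' r) {0..r}"
    by (rule has_integral_eq[OF _ has_integral_diff[OF I]]) (simp add: rho_eq_hh right_diff_distrib)
  have cd: "continuous_on {0..r} ?d"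
  proof -
    have ch: "continuous_on A hh" for A by (rule continuous_at_imp_continuous_on) (simp add: hh_isCont)
    have x: "continuous_on {0..r} (xi' p)" "continuous_on {0..r} (xi'' p)"
      unfolding xi'_def[abs_def] xi''_def[abs_def] by (auto intro!: continuous_intros)
    show ?thesis
      by (intro continuous_intros x continuous_on_compose2[OF ch]) auto
  qed
  have mono: "?h \<beta>' s < ?h \<beta> s" if "0 < s" for s
  proof (rule hh_strict_mono)
    have "0 < xi' p s" using p that by (simp add: xi'_def)
    then show "0 \<le> \<beta>' * sqrt (xi' p s)" "\<beta>' * sqrt (xi' p s) < \<beta> * sqrt (xi' p s)" using \<beta> by auto
  qed
  have d0: "0 \<le> ?d s" if "s \<in> {0..r}" for s
  proof (cases "s = 0")
    case True
    then show ?thesis using p by (simp add: xi'_0)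
  next
    case False
    then show ?thesis using that mono[of s] xi''_nonneg[OF p, of s] by (intro mult_nonneg_nonneg) auto
  qed
  have "0 \<le> integral {0..r} ?d" using D d0 by (intro integral_nonneg) (auto simp: has_integral_integrable)
  moreover have "integral {0..r} ?d \<noteq> 0"
  proof
    assume "integral {0..r} ?d = 0"
    then have "\<forall>s\<in>{0..r}. ?d s = 0" using integral_eq_0_iff[OF cd r d0] by simp
    moreover have "r \<in> {0..r}" using r by simp
    ultimately have "?d r = 0" by (rule bspec)
    then show False using mono[OF r] xi''_pos[OF p r] by simp
  qed
  ultimately have "0 < integral {0..r} ?d" by simp
  then have "2 / \<beta>'\<^sup>2 * PhiRS p \<beta>' r < 2 / \<beta>\<^sup>2 * PhiRS p \<beta> r" using integral_unique[OF D] by simp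
  also have "\<dots> \<le> 0" using c by (intro mult_nonneg_nonpos) auto
  finally have "2 / \<beta>'\<^sup>2 * PhiRS p \<beta>' r < 0" .
  moreover have "0 < 2 / \<beta>'\<^sup>2" using \<beta>(1) by simp
  ultimately show ?thesis by (simp only: pos_mult_sign)
qed

text \<open>By \<open>hh_le_square\<close>, \<open>rho\<close> is at most
  \<open>\<beta>\<^sup>2 * xi' p s\<close>, which for this \<open>\<beta>\<close> is
  \<open>s ^ (p - 1) / (2 * real p)\<close> and therefore at most \<open>s\<close>.\<close>

lemma rs_condition_small:
  assumes p: "2 \<le> p" and r: "0 \<le> r" "r \<le> 1"
  shows "PhiRS p (1 / real p) r \<le> 0"
proof -
  let ?b = "1 / real p"
  have b: "0 < ?b" using p by simp
  have "2 / ?b\<^sup>2 * PhiRS p ?b r \<le> 0"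
  proof (rule has_integral_le[OF PhiRS_integral[OF p b r(1)] has_integral_0])
    fix s assume s: "s \<in> {0..r}"
    then have s01: "0 \<le> s" "s \<le> 1" using r by auto
    have "rho p ?b s \<le> (?b * sqrt (xi' p s))\<^sup>2" using s01 hh_le_square by (simp add: rho_eq_hh)
    also have "\<dots> = ?b\<^sup>2 * xi' p s" using rs_square[OF s01(1), of p ?b] unfolding rs_def .
    also have "\<dots> = (1 / (2 * real p)) * s ^ (p - 1)" using p by (simp add: xi'_def power2_eq_square)
    also have "\<dots> \<le> 1 * s ^ 1" using s01 p by (intro mult_mono power_decreasing) auto
    finally show "xi'' p s * (rho p ?b s - s) \<le> 0" using xi''_nonneg[OF p s01(1)] by (intro mult_nonneg_nonpos) auto
  qed
  moreover have "0 < 2 / ?b\<^sup>2" using p by simp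
  ultimately show ?thesis by (simp only: pos_mult_sign)
qed

text \<open>Bounding \<open>sechm\<close> by 1 leaves an integrand with the explicit antiderivative
  \<open>?F\<close>. Since \<open>xi' p 1 - theta p 1 = 1 / 2\<close>, its increment exceeds
  \<open>1 / 2 - 2 / \<beta>\<^sup>2\<close>, which is nonnegative from 2 onwards.\<close>

lemma rs_condition_large:
  assumes p: "2 \<le> p" and \<beta>: "2 < \<beta>"
  shows "0 < PhiRS p \<beta> 1"
proof -
  let ?F = "\<lambda>s. xi' p s + 2 / \<beta>\<^sup>2 * exp (- (\<beta>\<^sup>2 * xi' p s / 2)) - theta p s"
  have b: "0 < \<beta>" "\<beta> \<noteq> 0" using \<beta> by auto
  have "((\<lambda>s. xi'' p s * (1 - exp (- (\<beta>\<^sup>2 * xi' p s / 2)) - s)) has_integral ?F 1 - ?F 0) {0..1}"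
  proof (rule fundamental_theorem_of_calculus)
    fix s assume "s \<in> {0..1::real}"
    have "(?F has_field_derivative xi'' p s * (1 - exp (- (\<beta>\<^sup>2 * xi' p s / 2)) - s)) (at s)"
      using b by (auto intro!: derivative_eq_intros xi'_deriv[OF p] theta_deriv[OF p] simp: field_simps)
    then show "(?F has_vector_derivative xi'' p s * (1 - exp (- (\<beta>\<^sup>2 * xi' p s / 2)) - s)) (at s within {0..1})"
      by (simp add: has_real_derivative_iff_has_vector_derivative has_vector_derivative_at_within)
  qed simp
  then have "?F 1 - ?F 0 \<le> 2 / \<beta>\<^sup>2 * PhiRS p \<beta> 1"
  proof (rule has_integral_le[OF _ PhiRS_integral[OF p b(1) zero_le_one]])
    fix s assume s: "s \<in> {0..1::real}"
    have "(\<beta> * sqrt (xi' p s))\<^sup>2 = \<beta>\<^sup>2 * xi' p s" using rs_square[of s p \<beta>] s unfolding rs_def by simp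
    then have "1 - exp (- (\<beta>\<^sup>2 * xi' p s / 2)) \<le> rho p \<beta> s" using s hh_ge[of "\<beta> * sqrt (xi' p s)"] by (simp add: rho_eq_hh)
    then show "xi'' p s * (1 - exp (- (\<beta>\<^sup>2 * xi' p s / 2)) - s) \<le> xi'' p s * (rho p \<beta> s - s)"
      using xi''_nonneg[OF p, of s] s by (intro mult_left_mono) auto
  qed
  moreover have "?F 0 = 2 / \<beta>\<^sup>2" using p by (simp add: xi'_0 theta_0)
  moreover have "?F 1 = 1 / 2 + 2 / \<beta>\<^sup>2 * exp (- (\<beta>\<^sup>2 * xi' p 1 / 2))" by (simp add: theta_def xi_def)
  moreover have "0 < 2 / \<beta>\<^sup>2 * exp (- (\<beta>\<^sup>2 * xi' p 1 / 2))" using b by simp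
  moreover have "2 / \<beta>\<^sup>2 \<le> 1 / 2"
  proof -
    have "2\<^sup>2 \<le> \<beta>\<^sup>2" using \<beta> by (intro power_mono) auto
    then show ?thesis using b by (simp add: pos_divide_le_eq)
  qed
  ultimately have "0 < 2 / \<beta>\<^sup>2 * PhiRS p \<beta> 1" by linarith
  moreover have "0 < 2 / \<beta>\<^sup>2" using b by simp
  ultimately show ?thesis by (simp only: pos_mult_sign)
qed

theorem mainTheorem6:
  fixes p :: nat
  assumes "p \<ge> 2"
  shows "replica_symmetric_set p = {0<..beta_crit p}
    \<and> (\<forall>\<beta>>0. \<beta> \<in> replica_symmetric_set p \<longleftrightarrow>
          (\<forall>r\<in>{0<..1}. integral {0..r} (\<lambda>s. xi'' p s * (rho p \<beta> s - s)) \<le> 0))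
    \<and> (\<forall>\<beta>. 0 < \<beta> \<and> \<beta> < beta_crit p \<longrightarrow>
          (\<forall>r\<in>{0<..1}. integral {0..r} (\<lambda>s. xi'' p s * (rho p \<beta> s - s)) < 0))"
proof -
  let ?R = "replica_symmetric_set p"
  have R: "\<beta> \<in> ?R \<longleftrightarrow> 0 < \<beta> \<and> (\<forall>r\<in>{0<..1}. PhiRS p \<beta> r \<le> 0)" for \<beta>
    using free_energy_eq_iff[OF assms, of \<beta>] by (auto simp: replica_symmetric_set_def)
  have le2: "\<beta> \<le> 2" if "\<beta> \<in> ?R" for \<beta>
    using that rs_condition_large[OF assms, of \<beta>] unfolding R by (force simp: not_le[symmetric])
  have bdd: "bdd_above ?R" by (rule bdd_aboveI[OF le2])
  have small: "1 / real p \<in> ?R" unfolding R using assms rs_condition_small[OF assms] by auto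
  define b where "b = Sup ?R"
  have "0 < 1 / real p" using assms by simp
  also have "\<dots> \<le> b" unfolding b_def by (rule cSup_upper[OF small bdd])
  finally have b0: "0 < b" .
  have down: "PhiRS p \<beta> r < 0" if \<beta>: "0 < \<beta>" "\<beta> < b" and r: "0 < r" "r \<le> 1" for \<beta> r
  proof -
    obtain \<beta>' where "\<beta>' \<in> ?R" "\<beta> < \<beta>'" using less_cSupD[of ?R \<beta>] \<beta>(2) small unfolding b_def by blast
    then show ?thesis using rs_condition_strict[OF assms \<beta>(1), of \<beta>' r] r unfolding R by auto
  qed
  \<comment> \<open>For fixed \<open>r\<close> the functional is continuous in
    \<open>\<beta>\<close>, so the strict inequalities below \<open>b\<close> survive in the limit
    as a weak one.\<close>
  have bR: "b \<in> ?R" unfolding R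
  proof (intro conjI ballI b0)
    fix r :: real assume r: "r \<in> {0<..1}"
    have "isCont At x" for x by (rule DERIV_isCont[OF At_deriv])
    then have "isCont (\<lambda>\<beta>. At (\<beta> * sqrt (xi' p r))) b"
      by (rule isCont_o2[rotated]) (intro continuous_intros)
    then have "isCont (\<lambda>\<beta>. PhiRS p \<beta> r) b"
      unfolding PhiRS_def by (intro continuous_intros) auto
    then have lim: "((\<lambda>\<beta>. PhiRS p \<beta> r) \<longlongrightarrow> PhiRS p b r) (at_left b)"
      by (simp add: isCont_def filterlim_at_split)
    have "\<forall>\<^sub>F \<beta> in at_left b. \<beta> \<in> {0<..<b}" by (rule eventually_at_leftI[OF _ b0])
    then have "\<forall>\<^sub>F \<beta> in at_left b. PhiRS p \<beta> r \<le> 0"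
      by eventually_elim (use down r in \<open>auto intro: less_imp_le\<close>)
    then show "PhiRS p b r \<le> 0" by (rule tendsto_upperbound[OF lim]) (simp add: trivial_limit_at_left_real)
  qed
  have up: "\<beta> \<le> b" if "\<beta> \<in> ?R" for \<beta> unfolding b_def by (rule cSup_upper[OF that bdd])
  \<comment> \<open>The supremum belongs to the set, so the \<open>GREATEST\<close> in
    \<open>beta_crit\<close> denotes it.\<close>
  have crit: "beta_crit p = b" unfolding beta_crit_def by (rule Greatest_equality[where P="\<lambda>\<beta>. \<beta> \<in> ?R", OF bR up])
  have Req: "?R = {0<..b}"
  proof (intro set_eqI iffI)
    show "\<beta> \<in> {0<..b}" if "\<beta> \<in> ?R" for \<beta> using that up[OF that] unfolding R by simp
    show "\<beta> \<in> ?R" if \<beta>: "\<beta> \<in> {0<..b}" for \<beta>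
    proof (cases "\<beta> = b")
      case False
      then show ?thesis unfolding R using \<beta> down[of \<beta>] by (auto intro: less_imp_le)
    qed (simp add: bR)
  qed
  have int_le: "integral {0..r} (\<lambda>s. xi'' p s * (rho p \<beta> s - s)) \<le> 0 \<longleftrightarrow> PhiRS p \<beta> r \<le> 0"
    and int_less: "integral {0..r} (\<lambda>s. xi'' p s * (rho p \<beta> s - s)) < 0 \<longleftrightarrow> PhiRS p \<beta> r < 0"
    if "0 < \<beta>" "0 < r" for \<beta> r
  proof -
    have "0 < 2 / \<beta>\<^sup>2" using that by simp
    then show "integral {0..r} (\<lambda>s. xi'' p s * (rho p \<beta> s - s)) \<le> 0 \<longleftrightarrow> PhiRS p \<beta> r \<le> 0"
      and "integral {0..r} (\<lambda>s. xi'' p s * (rho p \<beta> s - s)) < 0 \<longleftrightarrow> PhiRS p \<beta> r < 0"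
      unfolding rs_integral_eq[OF assms that(1) less_imp_le[OF that(2)]] by (simp_all only: pos_mult_sign)
  qed
  show ?thesis unfolding crit
  proof (intro conjI allI impI)
    show "\<beta> \<in> ?R \<longleftrightarrow> (\<forall>r\<in>{0<..1}. integral {0..r} (\<lambda>s. xi'' p s * (rho p \<beta> s - s)) \<le> 0)" if "0 < \<beta>" for \<beta>
      unfolding R using that int_le[OF that] by simp
    show "\<forall>r\<in>{0<..1}. integral {0..r} (\<lambda>s. xi'' p s * (rho p \<beta> s - s)) < 0" if "0 < \<beta> \<and> \<beta> < b" for \<beta>
      using that int_less down by simp
  qed (rule Req)
qed

end
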